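(* Let $d\ge2$, let $l/k$ be a finite Galois extension of fields, let $G$ be a finite subgroup of $GL_d(l)\rtimes\operatorname{Gal}(l/k)$ with $|G|$ not divisible by $\operatorname{char} k$ and $k=l^G$, let $S:=l[[x_1,\ldots,x_d]]$ with $\mathfrak{n}:=(x_1,\ldots,x_d)$, and assume that $H:=G\cap GL_d(l)\subseteq GL_d(l)$ is small. Let $\operatorname{sim}lH=\bigsqcup_{i=1}^s\{W_{i1},\ldots,W_{it_i}\}$ be the decomposition into $\operatorname{Gal}(l/k)$-orbits, let $V_i\in\operatorname{sim}l*G$ be the simple module corresponding to the $i$-th orbit, and let $a_i\ge1$ be the integer with $\operatorname{Res}_HV_i\cong(W_{i1}\oplus\cdots\oplus W_{it_i})^{\oplus a_i}$. Then: \begin{enumerate} \item As quivers without valuations, $\operatorname{MK}(l*G)$ coincides with the quotient quiver of $\operatorname{MK}(lH)$ by the action of $\operatorname{Gal}(l/k)$: \[\operatorname{MK}(l*G)=\operatorname{Gal}(l/k)\backslash\operatorname{MK}(lH),\] where $V_i$ corresponds to the orbit $\{W_{i1},\ldots,W_{it_i}\}$. \item Write $\operatorname{MK}(l*G)=(\operatorname{sim}l*G,d_G,d'_G)$ and $\operatorname{MK}(lH)=(\operatorname{sim}lH,d_H,d'_H)$. For $1\le i,i'\le s$, \[d_G(V_i,V_{i'})=\frac{a_{i'}}{a_i}\,d_H(i,i'),\qquad d'_G(V_i,V_{i'})=\frac{a_i}{a_{i'}}\,d'_H(i,i'),\] where $d_H(i,i'):=\sum_{j'=1}^{t_{i'}}d_H(W_{ij},W_{i'j'})$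 for any fixed $1\le j\le t_i$, and $d'_H(i,i'):=\sum_{j=1}^{t_i}d'_H(W_{ij},W_{i'j'})$ for any fixed $1\le j'\le t_{i'}$ (these do not depend on the choices). \end{enumerate}
   Context: In $GL_d(l)\rtimes\operatorname{Gal}(l/k)$ the Galois group acts on matrices entrywise, so $(A,\sigma)(B,\tau)=(A\sigma(B),\sigma\tau)$. This group acts on $S$ by continuous $k$-algebra automorphisms determined by $(A,\sigma)(\lambda)=\sigma(\lambda)$ for $\lambda\in l$ and $(A,\sigma)(x_j)=a_{1j}x_1+\cdots+a_{dj}x_d$ for $A=[a_{ij}]$; $G$ acts on $l$ through the projection to $\operatorname{Gal}(l/k)$, so $G/H\cong\operatorname{Gal}(l/k)$. $A\in GL_d(l)$ is a pseudo-reflection if $\operatorname{rank}(A-I_d)\le1$; a finite subgroup of $GL_d(l)$ is small if it contains no pseudo-reflection other than $I_d$. $l*G$ is the skew group ring ($(\lambda*g)(\mu*h)=\lambda g(\mu)*gh$), containing $lH$; $\operatorname{sim}A$ is the set of isomorphism classes of simple left $A$-modules; $\operatorname{Res}_H$ is restriction to $lH$. $\operatorname{Gal}(l/k)\cong G/H$ acts on $\operatorname{sim}lH$ by $W\mapsto g\otimes W\subseteq(l*G)\otimes_{lH}W$, i.e. $W$ with action $\lambda h\cdot(g\otimes w)=g\otimes(g^{-1}(\lambda)(g^{-1}hg)w)$. There is a bijection $\operatorname{Gal}(l/k)\backslash\operatorname{sim}lH\cong\operatorname{sim}l*G$ under which the simple module $V_i$ corresponding to the orbit $\{W_{i1},\dots,W_{it_i}\}$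 satisfies $\operatorname{Res}_HV_i\cong(W_{i1}\oplus\cdots\oplus W_{it_i})^{\oplus a_i}$ for some $a_i\ge1$. A valued quiver is a triple $(Q_0,d,d')$ with $Q_0$ a set and $d,d'\colon Q_0\times Q_0\to\mathbb{Z}_{\ge0}\cup\{\infty\}$; there is an arrow $X\to Y$ iff $(d_{XY},d'_{XY})\ne(0,0)$. With $U:=\mathfrak{n}/\mathfrak{n}^2\in\mathsf{mod}\,l*G$ and diagonal $G$-action on tensor and exterior powers over $l$, the McKay quiver is $\operatorname{MK}(l*G)=(\operatorname{sim}l*G,d_G,d'_G)$, where $d_G(V_1,V_2)$ is the multiplicity of $V_1$ as a direct summand of $U\otimes_lV_2$ and $d'_G(V_1,V_2)$ is the multiplicity of $V_2$ as a direct summand of $\bigwedge^{d-1}U\otimes_lV_1'$, with $V_1'\in\operatorname{sim}l*G$ determined by $V_1\cong\bigwedge^dU\otimes_lV_1'$. $\operatorname{MK}(lH)=(\operatorname{sim}lH,d_H,d'_H)$ is defined in the same way with $H$ in place of $G$ (and $U$ restricted to $H$). The action of $\operatorname{Gal}(l/k)$ on $\operatorname{sim}lH$ induces an action on $\operatorname{MK}(lH)$. For a quiver $Q$ with an action of a group $\Gamma$, the quotient quiver $\Gamma\backslash Q$ has as vertices the $\Gamma$-orbits of vertices of $Q$, with an arrow from orbit $i$ to orbit $j$ iff there is an arrow in $Q$ from some element of $i$ to some element of $j$. *)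

theory Defs
  imports
    "HOL-Analysis.Analysis"
    "HOL-Algebra.Module"
    "HOL-Algebra.QuotRing"
    "HOL-Algebra.Ideal_Product"
    "HOL-Library.Extended_Real"
begin

section \<open>Left modules over a possibly non-commutative ring\<close>

text \<open>
  The locale \<^locale>\<open>Module.module\<close> insists on a commutative ring of scalars.  The axioms below are
  the same, over an arbitrary ring; the record type and \<^locale>\<open>submodule\<close> are reused.  The
  multiplicative fields \<^const>\<open>mult\<close> and \<^const>\<open>one\<close> of a module record are irrelevant.
\<close>

locale left_module = R?: ring R + M?: abelian_group M for R (structure) and M (structure) +
  assumes smult_closed:
      "\<lbrakk>a \<in> carrier R; x \<in> carrier M\<rbrakk> \<Longrightarrow> a \<odot>\<^bsub>M\<^esub> x \<in> carrier M"
    and smult_l_distr: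
      "\<lbrakk>a \<in> carrier R; b \<in> carrier R; x \<in> carrier M\<rbrakk> \<Longrightarrow>
        (a \<oplus>\<^bsub>R\<^esub> b) \<odot>\<^bsub>M\<^esub> x = a \<odot>\<^bsub>M\<^esub> x \<oplus>\<^bsub>M\<^esub> b \<odot>\<^bsub>M\<^esub> x"
    and smult_r_distr:
      "\<lbrakk>a \<in> carrier R; x \<in> carrier M; y \<in> carrier M\<rbrakk> \<Longrightarrow>
        a \<odot>\<^bsub>M\<^esub> (x \<oplus>\<^bsub>M\<^esub> y) = a \<odot>\<^bsub>M\<^esub> x \<oplus>\<^bsub>M\<^esub> a \<odot>\<^bsub>M\<^esub> y"
    and smult_assoc1:
      "\<lbrakk>a \<in> carrier R; b \<in> carrier R; x \<in> carrier M\<rbrakk> \<Longrightarrow>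
        (a \<otimes>\<^bsub>R\<^esub> b) \<odot>\<^bsub>M\<^esub> x = a \<odot>\<^bsub>M\<^esub> (b \<odot>\<^bsub>M\<^esub> x)"
    and smult_one:
      "x \<in> carrier M \<Longrightarrow> \<one>\<^bsub>R\<^esub> \<odot>\<^bsub>M\<^esub> x = x"

definition lmod_iso ::
  "('a, 'r) ring_scheme \<Rightarrow> ('a, 'b, 'm) module_scheme \<Rightarrow> ('a, 'c, 'n) module_scheme \<Rightarrow> bool"
  where "lmod_iso R M N \<longleftrightarrow>
    (\<exists>\<phi> \<in> iso (add_monoid M) (add_monoid N).
       \<forall>a \<in> carrier R. \<forall>x \<in> carrier M. \<phi> (a \<odot>\<^bsub>M\<^esub> x) = a \<odot>\<^bsub>N\<^esub> \<phi> x)"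

definition simple_lmod :: "('a, 'r) ring_scheme \<Rightarrow> ('a, 'b, 'm) module_scheme \<Rightarrow> bool"
  where "simple_lmod R M \<longleftrightarrow>
    left_module R M \<and> carrier M \<noteq> {\<zero>\<^bsub>M\<^esub>} \<and>
    (\<forall>N. submodule N R M \<longrightarrow> N = {\<zero>\<^bsub>M\<^esub>} \<or> N = carrier M)"

text \<open>
  A simple left module over \<open>R\<close> is a quotient of \<open>R\<close>, so the modules whose elements are sets of
  elements of \<open>R\<close> realise all isomorphism classes of simple modules.  Hence nothing is lost by
  forming \<open>sim R\<close> below in this fixed type.
\<close>

lemma simple_lmod_transport:
  fixes R :: "('a, 'r) ring_scheme" and M :: "('a, 'b, 'm) module_scheme" and e :: "'b \<Rightarrow> 'c"
  assumes sM: "simple_lmod R M" and inj: "inj_on e (carrier M)"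
  shows "\<exists>N :: ('a, 'c) module. simple_lmod R N \<and> lmod_iso R M N"
proof -
  interpret left_module R M using sM by (simp add: simple_lmod_def)
  define d where "d = inv_into (carrier M) e"
  have de: "d (e x) = x" if "x \<in> carrier M" for x
    using that inj by (simp add: d_def)
  define N :: "('a, 'c) module" where "N =
    \<lparr>carrier = e ` carrier M, mult = undefined, one = undefined, zero = e \<zero>\<^bsub>M\<^esub>,
     add = (\<lambda>x y. e (d x \<oplus>\<^bsub>M\<^esub> d y)), smult = (\<lambda>a x. e (a \<odot>\<^bsub>M\<^esub> d x))\<rparr>"
  have "comm_group (add_monoid N)"
  proof (rule comm_groupI)
    fix x assume "x \<in> carrier (add_monoid N)"
    then obtain u where u: "u \<in> carrier M" "x = e u" by (auto simp: N_def)
    show "\<exists>y\<in>carrier (add_monoid N). y \<otimes>\<^bsub>add_monoid N\<^esub> x = \<one>\<^bsub>add_monoid N\<^esub>"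
      using u by (intro bexI[of _ "e (\<ominus>\<^bsub>M\<^esub> u)"]) (auto simp: N_def de M.l_neg)
  next
    fix x y z assume "x \<in> carrier (add_monoid N)" "y \<in> carrier (add_monoid N)" "z \<in> carrier (add_monoid N)"
    then show "x \<otimes>\<^bsub>add_monoid N\<^esub> y \<otimes>\<^bsub>add_monoid N\<^esub> z = x \<otimes>\<^bsub>add_monoid N\<^esub> (y \<otimes>\<^bsub>add_monoid N\<^esub> z)"
      by (auto simp: N_def de M.a_assoc)
  next
    fix x y assume "x \<in> carrier (add_monoid N)" "y \<in> carrier (add_monoid N)"
    then show "x \<otimes>\<^bsub>add_monoid N\<^esub> y = y \<otimes>\<^bsub>add_monoid N\<^esub> x"
      by (auto simp: N_def M.a_comm de)
  qed (auto simp: N_def de)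
  then have "abelian_group N"
    by (meson abelian_group.intro abelian_group_axioms.intro abelian_monoidI comm_group.axioms(1)
        abelian_monoid.intro)
  moreover have "left_module_axioms R N"
    by unfold_locales
       (auto simp: N_def de smult_closed smult_l_distr smult_r_distr smult_assoc1 smult_one)
  ultimately have lN: "left_module R N"
    by (simp add: left_module_def R.ring_axioms)
  have "e \<in> iso (add_monoid M) (add_monoid N)"
    using inj by (auto simp: iso_def hom_def bij_betw_def N_def de)
  moreover have "\<forall>a \<in> carrier R. \<forall>x \<in> carrier M. e (a \<odot>\<^bsub>M\<^esub> x) = a \<odot>\<^bsub>N\<^esub> e x"
    by (simp add: N_def de)
  ultimately have iso: "lmod_iso R M N"
    unfolding lmod_iso_def by blast
  interpret N: left_module R N by (fact lN)
  have "A = {\<zero>\<^bsub>N\<^esub>} \<or> A = carrier N" if A: "submodule A R N" for A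
  proof -
    interpret A: submodule A R N by (fact A)
    have Asub: "A \<subseteq> e ` carrier M" using A.subset by (simp add: N_def)
    define B where "B = d ` A"
    have Ac: "x \<in> carrier N" if "x \<in> A" for x using that Asub by (auto simp: N_def)
    have dM: "d x \<in> carrier M" "e (d x) = x" if "x \<in> A" for x
      using that Asub de by auto
    have AB: "A = e ` B" using dM by (force simp: B_def)
    have Bs: "B \<subseteq> carrier M" using dM by (auto simp: B_def)
    have inA: "e u \<in> A" if "u \<in> B" for u using that AB by auto
    have deA: "u \<in> B" if "e u \<in> A" "u \<in> carrier M" for u
      using that de unfolding B_def by force
    have "submodule B R M"
    proof (intro submodule.intro submodule_axioms.intro)
      show "subgroup B (add_monoid M)"
      proof (rule M.add.subgroupI)
        show "B \<subseteq> carrier M" by (fact Bs)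
        show "B \<noteq> {}" using A.one_closed by (auto simp: B_def)
        fix u assume u: "u \<in> B"
        have uM: "u \<in> carrier M" using u Bs by auto
        have "\<ominus>\<^bsub>N\<^esub> e u = e (\<ominus>\<^bsub>M\<^esub> u)"
          by (rule N.minus_equality) (use uM in \<open>auto simp: N_def de M.l_neg\<close>)
        moreover have "\<ominus>\<^bsub>N\<^esub> e u \<in> A"
          using A.m_inv_closed[OF inA[OF u]] by (simp add: a_inv_def)
        ultimately show "\<ominus>\<^bsub>M\<^esub> u \<in> B"
          using deA uM by simp
        fix v assume v: "v \<in> B"
        have vM: "v \<in> carrier M" using v Bs by auto
        have "e u \<oplus>\<^bsub>N\<^esub> e v \<in> A" using A.m_closed inA u v by force
        then show "u \<oplus>\<^bsub>M\<^esub> v \<in> B"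
          using uM vM by (intro deA) (auto simp: N_def de)
      qed
    next
      fix a u assume a: "a \<in> carrier R" and u: "u \<in> B"
      have uM: "u \<in> carrier M" using u Bs by auto
      show "a \<odot>\<^bsub>M\<^esub> u \<in> B"
        using A.smult_closed[OF a inA[OF u]] uM a smult_closed
        by (intro deA) (auto simp: N_def de)
    qed
    then have "B = {\<zero>\<^bsub>M\<^esub>} \<or> B = carrier M" using sM by (simp add: simple_lmod_def)
    then show ?thesis unfolding AB by (auto simp: N_def)
  qed
  moreover have "carrier N \<noteq> {\<zero>\<^bsub>N\<^esub>}"
  proof
    assume z: "carrier N = {\<zero>\<^bsub>N\<^esub>}"
    have "x = \<zero>\<^bsub>M\<^esub>" if "x \<in> carrier M" for x
    proof -
      have "e x = e \<zero>\<^bsub>M\<^esub>" using z that by (auto simp: N_def)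
      then show ?thesis using inj that by (simp add: inj_on_eq_iff)
    qed
    then have "carrier M = {\<zero>\<^bsub>M\<^esub>}" by auto
    then show False using sM by (simp add: simple_lmod_def)
  qed
  ultimately have "simple_lmod R N" using lN by (auto simp: simple_lmod_def)
  with iso show ?thesis by blast
qed

lemma simple_lmod_represented:
  fixes R :: "('a, 'r) ring_scheme" and M :: "('a, 'b, 'm) module_scheme"
  assumes sM: "simple_lmod R M"
  shows "\<exists>N :: ('a, 'a set) module. simple_lmod R N \<and> lmod_iso R M N"
proof -
  interpret left_module R M using sM by (simp add: simple_lmod_def)
  obtain x where x: "x \<in> carrier M" "x \<noteq> \<zero>\<^bsub>M\<^esub>"
    using sM M.zero_closed unfolding simple_lmod_def by blast
  define B where "B = (\<lambda>a. a \<odot>\<^bsub>M\<^esub> x) ` carrier R"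
  have zero: "\<zero>\<^bsub>R\<^esub> \<odot>\<^bsub>M\<^esub> x = \<zero>\<^bsub>M\<^esub>"
    using smult_l_distr[of "\<zero>\<^bsub>R\<^esub>" "\<zero>\<^bsub>R\<^esub>" x] x smult_closed[of "\<zero>\<^bsub>R\<^esub>" x]
    by (metis M.add.r_cancel_one' R.add.one_closed R.r_zero)
  have "submodule B R M"
  proof (intro submodule.intro submodule_axioms.intro)
    show "subgroup B (add_monoid M)"
    proof (rule M.add.subgroupI)
      show "B \<subseteq> carrier M" using x smult_closed by (auto simp: B_def)
      show "B \<noteq> {}" by (auto simp: B_def)
      fix u assume "u \<in> B"
      then obtain a where a: "a \<in> carrier R" "u = a \<odot>\<^bsub>M\<^esub> x" by (auto simp: B_def)
      have "\<ominus>\<^bsub>M\<^esub> u = (\<ominus>\<^bsub>R\<^esub> a) \<odot>\<^bsub>M\<^esub> x"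
        by (rule M.minus_equality)
           (use a x zero smult_closed smult_l_distr[of "\<ominus>\<^bsub>R\<^esub> a" a x] in \<open>auto simp: R.l_neg\<close>)
      then show "\<ominus>\<^bsub>M\<^esub> u \<in> B" using a by (auto simp: B_def)
      fix v assume "v \<in> B"
      then show "u \<oplus>\<^bsub>M\<^esub> v \<in> B" using a x by (auto simp: B_def smult_l_distr[symmetric])
    qed
  next
    fix a u assume "a \<in> carrier R" "u \<in> B"
    then show "a \<odot>\<^bsub>M\<^esub> u \<in> B" using x by (auto simp: B_def smult_assoc1[symmetric])
  qed
  moreover have "x \<in> B" using x smult_one by (force simp: B_def)
  ultimately have B: "carrier M = B" using sM x by (auto simp: simple_lmod_def)
  have "inj_on (\<lambda>y. {a \<in> carrier R. a \<odot>\<^bsub>M\<^esub> x = y}) (carrier M)"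
    unfolding B by (rule inj_onI) (auto simp: B_def)
  from simple_lmod_transport[OF sM this] show ?thesis .
qed

definition iso_class ::
  "('a, 'r) ring_scheme \<Rightarrow> ('a, 'a set) module \<Rightarrow> ('a, 'a set) module set"
  where "iso_class R M = {N. left_module R N \<and> lmod_iso R N M}"

definition sim :: "('a, 'r) ring_scheme \<Rightarrow> ('a, 'a set) module set set"
  where "sim R = {iso_class R M | M. simple_lmod R M}"

definition rep :: "('a, 'a set) module set \<Rightarrow> ('a, 'a set) module"
  where "rep C = (SOME M. M \<in> C)"

text \<open>Used for finite index sets only, where the direct sum is the product.\<close>

definition direct_sum :: "'i set \<Rightarrow> ('i \<Rightarrow> ('a, 'b) module) \<Rightarrow> ('a, 'i \<Rightarrow> 'b) module"
  where "direct_sum I M =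
    \<lparr>carrier = (\<Pi>\<^sub>E i\<in>I. carrier (M i)),
     mult = undefined, one = undefined,
     zero = (\<lambda>i\<in>I. \<zero>\<^bsub>M i\<^esub>),
     add = (\<lambda>f g. \<lambda>i\<in>I. f i \<oplus>\<^bsub>M i\<^esub> g i),
     smult = (\<lambda>a f. \<lambda>i\<in>I. a \<odot>\<^bsub>M i\<^esub> f i)\<rparr>"

definition quotient_lmod :: "('a, 'b) module \<Rightarrow> 'b set \<Rightarrow> ('a, 'b set) module"
  where "quotient_lmod M N =
    \<lparr>carrier = a_rcosets\<^bsub>M\<^esub> N,
     mult = undefined, one = undefined,
     zero = N,
     add = set_add M,
     smult = (\<lambda>a C. \<Union>x\<in>C. N +>\<^bsub>M\<^esub> (a \<odot>\<^bsub>M\<^esub> x))\<rparr>"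

definition summand_multiplicity ::
  "('a, 'r) ring_scheme \<Rightarrow> ('a, 'b) module \<Rightarrow> ('a, 'c) module \<Rightarrow> enat"
  where "summand_multiplicity R V M =
    Sup {enat m | m. \<exists>N N'. submodule N R M \<and> submodule N' R M \<and>
           N \<inter> N' = {\<zero>\<^bsub>M\<^esub>} \<and> N <+>\<^bsub>M\<^esub> N' = carrier M \<and>
           lmod_iso R (M\<lparr>carrier := N\<rparr>) (direct_sum {..<m} (\<lambda>_. V))}"

section \<open>Finite Galois extensions and the semilinear group\<close>

text \<open>The field \<open>l\<close> is the type \<open>'l\<close> and \<open>k\<close> is a subset of it.\<close>

definition galois_group :: "'l::field set \<Rightarrow> ('l \<Rightarrow> 'l) set"
  where "galois_group k =
    {\<sigma>. bij \<sigma> \<and> (\<forall>x y. \<sigma> (x + y) = \<sigma> x + \<sigma> y) \<and> (\<forall>x y. \<sigma> (x * y) = \<sigma> x * \<sigma> y) \<and> (\<forall>x\<in>k. \<sigma> x = x)}"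

definition is_subfield :: "'l::field set \<Rightarrow> bool"
  where "is_subfield k \<longleftrightarrow>
    0 \<in> k \<and> 1 \<in> k \<and> (\<forall>x\<in>k. \<forall>y\<in>k. x - y \<in> k \<and> x * y \<in> k) \<and> (\<forall>x\<in>k. inverse x \<in> k)"

definition finite_galois_extension :: "'l::field set \<Rightarrow> bool"
  where "finite_galois_extension k \<longleftrightarrow>
    is_subfield k \<and>
    (\<exists>B. finite B \<and> (\<forall>x. \<exists>c. c ` B \<subseteq> k \<and> x = (\<Sum>b\<in>B. c b * b))) \<and>
    {x. \<forall>\<sigma> \<in> galois_group k. \<sigma> x = x} = k"

type_synonym ('l, 'd) semilin = "('l^'d^'d) \<times> ('l \<Rightarrow> 'l)"

definition semilin_mult ::
  "('l::field, 'd::finite) semilin \<Rightarrow> ('l, 'd) semilin \<Rightarrow> ('l, 'd) semilin"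
  where "semilin_mult g h = (fst g ** map_matrix (snd g) (fst h), snd g \<circ> snd h)"

definition semilin_one :: "('l::field, 'd::finite) semilin"
  where "semilin_one = (mat 1, id)"

text \<open>The group \<open>GL\<^sub>d(l) \<rtimes> Gal(l/k)\<close>, where \<open>d = CARD('d)\<close>.\<close>

definition semilin_group :: "'l::field set \<Rightarrow> ('l, 'd::finite) semilin monoid"
  where "semilin_group k =
    \<lparr>carrier = {A. invertible A} \<times> galois_group k, mult = semilin_mult, one = semilin_one\<rparr>"

text \<open>The subgroup \<open>G \<inter> GL\<^sub>d(l)\<close>, with \<open>A\<close> identified with \<open>(A, id)\<close>.\<close>

definition linear_part :: "('l::field, 'd::finite) semilin set \<Rightarrow> ('l, 'd) semilin set"
  where "linear_part G = {g \<in> G. snd g = id}"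

definition pseudo_reflection :: "'l::field^'d^'d \<Rightarrow> bool"
  where "pseudo_reflection A \<longleftrightarrow> invertible A \<and> rank (A - mat 1) \<le> 1"

definition small :: "('l::field^'d^'d) set \<Rightarrow> bool"
  where "small \<H> \<longleftrightarrow> (\<forall>A \<in> \<H>. pseudo_reflection A \<longrightarrow> A = mat 1)"

section \<open>Skew group rings\<close>

text \<open>
  The skew group ring \<open>l*K\<close> of a finite set \<open>K\<close> of semilinear transformations that is closed under
  multiplication: \<open>a\<close> stands for \<open>\<Sum>g\<in>K. a g * g\<close>.  Since elements are functions vanishing off
  \<open>K\<close>, for \<open>K \<subseteq> K'\<close> the ring \<open>l*K\<close> is literally a subring of \<open>l*K'\<close>, and the restriction of an
  \<open>l*K'\<close>-module to \<open>l*K\<close> is given by the same record.  For \<open>K = linear_part G\<close> this is the ordinary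
  group ring.
\<close>

definition skew_group_ring ::
  "('l::field, 'd::finite) semilin set \<Rightarrow> (('l, 'd) semilin \<Rightarrow> 'l) ring"
  where "skew_group_ring K =
    \<lparr>carrier = {a. \<forall>g. g \<notin> K \<longrightarrow> a g = 0},
     mult = (\<lambda>a b g. \<Sum>(h, h') \<in> {(h, h') \<in> K \<times> K. semilin_mult h h' = g}. a h * snd h (b h')),
     one = (\<lambda>g. if g = semilin_one then 1 else 0),
     zero = (\<lambda>g. 0),
     add = (\<lambda>a b g. a g + b g)\<rparr>"

definition skew_elt ::
  "'l::field \<Rightarrow> ('l, 'd::finite) semilin \<Rightarrow> ('l, 'd) semilin \<Rightarrow> 'l"
  where "skew_elt c g = (\<lambda>h. if h = g then c else 0)"

section \<open>Tensor and exterior powers over \<open>l\<close> with the diagonal action\<close>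

text \<open>
  Given a \<open>K\<close>-set \<open>X\<close>, the free \<open>l\<close>-module on \<open>X\<close> with semilinear \<open>K\<close>-action
  \<open>g (\<Sum>x. f x * x) = \<Sum>x. g(f x) * (g x)\<close>.
\<close>

definition delta :: "'x \<Rightarrow> 'x \<Rightarrow> 'l::field"
  where "delta x = (\<lambda>y. if y = x then 1 else 0)"

definition free_lmod ::
  "('l::field, 'd::finite) semilin set \<Rightarrow> (('l, 'd) semilin \<Rightarrow> 'x \<Rightarrow> 'x) \<Rightarrow> 'x set \<Rightarrow>
   (('l, 'd) semilin \<Rightarrow> 'l, 'x \<Rightarrow> 'l) module"
  where "free_lmod K act X =
    \<lparr>carrier = {f. finite {x. f x \<noteq> 0} \<and> {x. f x \<noteq> 0} \<subseteq> X},
     mult = undefined, one = undefined,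
     zero = (\<lambda>x. 0),
     add = (\<lambda>f f' x. f x + f' x),
     smult = (\<lambda>a f y. \<Sum>g\<in>K. a g * (\<Sum>x | f x \<noteq> 0 \<and> act g x = y. snd g (f x)))\<rparr>"

text \<open>
  The \<open>l\<close>-linear span of a subset of an \<open>l*K\<close>-module, for \<open>K\<close> a group: \<open>l\<close> is the subring
  \<open>l*{1}\<close> of \<open>l*K\<close>.
\<close>

definition l_span ::
  "(('l::field, 'd::finite) semilin \<Rightarrow> 'l, 'b) module \<Rightarrow> 'b set \<Rightarrow> 'b set"
  where "l_span M B = \<Inter>{N. submodule N (skew_group_ring {semilin_one}) M \<and> B \<subseteq> N}"

definition tensor_relations ::
  "(('l::field, 'd::finite) semilin \<Rightarrow> 'l, 'b) module \<Rightarrow> (('l, 'd) semilin \<Rightarrow> 'l, 'c) module \<Rightarrow>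
   ('b \<times> 'c \<Rightarrow> 'l) set"
  where "tensor_relations M N =
    {(\<lambda>y. delta (u \<oplus>\<^bsub>M\<^esub> u', v) y - delta (u, v) y - delta (u', v) y) | u u' v.
       u \<in> carrier M \<and> u' \<in> carrier M \<and> v \<in> carrier N} \<union>
    {(\<lambda>y. delta (u, v \<oplus>\<^bsub>N\<^esub> v') y - delta (u, v) y - delta (u, v') y) | u v v'.
       u \<in> carrier M \<and> v \<in> carrier N \<and> v' \<in> carrier N} \<union>
    {(\<lambda>y. delta (skew_elt c semilin_one \<odot>\<^bsub>M\<^esub> u, v) y - c * delta (u, v) y) | c u v.
       u \<in> carrier M \<and> v \<in> carrier N} \<union>
    {(\<lambda>y. delta (u, skew_elt c semilin_one \<odot>\<^bsub>N\<^esub> v) y - c * delta (u, v) y) | c u v.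
       u \<in> carrier M \<and> v \<in> carrier N}"

definition tensor ::
  "('l::field, 'd::finite) semilin set \<Rightarrow>
   (('l, 'd) semilin \<Rightarrow> 'l, 'b) module \<Rightarrow> (('l, 'd) semilin \<Rightarrow> 'l, 'c) module \<Rightarrow>
   (('l, 'd) semilin \<Rightarrow> 'l, ('b \<times> 'c \<Rightarrow> 'l) set) module"
  where "tensor K M N =
    (let F = free_lmod K (\<lambda>g (u, v). (skew_elt 1 g \<odot>\<^bsub>M\<^esub> u, skew_elt 1 g \<odot>\<^bsub>N\<^esub> v))
               (carrier M \<times> carrier N)
     in quotient_lmod F (l_span F (tensor_relations M N)))"

definition exterior_relations ::
  "nat \<Rightarrow> (('l::field, 'd::finite) semilin \<Rightarrow> 'l, 'b) module \<Rightarrow> ('b list \<Rightarrow> 'l) set"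
  where "exterior_relations m M =
    {(\<lambda>y. delta (us[i := u \<oplus>\<^bsub>M\<^esub> u']) y - delta (us[i := u]) y - delta (us[i := u']) y) | us i u u'.
       length us = m \<and> set us \<subseteq> carrier M \<and> i < m \<and> u \<in> carrier M \<and> u' \<in> carrier M} \<union>
    {(\<lambda>y. delta (us[i := skew_elt c semilin_one \<odot>\<^bsub>M\<^esub> u]) y - c * delta (us[i := u]) y) | us i c u.
       length us = m \<and> set us \<subseteq> carrier M \<and> i < m \<and> u \<in> carrier M} \<union>
    {delta us | us. length us = m \<and> set us \<subseteq> carrier M \<and> (\<exists>i j. i < j \<and> j < m \<and> us ! i = us ! j)}"

definition exterior_power ::
  "('l::field, 'd::finite) semilin set \<Rightarrow> nat \<Rightarrow> (('l, 'd) semilin \<Rightarrow> 'l, 'b) module \<Rightarrow>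
   (('l, 'd) semilin \<Rightarrow> 'l, ('b list \<Rightarrow> 'l) set) module"
  where "exterior_power K m M =
    (let F = free_lmod K (\<lambda>g. map (\<lambda>u. skew_elt 1 g \<odot>\<^bsub>M\<^esub> u))
               {us. length us = m \<and> set us \<subseteq> carrier M}
     in quotient_lmod F (l_span F (exterior_relations m M)))"

section \<open>The power series ring and \<open>U = n/n\<^sup>2\<close>\<close>

text \<open>
  \<open>S = l[[x\<^sub>j | j \<in> 'd]]\<close>: a series is given by its coefficients, and an exponent vector is a
  function \<open>'d \<Rightarrow> nat\<close>.
\<close>

definition pow_series_ring :: "(('d::finite \<Rightarrow> nat) \<Rightarrow> 'l::field) ring"
  where "pow_series_ring =
    \<lparr>carrier = UNIV,
     mult = (\<lambda>f h \<gamma>. \<Sum>(\<alpha>, \<beta>) \<in> {(\<alpha>, \<beta>). (\<lambda>j. \<alpha> j + \<beta> j) = \<gamma>}. f \<alpha> * h \<beta>),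
     one = (\<lambda>\<alpha>. if \<alpha> = (\<lambda>_. 0) then 1 else 0),
     zero = (\<lambda>\<alpha>. 0),
     add = (\<lambda>f h \<alpha>. f \<alpha> + h \<alpha>)\<rparr>"

definition ps_var :: "'d::finite \<Rightarrow> ('d \<Rightarrow> nat) \<Rightarrow> 'l::field"
  where "ps_var j = (\<lambda>\<alpha>. if \<alpha> = (\<lambda>i. if i = j then 1 else 0) then 1 else 0)"

definition ps_max_ideal :: "(('d::finite \<Rightarrow> nat) \<Rightarrow> 'l::field) set"
  where "ps_max_ideal = Idl\<^bsub>pow_series_ring\<^esub> (range ps_var)"

text \<open>
  For \<open>g = (A, \<sigma>)\<close>, \<open>ps_lin_form A j\<close> is \<open>g(x\<^sub>j) = \<Sum>i. a\<^sub>i\<^sub>j x\<^sub>i\<close>, and the continuous automorphism given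
  by \<open>g\<close> is the substitution
  \<open>g(\<Sum>\<alpha>. f \<alpha> x\<^sup>\<alpha>) = \<Sum>\<alpha>. \<sigma>(f \<alpha>) \<Prod>j. g(x\<^sub>j) ^ \<alpha> j\<close>.  As the product belonging to \<open>\<alpha>\<close> is homogeneous of
  degree \<open>|\<alpha>|\<close>, only the (finitely many) \<open>\<alpha>\<close> with \<open>|\<alpha>| = |\<beta>|\<close> contribute to the coefficient at \<open>\<beta>\<close>.
\<close>

definition ps_lin_form :: "'l::field^'d^'d \<Rightarrow> 'd::finite \<Rightarrow> ('d \<Rightarrow> nat) \<Rightarrow> 'l"
  where "ps_lin_form A j = (\<lambda>\<alpha>. \<Sum>i\<in>UNIV. A $ i $ j * ps_var i \<alpha>)"

definition ps_act ::
  "('l::field, 'd::finite) semilin \<Rightarrow> (('d \<Rightarrow> nat) \<Rightarrow> 'l) \<Rightarrow> ('d \<Rightarrow> nat) \<Rightarrow> 'l"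
  where "ps_act g f =
    (\<lambda>\<beta>. \<Sum>\<alpha> | (\<Sum>j\<in>UNIV. \<alpha> j) = (\<Sum>j\<in>UNIV. \<beta> j).
       snd g (f \<alpha>) *
       (\<Otimes>\<^bsub>pow_series_ring\<^esub>j\<in>UNIV. ps_lin_form (fst g) j [^]\<^bsub>pow_series_ring\<^esub> \<alpha> j) \<beta>)"

definition pow_series_module ::
  "('l::field, 'd::finite) semilin set \<Rightarrow> (('l, 'd) semilin \<Rightarrow> 'l, ('d \<Rightarrow> nat) \<Rightarrow> 'l) module"
  where "pow_series_module K =
    \<lparr>carrier = carrier pow_series_ring,
     mult = mult pow_series_ring,
     one = one pow_series_ring,
     zero = zero pow_series_ring,
     add = add pow_series_ring,
     smult = (\<lambda>a f \<beta>. \<Sum>g\<in>K. a g * ps_act g f \<beta>)\<rparr>"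

definition cotangent_module ::
  "('l::field, 'd::finite) semilin set \<Rightarrow> (('l, 'd) semilin \<Rightarrow> 'l, (('d \<Rightarrow> nat) \<Rightarrow> 'l) set) module"
  where "cotangent_module K =
    quotient_lmod ((pow_series_module K)\<lparr>carrier := ps_max_ideal\<rparr>)
      (ideal_prod pow_series_ring ps_max_ideal ps_max_ideal)"

section \<open>Quivers\<close>

record 'v valued_quiver =
  vertices :: "'v set"
  val :: "'v \<Rightarrow> 'v \<Rightarrow> enat"
  val' :: "'v \<Rightarrow> 'v \<Rightarrow> enat"

record 'v quiver =
  verts :: "'v set"
  arrows :: "('v \<times> 'v) set"

definition underlying_quiver :: "'v valued_quiver \<Rightarrow> 'v quiver"
  where "underlying_quiver Q =
    \<lparr>verts = vertices Q,
     arrows = {(x, y) \<in> vertices Q \<times> vertices Q. (val Q x y, val' Q x y) \<noteq> (0, 0)}\<rparr>"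

definition orbits :: "'g set \<Rightarrow> ('g \<Rightarrow> 'v \<Rightarrow> 'v) \<Rightarrow> 'v set \<Rightarrow> 'v set set"
  where "orbits \<Gamma> act X = {{act \<gamma> x | \<gamma>. \<gamma> \<in> \<Gamma>} | x. x \<in> X}"

definition quotient_quiver :: "'g set \<Rightarrow> ('g \<Rightarrow> 'v \<Rightarrow> 'v) \<Rightarrow> 'v quiver \<Rightarrow> 'v set quiver"
  where "quotient_quiver \<Gamma> act Q =
    \<lparr>verts = orbits \<Gamma> act (verts Q),
     arrows = {(p, q) \<in> orbits \<Gamma> act (verts Q) \<times> orbits \<Gamma> act (verts Q).
                 \<exists>x\<in>p. \<exists>y\<in>q. (x, y) \<in> arrows Q}\<rparr>"

definition quiver_iso :: "('v \<Rightarrow> 'w) \<Rightarrow> 'v quiver \<Rightarrow> 'w quiver \<Rightarrow> bool"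
  where "quiver_iso \<phi> Q Q' \<longleftrightarrow>
    bij_betw \<phi> (verts Q) (verts Q') \<and>
    (\<forall>x \<in> verts Q. \<forall>y \<in> verts Q. (x, y) \<in> arrows Q \<longleftrightarrow> (\<phi> x, \<phi> y) \<in> arrows Q')"

section \<open>McKay quivers and the Galois action\<close>

type_synonym ('l, 'd) sgr_vertex =
  "(('l, 'd) semilin \<Rightarrow> 'l, (('l, 'd) semilin \<Rightarrow> 'l) set) module set"

definition det_untwist ::
  "('l::field, 'd::finite) semilin set \<Rightarrow> ('l, 'd) sgr_vertex \<Rightarrow> ('l, 'd) sgr_vertex"
  where "det_untwist K V =
    (THE V'. V' \<in> sim (skew_group_ring K) \<and>
       lmod_iso (skew_group_ring K) (rep V)
         (tensor K (exterior_power K CARD('d) (cotangent_module K)) (rep V')))"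

definition McKay_quiver ::
  "('l::field, 'd::finite) semilin set \<Rightarrow> ('l, 'd) sgr_vertex valued_quiver"
  where "McKay_quiver K =
    \<lparr>vertices = sim (skew_group_ring K),
     val = (\<lambda>V\<^sub>1 V\<^sub>2. summand_multiplicity (skew_group_ring K) (rep V\<^sub>1)
              (tensor K (cotangent_module K) (rep V\<^sub>2))),
     val' = (\<lambda>V\<^sub>1 V\<^sub>2. summand_multiplicity (skew_group_ring K) (rep V\<^sub>2)
              (tensor K (exterior_power K (CARD('d) - 1) (cotangent_module K))
                 (rep (det_untwist K V\<^sub>1))))\<rparr>"

text \<open>
  For \<open>g \<in> G\<close> and an \<open>lH\<close>-module \<open>W\<close>, the module \<open>g \<otimes> W\<close>: on \<open>W\<close>, the element \<open>\<lambda>h\<close> of \<open>lH\<close> acts as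
  \<open>g\<^sup>-\<^sup>1(\<lambda>) (g\<^sup>-\<^sup>1 h g)\<close>.  Hence \<open>a\<close> acts as the element whose coefficient at \<open>h\<close> is
  \<open>g\<^sup>-\<^sup>1(a (g h g\<^sup>-\<^sup>1))\<close>.
\<close>

definition conj_module ::
  "'l::field set \<Rightarrow> ('l, 'd::finite) semilin set \<Rightarrow> ('l, 'd) semilin \<Rightarrow>
   (('l, 'd) semilin \<Rightarrow> 'l, 'b) module \<Rightarrow> (('l, 'd) semilin \<Rightarrow> 'l, 'b) module"
  where "conj_module k H g W =
    W\<lparr>smult := (\<lambda>a w.
      (\<lambda>h. if h \<in> H
           then snd (inv\<^bsub>semilin_group k\<^esub> g)
                  (a (semilin_mult (semilin_mult g h) (inv\<^bsub>semilin_group k\<^esub> g)))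
           else 0) \<odot>\<^bsub>W\<^esub> w)\<rparr>"

text \<open>
  The class of \<open>g \<otimes> W\<close> depends only on the class of \<open>W\<close> and on the image \<open>\<sigma>\<close> of \<open>g\<close> in \<open>Gal(l/k)\<close>, so
  the union below is a single class.
\<close>

definition galois_act ::
  "'l::field set \<Rightarrow> ('l, 'd::finite) semilin set \<Rightarrow> ('l \<Rightarrow> 'l) \<Rightarrow>
   ('l, 'd) sgr_vertex \<Rightarrow> ('l, 'd) sgr_vertex"
  where "galois_act k G \<sigma> C =
    (\<Union>W\<in>C. \<Union>g\<in>{g \<in> G. snd g = \<sigma>}.
       iso_class (skew_group_ring (linear_part G)) (conj_module k (linear_part G) g W))"

end

(*
  Restriction from l*G to lH determines everything.  By Dedekind's independence of automorphisms,
  G maps onto Gal(l/k), and a nonzero lH-homomorphism between l*G-modules yields a nonzero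
  l*G-homomorphism; so simple l*G-modules with a common simple constituent over lH are isomorphic,
  and the V_i are exactly the simple l*G-modules.  If X is a semisimple l*G-module containing V_i
  with multiplicity n, then W_ij occurs in Res X with multiplicity a_i n.  Apply this to
  X = U (x) V_i', where Res X is the sum over j' of a_i' copies of U (x) W_i'j': the multiplicities
  satisfy a_i d_G(V_i, V_i') = a_i' (sum over j' of d_H(W_ij, W_i'j')).  The same argument
  with the (d-1)-st exterior power of U gives d', because the inverse twist by the determinant
  character of G restricts to the one of H.  The arrows are read off from the valuations.

  Tensor products and exterior powers are computed in coordinates: a module with an l-basis is a
  semilinear cocycle of matrices, and tensoring with it only needs that cocycle.
*)

theory Submission
  imports Defs
begin

section \<open>Module homomorphisms and direct sums\<close>

text \<open>The ratios of the a_i come from dividing an equation between multiplicities, so these,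
  defined as suprema over direct summands, must first be shown to be finite counts. This is the
  uniqueness of decompositions into simples; the decompositions come from Maschke, over l*G and over
  lH. It applies because |G| and, by Lagrange, |H| are nonzero in l; over l*G the averaging is
  compatible with the semilinear action since 1/|G| lies in the prime field. |H| is needed again in
  the descent: once all terms outside H are killed, the remaining |H| terms coincide. In d' the
  ratio is inverted because the tensor factor comes from V_i instead of V_i': its untwist restricts
  with multiplicity a_i, while the constituent that is counted belongs to V_i'. The variables give a
  basis of U, and a determinant computes its top exterior power. For the (d-1)-st power no minors
  are written down: it is finitely generated over l, and any basis of it yields a cocycle over G
  whose restriction serves over H.\<close>

definition lhom ::
  "('a, 'r) ring_scheme \<Rightarrow> ('a, 'b, 'm) module_scheme \<Rightarrow> ('a, 'c, 'n) module_scheme \<Rightarrow> ('b \<Rightarrow> 'c) set"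
  where "lhom R M N = {f. (\<forall>x\<in>carrier M. f x \<in> carrier N) \<and>
     (\<forall>x\<in>carrier M. \<forall>y\<in>carrier M. f (x \<oplus>\<^bsub>M\<^esub> y) = f x \<oplus>\<^bsub>N\<^esub> f y) \<and>
     (\<forall>a\<in>carrier R. \<forall>x\<in>carrier M. f (a \<odot>\<^bsub>M\<^esub> x) = a \<odot>\<^bsub>N\<^esub> f x)}"

lemma lhomI:
  assumes "\<And>x. x \<in> carrier M \<Longrightarrow> f x \<in> carrier N"
    and "\<And>x y. x \<in> carrier M \<Longrightarrow> y \<in> carrier M \<Longrightarrow> f (x \<oplus>\<^bsub>M\<^esub> y) = f x \<oplus>\<^bsub>N\<^esub> f y"
    and "\<And>a x. a \<in> carrier R \<Longrightarrow> x \<in> carrier M \<Longrightarrow> f (a \<odot>\<^bsub>M\<^esub> x) = a \<odot>\<^bsub>N\<^esub> f x"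
  shows "f \<in> lhom R M N"
  using assms by (simp add: lhom_def)

lemma lhomD:
  assumes "f \<in> lhom R M N"
  shows lhom_closed: "\<And>x. x \<in> carrier M \<Longrightarrow> f x \<in> carrier N"
    and lhom_add: "\<And>x y. x \<in> carrier M \<Longrightarrow> y \<in> carrier M \<Longrightarrow> f (x \<oplus>\<^bsub>M\<^esub> y) = f x \<oplus>\<^bsub>N\<^esub> f y"
    and lhom_smult: "\<And>a x. a \<in> carrier R \<Longrightarrow> x \<in> carrier M \<Longrightarrow> f (a \<odot>\<^bsub>M\<^esub> x) = a \<odot>\<^bsub>N\<^esub> f x"
  using assms by (simp_all add: lhom_def)

lemma lmod_iso_lhom:
  "lmod_iso R M N \<longleftrightarrow> (\<exists>f\<in>lhom R M N. bij_betw f (carrier M) (carrier N))"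
  unfolding lmod_iso_def iso_def hom_def lhom_def by (auto simp: Pi_def)

lemma lmod_isoI:
  assumes "f \<in> lhom R M N" "bij_betw f (carrier M) (carrier N)"
  shows "lmod_iso R M N"
  using assms by (auto simp: lmod_iso_lhom)

lemma lhom_comp:
  assumes "f \<in> lhom R M N" "g \<in> lhom R N P"
  shows "g \<circ> f \<in> lhom R M P"
  using assms by (simp add: lhom_def)

lemma lmod_iso_refl: "lmod_iso R M M"
  by (rule lmod_isoI[of id]) (auto intro: lhomI)

lemma lmod_iso_trans:
  assumes "lmod_iso R M N" "lmod_iso R N P"
  shows "lmod_iso R M P"
proof -
  from assms obtain f g where "f \<in> lhom R M N" "bij_betw f (carrier M) (carrier N)"
    "g \<in> lhom R N P" "bij_betw g (carrier N) (carrier P)"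
    by (auto simp: lmod_iso_lhom)
  then show ?thesis by (meson lmod_isoI lhom_comp bij_betw_trans)
qed

text \<open>Restriction of scalars from l*G to lH: both rings act through the same module records,
  and only the set of scalars for which linearity is demanded shrinks.\<close>

lemma lmod_iso_mono:
  assumes "lmod_iso R M N" "carrier S \<subseteq> carrier R"
  shows "lmod_iso S M N"
  using assms unfolding lmod_iso_def by blast

lemma left_moduleI:
  assumes R: "ring R"
    and "\<And>x y. x \<in> carrier M \<Longrightarrow> y \<in> carrier M \<Longrightarrow> x \<oplus>\<^bsub>M\<^esub> y \<in> carrier M"
    and "\<zero>\<^bsub>M\<^esub> \<in> carrier M"
    and "\<And>x y z. x \<in> carrier M \<Longrightarrow> y \<in> carrier M \<Longrightarrow> z \<in> carrier M \<Longrightarrow> (x \<oplus>\<^bsub>M\<^esub> y) \<oplus>\<^bsub>M\<^esub> z = x \<oplus>\<^bsub>M\<^esub> (y \<oplus>\<^bsub>M\<^esub> z)"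
    and "\<And>x y. x \<in> carrier M \<Longrightarrow> y \<in> carrier M \<Longrightarrow> x \<oplus>\<^bsub>M\<^esub> y = y \<oplus>\<^bsub>M\<^esub> x"
    and "\<And>x. x \<in> carrier M \<Longrightarrow> \<zero>\<^bsub>M\<^esub> \<oplus>\<^bsub>M\<^esub> x = x"
    and "\<And>x. x \<in> carrier M \<Longrightarrow> \<exists>y\<in>carrier M. y \<oplus>\<^bsub>M\<^esub> x = \<zero>\<^bsub>M\<^esub>"
    and "\<And>a x. a \<in> carrier R \<Longrightarrow> x \<in> carrier M \<Longrightarrow> a \<odot>\<^bsub>M\<^esub> x \<in> carrier M"
    and "\<And>a b x. a \<in> carrier R \<Longrightarrow> b \<in> carrier R \<Longrightarrow> x \<in> carrier M \<Longrightarrow>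
        (a \<oplus>\<^bsub>R\<^esub> b) \<odot>\<^bsub>M\<^esub> x = a \<odot>\<^bsub>M\<^esub> x \<oplus>\<^bsub>M\<^esub> b \<odot>\<^bsub>M\<^esub> x"
    and "\<And>a x y. a \<in> carrier R \<Longrightarrow> x \<in> carrier M \<Longrightarrow> y \<in> carrier M \<Longrightarrow>
        a \<odot>\<^bsub>M\<^esub> (x \<oplus>\<^bsub>M\<^esub> y) = a \<odot>\<^bsub>M\<^esub> x \<oplus>\<^bsub>M\<^esub> a \<odot>\<^bsub>M\<^esub> y"
    and "\<And>a b x. a \<in> carrier R \<Longrightarrow> b \<in> carrier R \<Longrightarrow> x \<in> carrier M \<Longrightarrow>
        (a \<otimes>\<^bsub>R\<^esub> b) \<odot>\<^bsub>M\<^esub> x = a \<odot>\<^bsub>M\<^esub> (b \<odot>\<^bsub>M\<^esub> x)"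
    and "\<And>x. x \<in> carrier M \<Longrightarrow> \<one>\<^bsub>R\<^esub> \<odot>\<^bsub>M\<^esub> x = x"
  shows "left_module R M"
proof -
  have "abelian_group M"
    by (rule abelian_groupI) (use assms in auto)
  then show ?thesis
    unfolding left_module_def left_module_axioms_def using assms by auto
qed

context left_module
begin

lemma smult_zero_l: "x \<in> carrier M \<Longrightarrow> \<zero>\<^bsub>R\<^esub> \<odot>\<^bsub>M\<^esub> x = \<zero>\<^bsub>M\<^esub>"
  using smult_l_distr[of "\<zero>\<^bsub>R\<^esub>" "\<zero>\<^bsub>R\<^esub>" x] smult_closed[of "\<zero>\<^bsub>R\<^esub>" x]
  by (metis M.add.r_cancel_one' R.add.one_closed R.r_zero)

lemma smult_zero_r: "a \<in> carrier R \<Longrightarrow> a \<odot>\<^bsub>M\<^esub> \<zero>\<^bsub>M\<^esub> = \<zero>\<^bsub>M\<^esub>"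
  using smult_r_distr[of a "\<zero>\<^bsub>M\<^esub>" "\<zero>\<^bsub>M\<^esub>"] smult_closed[of a "\<zero>\<^bsub>M\<^esub>"]
  by (metis M.add.r_cancel_one' M.zero_closed M.r_zero)

lemma smult_minus_one: "x \<in> carrier M \<Longrightarrow> (\<ominus>\<^bsub>R\<^esub> \<one>\<^bsub>R\<^esub>) \<odot>\<^bsub>M\<^esub> x = \<ominus>\<^bsub>M\<^esub> x"
proof -
  assume x: "x \<in> carrier M"
  have "(\<ominus>\<^bsub>R\<^esub> \<one>\<^bsub>R\<^esub>) \<odot>\<^bsub>M\<^esub> x \<oplus>\<^bsub>M\<^esub> x = ((\<ominus>\<^bsub>R\<^esub> \<one>\<^bsub>R\<^esub>) \<oplus>\<^bsub>R\<^esub> \<one>\<^bsub>R\<^esub>) \<odot>\<^bsub>M\<^esub> x"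
    using x by (subst smult_l_distr) (auto simp: smult_one)
  also have "\<dots> = \<zero>\<^bsub>M\<^esub>" using x by (simp add: R.l_neg smult_zero_l)
  finally show ?thesis
    using x by (metis M.minus_equality smult_closed R.a_inv_closed R.one_closed)
qed

lemma smult_minus_r: "a \<in> carrier R \<Longrightarrow> x \<in> carrier M \<Longrightarrow> a \<odot>\<^bsub>M\<^esub> (\<ominus>\<^bsub>M\<^esub> x) = \<ominus>\<^bsub>M\<^esub> (a \<odot>\<^bsub>M\<^esub> x)"
  by (rule M.minus_equality[symmetric])
     (auto simp: smult_closed M.l_neg smult_zero_r simp flip: smult_r_distr)

lemma smult_finsum:
  assumes "a \<in> carrier R" "f \<in> A \<rightarrow> carrier M" "finite A"
  shows "a \<odot>\<^bsub>M\<^esub> finsum M f A = finsum M (\<lambda>i. a \<odot>\<^bsub>M\<^esub> f i) A"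
  using assms(3,2)
  by (induction A) (auto simp: smult_zero_r assms smult_r_distr smult_closed Pi_def)

text \<open>Negatives come for free, being multiples by -1.\<close>

lemma submoduleI:
  assumes "N \<subseteq> carrier M" "\<zero>\<^bsub>M\<^esub> \<in> N"
    and "\<And>x y. x \<in> N \<Longrightarrow> y \<in> N \<Longrightarrow> x \<oplus>\<^bsub>M\<^esub> y \<in> N"
    and "\<And>a x. a \<in> carrier R \<Longrightarrow> x \<in> N \<Longrightarrow> a \<odot>\<^bsub>M\<^esub> x \<in> N"
  shows "submodule N R M"
proof (intro submodule.intro submodule_axioms.intro)
  show "subgroup N (add_monoid M)"
  proof (rule M.add.subgroupI)
    fix x assume "x \<in> N"
    then show "\<ominus>\<^bsub>M\<^esub> x \<in> N" using assms(1,4) smult_minus_one by (metis R.a_inv_closed R.one_closed subsetD)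
  qed (use assms in auto)
qed (use assms in auto)

end

lemma submoduleD:
  assumes "submodule N R M"
  shows submodule_subset: "N \<subseteq> carrier M" and submodule_zero: "\<zero>\<^bsub>M\<^esub> \<in> N"
    and submodule_add: "\<And>x y. x \<in> N \<Longrightarrow> y \<in> N \<Longrightarrow> x \<oplus>\<^bsub>M\<^esub> y \<in> N"
    and submodule_smult: "\<And>a x. a \<in> carrier R \<Longrightarrow> x \<in> N \<Longrightarrow> a \<odot>\<^bsub>M\<^esub> x \<in> N"
    and submodule_minus: "\<And>x. x \<in> N \<Longrightarrow> \<ominus>\<^bsub>M\<^esub> x \<in> N"
proof -
  interpret submodule N R M by (fact assms)
  show "N \<subseteq> carrier M" using subset by simp
  show "\<zero>\<^bsub>M\<^esub> \<in> N" using one_closed by simp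
  show "\<And>x y. x \<in> N \<Longrightarrow> y \<in> N \<Longrightarrow> x \<oplus>\<^bsub>M\<^esub> y \<in> N" using m_closed by simp
  show "\<And>a x. a \<in> carrier R \<Longrightarrow> x \<in> N \<Longrightarrow> a \<odot>\<^bsub>M\<^esub> x \<in> N" by (rule smult_closed)
  show "\<And>x. x \<in> N \<Longrightarrow> \<ominus>\<^bsub>M\<^esub> x \<in> N" using m_inv_closed by (simp add: a_inv_def)
qed

lemma submodule_diff:
  assumes "submodule N R M" "x \<in> N" "y \<in> N"
  shows "x \<ominus>\<^bsub>M\<^esub> y \<in> N"
  unfolding a_minus_def by (intro submodule_add[OF assms(1)] submodule_minus[OF assms(1)] assms)

lemma submodule_left_module:
  assumes "left_module R M" "submodule N R M"
  shows "left_module R (M\<lparr>carrier := N\<rparr>)"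
proof -
  interpret left_module R M by fact
  note N = submoduleD[OF assms(2)]
  show ?thesis
  proof (rule left_moduleI)
    fix x assume "x \<in> carrier (M\<lparr>carrier := N\<rparr>)"
    then have "\<ominus>\<^bsub>M\<^esub> x \<in> N" "\<ominus>\<^bsub>M\<^esub> x \<oplus>\<^bsub>M\<^esub> x = \<zero>\<^bsub>M\<^esub>" using N(1,5) by (auto simp: M.l_neg)
    then show "\<exists>y\<in>carrier (M\<lparr>carrier := N\<rparr>). y \<oplus>\<^bsub>M\<lparr>carrier := N\<rparr>\<^esub> x = \<zero>\<^bsub>M\<lparr>carrier := N\<rparr>\<^esub>" by auto
  next
    fix x y assume "x \<in> carrier (M\<lparr>carrier := N\<rparr>)" "y \<in> carrier (M\<lparr>carrier := N\<rparr>)"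
    then show "x \<oplus>\<^bsub>M\<lparr>carrier := N\<rparr>\<^esub> y = y \<oplus>\<^bsub>M\<lparr>carrier := N\<rparr>\<^esub> x" using N(1) M.a_comm[of x y] by auto
  qed (use N in \<open>auto simp: R.ring_axioms M.a_assoc subset_iff smult_l_distr smult_r_distr smult_assoc1 smult_one\<close>)
qed

lemma submodule_trans:
  assumes "submodule N R M" "submodule N' R (M\<lparr>carrier := N\<rparr>)" "left_module R M"
  shows "submodule N' R M"
proof -
  interpret left_module R M by fact
  note N = submoduleD[OF assms(1)] and N' = submoduleD[OF assms(2)]
  show ?thesis by (rule submoduleI) (use N N' in auto)
qed

lemma submodule_restrict:
  assumes "submodule N R M" "submodule N' R M" "N' \<subseteq> N" "left_module R M"
  shows "submodule N' R (M\<lparr>carrier := N\<rparr>)"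
proof -
  interpret left_module R "M\<lparr>carrier := N\<rparr>" using assms by (simp add: submodule_left_module)
  note N' = submoduleD[OF assms(2)]
  show ?thesis by (rule submoduleI) (use N' assms in auto)
qed

lemma submodule_Int:
  assumes "submodule N R M" "submodule N' R M" "left_module R M"
  shows "submodule (N \<inter> N') R M"
proof -
  interpret left_module R M by fact
  note N = submoduleD[OF assms(1)] and N' = submoduleD[OF assms(2)]
  show ?thesis by (rule submoduleI) (use N N' in auto)
qed

lemma lhom_zero:
  assumes "left_module R M" "left_module R N" "f \<in> lhom R M N"
  shows "f \<zero>\<^bsub>M\<^esub> = \<zero>\<^bsub>N\<^esub>"
proof -
  interpret M: left_module R M by fact
  interpret N: left_module R N by fact
  show ?thesis
    using lhom_smult[OF assms(3), of "\<zero>\<^bsub>R\<^esub>" "\<zero>\<^bsub>M\<^esub>"] lhom_closed[OF assms(3), of "\<zero>\<^bsub>M\<^esub>"]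
    by (simp add: M.smult_zero_l N.smult_zero_l)
qed

lemma lhom_minus:
  assumes "left_module R M" "left_module R N" "f \<in> lhom R M N" "x \<in> carrier M"
  shows "f (\<ominus>\<^bsub>M\<^esub> x) = \<ominus>\<^bsub>N\<^esub> f x"
proof -
  interpret M: left_module R M by fact
  interpret N: left_module R N by fact
  show ?thesis
    using lhom_smult[OF assms(3), of "\<ominus>\<^bsub>R\<^esub> \<one>\<^bsub>R\<^esub>" x] lhom_closed[OF assms(3), of x] assms(4)
    by (simp add: M.smult_minus_one N.smult_minus_one)
qed

lemma lhom_finsum:
  assumes "left_module R M" "left_module R N" "f \<in> lhom R M N" "finite A" "g \<in> A \<rightarrow> carrier M"
  shows "f (finsum M g A) = finsum N (\<lambda>i. f (g i)) A"
proof -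
  interpret M: left_module R M by fact
  interpret N: left_module R N by fact
  show ?thesis using assms(4,5)
    by (induction A) (auto simp: lhom_zero[OF assms(1-3)] lhom_add[OF assms(3)] lhom_closed[OF assms(3)] Pi_def)
qed

lemma lhom_inj_on:
  assumes "left_module R M" "left_module R N" "f \<in> lhom R M N"
    and "\<And>x. x \<in> carrier M \<Longrightarrow> f x = \<zero>\<^bsub>N\<^esub> \<Longrightarrow> x = \<zero>\<^bsub>M\<^esub>"
  shows "inj_on f (carrier M)"
proof (rule inj_onI)
  interpret M: left_module R M by fact
  interpret N: left_module R N by fact
  fix x y assume xy: "x \<in> carrier M" "y \<in> carrier M" "f x = f y"
  have "f (x \<ominus>\<^bsub>M\<^esub> y) = \<zero>\<^bsub>N\<^esub>"
    using xy assms by (simp add: a_minus_def lhom_add[OF assms(3)] lhom_minus[OF assms(1-3)] lhom_closed[OF assms(3)] N.r_neg)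
  with assms(4) xy have "x \<ominus>\<^bsub>M\<^esub> y = \<zero>\<^bsub>M\<^esub>" by simp
  moreover have "x = (x \<ominus>\<^bsub>M\<^esub> y) \<oplus>\<^bsub>M\<^esub> y" using xy by (simp add: a_minus_def M.a_assoc M.l_neg)
  ultimately show "x = y" using xy by simp
qed

lemma lhom_inv_into:
  assumes "left_module R M" "f \<in> lhom R M N" "bij_betw f (carrier M) (carrier N)"
  shows "inv_into (carrier M) f \<in> lhom R N M"
    and "bij_betw (inv_into (carrier M) f) (carrier N) (carrier M)"
proof -
  interpret M: left_module R M by fact
  have inj: "inj_on f (carrier M)" and img: "f ` carrier M = carrier N"
    using assms(3) by (auto simp: bij_betw_def)
  note * = inv_into_f_f[OF inj] f_inv_into_f[of _ f "carrier M"] inv_into_into[of _ f "carrier M"]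
  show "inv_into (carrier M) f \<in> lhom R N M"
  proof (rule lhomI)
    fix x y assume "x \<in> carrier N" "y \<in> carrier N"
    then obtain u v where "u \<in> carrier M" "v \<in> carrier M" "x = f u" "y = f v" using img by blast
    then show "inv_into (carrier M) f (x \<oplus>\<^bsub>N\<^esub> y) = inv_into (carrier M) f x \<oplus>\<^bsub>M\<^esub> inv_into (carrier M) f y"
      using * by (simp flip: lhom_add[OF assms(2)])
  next
    fix a y assume "a \<in> carrier R" "y \<in> carrier N"
    moreover then obtain v where "v \<in> carrier M" "y = f v" using img by auto
    ultimately show "inv_into (carrier M) f (a \<odot>\<^bsub>N\<^esub> y) = a \<odot>\<^bsub>M\<^esub> inv_into (carrier M) f y"
      using * by (simp add: M.smult_closed flip: lhom_smult[OF assms(2)])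
  qed (use * img in auto)
  show "bij_betw (inv_into (carrier M) f) (carrier N) (carrier M)"
    using assms(3) by (rule bij_betw_inv_into)
qed

lemma lmod_iso_sym:
  assumes "left_module R M" "lmod_iso R M N"
  shows "lmod_iso R N M"
  using assms lhom_inv_into by (metis lmod_iso_lhom)

lemma submodule_kernel:
  assumes "left_module R M" "left_module R N" "f \<in> lhom R M N"
  shows "submodule {x \<in> carrier M. f x = \<zero>\<^bsub>N\<^esub>} R M"
proof -
  interpret M: left_module R M by fact
  interpret N: left_module R N by fact
  show ?thesis
    by (rule M.submoduleI)
       (auto simp: lhom_zero[OF assms] lhom_add[OF assms(3)] lhom_smult[OF assms(3)] N.smult_zero_r M.smult_closed)
qed

lemma submodule_image:
  assumes "left_module R M" "left_module R N" "f \<in> lhom R M N"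
  shows "submodule (f ` carrier M) R N"
proof -
  interpret M: left_module R M by fact
  interpret N: left_module R N by fact
  note f = lhomD[OF assms(3)]
  show ?thesis
  proof (rule N.submoduleI)
    show "\<zero>\<^bsub>N\<^esub> \<in> f ` carrier M" using lhom_zero[OF assms] by force
  qed (use f in \<open>auto simp: M.smult_closed simp flip: f(2,3) intro!: imageI\<close>)
qed

lemma submodule_vimage:
  assumes "left_module R M" "left_module R N" "f \<in> lhom R M N" "submodule A R N"
  shows "submodule {x \<in> carrier M. f x \<in> A} R M"
proof -
  interpret M: left_module R M by fact
  interpret N: left_module R N by fact
  note A = submoduleD[OF assms(4)]
  show ?thesis
    by (rule M.submoduleI)
       (use A in \<open>auto simp: lhom_zero[OF assms(1-3)] lhom_add[OF assms(3)] lhom_smult[OF assms(3)] M.smult_closed\<close>)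
qed

lemma simple_lmodD:
  assumes "simple_lmod R M"
  shows simple_left_module: "left_module R M" and simple_nonzero: "\<exists>x\<in>carrier M. x \<noteq> \<zero>\<^bsub>M\<^esub>"
    and simple_submodule: "submodule N R M \<Longrightarrow> N = {\<zero>\<^bsub>M\<^esub>} \<or> N = carrier M"
proof -
  interpret left_module R M using assms by (simp add: simple_lmod_def)
  show "left_module R M" by (fact left_module_axioms)
  show "\<exists>x\<in>carrier M. x \<noteq> \<zero>\<^bsub>M\<^esub>" using assms M.zero_closed unfolding simple_lmod_def by blast
  show "submodule N R M \<Longrightarrow> N = {\<zero>\<^bsub>M\<^esub>} \<or> N = carrier M" using assms by (simp add: simple_lmod_def)
qed

text \<open>Kernel and image are submodules; the nonzero value \<open>f x\<close> excludes a full
  kernel and a zero image.\<close>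

lemma Schur:
  assumes "simple_lmod R M" "simple_lmod R N" "f \<in> lhom R M N" "x \<in> carrier M" "f x \<noteq> \<zero>\<^bsub>N\<^esub>"
  shows "bij_betw f (carrier M) (carrier N)"
proof -
  note M = simple_lmodD[OF assms(1)] and N = simple_lmodD[OF assms(2)]
  have "{x \<in> carrier M. f x = \<zero>\<^bsub>N\<^esub>} = {\<zero>\<^bsub>M\<^esub>} \<or> {x \<in> carrier M. f x = \<zero>\<^bsub>N\<^esub>} = carrier M"
    by (intro M(3) submodule_kernel[OF M(1) N(1) assms(3)])
  then have k: "{x \<in> carrier M. f x = \<zero>\<^bsub>N\<^esub>} = {\<zero>\<^bsub>M\<^esub>}" using assms(4,5) by blast
  have "inj_on f (carrier M)" by (rule lhom_inj_on[OF M(1) N(1) assms(3)]) (use k in blast)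
  moreover have "f ` carrier M = {\<zero>\<^bsub>N\<^esub>} \<or> f ` carrier M = carrier N"
    by (intro N(3) submodule_image[OF M(1) N(1) assms(3)])
  then have "f ` carrier M = carrier N" using assms(4,5) by blast
  ultimately show ?thesis by (simp add: bij_betw_def)
qed

text \<open>Each submodule of \<open>N\<close> is the image of its preimage under the isomorphism,
  and that preimage is trivial or full.\<close>

lemma simple_lmod_cong:
  assumes "simple_lmod R M" "lmod_iso R M N" "left_module R N"
  shows "simple_lmod R N"
proof -
  note M = simple_lmodD[OF assms(1)]
  obtain f where f: "f \<in> lhom R M N" "bij_betw f (carrier M) (carrier N)"
    using assms(2) by (auto simp: lmod_iso_lhom)
  have img: "f ` carrier M = carrier N" and inj: "inj_on f (carrier M)" using f(2) by (auto simp: bij_betw_def)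
  interpret M: left_module R M by (fact M(1))
  obtain x where x: "x \<in> carrier M" "x \<noteq> \<zero>\<^bsub>M\<^esub>" using M(2) by blast
  have "f x \<noteq> \<zero>\<^bsub>N\<^esub>"
    using inj x lhom_zero[OF M(1) assms(3) f(1)] by (metis M.zero_closed inj_onD)
  then have "carrier N \<noteq> {\<zero>\<^bsub>N\<^esub>}" using img x(1) by blast
  moreover have "A = {\<zero>\<^bsub>N\<^esub>} \<or> A = carrier N" if A: "submodule A R N" for A
  proof -
    have AN: "A \<subseteq> f ` carrier M" using submodule_subset[OF A] img by simp
    have "{x \<in> carrier M. f x \<in> A} = {\<zero>\<^bsub>M\<^esub>} \<or> {x \<in> carrier M. f x \<in> A} = carrier M"
      by (intro M(3) submodule_vimage[OF M(1) assms(3) f(1) A])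
    moreover have "A = f ` {x \<in> carrier M. f x \<in> A}" using AN by blast
    ultimately show ?thesis using lhom_zero[OF M(1) assms(3) f(1)] img by fastforce
  qed
  ultimately show ?thesis using assms(3) by (auto simp: simple_lmod_def)
qed

section \<open>Direct sums of modules\<close>

lemma direct_sum_simps:
  "carrier (direct_sum I M) = (\<Pi>\<^sub>E i\<in>I. carrier (M i))"
  "\<zero>\<^bsub>direct_sum I M\<^esub> = (\<lambda>i\<in>I. \<zero>\<^bsub>M i\<^esub>)"
  "f \<oplus>\<^bsub>direct_sum I M\<^esub> g = (\<lambda>i\<in>I. f i \<oplus>\<^bsub>M i\<^esub> g i)"
  "a \<odot>\<^bsub>direct_sum I M\<^esub> f = (\<lambda>i\<in>I. a \<odot>\<^bsub>M i\<^esub> f i)"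
  by (simp_all add: direct_sum_def)

lemma left_module_direct_sum:
  assumes R: "ring R" and M: "\<And>i. i \<in> I \<Longrightarrow> left_module R (M i)"
  shows "left_module R (direct_sum I M)"
proof -
  have ag: "abelian_group (M i)" if "i \<in> I" for i using M[OF that] by (simp add: left_module_def)
  have am: "abelian_monoid (M i)" if "i \<in> I" for i using ag[OF that] by (simp add: abelian_group_def)
  note m = abelian_monoid.a_closed[OF am] abelian_monoid.a_assoc[OF am]
    abelian_monoid.zero_closed[OF am] abelian_monoid.l_zero[OF am]
  note lm = left_module.smult_closed[OF M] left_module.smult_l_distr[OF M] left_module.smult_r_distr[OF M]
    left_module.smult_assoc1[OF M] left_module.smult_one[OF M]
  show ?thesis
  proof (rule left_moduleI)
    fix x assume x: "x \<in> carrier (direct_sum I M)"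
    show "\<exists>y\<in>carrier (direct_sum I M). y \<oplus>\<^bsub>direct_sum I M\<^esub> x = \<zero>\<^bsub>direct_sum I M\<^esub>"
    proof (rule bexI[of _ "\<lambda>i\<in>I. \<ominus>\<^bsub>M i\<^esub> x i"])
      show "(\<lambda>i\<in>I. \<ominus>\<^bsub>M i\<^esub> x i) \<oplus>\<^bsub>direct_sum I M\<^esub> x = \<zero>\<^bsub>direct_sum I M\<^esub>"
        using x by (auto simp: direct_sum_simps fun_eq_iff PiE_iff restrict_def abelian_group.l_neg[OF ag])
      show "(\<lambda>i\<in>I. \<ominus>\<^bsub>M i\<^esub> x i) \<in> carrier (direct_sum I M)"
        using x by (auto simp: direct_sum_simps PiE_iff abelian_group.a_inv_closed[OF ag])
    qed
  next
    fix x y assume "x \<in> carrier (direct_sum I M)" "y \<in> carrier (direct_sum I M)"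
    then show "x \<oplus>\<^bsub>direct_sum I M\<^esub> y = y \<oplus>\<^bsub>direct_sum I M\<^esub> x"
      by (auto simp: direct_sum_simps PiE_iff fun_eq_iff restrict_def abelian_monoid.a_comm[OF am])
  qed (auto simp: R direct_sum_simps PiE_iff restrict_def fun_eq_iff extensional_def m lm)
qed

lemma direct_sum_cong_iso:
  assumes "\<And>i. i \<in> I \<Longrightarrow> lmod_iso R (M i) (N i)"
    and M: "\<And>i. i \<in> I \<Longrightarrow> left_module R (M i)"
  shows "lmod_iso R (direct_sum I M) (direct_sum I N)"
proof -
  have "\<forall>i\<in>I. \<exists>f\<in>lhom R (M i) (N i). bij_betw f (carrier (M i)) (carrier (N i))"
    using assms by (simp add: lmod_iso_lhom)
  then obtain f where f: "\<And>i. i \<in> I \<Longrightarrow> f i \<in> lhom R (M i) (N i)"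
    "\<And>i. i \<in> I \<Longrightarrow> bij_betw (f i) (carrier (M i)) (carrier (N i))" by metis
  define g where "g = (\<lambda>i. inv_into (carrier (M i)) (f i))"
  have ag: "abelian_group (M i)" if "i \<in> I" for i using M[OF that] by (simp add: left_module_def)
  have am: "abelian_monoid (M i)" if "i \<in> I" for i using ag[OF that] by (simp add: abelian_group_def)
  have g: "g i y \<in> carrier (M i)" "f i (g i y) = y" if "i \<in> I" "y \<in> carrier (N i)" for i y
    using f(2)[OF that(1)] that(2) unfolding g_def
    by (metis bij_betw_def inv_into_into, metis bij_betw_def f_inv_into_f)
  have g': "g i (f i x) = x" if "i \<in> I" "x \<in> carrier (M i)" for i x
    using f(2)[OF that(1)] that(2) unfolding g_def by (metis bij_betw_def inv_into_f_f)
  show ?thesis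
  proof (rule lmod_isoI[of "\<lambda>x. \<lambda>i\<in>I. f i (x i)"])
    show "(\<lambda>x. \<lambda>i\<in>I. f i (x i)) \<in> lhom R (direct_sum I M) (direct_sum I N)"
      by (rule lhomI)
         (auto simp: direct_sum_simps PiE_iff fun_eq_iff lhom_closed[OF f(1)] lhom_add[OF f(1)] lhom_smult[OF f(1)]
            abelian_monoid.a_closed[OF am] left_module.smult_closed[OF M])
    show "bij_betw (\<lambda>x. \<lambda>i\<in>I. f i (x i)) (carrier (direct_sum I M)) (carrier (direct_sum I N))"
      by (rule bij_betw_byWitness[where f' = "\<lambda>y. \<lambda>i\<in>I. g i (y i)"])
         (auto simp: direct_sum_simps PiE_iff fun_eq_iff restrict_def extensional_def lhom_closed[OF f(1)] g g')
  qed
qed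

lemma direct_sum_reindex:
  assumes h: "bij_betw h J I"
  shows "lmod_iso R (direct_sum I M) (direct_sum J (\<lambda>j. M (h j)))"
proof (rule lmod_isoI[of "\<lambda>x. \<lambda>j\<in>J. x (h j)"])
  have hI: "h j \<in> I" if "j \<in> J" for j using h that by (auto simp: bij_betw_def)
  define k where "k = inv_into J h"
  have k: "k i \<in> J" "h (k i) = i" if "i \<in> I" for i
    using h that unfolding k_def by (metis bij_betw_def inv_into_into, metis bij_betw_def f_inv_into_f)
  have kh: "k (h j) = j" if "j \<in> J" for j
    using h that unfolding k_def by (metis bij_betw_def inv_into_f_f)
  show "(\<lambda>x. \<lambda>j\<in>J. x (h j)) \<in> lhom R (direct_sum I M) (direct_sum J (\<lambda>j. M (h j)))"
    by (rule lhomI) (auto simp: direct_sum_simps PiE_iff fun_eq_iff hI)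
  show "bij_betw (\<lambda>x. \<lambda>j\<in>J. x (h j)) (carrier (direct_sum I M)) (carrier (direct_sum J (\<lambda>j. M (h j))))"
  proof (rule bij_betw_byWitness[where f' = "\<lambda>y. \<lambda>i\<in>I. y (k i)"])
    show "(\<lambda>y. \<lambda>i\<in>I. y (k i)) ` carrier (direct_sum J (\<lambda>j. M (h j))) \<subseteq> carrier (direct_sum I M)"
    proof (clarsimp simp: direct_sum_simps PiE_iff)
      fix x i assume "\<forall>j\<in>J. x j \<in> carrier (M (h j))" "i \<in> I"
      then show "x (k i) \<in> carrier (M i)" using k[of i] by metis
    qed
  qed (auto simp: direct_sum_simps PiE_iff fun_eq_iff restrict_def hI k kh extensional_def)
qed

text \<open>Flattens nested sums, such as the \<open>a i\<close> copies of the sum of the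
  \<open>W i j\<close>, into one family of simple modules whose members can be counted.\<close>

lemma direct_sum_Sigma:
  "lmod_iso R (direct_sum I (\<lambda>i. direct_sum (J i) (M i))) (direct_sum (Sigma I J) (\<lambda>p. M (fst p) (snd p)))"
proof (rule lmod_isoI[of "\<lambda>x. \<lambda>p\<in>Sigma I J. x (fst p) (snd p)"])
  show "(\<lambda>x. \<lambda>p\<in>Sigma I J. x (fst p) (snd p)) \<in>
    lhom R (direct_sum I (\<lambda>i. direct_sum (J i) (M i))) (direct_sum (Sigma I J) (\<lambda>p. M (fst p) (snd p)))"
    by (rule lhomI) (auto simp: direct_sum_simps PiE_iff fun_eq_iff)
  show "bij_betw (\<lambda>x. \<lambda>p\<in>Sigma I J. x (fst p) (snd p))
     (carrier (direct_sum I (\<lambda>i. direct_sum (J i) (M i)))) (carrier (direct_sum (Sigma I J) (\<lambda>p. M (fst p) (snd p))))"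
  proof (rule bij_betw_byWitness[where f' = "\<lambda>y. \<lambda>i\<in>I. \<lambda>j\<in>J i. y (i, j)"])
    show "\<forall>x\<in>carrier (direct_sum I (\<lambda>i. direct_sum (J i) (M i))).
      (\<lambda>i\<in>I. \<lambda>j\<in>J i. (\<lambda>p\<in>Sigma I J. x (fst p) (snd p)) (i, j)) = x"
      by (auto simp: direct_sum_simps PiE_iff fun_eq_iff restrict_def extensional_def)
    show "\<forall>y\<in>carrier (direct_sum (Sigma I J) (\<lambda>p. M (fst p) (snd p))).
      (\<lambda>p\<in>Sigma I J. (\<lambda>i\<in>I. \<lambda>j\<in>J i. y (i, j)) (fst p) (snd p)) = y"
      by (auto simp: direct_sum_simps PiE_iff fun_eq_iff restrict_def extensional_def)
  qed (auto simp: direct_sum_simps PiE_iff split: if_splits)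
qed

lemma lhom_into_submodule:
  assumes "f \<in> lhom R M (N\<lparr>carrier := A\<rparr>)" "A \<subseteq> carrier N"
  shows "f \<in> lhom R M N"
  using assms by (auto simp: lhom_def)

section \<open>Multiplicities in semisimple modules\<close>

lemma lhom_proj: "i \<in> I \<Longrightarrow> (\<lambda>x. x i) \<in> lhom R (direct_sum I M) (M i)"
  by (rule lhomI) (auto simp: direct_sum_simps)

text \<open>The inclusion of the summand at \<open>i\<close>.\<close>

definition dinj :: "'i set \<Rightarrow> ('i \<Rightarrow> ('a, 'b) module) \<Rightarrow> 'i \<Rightarrow> 'b \<Rightarrow> 'i \<Rightarrow> 'b"
  where "dinj I M i v = (\<lambda>j\<in>I. if j = i then v else \<zero>\<^bsub>M j\<^esub>)"

lemma lhom_dinj: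
  assumes "\<And>i. i \<in> I \<Longrightarrow> left_module R (M i)" "i \<in> I"
  shows "dinj I M i \<in> lhom R (M i) (direct_sum I M)"
proof -
  have am: "abelian_monoid (M j)" if "j \<in> I" for j
    using assms(1)[OF that] by (simp add: left_module_def abelian_group_def)
  show ?thesis
  proof (rule lhomI)
  fix x assume "x \<in> carrier (M i)"
  then show "dinj I M i x \<in> carrier (direct_sum I M)"
    using assms(2) by (auto simp: dinj_def direct_sum_simps abelian_monoid.zero_closed[OF am])
next
  fix x y assume "x \<in> carrier (M i)" "y \<in> carrier (M i)"
  then show "dinj I M i (x \<oplus>\<^bsub>M i\<^esub> y) = dinj I M i x \<oplus>\<^bsub>direct_sum I M\<^esub> dinj I M i y"
    using assms(2) by (auto simp: dinj_def direct_sum_simps fun_eq_iff abelian_monoid.l_zero[OF am] abelian_monoid.zero_closed[OF am])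
next
  fix a x assume "a \<in> carrier R" "x \<in> carrier (M i)"
  then show "dinj I M i (a \<odot>\<^bsub>M i\<^esub> x) = a \<odot>\<^bsub>direct_sum I M\<^esub> dinj I M i x"
    using assms(2) by (auto simp: dinj_def direct_sum_simps fun_eq_iff left_module.smult_zero_r[OF assms(1)])
  qed
qed

text \<open>Every element is the finite sum of its components; the coordinates are filled in one
  after another, by induction over the set \<open>J\<close> of those already filled.\<close>

lemma direct_sum_generated:
  assumes M: "\<And>i. i \<in> I \<Longrightarrow> left_module R (M i)" and "finite I"
    and A: "submodule A R (direct_sum I M)"
    and inj: "\<And>i v. i \<in> I \<Longrightarrow> v \<in> carrier (M i) \<Longrightarrow> dinj I M i v \<in> A"
  shows "A = carrier (direct_sum I M)"
proof
  show "A \<subseteq> carrier (direct_sum I M)" using submodule_subset[OF A] .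
  show "carrier (direct_sum I M) \<subseteq> A"
  proof
    fix x assume x: "x \<in> carrier (direct_sum I M)"
    have xi: "x i \<in> carrier (M i)" if "i \<in> I" for i using x that by (auto simp: direct_sum_simps)
    have am: "abelian_monoid (M i)" if "i \<in> I" for i
      using M[OF that] by (simp add: left_module_def abelian_group_def)
    have "(\<lambda>i\<in>I. if i \<in> J then x i else \<zero>\<^bsub>M i\<^esub>) \<in> A" if "J \<subseteq> I" for J
      using finite_subset[OF that assms(2)] that
    proof (induction J)
      case empty
      have "(\<lambda>i\<in>I. if i \<in> {} then x i else \<zero>\<^bsub>M i\<^esub>) = \<zero>\<^bsub>direct_sum I M\<^esub>"
        by (simp only: direct_sum_simps empty_iff if_False)
      show ?case unfolding \<open>_ = \<zero>\<^bsub>direct_sum I M\<^esub>\<close> by (rule submodule_zero[OF A])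
    next
      case (insert j J)
      have "(\<lambda>i\<in>I. if i \<in> insert j J then x i else \<zero>\<^bsub>M i\<^esub>) =
        dinj I M j (x j) \<oplus>\<^bsub>direct_sum I M\<^esub> (\<lambda>i\<in>I. if i \<in> J then x i else \<zero>\<^bsub>M i\<^esub>)"
      proof
        fix i
        show "(\<lambda>i\<in>I. if i \<in> insert j J then x i else \<zero>\<^bsub>M i\<^esub>) i =
          (dinj I M j (x j) \<oplus>\<^bsub>direct_sum I M\<^esub> (\<lambda>i\<in>I. if i \<in> J then x i else \<zero>\<^bsub>M i\<^esub>)) i"
        proof (cases "i \<in> I")
          case True
          interpret Mi: left_module R "M i" using M[OF True] .
          show ?thesis using True insert(2) xi[OF True]
            by (cases "j = i") (simp_all add: dinj_def direct_sum_simps)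
        qed (simp add: direct_sum_simps)
      qed
      moreover have "(\<lambda>i\<in>I. if i \<in> J then x i else \<zero>\<^bsub>M i\<^esub>) \<in> A" using insert.IH insert.prems by blast
      moreover have "dinj I M j (x j) \<in> A" using inj xi insert.prems by auto
      ultimately show ?case using submodule_add[OF A] by simp
    qed
    from this[of I] have "(\<lambda>i\<in>I. if i \<in> I then x i else \<zero>\<^bsub>M i\<^esub>) \<in> A" by simp
    moreover have "(\<lambda>i\<in>I. if i \<in> I then x i else \<zero>\<^bsub>M i\<^esub>) = x"
      using x by (auto simp: direct_sum_simps fun_eq_iff PiE_iff extensional_def)
    ultimately show "x \<in> A" by simp
  qed
qed

text \<open>
  Gaussian elimination, by induction on \<open>I\<close>: if the component of \<open>f\<close> at \<open>i\<close> is nonzero, it is an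
  isomorphism on some copy of \<open>V\<close>, which is eliminated together with \<open>S i\<close>.
\<close>

lemma lmod_iso_card_le:
  assumes R: "ring R" and V: "simple_lmod R V" and "finite I" "\<And>i. i \<in> I \<Longrightarrow> simple_lmod R (S i)"
    and "finite J" "f \<in> lhom R (direct_sum J (\<lambda>_. V)) (direct_sum I S)"
    and "inj_on f (carrier (direct_sum J (\<lambda>_. V)))"
  shows "card J \<le> card {i \<in> I. lmod_iso R (S i) V}"
  using assms(3-)
proof (induction I arbitrary: J f)
  case empty
  interpret V: left_module R V using V by (rule simple_left_module)
  have "J = {}"
  proof (rule ccontr)
    assume "J \<noteq> {}"
    then obtain j where j: "j \<in> J" by blast
    obtain v where v: "v \<in> carrier V" "v \<noteq> \<zero>\<^bsub>V\<^esub>" using simple_nonzero[OF V] by blast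
    define x where "x = dinj J (\<lambda>_. V) j v"
    define y where "y = dinj J (\<lambda>_. V) j \<zero>\<^bsub>V\<^esub>"
    have xy: "x \<in> carrier (direct_sum J (\<lambda>_. V))" "y \<in> carrier (direct_sum J (\<lambda>_. V))"
      unfolding x_def y_def using v lhom_closed[OF lhom_dinj[OF V.left_module_axioms j]] by auto
    then have "f x \<in> carrier (direct_sum {} S)" "f y \<in> carrier (direct_sum {} S)"
      using lhom_closed[OF empty(3)] by auto
    then have "f x = f y" by (simp add: direct_sum_simps)
    then have "x = y" using empty(4) xy by (meson inj_onD)
    then have "x j = y j" by simp
    then show False using v j by (simp add: x_def y_def dinj_def)
  qed
  then show ?case by simp
next
  case (insert i I)
  interpret V: left_module R V using V by (rule simple_left_module)
  note f = lhomD[OF insert.prems(3)]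
  let ?D = "direct_sum J (\<lambda>_. V)"
  have lD: "left_module R ?D" using R V.left_module_axioms by (rule left_module_direct_sum)
  interpret D: left_module R ?D by (fact lD)
  have simp': "\<And>i. i \<in> I \<Longrightarrow> simple_lmod R (S i)" and simpi: "simple_lmod R (S i)" using insert.prems(1) by auto
  interpret Si: left_module R "S i" using simpi by (rule simple_left_module)
  define p where "p = (\<lambda>x. x i) \<circ> f"
  have p: "p \<in> lhom R ?D (S i)"
    unfolding p_def by (rule lhom_comp[OF insert.prems(3)]) (simp add: lhom_proj)
  let ?r = "\<lambda>x. restrict x I"
  have r: "?r \<in> lhom R (direct_sum (insert i I) S) (direct_sum I S)"
    by (rule lhomI) (auto simp: direct_sum_simps fun_eq_iff)
  have rinj: "x = y" if "x \<in> carrier (direct_sum (insert i I) S)" "y \<in> carrier (direct_sum (insert i I) S)"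
     "?r x = ?r y" "x i = y i" for x y
  proof
    fix j
    show "x j = y j"
    proof (cases "j \<in> I")
      case True
      then show ?thesis using fun_cong[OF that(3), of j] by simp
    next
      case False
      then show ?thesis using that(1,2,4) by (cases "j = i") (auto simp: direct_sum_simps PiE_iff extensional_def)
    qed
  qed
  show ?case
  proof (cases "\<forall>x\<in>carrier ?D. p x = \<zero>\<^bsub>S i\<^esub>")
    case True
    \<comment> \<open>The image of \<open>f\<close> has zero component at \<open>i\<close>, so
      nothing is lost by dropping this coordinate.\<close>
    have inj: "inj_on (?r \<circ> f) (carrier ?D)"
    proof (rule inj_onI)
      fix x y assume *: "x \<in> carrier ?D" "y \<in> carrier ?D" "(?r \<circ> f) x = (?r \<circ> f) y"
      have "f x i = f y i" using True * by (simp add: p_def)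
      then have "f x = f y" using * f(1) rinj by auto
      then show "x = y" using insert.prems(4) * by (auto dest: inj_onD)
    qed
    have le: "card J \<le> card {j \<in> I. lmod_iso R (S j) V}"
      by (rule insert.IH[OF simp' insert.prems(2) lhom_comp[OF insert.prems(3) r] inj])
    have "card {j \<in> I. lmod_iso R (S j) V} \<le> card {j \<in> insert i I. lmod_iso R (S j) V}"
    proof (rule card_mono)
      show "finite {j \<in> insert i I. lmod_iso R (S j) V}"
        by (rule finite_subset[OF _ finite.insertI[OF insert(1), of i]]) blast
    qed blast
    with le show ?thesis by (rule order_trans)
  next
    case False
    have "\<exists>j\<in>J. \<exists>v\<in>carrier V. p (dinj J (\<lambda>_. V) j v) \<noteq> \<zero>\<^bsub>S i\<^esub>"
    proof (rule ccontr)
      assume *: "\<not> ?thesis"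
      have "{x \<in> carrier ?D. p x = \<zero>\<^bsub>S i\<^esub>} = carrier ?D"
      proof (rule direct_sum_generated[OF V.left_module_axioms insert.prems(2)
            submodule_kernel[OF lD Si.left_module_axioms p]])
        fix j v assume jv: "j \<in> J" "v \<in> carrier V"
        have "p (dinj J (\<lambda>_. V) j v) = \<zero>\<^bsub>S i\<^esub>"
        proof (rule ccontr)
          assume "p (dinj J (\<lambda>_. V) j v) \<noteq> \<zero>\<^bsub>S i\<^esub>"
          then have "\<exists>j\<in>J. \<exists>v\<in>carrier V. p (dinj J (\<lambda>_. V) j v) \<noteq> \<zero>\<^bsub>S i\<^esub>"            by (rule bexI[OF bexI[OF _ jv(2)] jv(1)])
          with * show False by (rule notE)
        qed
        moreover have "dinj J (\<lambda>_. V) j v \<in> carrier ?D"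
          by (rule lhom_closed[OF lhom_dinj[OF V.left_module_axioms jv(1)] jv(2)])
        ultimately show "dinj J (\<lambda>_. V) j v \<in> {x \<in> carrier ?D. p x = \<zero>\<^bsub>S i\<^esub>}"
          by (intro CollectI conjI)
      qed
      then have "\<forall>x\<in>carrier ?D. p x = \<zero>\<^bsub>S i\<^esub>" by (blast dest: equalityD2)
      with False show False by (rule notE)
    qed
    then obtain j v where j: "j \<in> J" and v: "v \<in> carrier V" and pv: "p (dinj J (\<lambda>_. V) j v) \<noteq> \<zero>\<^bsub>S i\<^esub>" by blast
    define q where "q = p \<circ> dinj J (\<lambda>_. V) j"
    have q: "q \<in> lhom R V (S i)"
      unfolding q_def by (rule lhom_comp[OF lhom_dinj[OF V.left_module_axioms j] p])
    have bq: "bij_betw q (carrier V) (carrier (S i))"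
      by (rule Schur[OF V simpi q v]) (use pv in \<open>simp add: q_def\<close>)
    define q' where "q' = inv_into (carrier V) q"
    have q': "q' \<in> lhom R (S i) V" unfolding q'_def using lhom_inv_into[OF V.left_module_axioms q bq] by simp
    have qq': "q (q' y) = y" if "y \<in> carrier (S i)" for y
      using bq that unfolding q'_def by (metis bij_betw_def f_inv_into_f)
    have iso: "lmod_iso R (S i) V" by (rule lmod_iso_sym[OF V.left_module_axioms lmod_isoI[OF q bq]])
    let ?J = "J - {j}"
    let ?E = "direct_sum ?J (\<lambda>_. V)"
    define w0 where "w0 = (\<lambda>w. \<lambda>j'\<in>J. if j' = j then \<zero>\<^bsub>V\<^esub> else w j')"
    have w0: "w0 \<in> lhom R ?E ?D"
    proof (rule lhomI)
      fix w assume "w \<in> carrier ?E"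
      then have "w j' \<in> carrier V" if "j' \<in> J" "j' \<noteq> j" for j'
        using that by (simp add: direct_sum_simps PiE_iff)
      then show "w0 w \<in> carrier ?D"
        unfolding w0_def direct_sum_simps by (simp add: restrict_PiE_iff)
    next
      fix w w'
      show "w0 (w \<oplus>\<^bsub>?E\<^esub> w') = w0 w \<oplus>\<^bsub>?D\<^esub> w0 w'"
        unfolding w0_def direct_sum_simps by (rule restrict_ext) (use V.M.zero_closed in simp)
    next
      fix a w assume a: "a \<in> carrier R"
      show "w0 (a \<odot>\<^bsub>?E\<^esub> w) = a \<odot>\<^bsub>?D\<^esub> w0 w"
        unfolding w0_def direct_sum_simps by (rule restrict_ext) (use V.smult_zero_r[OF a] in simp)
    qed
    define c where "c = q' \<circ> (p \<circ> w0)"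
    have c: "c \<in> lhom R ?E V"
      unfolding c_def using lhom_comp[OF lhom_comp[OF w0 p] q'] by simp
    \<comment> \<open>Embeds the remaining copies as a graph: the copy at \<open>j\<close> receives
      the element \<open>- c w\<close> for which the component of \<open>f\<close> at
      \<open>i\<close> cancels, where \<open>c w\<close> is the preimage under \<open>q\<close> of
      the contribution of the other copies.\<close>
    define e where "e = (\<lambda>w. \<lambda>j'\<in>J. if j' = j then \<ominus>\<^bsub>V\<^esub> c w else w j')"
    have e: "e \<in> lhom R ?E ?D"
    proof (rule lhomI)
      fix w assume w: "w \<in> carrier ?E"
      then have "w j' \<in> carrier V" if "j' \<in> J" "j' \<noteq> j" for j'
        using that by (simp add: direct_sum_simps PiE_iff)
      then show "e w \<in> carrier ?D"
        using lhom_closed[OF c w] unfolding e_def direct_sum_simps by (simp add: restrict_PiE_iff)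
    next
      fix w w' assume w: "w \<in> carrier ?E" "w' \<in> carrier ?E"
      have "\<ominus>\<^bsub>V\<^esub> c (w \<oplus>\<^bsub>?E\<^esub> w') = \<ominus>\<^bsub>V\<^esub> c w \<oplus>\<^bsub>V\<^esub> \<ominus>\<^bsub>V\<^esub> c w'"
        using lhom_closed[OF c] w by (simp add: lhom_add[OF c w] V.minus_add)
      then show "e (w \<oplus>\<^bsub>?E\<^esub> w') = e w \<oplus>\<^bsub>?D\<^esub> e w'"
        unfolding e_def direct_sum_simps by (intro restrict_ext) simp
    next
      fix a w assume w: "a \<in> carrier R" "w \<in> carrier ?E"
      have "\<ominus>\<^bsub>V\<^esub> c (a \<odot>\<^bsub>?E\<^esub> w) = a \<odot>\<^bsub>V\<^esub> (\<ominus>\<^bsub>V\<^esub> c w)"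
        using lhom_closed[OF c] w by (simp add: lhom_smult[OF c w] V.smult_minus_r)
      then show "e (a \<odot>\<^bsub>?E\<^esub> w) = a \<odot>\<^bsub>?D\<^esub> e w"
        unfolding e_def direct_sum_simps by (intro restrict_ext) simp
    qed
    have pe: "p (e w) = \<zero>\<^bsub>S i\<^esub>" if w: "w \<in> carrier ?E" for w
    proof -
      have cw: "c w \<in> carrier V" using lhom_closed[OF c w] .
      have "e w = w0 w \<oplus>\<^bsub>?D\<^esub> dinj J (\<lambda>_. V) j (\<ominus>\<^bsub>V\<^esub> c w)"
        unfolding e_def w0_def dinj_def direct_sum_simps
      proof (rule restrict_ext)
        fix j' assume j': "j' \<in> J"
        show "(if j' = j then \<ominus>\<^bsub>V\<^esub> c w else w j') =
          (\<lambda>j'\<in>J. if j' = j then \<zero>\<^bsub>V\<^esub> else w j') j' \<oplus>\<^bsub>V\<^esub> (\<lambda>j'\<in>J. if j' = j then \<ominus>\<^bsub>V\<^esub> c w else \<zero>\<^bsub>V\<^esub>) j'"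
        proof (cases "j' = j")
          case False
          then have "w j' \<in> carrier V" using w j' by (simp add: direct_sum_simps PiE_iff)
          then show ?thesis using j' False by simp
        qed (use j' cw in simp)
      qed
      then have "p (e w) = p (w0 w) \<oplus>\<^bsub>S i\<^esub> q (\<ominus>\<^bsub>V\<^esub> c w)"
        using lhom_add[OF p] lhom_closed[OF w0 w] lhom_closed[OF lhom_dinj[OF V.left_module_axioms j]] cw
        by (simp add: q_def)
      also have "q (\<ominus>\<^bsub>V\<^esub> c w) = \<ominus>\<^bsub>S i\<^esub> p (w0 w)"
        using lhom_minus[OF V.left_module_axioms Si.left_module_axioms q cw] lhom_closed[OF p lhom_closed[OF w0 w]]
        by (simp add: c_def qq')
      finally show ?thesis using lhom_closed[OF p lhom_closed[OF w0 w]] by (simp add: Si.M.r_neg)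
    qed
    have inj: "inj_on (?r \<circ> (f \<circ> e)) (carrier ?E)"
    proof (rule inj_onI)
      fix x y assume *: "x \<in> carrier ?E" "y \<in> carrier ?E" "(?r \<circ> (f \<circ> e)) x = (?r \<circ> (f \<circ> e)) y"
      have ee: "e x \<in> carrier ?D" "e y \<in> carrier ?D" using * lhom_closed[OF e] by auto
      have "f (e x) i = f (e y) i" using pe * by (simp add: p_def)
      then have "f (e x) = f (e y)" using * ee f(1) rinj by auto
      then have exy: "e x = e y" using insert.prems(4) ee by (meson inj_onD)
      show "x = y"
      proof
        fix j'
        show "x j' = y j'"
        proof (cases "j' \<in> ?J")
          case True
          then show ?thesis using fun_cong[OF exy, of j'] by (simp add: e_def)
        next
          case False
          then show ?thesis
            using PiE_arb[OF *(1)[unfolded direct_sum_simps] False] PiE_arb[OF *(2)[unfolded direct_sum_simps] False]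
            by simp
        qed
      qed
    qed
    \<comment> \<open>One copy of \<open>V\<close> and the index \<open>i\<close> have been removed;
      as \<open>S i\<close> is isomorphic to \<open>V\<close>, both counts drop by exactly
      one.\<close>
    have "card ?J \<le> card {j \<in> I. lmod_iso R (S j) V}"
      by (rule insert.IH[OF simp' finite_Diff[OF insert.prems(2)] lhom_comp[OF lhom_comp[OF e insert.prems(3)] r] inj])
    moreover have "{j \<in> insert i I. lmod_iso R (S j) V} = insert i {j \<in> I. lmod_iso R (S j) V}"
      using iso by auto
    ultimately show ?thesis using j insert.prems(2) insert(1,2) by (simp add: card_Diff_singleton)
  qed
qed

text \<open>\<open>N\<close> is the preimage under \<open>f\<close> of the partial sum over
  \<open>J\<close>. Applied to a set of indices and to its complement, this produces complementary
  summands of \<open>M\<close>.\<close>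

lemma direct_sum_submodule:
  assumes M: "left_module R M" and S: "\<And>i. i \<in> I \<Longrightarrow> left_module R (S i)" and JI: "J \<subseteq> I"
    and f: "f \<in> lhom R M (direct_sum I S)" "bij_betw f (carrier M) (carrier (direct_sum I S))"
  defines "N \<equiv> {x \<in> carrier M. \<forall>i\<in>I - J. f x i = \<zero>\<^bsub>S i\<^esub>}"
  shows "submodule N R M" "lmod_iso R (M\<lparr>carrier := N\<rparr>) (direct_sum J S)"
proof -
  interpret M: left_module R M by fact
  have R: "ring R" by (rule M.R.ring_axioms)
  have sI: "left_module R (direct_sum I S)" using R S by (rule left_module_direct_sum)
  have am: "abelian_monoid (S i)" if "i \<in> I" for i
    using S[OF that] by (simp add: left_module_def abelian_group_def)
  note fD = lhomD[OF f(1)]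
  have fi: "f x i \<in> carrier (S i)" if "x \<in> carrier M" "i \<in> I" for x i
    using fD(1)[OF that(1)] that(2) by (auto simp: direct_sum_simps)
  show N: "submodule N R M"
    unfolding N_def
    by (rule M.submoduleI)
       (auto simp: fD(2,3) direct_sum_simps lhom_zero[OF M sI f(1)] M.smult_closed left_module.smult_zero_r[OF S]
           abelian_monoid.l_zero[OF am] abelian_monoid.zero_closed[OF am])
  have NM: "N \<subseteq> carrier M" by (auto simp: N_def)
  show "lmod_iso R (M\<lparr>carrier := N\<rparr>) (direct_sum J S)"
  proof (rule lmod_isoI[of "\<lambda>x. restrict (f x) J"])
    show "(\<lambda>x. restrict (f x) J) \<in> lhom R (M\<lparr>carrier := N\<rparr>) (direct_sum J S)"
      by (rule lhomI) (use NM JI fi fD in \<open>auto simp: direct_sum_simps fun_eq_iff subset_iff\<close>)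
    show "bij_betw (\<lambda>x. restrict (f x) J) (carrier (M\<lparr>carrier := N\<rparr>)) (carrier (direct_sum J S))"
      unfolding bij_betw_def
    proof
      show "inj_on (\<lambda>x. restrict (f x) J) (carrier (M\<lparr>carrier := N\<rparr>))"
      proof (rule inj_onI, simp)
        fix x y assume *: "x \<in> N" "y \<in> N" "restrict (f x) J = restrict (f y) J"
        have "f x i = f y i" for i
        proof -
          consider "i \<in> J" | "i \<in> I - J" | "i \<notin> I" by blast
          then show ?thesis
          proof cases
            case 1
            then show ?thesis using fun_cong[OF *(3), of i] by simp
          next
            case 2
            then show ?thesis using * by (simp add: N_def)
          next
            case 3
            then show ?thesis using * fD(1)[of x] fD(1)[of y] NM
              by (auto simp: direct_sum_simps PiE_iff extensional_def subset_iff)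
          qed
        qed
        then show "x = y" using f(2) * NM by (metis bij_betw_def ext inj_onD subset_iff)
      qed
      show "(\<lambda>x. restrict (f x) J) ` carrier (M\<lparr>carrier := N\<rparr>) = carrier (direct_sum J S)"
      proof
        show "(\<lambda>x. restrict (f x) J) ` carrier (M\<lparr>carrier := N\<rparr>) \<subseteq> carrier (direct_sum J S)"
          using NM JI fi by (auto simp: direct_sum_simps subset_iff)
        show "carrier (direct_sum J S) \<subseteq> (\<lambda>x. restrict (f x) J) ` carrier (M\<lparr>carrier := N\<rparr>)"
        proof
          fix y assume y: "y \<in> carrier (direct_sum J S)"
          define z where "z = (\<lambda>i\<in>I. if i \<in> J then y i else \<zero>\<^bsub>S i\<^esub>)"
          have "z \<in> carrier (direct_sum I S)"
            using y JI abelian_monoid.zero_closed[OF am] by (auto simp: z_def direct_sum_simps)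
          then obtain x where x: "x \<in> carrier M" "f x = z" using f(2) by (metis bij_betw_imp_surj_on imageE)
          then have "x \<in> N" by (auto simp: N_def z_def)
          moreover have "restrict (f x) J = y"
            using x y JI by (auto simp: z_def direct_sum_simps fun_eq_iff PiE_iff extensional_def restrict_def)
          ultimately show "y \<in> (\<lambda>x. restrict (f x) J) ` carrier (M\<lparr>carrier := N\<rparr>)" by force
        qed
      qed
    qed
  qed
qed

text \<open>The summands isomorphic to \<open>V\<close> together form a direct summand, which
  attains the count. Conversely a summand consisting of \<open>m\<close> copies of \<open>V\<close>
  embeds into the sum of the \<open>S i\<close>, and \<open>lmod_iso_card_le\<close> bounds
  \<open>m\<close>. The supremum is thus a maximum, and the count does not depend on the
  decomposition.\<close>

lemma summand_multiplicity_eq: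
  assumes M: "left_module R M" and V: "simple_lmod R V" and I: "finite I"
    and S: "\<And>i. i \<in> I \<Longrightarrow> simple_lmod R (S i)"
    and iso: "lmod_iso R M (direct_sum I S)"
  shows "summand_multiplicity R V M = enat (card {i \<in> I. lmod_iso R (S i) V})"
  unfolding summand_multiplicity_def
proof (rule cSup_eq_maximum)
  interpret M: left_module R M by fact
  have R: "ring R" by (rule M.R.ring_axioms)
  have lS: "left_module R (S i)" if "i \<in> I" for i using S[OF that] by (rule simple_left_module)
  have lV: "left_module R V" using V by (rule simple_left_module)
  have sI: "left_module R (direct_sum I S)" using R lS by (rule left_module_direct_sum)
  have am: "abelian_monoid (S i)" if "i \<in> I" for i
    using lS[OF that] by (simp add: left_module_def abelian_group_def)
  obtain f where f: "f \<in> lhom R M (direct_sum I S)" "bij_betw f (carrier M) (carrier (direct_sum I S))"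
    using iso by (auto simp: lmod_iso_lhom)
  have fi: "f x i \<in> carrier (S i)" if "x \<in> carrier M" "i \<in> I" for x i
    using lhom_closed[OF f(1) that(1)] that(2) by (auto simp: direct_sum_simps)
  have finj: "x = y" if "x \<in> carrier M" "y \<in> carrier M" "\<And>i. i \<in> I \<Longrightarrow> f x i = f y i" for x y
  proof -
    have "f x = f y"
      using that lhom_closed[OF f(1) that(1)] lhom_closed[OF f(1) that(2)]
      by (auto simp: direct_sum_simps intro: PiE_ext)
    then show ?thesis using f(2) that by (meson bij_betw_def inj_onD)
  qed
  have fsurj: "\<exists>x\<in>carrier M. f x = y" if "y \<in> carrier (direct_sum I S)" for y
    using f(2) that by (metis bij_betw_imp_surj_on imageE)
  let ?J = "{i \<in> I. lmod_iso R (S i) V}"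
  \<comment> \<open>The isotypic part and its complement. The second condition is written with
    \<open>I - (I - ?J)\<close> so that it is literally the instance of
    \<open>direct_sum_submodule\<close> for the index set \<open>I - ?J\<close>.\<close>
  let ?N = "{x \<in> carrier M. \<forall>i\<in>I - ?J. f x i = \<zero>\<^bsub>S i\<^esub>}" and ?N' = "{x \<in> carrier M. \<forall>i\<in>I - (I - ?J). f x i = \<zero>\<^bsub>S i\<^esub>}"
  have JI: "?J \<subseteq> I" "I - ?J \<subseteq> I" by auto
  note N = direct_sum_submodule[OF M lS JI(1) f] and N' = direct_sum_submodule[OF M lS JI(2) f]
  have f0: "f \<zero>\<^bsub>M\<^esub> = (\<lambda>i\<in>I. \<zero>\<^bsub>S i\<^esub>)" using lhom_zero[OF M sI f(1)] by (simp add: direct_sum_simps)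
  have int: "?N \<inter> ?N' = {\<zero>\<^bsub>M\<^esub>}"
  proof
    show "?N \<inter> ?N' \<subseteq> {\<zero>\<^bsub>M\<^esub>}"
    proof
      fix x assume x: "x \<in> ?N \<inter> ?N'"
      then have "f x i = f \<zero>\<^bsub>M\<^esub> i" if "i \<in> I" for i using that f0 by (cases "i \<in> ?J") auto
      then show "x \<in> {\<zero>\<^bsub>M\<^esub>}" using x finj[of x "\<zero>\<^bsub>M\<^esub>"] by auto
    qed
  qed (auto simp: f0)
  have sum: "?N <+>\<^bsub>M\<^esub> ?N' = carrier M"
  proof
    show "?N <+>\<^bsub>M\<^esub> ?N' \<subseteq> carrier M" by (auto simp: set_add_def')
    show "carrier M \<subseteq> ?N <+>\<^bsub>M\<^esub> ?N'"
    proof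
      fix x assume x: "x \<in> carrier M"
      define y1 where "y1 = (\<lambda>i\<in>I. if i \<in> ?J then f x i else \<zero>\<^bsub>S i\<^esub>)"
      define y2 where "y2 = (\<lambda>i\<in>I. if i \<in> ?J then \<zero>\<^bsub>S i\<^esub> else f x i)"
      have "y1 \<in> carrier (direct_sum I S)" "y2 \<in> carrier (direct_sum I S)"
        using fi[OF x] abelian_monoid.zero_closed[OF am] by (auto simp: y1_def y2_def direct_sum_simps)
      then obtain x1 x2 where x12: "x1 \<in> carrier M" "f x1 = y1" "x2 \<in> carrier M" "f x2 = y2"
        using fsurj by metis
      have "x1 \<in> ?N" "x2 \<in> ?N'" using x12 by (auto simp: y1_def y2_def)
      moreover have "x = x1 \<oplus>\<^bsub>M\<^esub> x2"
        by (rule finj)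
           (use x x12 fi abelian_monoid.l_zero[OF am] abelian_monoid.r_zero[OF am] in
             \<open>auto simp: lhom_add[OF f(1)] direct_sum_simps y1_def y2_def\<close>)
      ultimately show "x \<in> ?N <+>\<^bsub>M\<^esub> ?N'" by (auto simp: set_add_def')
    qed
  qed
  have fJ: "finite ?J" by (rule finite_subset[OF JI(1) I])
  obtain h where h: "bij_betw h {..<card ?J} ?J"
    using ex_bij_betw_nat_finite[OF fJ] by (auto simp: atLeast0LessThan)
  have d1: "lmod_iso R (direct_sum ?J S) (direct_sum {..<card ?J} (\<lambda>n. S (h n)))"
    by (rule direct_sum_reindex[OF h])
  have d2: "lmod_iso R (direct_sum {..<card ?J} (\<lambda>n. S (h n))) (direct_sum {..<card ?J} (\<lambda>_. V))"
  proof (rule direct_sum_cong_iso)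
    fix n assume "n \<in> {..<card ?J}"
    then have "h n \<in> ?J" using h by (meson bij_betwE)
    then show "lmod_iso R (S (h n)) V" "left_module R (S (h n))" using lS by auto
  qed
  have "lmod_iso R (M\<lparr>carrier := ?N\<rparr>) (direct_sum {..<card ?J} (\<lambda>_. V))"
    by (rule lmod_iso_trans[OF N(2) lmod_iso_trans[OF d1 d2]])
  then show "enat (card ?J) \<in> {enat m |m. \<exists>N N'. submodule N R M \<and> submodule N' R M \<and> N \<inter> N' = {\<zero>\<^bsub>M\<^esub>} \<and>
      N <+>\<^bsub>M\<^esub> N' = carrier M \<and> lmod_iso R (M\<lparr>carrier := N\<rparr>) (direct_sum {..<m} (\<lambda>_. V))}"
    using N(1) N'(1) int sum by blast
next
  fix x assume "x \<in> {enat m |m. \<exists>N N'. submodule N R M \<and> submodule N' R M \<and> N \<inter> N' = {\<zero>\<^bsub>M\<^esub>} \<and>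
      N <+>\<^bsub>M\<^esub> N' = carrier M \<and> lmod_iso R (M\<lparr>carrier := N\<rparr>) (direct_sum {..<m} (\<lambda>_. V))}"
  then obtain m N where m: "x = enat m" "submodule N R M" "lmod_iso R (M\<lparr>carrier := N\<rparr>) (direct_sum {..<m} (\<lambda>_. V))"
    by blast
  have N: "left_module R (M\<lparr>carrier := N\<rparr>)" using M m(2) by (rule submodule_left_module)
  obtain g where g: "g \<in> lhom R (direct_sum {..<m} (\<lambda>_. V)) (M\<lparr>carrier := N\<rparr>)"
    "bij_betw g (carrier (direct_sum {..<m} (\<lambda>_. V))) N"
    using lmod_iso_sym[OF N m(3)] by (auto simp: lmod_iso_lhom)
  obtain f where f: "f \<in> lhom R M (direct_sum I S)" "bij_betw f (carrier M) (carrier (direct_sum I S))"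
    using iso by (auto simp: lmod_iso_lhom)
  have NM: "N \<subseteq> carrier M" using submodule_subset[OF m(2)] .
  have "inj_on (f \<circ> g) (carrier (direct_sum {..<m} (\<lambda>_. V)))"
    using f(2) g(2) NM by (metis bij_betw_def comp_inj_on inj_on_subset)
  from lmod_iso_card_le[OF _ V I S _ lhom_comp[OF lhom_into_submodule[OF g(1) NM] f(1)] this]
  show "x \<le> enat (card {i \<in> I. lmod_iso R (S i) V})"
    using M by (simp add: m(1) left_module_def)
qed

text \<open>Converts an internal direct sum into an external one with one additional summand
  \<open>T\<close> at the fresh index \<open>i\<close>; it is the step by which the induction in
  \<open>semisimple\<close> splits off a simple submodule.\<close>

lemma direct_sum_internal:
  assumes M: "left_module R M" and N: "submodule N R M" and N': "submodule N' R M"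
    and int: "N \<inter> N' = {\<zero>\<^bsub>M\<^esub>}" and sum: "\<And>x. x \<in> carrier M \<Longrightarrow> \<exists>u\<in>N. \<exists>v\<in>N'. x = u \<oplus>\<^bsub>M\<^esub> v"
    and S: "lmod_iso R (M\<lparr>carrier := N\<rparr>) (direct_sum I S)" "\<And>i. i \<in> I \<Longrightarrow> left_module R (S i)"
    and T: "lmod_iso R (M\<lparr>carrier := N'\<rparr>) T" "left_module R T" and i: "i \<notin> I"
  shows "lmod_iso R M (direct_sum (insert i I) (S(i := T)))"
proof -
  interpret M: left_module R M by fact
  note NM = submodule_subset[OF N] and NM' = submodule_subset[OF N']
  let ?D = "direct_sum (insert i I) (S(i := T))"
  have D: "left_module R ?D"
    by (rule left_module_direct_sum) (use M.R.ring_axioms S(2) T(2) i in auto)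
  obtain g where g: "g \<in> lhom R (direct_sum I S) (M\<lparr>carrier := N\<rparr>)" "bij_betw g (carrier (direct_sum I S)) N"
    using lmod_iso_sym[OF submodule_left_module[OF M N] S(1)] by (auto simp: lmod_iso_lhom)
  obtain h where h: "h \<in> lhom R T (M\<lparr>carrier := N'\<rparr>)" "bij_betw h (carrier T) N'"
    using lmod_iso_sym[OF submodule_left_module[OF M N'] T(1)] by (auto simp: lmod_iso_lhom)
  have r: "(\<lambda>x. restrict x I) \<in> lhom R ?D (direct_sum I S)"
    by (rule lhomI) (use i in \<open>auto simp: direct_sum_simps fun_eq_iff PiE_iff split: if_splits\<close>)
  have pr: "(\<lambda>x. x i) \<in> lhom R ?D T"
    using lhom_proj[of i "insert i I" R "S(i := T)"] by simp
  define g' where "g' = g \<circ> (\<lambda>x. restrict x I)"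
  define h' where "h' = h \<circ> (\<lambda>x. x i)"
  have g': "g' \<in> lhom R ?D (M\<lparr>carrier := N\<rparr>)" unfolding g'_def by (rule lhom_comp[OF r g(1)])
  have h': "h' \<in> lhom R ?D (M\<lparr>carrier := N'\<rparr>)" unfolding h'_def by (rule lhom_comp[OF pr h(1)])
  have gN: "g' x \<in> N" "h' x \<in> N'" if "x \<in> carrier ?D" for x
    using lhom_closed[OF g' that] lhom_closed[OF h' that] by auto
  define k where "k x = g' x \<oplus>\<^bsub>M\<^esub> h' x" for x
  have k: "k \<in> lhom R ?D M"
  proof (rule lhomI)
    fix x y assume xy: "x \<in> carrier ?D" "y \<in> carrier ?D"
    have "g' x \<in> carrier M" "g' y \<in> carrier M" "h' x \<in> carrier M" "h' y \<in> carrier M"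
      using gN xy NM NM' by auto
    then show "k (x \<oplus>\<^bsub>?D\<^esub> y) = k x \<oplus>\<^bsub>M\<^esub> k y"
      using lhom_add[OF g' xy] lhom_add[OF h' xy] by (simp add: k_def M.M.a_ac)
  next
    fix a x assume ax: "a \<in> carrier R" "x \<in> carrier ?D"
    have "g' x \<in> carrier M" "h' x \<in> carrier M" using gN ax NM NM' by auto
    then show "k (a \<odot>\<^bsub>?D\<^esub> x) = a \<odot>\<^bsub>M\<^esub> k x"
      using lhom_smult[OF g' ax] lhom_smult[OF h' ax] ax by (simp add: k_def M.smult_r_distr)
  qed (use gN NM NM' in \<open>auto simp: k_def subset_iff\<close>)
  have "inj_on k (carrier ?D)"
  proof (rule inj_onI)
    fix x y assume xy: "x \<in> carrier ?D" "y \<in> carrier ?D" "k x = k y"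
    have c: "g' x \<in> carrier M" "g' y \<in> carrier M" "h' x \<in> carrier M" "h' y \<in> carrier M"
      using gN xy NM NM' by auto
    \<comment> \<open>If two sums agree, the difference of their \<open>N\<close>-parts equals a
      difference of \<open>N'\<close>-parts, hence lies in the trivial intersection.\<close>
    have e: "g' x \<ominus>\<^bsub>M\<^esub> g' y = h' y \<ominus>\<^bsub>M\<^esub> h' x"
    proof -
      have "g' x \<ominus>\<^bsub>M\<^esub> g' y = (g' x \<oplus>\<^bsub>M\<^esub> h' x) \<oplus>\<^bsub>M\<^esub> (\<ominus>\<^bsub>M\<^esub> g' y \<oplus>\<^bsub>M\<^esub> \<ominus>\<^bsub>M\<^esub> h' x)"
        using c by (simp add: a_minus_def M.M.a_assoc M.M.a_lcomm[of "h' x"] M.M.r_neg)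
      also have "\<dots> = (g' y \<oplus>\<^bsub>M\<^esub> h' y) \<oplus>\<^bsub>M\<^esub> (\<ominus>\<^bsub>M\<^esub> g' y \<oplus>\<^bsub>M\<^esub> \<ominus>\<^bsub>M\<^esub> h' x)"
        using xy(3) by (simp add: k_def)
      also have "\<dots> = h' y \<ominus>\<^bsub>M\<^esub> h' x"
        using c by (simp add: a_minus_def M.M.a_comm[of "g' y" "h' y"] M.M.a_assoc M.M.r_neg2)
      finally show ?thesis .
    qed
    have "g' x \<ominus>\<^bsub>M\<^esub> g' y \<in> N \<inter> N'"
      using submodule_diff[OF N gN(1)[OF xy(1)] gN(1)[OF xy(2)]] submodule_diff[OF N' gN(2)[OF xy(2)] gN(2)[OF xy(1)]] e
      by simp
    then have z: "g' x \<ominus>\<^bsub>M\<^esub> g' y = \<zero>\<^bsub>M\<^esub>" "h' y \<ominus>\<^bsub>M\<^esub> h' x = \<zero>\<^bsub>M\<^esub>" using int e by auto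
    have eq: "u = v" if "u \<ominus>\<^bsub>M\<^esub> v = \<zero>\<^bsub>M\<^esub>" "u \<in> carrier M" "v \<in> carrier M" for u v
    proof -
      have "u = (u \<ominus>\<^bsub>M\<^esub> v) \<oplus>\<^bsub>M\<^esub> v" using that(2,3) by (simp add: a_minus_def M.M.a_assoc M.M.l_neg)
      also have "\<dots> = v" using that by simp
      finally show ?thesis .
    qed
    have "g' x = g' y" "h' x = h' y" using eq z c by metis+
    moreover have "restrict x I \<in> carrier (direct_sum I S)" "restrict y I \<in> carrier (direct_sum I S)"
      "x i \<in> carrier T" "y i \<in> carrier T"
      using lhom_closed[OF r] lhom_closed[OF pr] xy by auto
    ultimately have *: "restrict x I = restrict y I" "x i = y i"
      using inj_onD[OF bij_betw_imp_inj_on[OF g(2)]] inj_onD[OF bij_betw_imp_inj_on[OF h(2)]]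
      by (auto simp: g'_def h'_def)
    show "x = y"
    proof
      fix j
      show "x j = y j"
        using fun_cong[OF *(1), of j] *(2) xy(1,2)
        by (cases "j \<in> insert i I") (auto simp: direct_sum_simps PiE_iff extensional_def)
    qed
  qed
  moreover have "k ` carrier ?D = carrier M"
  proof
    show "k ` carrier ?D \<subseteq> carrier M" using lhom_closed[OF k] by auto
    show "carrier M \<subseteq> k ` carrier ?D"
    proof
      fix x assume "x \<in> carrier M"
      then obtain u v where uv: "u \<in> N" "v \<in> N'" "x = u \<oplus>\<^bsub>M\<^esub> v" using sum by blast
      have "u \<in> g ` carrier (direct_sum I S)" "v \<in> h ` carrier T"
        using g(2) h(2) uv by (simp_all add: bij_betw_def)
      then obtain y t where y: "y \<in> carrier (direct_sum I S)" "g y = u" and t: "t \<in> carrier T" "h t = v"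
        by blast
      define z where "z = (\<lambda>j\<in>insert i I. if j = i then t else y j)"
      have "z \<in> carrier ?D" using y t i by (auto simp: z_def direct_sum_simps)
      moreover have "restrict z I = y" "z i = t"
        using y i by (auto simp: z_def direct_sum_simps fun_eq_iff PiE_iff extensional_def)
      then have "k z = x" by (simp add: k_def g'_def h'_def y t uv)
      ultimately show "x \<in> k ` carrier ?D" by blast
    qed
  qed
  ultimately have "lmod_iso R ?D M" using k by (intro lmod_isoI) (auto simp: bij_betw_def)
  then show ?thesis using D by (rule lmod_iso_sym[rotated])
qed

section \<open>Skew group rings and their modules\<close>

text \<open>Automorphisms without reference to a fixed field, so that skew group rings can be
  treated before \<open>k\<close> enters.\<close>

definition field_aut :: "('l::field \<Rightarrow> 'l) \<Rightarrow> bool"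
  where "field_aut \<sigma> \<longleftrightarrow> bij \<sigma> \<and> (\<forall>x y. \<sigma> (x + y) = \<sigma> x + \<sigma> y) \<and> (\<forall>x y. \<sigma> (x * y) = \<sigma> x * \<sigma> y)"

lemma field_autD:
  assumes "field_aut \<sigma>"
  shows field_aut_add: "\<sigma> (x + y) = \<sigma> x + \<sigma> y" and field_aut_mult: "\<sigma> (x * y) = \<sigma> x * \<sigma> y"
    and field_aut_0: "\<sigma> 0 = 0" and field_aut_1: "\<sigma> 1 = 1" and field_aut_bij: "bij \<sigma>"
    and field_aut_minus: "\<sigma> (- x) = - \<sigma> x"
    and field_aut_eq_0: "\<sigma> x = 0 \<longleftrightarrow> x = 0"
proof -
  show *: "\<sigma> (x + y) = \<sigma> x + \<sigma> y" "\<sigma> (x * y) = \<sigma> x * \<sigma> y" "bij \<sigma>" for x y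
    using assms by (auto simp: field_aut_def)
  show z: "\<sigma> 0 = 0" using *(1)[of 0 0] by (metis add.right_neutral add_left_cancel)
  have inj: "inj \<sigma>" using *(3) by (rule bij_is_inj)
  show e: "\<sigma> x = 0 \<longleftrightarrow> x = 0" for x using inj z by (metis injD)
  show "\<sigma> 1 = 1" using *(2)[of 1 1] e[of 1] by simp
  show "\<sigma> (- x) = - \<sigma> x" using *(1)[of x "- x"] z by (simp add: eq_neg_iff_add_eq_0 add.commute)
qed

lemma field_aut_sum: "field_aut \<sigma> \<Longrightarrow> \<sigma> (sum f A) = (\<Sum>i\<in>A. \<sigma> (f i))"
  by (induction A rule: infinite_finite_induct) (auto simp: field_aut_0 field_aut_add)

lemma field_aut_id: "field_aut id"
  by (auto simp: field_aut_def)

lemma field_aut_comp: "field_aut \<sigma> \<Longrightarrow> field_aut \<tau> \<Longrightarrow> field_aut (\<sigma> \<circ> \<tau>)"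
  by (auto simp: field_aut_def intro: bij_comp)

lemma map_matrix_mult:
  "field_aut \<sigma> \<Longrightarrow> map_matrix \<sigma> (A ** B) = map_matrix \<sigma> A ** map_matrix \<sigma> (B :: 'l::field^'d^'d)"
  by (simp add: vec_eq_iff matrix_matrix_mult_def field_aut_sum field_aut_mult)

lemma map_matrix_mat_1: "field_aut \<sigma> \<Longrightarrow> map_matrix \<sigma> (mat 1 :: 'l::field^'d^'d) = mat 1"
  by (simp add: vec_eq_iff mat_def field_aut_0 field_aut_1)

text \<open>\<open>snd x\<close> is the map that has to pass through a matrix product.\<close>

lemma semilin_mult_assoc:
  "field_aut (snd x) \<Longrightarrow> semilin_mult (semilin_mult x y) z = semilin_mult x (semilin_mult y z)"
proof -
  assume a: "field_aut (snd x)"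
  have m: "map_matrix (snd x \<circ> snd y) (fst z) = map_matrix (snd x) (map_matrix (snd y) (fst z))"
    by (simp add: vec_eq_iff)
  show ?thesis
    by (simp only: semilin_mult_def fst_conv snd_conv map_matrix_mult[OF a] m matrix_mul_assoc comp_assoc)
qed

lemma semilin_mult_one_left [simp]: "semilin_mult semilin_one x = x"
  by (simp add: semilin_mult_def semilin_one_def prod_eq_iff vec_eq_iff matrix_mul_lid flip: id_def)

lemma semilin_mult_one_right: "field_aut (snd x) \<Longrightarrow> semilin_mult x semilin_one = x"
  by (simp add: semilin_mult_def semilin_one_def map_matrix_mat_1 matrix_mul_rid)

lemma snd_semilin_mult [simp]: "snd (semilin_mult x y) = snd x \<circ> snd y"
  by (simp add: semilin_mult_def)

lemma snd_semilin_one [simp]: "snd semilin_one = id"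
  by (simp add: semilin_one_def)

declare split_paired_All [simp del] split_paired_Ex [simp del]

text \<open>A finite group of semilinear transformations described from inside, by its
  multiplication alone and without \<open>k\<close>. The same locale serves for \<open>G\<close>,
  for its linear part and for the trivial group, whose ring is a copy of l.\<close>

locale skew =
  fixes K :: "('l::field, 'd::finite) semilin set"
  assumes finite_K: "finite K" and one_K [simp]: "semilin_one \<in> K"
    and mult_K [simp]: "g \<in> K \<Longrightarrow> h \<in> K \<Longrightarrow> semilin_mult g h \<in> K"
    and inv_K: "g \<in> K \<Longrightarrow> \<exists>h\<in>K. semilin_mult h g = semilin_one \<and> semilin_mult g h = semilin_one"
    and aut_K: "g \<in> K \<Longrightarrow> field_aut (snd g)"
begin

abbreviation "R \<equiv> skew_group_ring K"

lemma assoc_K: "x \<in> K \<Longrightarrow> semilin_mult (semilin_mult x y) z = semilin_mult x (semilin_mult y z)"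
  by (rule semilin_mult_assoc[OF aut_K])

lemma one_right_K [simp]: "x \<in> K \<Longrightarrow> semilin_mult x semilin_one = x"
  by (rule semilin_mult_one_right[OF aut_K])

definition ginv :: "('l, 'd) semilin \<Rightarrow> ('l, 'd) semilin"
  where "ginv g = (SOME h. h \<in> K \<and> semilin_mult h g = semilin_one \<and> semilin_mult g h = semilin_one)"

lemma ginv:
  assumes "g \<in> K"
  shows ginv_K [simp]: "ginv g \<in> K" and ginv_left [simp]: "semilin_mult (ginv g) g = semilin_one"
    and ginv_right [simp]: "semilin_mult g (ginv g) = semilin_one"
proof -
  have "\<exists>h. h \<in> K \<and> semilin_mult h g = semilin_one \<and> semilin_mult g h = semilin_one"
    using inv_K[OF assms] by blast
  from someI_ex[OF this] show "ginv g \<in> K" "semilin_mult (ginv g) g = semilin_one"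
    "semilin_mult g (ginv g) = semilin_one"
    unfolding ginv_def by blast+
qed

lemma ginv_cancel:
  assumes "g \<in> K"
  shows "semilin_mult (ginv g) (semilin_mult g x) = x" "semilin_mult g (semilin_mult (ginv g) x) = x"
  using assms assoc_K[of "ginv g" g x] assoc_K[of g "ginv g" x] by simp_all

lemma bij_mult_left: "g \<in> K \<Longrightarrow> bij_betw (semilin_mult g) K K"
  by (rule bij_betw_byWitness[where f' = "semilin_mult (ginv g)"]) (auto simp: ginv_cancel)

lemma R_simps:
  "carrier R = {a. \<forall>g. g \<notin> K \<longrightarrow> a g = 0}"
  "\<one>\<^bsub>R\<^esub> = skew_elt 1 semilin_one" "\<zero>\<^bsub>R\<^esub> = (\<lambda>g. 0)" "a \<oplus>\<^bsub>R\<^esub> b = (\<lambda>g. a g + b g)"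
  by (simp_all add: skew_group_ring_def skew_elt_def)

text \<open>The sum over pairs with prescribed product becomes a full double sum with a condition,
  in which the order of summation can be exchanged freely.\<close>

lemma R_mult:
  "(a \<otimes>\<^bsub>R\<^esub> b) g = (\<Sum>h\<in>K. \<Sum>h'\<in>K. if semilin_mult h h' = g then a h * snd h (b h') else 0)"
proof -
  have "(a \<otimes>\<^bsub>R\<^esub> b) g = (\<Sum>p\<in>{p \<in> K \<times> K. semilin_mult (fst p) (snd p) = g}. a (fst p) * snd (fst p) (b (snd p)))"
    unfolding skew_group_ring_def by (simp add: case_prod_beta) (rule sum.cong, auto)
  also have "\<dots> = (\<Sum>p\<in>K \<times> K. if semilin_mult (fst p) (snd p) = g then a (fst p) * snd (fst p) (b (snd p)) else 0)"
    by (rule sum.mono_neutral_cong_left) (auto simp: finite_K)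
  finally show ?thesis by (simp add: sum.cartesian_product case_prod_beta)
qed

text \<open>Each pair \<open>h\<close>, \<open>h'\<close> contributes to the product at the single
  place \<open>semilin_mult h h'\<close>, so an additive expression in the coefficients of a product
  can be evaluated pair by pair. Associativity of the ring and of the actions on
  \<open>lfield\<close> and on free modules reduce to this.\<close>

lemma sum_R_mult:
  assumes "\<And>x y z. F x (y + z) = F x y + F x z" "\<And>x. F x 0 = (0::'l)"
  shows "(\<Sum>x\<in>K. F x ((a \<otimes>\<^bsub>R\<^esub> b) x)) = (\<Sum>h\<in>K. \<Sum>h'\<in>K. F (semilin_mult h h') (a h * snd h (b h')))"
proof -
  have F: "F x (sum f A) = (\<Sum>i\<in>A. F x (f i))" for x f and A :: "('l, 'd) semilin set"
    by (induction A rule: infinite_finite_induct) (auto simp: assms)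
  have "(\<Sum>x\<in>K. F x ((a \<otimes>\<^bsub>R\<^esub> b) x)) =
     (\<Sum>x\<in>K. \<Sum>h\<in>K. \<Sum>h'\<in>K. if semilin_mult h h' = x then F x (a h * snd h (b h')) else 0)"
    by (simp add: R_mult F if_distrib[of "F _"] assms(2) cong: if_cong)
  also have "\<dots> = (\<Sum>h\<in>K. \<Sum>x\<in>K. \<Sum>h'\<in>K. if semilin_mult h h' = x then F x (a h * snd h (b h')) else 0)"
    by (rule sum.swap)
  also have "\<dots> = (\<Sum>h\<in>K. \<Sum>h'\<in>K. \<Sum>x\<in>K. if semilin_mult h h' = x then F x (a h * snd h (b h')) else 0)"
    by (rule sum.cong[OF refl], rule sum.swap)
  also have "\<dots> = (\<Sum>h\<in>K. \<Sum>h'\<in>K. F (semilin_mult h h') (a h * snd h (b h')))"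
    by (intro sum.cong refl) (simp add: sum.delta' finite_K)
  finally show ?thesis .
qed

lemma R_mult_closed: "a \<otimes>\<^bsub>R\<^esub> b \<in> carrier R"
  unfolding R_simps mem_Collect_eq R_mult
proof (intro allI impI sum.neutral ballI)
  fix g h h' assume "g \<notin> K" "h \<in> K" "h' \<in> K"
  then show "(if semilin_mult h h' = g then a h * snd h (b h') else 0) = 0" using mult_K by metis
qed

text \<open>Two applications of \<open>sum_R_mult\<close> bring both bracketings to the same triple
  sum; the auxiliary \<open>?F x y\<close> is the contribution at \<open>g\<close> of a coefficient
  \<open>y\<close> standing at \<open>x\<close>.\<close>

lemma R_mult_assoc: "(a \<otimes>\<^bsub>R\<^esub> b) \<otimes>\<^bsub>R\<^esub> c = a \<otimes>\<^bsub>R\<^esub> (b \<otimes>\<^bsub>R\<^esub> c)"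
proof
  fix g
  let ?F = "\<lambda>x y. \<Sum>z\<in>K. if semilin_mult x z = g then y * snd x (c z) else 0"
  have add: "?F x (y + z) = ?F x y + ?F x z" for x y z
    unfolding sum.distrib[symmetric] by (intro sum.cong refl) (simp add: distrib_right)
  have z: "?F x 0 = 0" for x by (intro sum.neutral) simp
  have "((a \<otimes>\<^bsub>R\<^esub> b) \<otimes>\<^bsub>R\<^esub> c) g = (\<Sum>x\<in>K. ?F x ((a \<otimes>\<^bsub>R\<^esub> b) x))"
    by (simp only: R_mult[of "a \<otimes>\<^bsub>R\<^esub> b"])
  also have "\<dots> = (\<Sum>h\<in>K. \<Sum>h'\<in>K. ?F (semilin_mult h h') (a h * snd h (b h')))"
    by (rule sum_R_mult[of ?F, OF add z])
  also have "\<dots> = (\<Sum>h\<in>K. \<Sum>h'\<in>K. \<Sum>z\<in>K. if semilin_mult (semilin_mult h h') z = g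
       then a h * snd h (b h') * snd h (snd h' (c z)) else 0)"
    by (simp cong: if_cong)
  also have "\<dots> = (\<Sum>h\<in>K. \<Sum>h'\<in>K. \<Sum>z\<in>K. if semilin_mult h (semilin_mult h' z) = g
       then a h * snd h (b h' * snd h' (c z)) else 0)"
    by (intro sum.cong refl) (simp add: assoc_K field_aut_mult[OF aut_K] mult.assoc)
  also have "\<dots> = (\<Sum>h\<in>K. \<Sum>x\<in>K. if semilin_mult h x = g then a h * snd h ((b \<otimes>\<^bsub>R\<^esub> c) x) else 0)"
  proof (rule sum.cong[OF refl])
    fix h assume h: "h \<in> K"
    let ?F = "\<lambda>x y. if semilin_mult h x = g then a h * snd h y else 0"
    have "(\<Sum>x\<in>K. ?F x ((b \<otimes>\<^bsub>R\<^esub> c) x)) = (\<Sum>h'\<in>K. \<Sum>z\<in>K. ?F (semilin_mult h' z) (b h' * snd h' (c z)))"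
      by (rule sum_R_mult[of ?F])
         (simp_all add: field_aut_add[OF aut_K[OF h]] field_aut_0[OF aut_K[OF h]] distrib_left)
    then show "(\<Sum>h'\<in>K. \<Sum>z\<in>K. if semilin_mult h (semilin_mult h' z) = g then a h * snd h (b h' * snd h' (c z)) else 0) =
      (\<Sum>x\<in>K. if semilin_mult h x = g then a h * snd h ((b \<otimes>\<^bsub>R\<^esub> c) x) else 0)" by (rule sym)
  qed
  also have "\<dots> = (a \<otimes>\<^bsub>R\<^esub> (b \<otimes>\<^bsub>R\<^esub> c)) g"
    by (simp only: R_mult[of a])
  finally show "((a \<otimes>\<^bsub>R\<^esub> b) \<otimes>\<^bsub>R\<^esub> c) g = (a \<otimes>\<^bsub>R\<^esub> (b \<otimes>\<^bsub>R\<^esub> c)) g" .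
qed

lemma skew_elt_mult:
  assumes "g \<in> K" "h \<in> K"
  shows "skew_elt c g \<otimes>\<^bsub>R\<^esub> skew_elt c' h = skew_elt (c * snd g c') (semilin_mult g h)"
proof
  fix x
  have "(skew_elt c g \<otimes>\<^bsub>R\<^esub> skew_elt c' h) x =
     (\<Sum>y\<in>K. if g = y then (\<Sum>z\<in>K. if h = z then (if semilin_mult g h = x then c * snd g c' else 0) else 0) else 0)"
    unfolding R_mult
  proof (intro sum.cong refl)
    fix y assume "y \<in> K"
    then show "(\<Sum>h'\<in>K. if semilin_mult y h' = x then skew_elt c g y * snd y (skew_elt c' h h') else 0) =
      (if g = y then \<Sum>z\<in>K. if h = z then if semilin_mult g h = x then c * snd g c' else 0 else 0 else 0)"
      by (cases "g = y") (auto simp: skew_elt_def field_aut_0[OF aut_K] intro!: sum.cong sum.neutral)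
  qed
  also have "\<dots> = skew_elt (c * snd g c') (semilin_mult g h) x"
    using assms by (simp add: sum.delta' finite_K skew_elt_def)
  finally show "(skew_elt c g \<otimes>\<^bsub>R\<^esub> skew_elt c' h) x = skew_elt (c * snd g c') (semilin_mult g h) x" .
qed

lemma skew_elt_R: "g \<in> K \<Longrightarrow> skew_elt c g \<in> carrier R"
  by (auto simp: R_simps skew_elt_def)

lemma R_one_left: "a \<in> carrier R \<Longrightarrow> \<one>\<^bsub>R\<^esub> \<otimes>\<^bsub>R\<^esub> a = a"
proof
  fix g assume a: "a \<in> carrier R"
  have "(\<one>\<^bsub>R\<^esub> \<otimes>\<^bsub>R\<^esub> a) g = (\<Sum>h\<in>K. if semilin_one = h then (\<Sum>h'\<in>K. if h' = g then a h' else 0) else 0)"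
    unfolding R_mult R_simps
  proof (intro sum.cong refl)
    fix h assume "h \<in> K"
    show "(\<Sum>h'\<in>K. if semilin_mult h h' = g then skew_elt 1 semilin_one h * snd h (a h') else 0) =
      (if semilin_one = h then (\<Sum>h'\<in>K. if h' = g then a h' else 0) else 0)"
      by (cases "semilin_one = h") (simp_all add: skew_elt_def cong: if_cong)
  qed
  also have "\<dots> = a g" using a by (simp add: sum.delta' sum.delta finite_K R_simps)
  finally show "(\<one>\<^bsub>R\<^esub> \<otimes>\<^bsub>R\<^esub> a) g = a g" .
qed

lemma R_one_right: "a \<in> carrier R \<Longrightarrow> a \<otimes>\<^bsub>R\<^esub> \<one>\<^bsub>R\<^esub> = a"
proof
  fix g assume a: "a \<in> carrier R"
  have "(a \<otimes>\<^bsub>R\<^esub> \<one>\<^bsub>R\<^esub>) g = (\<Sum>h\<in>K. if h = g then a h else 0)"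
    unfolding R_mult R_simps
  proof (intro sum.cong refl)
    fix h assume h: "h \<in> K"
    have "(\<Sum>h'\<in>K. if semilin_mult h h' = g then a h * snd h (skew_elt 1 semilin_one h') else 0) =
      (\<Sum>h'\<in>K. if semilin_one = h' then (if h = g then a h else 0) else 0)"
      using h by (intro sum.cong refl) (auto simp: skew_elt_def field_aut_0[OF aut_K] field_aut_1[OF aut_K])
    then show "(\<Sum>h'\<in>K. if semilin_mult h h' = g then a h * snd h (skew_elt 1 semilin_one h') else 0) =
      (if h = g then a h else 0)" by (simp add: sum.delta' finite_K)
  qed
  also have "\<dots> = a g" using a by (simp add: sum.delta finite_K R_simps)
  finally show "(a \<otimes>\<^bsub>R\<^esub> \<one>\<^bsub>R\<^esub>) g = a g" .
qed

lemma R_distr: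
  "(a \<oplus>\<^bsub>R\<^esub> b) \<otimes>\<^bsub>R\<^esub> c = a \<otimes>\<^bsub>R\<^esub> c \<oplus>\<^bsub>R\<^esub> b \<otimes>\<^bsub>R\<^esub> c" "c \<otimes>\<^bsub>R\<^esub> (a \<oplus>\<^bsub>R\<^esub> b) = c \<otimes>\<^bsub>R\<^esub> a \<oplus>\<^bsub>R\<^esub> c \<otimes>\<^bsub>R\<^esub> b"
  unfolding fun_eq_iff R_mult R_simps sum.distrib[symmetric]
  by (intro allI sum.cong refl, simp add: distrib_right)
     (intro allI sum.cong refl, simp add: distrib_left field_aut_add[OF aut_K])

lemma ring_R: "ring R"
proof (rule ringI)
  show "abelian_group R"
  proof (rule abelian_groupI)
    fix x assume "x \<in> carrier R"
    then show "\<exists>y\<in>carrier R. y \<oplus>\<^bsub>R\<^esub> x = \<zero>\<^bsub>R\<^esub>"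
      by (intro bexI[of _ "\<lambda>g. - x g"]) (auto simp: R_simps)
  qed (auto simp: R_simps)
  show "monoid R"
    by (rule monoidI) (simp_all add: R_mult_closed R_mult_assoc R_one_left R_one_right skew_elt_R, simp add: skew_elt_R R_simps(2))
qed (auto simp: R_distr)

sublocale R: ring R by (rule ring_R)

lemma finsum_R: "f \<in> A \<rightarrow> carrier R \<Longrightarrow> finsum R f A = (\<lambda>g. \<Sum>i\<in>A. f i g)"
  by (induction A rule: infinite_finite_induct) (auto simp: Pi_def R_simps)

text \<open>Monomials \<open>skew_elt c g\<close> span the ring; this is why an action of
  \<open>l*K\<close> is determined by the scalars and the group elements.\<close>

lemma R_expand: "a \<in> carrier R \<Longrightarrow> a = finsum R (\<lambda>g. skew_elt (a g) g) K"
proof -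
  assume a: "a \<in> carrier R"
  have "finsum R (\<lambda>g. skew_elt (a g) g) K = (\<lambda>x. \<Sum>g\<in>K. skew_elt (a g) g x)"
    by (rule finsum_R) (auto simp: skew_elt_R)
  also have "\<dots> = (\<lambda>x. \<Sum>g\<in>K. if x = g then a g else 0)"
    by (intro ext sum.cong) (auto simp: skew_elt_def)
  also have "\<dots> = a" using a by (auto simp: fun_eq_iff sum.delta finite_K R_simps)
  finally show ?thesis by (rule sym)
qed

end

section \<open>Modules over a skew group ring as semilinear representations\<close>

lemma (in left_module) smult_finsum_l:
  assumes "f \<in> A \<rightarrow> carrier R" "x \<in> carrier M" "finite A"
  shows "finsum R f A \<odot>\<^bsub>M\<^esub> x = finsum M (\<lambda>i. f i \<odot>\<^bsub>M\<^esub> x) A"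
  using assms(3,1)
  by (induction A) (auto simp: smult_zero_l assms smult_l_distr smult_closed Pi_def)

lemma (in abelian_monoid) finsum_swap:
  assumes "finite A" "finite B" "\<And>i j. i \<in> A \<Longrightarrow> j \<in> B \<Longrightarrow> f i j \<in> carrier G"
  shows "finsum G (\<lambda>i. finsum G (f i) B) A = finsum G (\<lambda>j. finsum G (\<lambda>i. f i j) A) B"
  using assms(1,3)
proof (induction A)
  case empty
  then show ?case using assms(2) by (simp add: finsum_zero)
next
  case (insert a A)
  have *: "finsum G (\<lambda>j. f a j \<oplus> finsum G (\<lambda>i. f i j) A) B =
      finsum G (f a) B \<oplus> finsum G (\<lambda>j. finsum G (\<lambda>i. f i j) A) B"
    by (rule finsum_addf) (auto simp: insert)
  have "finsum G (\<lambda>j. finsum G (\<lambda>i. f i j) (insert a A)) B = finsum G (\<lambda>j. f a j \<oplus> finsum G (\<lambda>i. f i j) A) B"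
    by (rule finsum_cong') (auto simp: insert Pi_def)
  then show ?case using insert * by (simp add: Pi_def)
qed

text \<open>With \<open>act\<close>, this splits a module over \<open>l*K\<close> into an l-space
  and a semilinear group action, and \<open>smult_expand\<close> puts the two halves together
  again.\<close>

definition scal :: "(('l::field, 'd::finite) semilin \<Rightarrow> 'l, 'b, 'm) module_scheme \<Rightarrow> 'l \<Rightarrow> 'b \<Rightarrow> 'b"
  where "scal M c x = skew_elt c semilin_one \<odot>\<^bsub>M\<^esub> x"

definition act :: "(('l::field, 'd::finite) semilin \<Rightarrow> 'l, 'b, 'm) module_scheme \<Rightarrow> ('l, 'd) semilin \<Rightarrow> 'b \<Rightarrow> 'b"
  where "act M g x = skew_elt 1 g \<odot>\<^bsub>M\<^esub> x"

locale skew_module = skew K + left_module "skew_group_ring K" M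
  for K :: "('l::field, 'd::finite) semilin set" and M :: "(('l, 'd) semilin \<Rightarrow> 'l, 'b) module"
begin

lemma scal_closed [simp]: "x \<in> carrier M \<Longrightarrow> scal M c x \<in> carrier M"
  by (simp add: scal_def smult_closed skew_elt_R)

lemma act_closed [simp]: "g \<in> K \<Longrightarrow> x \<in> carrier M \<Longrightarrow> act M g x \<in> carrier M"
  by (simp add: act_def smult_closed skew_elt_R)

lemma skew_elt_smult: "g \<in> K \<Longrightarrow> x \<in> carrier M \<Longrightarrow> skew_elt c g \<odot>\<^bsub>M\<^esub> x = scal M c (act M g x)"
  unfolding scal_def act_def
  by (subst smult_assoc1[symmetric]) (simp_all add: skew_elt_R skew_elt_mult)

lemma scal_add_r: "x \<in> carrier M \<Longrightarrow> y \<in> carrier M \<Longrightarrow> scal M c (x \<oplus>\<^bsub>M\<^esub> y) = scal M c x \<oplus>\<^bsub>M\<^esub> scal M c y"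
  by (simp add: scal_def smult_r_distr skew_elt_R)

lemma act_add: "g \<in> K \<Longrightarrow> x \<in> carrier M \<Longrightarrow> y \<in> carrier M \<Longrightarrow> act M g (x \<oplus>\<^bsub>M\<^esub> y) = act M g x \<oplus>\<^bsub>M\<^esub> act M g y"
  by (simp add: act_def smult_r_distr skew_elt_R)

lemma scal_add_l: "x \<in> carrier M \<Longrightarrow> scal M (c + c') x = scal M c x \<oplus>\<^bsub>M\<^esub> scal M c' x"
proof -
  have "skew_elt (c + c') semilin_one = skew_elt c semilin_one \<oplus>\<^bsub>R\<^esub> skew_elt c' semilin_one"
    by (auto simp: R_simps skew_elt_def)
  then show "x \<in> carrier M \<Longrightarrow> ?thesis" by (simp add: scal_def smult_l_distr skew_elt_R)
qed

lemma scal_scal: "x \<in> carrier M \<Longrightarrow> scal M c (scal M c' x) = scal M (c * c') x"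
  unfolding scal_def by (subst smult_assoc1[symmetric]) (simp_all add: skew_elt_R skew_elt_mult)

lemma scal_1 [simp]: "x \<in> carrier M \<Longrightarrow> scal M 1 x = x"
  using smult_one[of x] by (simp add: scal_def R_simps)

lemma act_one [simp]: "x \<in> carrier M \<Longrightarrow> act M semilin_one x = x"
  using smult_one[of x] by (simp add: act_def R_simps)

lemma scal_0_l [simp]: "x \<in> carrier M \<Longrightarrow> scal M 0 x = \<zero>\<^bsub>M\<^esub>"
proof -
  have "skew_elt 0 semilin_one = \<zero>\<^bsub>R\<^esub>" by (auto simp: R_simps skew_elt_def)
  then show "x \<in> carrier M \<Longrightarrow> ?thesis" by (simp add: scal_def smult_zero_l)
qed

lemma scal_0_r [simp]: "scal M c \<zero>\<^bsub>M\<^esub> = \<zero>\<^bsub>M\<^esub>"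
  by (simp add: scal_def smult_zero_r skew_elt_R)

lemma act_0 [simp]: "g \<in> K \<Longrightarrow> act M g \<zero>\<^bsub>M\<^esub> = \<zero>\<^bsub>M\<^esub>"
  by (simp add: act_def smult_zero_r skew_elt_R)

lemma act_act: "g \<in> K \<Longrightarrow> h \<in> K \<Longrightarrow> x \<in> carrier M \<Longrightarrow> act M g (act M h x) = act M (semilin_mult g h) x"
  unfolding act_def
  by (subst smult_assoc1[symmetric]) (simp_all add: skew_elt_R skew_elt_mult field_aut_1[OF aut_K])

lemma act_scal: "g \<in> K \<Longrightarrow> x \<in> carrier M \<Longrightarrow> act M g (scal M c x) = scal M (snd g c) (act M g x)"
proof -
  assume *: "g \<in> K" "x \<in> carrier M"
  have "act M g (scal M c x) = skew_elt (snd g c) g \<odot>\<^bsub>M\<^esub> x"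
    unfolding act_def scal_def using *
    by (subst smult_assoc1[symmetric]) (simp_all add: skew_elt_R skew_elt_mult)
  then show ?thesis using * by (simp add: skew_elt_smult)
qed

lemma smult_expand:
  assumes "a \<in> carrier R" "x \<in> carrier M"
  shows "a \<odot>\<^bsub>M\<^esub> x = finsum M (\<lambda>g. scal M (a g) (act M g x)) K"
proof -
  have "a \<odot>\<^bsub>M\<^esub> x = finsum R (\<lambda>g. skew_elt (a g) g) K \<odot>\<^bsub>M\<^esub> x" using R_expand[OF assms(1)] by simp
  also have "\<dots> = finsum M (\<lambda>g. skew_elt (a g) g \<odot>\<^bsub>M\<^esub> x) K"
    by (rule smult_finsum_l) (auto simp: skew_elt_R assms finite_K)
  also have "\<dots> = finsum M (\<lambda>g. scal M (a g) (act M g x)) K"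
    by (rule M.finsum_cong') (auto simp: assms skew_elt_smult)
  finally show ?thesis .
qed

lemma scal_minus_1: "x \<in> carrier M \<Longrightarrow> scal M (- 1) x = \<ominus>\<^bsub>M\<^esub> x"
  by (rule M.minus_equality[symmetric])
     (use scal_add_l[of x "-1" 1] in auto)

lemma scal_finsum: "f \<in> A \<rightarrow> carrier M \<Longrightarrow> finite A \<Longrightarrow> scal M c (finsum M f A) = finsum M (\<lambda>i. scal M c (f i)) A"
  unfolding scal_def by (rule smult_finsum) (auto simp: skew_elt_R)

lemma act_finsum: "g \<in> K \<Longrightarrow> f \<in> A \<rightarrow> carrier M \<Longrightarrow> finite A \<Longrightarrow> act M g (finsum M f A) = finsum M (\<lambda>i. act M g (f i)) A"
  unfolding act_def by (rule smult_finsum) (auto simp: skew_elt_R)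

lemma finsum_scal: "finite A \<Longrightarrow> x \<in> carrier M \<Longrightarrow> scal M (sum c A) x = finsum M (\<lambda>i. scal M (c i) x) A"
  by (induction A rule: finite_induct) (auto simp: scal_add_l)

text \<open>By \<open>smult_expand\<close> a multiple is a sum of scalar multiples of translates, so
  general ring elements disappear from the closure conditions.\<close>

lemma submodule_iff:
  "submodule N R M \<longleftrightarrow> N \<subseteq> carrier M \<and> \<zero>\<^bsub>M\<^esub> \<in> N \<and> (\<forall>x\<in>N. \<forall>y\<in>N. x \<oplus>\<^bsub>M\<^esub> y \<in> N) \<and>
     (\<forall>c. \<forall>x\<in>N. scal M c x \<in> N) \<and> (\<forall>g\<in>K. \<forall>x\<in>N. act M g x \<in> N)"
proof
  assume "submodule N R M"
  note N = submoduleD[OF this]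
  show "N \<subseteq> carrier M \<and> \<zero>\<^bsub>M\<^esub> \<in> N \<and> (\<forall>x\<in>N. \<forall>y\<in>N. x \<oplus>\<^bsub>M\<^esub> y \<in> N) \<and>
     (\<forall>c. \<forall>x\<in>N. scal M c x \<in> N) \<and> (\<forall>g\<in>K. \<forall>x\<in>N. act M g x \<in> N)"
    unfolding scal_def act_def by (intro conjI ballI allI N skew_elt_R one_K)
next
  assume N: "N \<subseteq> carrier M \<and> \<zero>\<^bsub>M\<^esub> \<in> N \<and> (\<forall>x\<in>N. \<forall>y\<in>N. x \<oplus>\<^bsub>M\<^esub> y \<in> N) \<and>
     (\<forall>c. \<forall>x\<in>N. scal M c x \<in> N) \<and> (\<forall>g\<in>K. \<forall>x\<in>N. act M g x \<in> N)"
  have sum: "finsum M f A \<in> N" if "finite A" "f \<in> A \<rightarrow> N" for A :: "('l, 'd) semilin set" and f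
    using that
  proof (induction A)
    case (insert a A)
    then have "f \<in> A \<rightarrow> carrier M" "f a \<in> carrier M" using N by (auto simp: Pi_def)
    then show ?case using insert N by (auto simp: Pi_def)
  qed (use N in auto)
  show "submodule N R M"
  proof (rule submoduleI)
    fix a x assume a: "a \<in> carrier R" "x \<in> N"
    then have "a \<odot>\<^bsub>M\<^esub> x = finsum M (\<lambda>g. scal M (a g) (act M g x)) K" using N by (intro smult_expand) auto
    then show "a \<odot>\<^bsub>M\<^esub> x \<in> N" using sum[OF finite_K] a N by auto
  qed (use N in auto)
qed

end

text \<open>An l-linear equivariant map commutes with the expansion of a multiple into scalar
  multiples of translates. Preservation of zero, needed for the sums, is linearity for the scalar
  0.\<close>

lemma skew_lhomI:
  assumes "skew_module K M" "skew_module K N"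
    and "\<And>x. x \<in> carrier M \<Longrightarrow> f x \<in> carrier N"
    and "\<And>x y. x \<in> carrier M \<Longrightarrow> y \<in> carrier M \<Longrightarrow> f (x \<oplus>\<^bsub>M\<^esub> y) = f x \<oplus>\<^bsub>N\<^esub> f y"
    and "\<And>c x. x \<in> carrier M \<Longrightarrow> f (scal M c x) = scal N c (f x)"
    and "\<And>g x. g \<in> K \<Longrightarrow> x \<in> carrier M \<Longrightarrow> f (act M g x) = act N g (f x)"
  shows "f \<in> lhom (skew_group_ring K) M N"
proof (rule lhomI)
  interpret M: skew_module K M by fact
  interpret N: skew_module K N by fact
  fix a x assume a: "a \<in> carrier M.R" "x \<in> carrier M"
  have f0: "f \<zero>\<^bsub>M\<^esub> = \<zero>\<^bsub>N\<^esub>" using assms(5)[of "\<zero>\<^bsub>M\<^esub>" 0] assms(3)[of "\<zero>\<^bsub>M\<^esub>"] by simp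
  have fs: "f (finsum M h A) = finsum N (\<lambda>i. f (h i)) A"
    if "finite A" "h \<in> A \<rightarrow> carrier M" for h and A :: "('a, 'b) semilin set"
    using that by (induction A) (auto simp: f0 assms(3,4) Pi_def)
  have "f (a \<odot>\<^bsub>M\<^esub> x) = f (finsum M (\<lambda>g. scal M (a g) (act M g x)) K)" using a by (simp add: M.smult_expand)
  also have "\<dots> = finsum N (\<lambda>g. f (scal M (a g) (act M g x))) K"
    using a by (intro fs) (auto simp: M.finite_K)
  also have "\<dots> = finsum N (\<lambda>g. scal N (a g) (act N g (f x))) K"
    using a by (intro N.M.finsum_cong') (auto simp: assms)
  also have "\<dots> = a \<odot>\<^bsub>N\<^esub> f x" using a by (simp add: N.smult_expand assms)
  finally show "f (a \<odot>\<^bsub>M\<^esub> x) = a \<odot>\<^bsub>N\<^esub> f x" .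
qed (use assms in auto)

lemma skew_lhomD:
  assumes "skew K" "f \<in> lhom (skew_group_ring K) M N" "x \<in> carrier M"
  shows lhom_scal: "f (scal M c x) = scal N c (f x)"
    and lhom_act: "g \<in> K \<Longrightarrow> f (act M g x) = act N g (f x)"
proof -
  interpret skew K by fact
  show "f (scal M c x) = scal N c (f x)" "g \<in> K \<Longrightarrow> f (act M g x) = act N g (f x)"
    using lhom_smult[OF assms(2)] assms(3) skew_elt_R by (auto simp: scal_def act_def)
qed

lemma skew_mono:
  assumes "skew K" "K' \<subseteq> K" "semilin_one \<in> K'"
    "\<And>g h. g \<in> K' \<Longrightarrow> h \<in> K' \<Longrightarrow> semilin_mult g h \<in> K'"
    "\<And>g. g \<in> K' \<Longrightarrow> \<exists>h\<in>K'. semilin_mult h g = semilin_one \<and> semilin_mult g h = semilin_one"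
  shows "skew K'"
proof -
  interpret skew K by fact
  show ?thesis
    by unfold_locales (use assms finite_subset[OF _ finite_K] aut_K in auto)
qed

text \<open>Elements supported in \<open>K'\<close> have the same product in both rings, because the
  additional summands vanish; hence the very same record is a module over the smaller ring.\<close>

lemma skew_module_restrict:
  assumes M: "skew_module K M" and K': "skew K'" "K' \<subseteq> K"
  shows "skew_module K' M"
proof -
  interpret M: skew_module K M by fact
  interpret K': skew K' by fact
  have sub: "a \<in> carrier M.R" if "a \<in> carrier K'.R" for a using that K'(2) by (auto simp: M.R_simps K'.R_simps)
  have mult: "a \<otimes>\<^bsub>K'.R\<^esub> b = a \<otimes>\<^bsub>M.R\<^esub> b" if a: "a \<in> carrier K'.R" "b \<in> carrier K'.R" for a b
  proof
    fix g
    have "(a \<otimes>\<^bsub>M.R\<^esub> b) g = (\<Sum>h\<in>K'. \<Sum>h'\<in>K. if semilin_mult h h' = g then a h * snd h (b h') else 0)"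
      unfolding M.R_mult
      by (rule sum.mono_neutral_right)
         (use a K'(2) in \<open>auto simp: M.finite_K K'.R_simps intro!: sum.neutral\<close>)
    also have "\<dots> = (\<Sum>h\<in>K'. \<Sum>h'\<in>K'. if semilin_mult h h' = g then a h * snd h (b h') else 0)"
    proof (rule sum.cong[OF refl])
      fix h assume "h \<in> K'"
      then show "(\<Sum>h'\<in>K. if semilin_mult h h' = g then a h * snd h (b h') else 0) =
        (\<Sum>h'\<in>K'. if semilin_mult h h' = g then a h * snd h (b h') else 0)"
        by (intro sum.mono_neutral_right)
           (use a K'(2) in \<open>auto simp: M.finite_K K'.R_simps field_aut_0[OF K'.aut_K]\<close>)
    qed
    finally show "(a \<otimes>\<^bsub>K'.R\<^esub> b) g = (a \<otimes>\<^bsub>M.R\<^esub> b) g" by (simp add: K'.R_mult)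
  qed
  have "left_module K'.R M"
  proof (intro left_module.intro left_module_axioms.intro K'.ring_R M.abelian_group_axioms)
    fix a b x assume a: "a \<in> carrier K'.R" "b \<in> carrier K'.R" and x: "x \<in> carrier M"
    show "(a \<oplus>\<^bsub>K'.R\<^esub> b) \<odot>\<^bsub>M\<^esub> x = a \<odot>\<^bsub>M\<^esub> x \<oplus>\<^bsub>M\<^esub> b \<odot>\<^bsub>M\<^esub> x"
      using M.smult_l_distr[OF sub[OF a(1)] sub[OF a(2)] x] by (simp add: M.R_simps K'.R_simps)
    show "(a \<otimes>\<^bsub>K'.R\<^esub> b) \<odot>\<^bsub>M\<^esub> x = a \<odot>\<^bsub>M\<^esub> (b \<odot>\<^bsub>M\<^esub> x)"
      using M.smult_assoc1[OF sub[OF a(1)] sub[OF a(2)] x] by (simp add: mult a)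
  next
    fix x assume x: "x \<in> carrier M"
    show "\<one>\<^bsub>K'.R\<^esub> \<odot>\<^bsub>M\<^esub> x = x"
      using M.smult_one[OF x] by (simp add: M.R_simps K'.R_simps)
  qed (use sub M.smult_closed M.smult_r_distr in auto)
  then show ?thesis by (simp add: skew_module_def K'.skew_axioms)
qed

lemma skew_trivial: "skew {semilin_one}"
  by unfold_locales (auto simp: field_aut_id)

context skew_module
begin

lemma l_module: "skew_module {semilin_one} M"
  by (rule skew_module_restrict[OF skew_module_axioms skew_trivial]) simp

text \<open>Subspaces over l are submodules over the ring of the trivial group, so the lemmas on
  modules apply to them unchanged.\<close>

abbreviation l_submodule :: "'b set \<Rightarrow> bool"
  where "l_submodule N \<equiv> submodule N (skew_group_ring {semilin_one}) M"

lemma l_submodule_iff: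
  "l_submodule N \<longleftrightarrow> N \<subseteq> carrier M \<and> \<zero>\<^bsub>M\<^esub> \<in> N \<and> (\<forall>x\<in>N. \<forall>y\<in>N. x \<oplus>\<^bsub>M\<^esub> y \<in> N) \<and> (\<forall>c. \<forall>x\<in>N. scal M c x \<in> N)"
  using skew_module.submodule_iff[OF l_module, of N]
  by (auto simp: skew_module.act_one[OF l_module] subset_iff)

lemma submodule_l: "submodule N R M \<Longrightarrow> l_submodule N"
  by (simp add: submodule_iff l_submodule_iff)

end

section \<open>Semilinear cocycles and quotient modules\<close>

text \<open>The module l on which \<open>g\<close> acts by its automorphism. Summing over the
  support of \<open>a\<close> instead of a group makes one record serve for every \<open>K\<close>,
  and its restriction to a subgroup is again \<open>lfield\<close>.\<close>

definition lfield :: "(('l::field, 'd::finite) semilin \<Rightarrow> 'l, 'l) module"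
  where "lfield = \<lparr>carrier = UNIV, mult = undefined, one = undefined, zero = 0, add = (+),
     smult = (\<lambda>a c. \<Sum>g | a g \<noteq> 0. a g * snd g c)\<rparr>"

lemma lfield_simps:
  "carrier lfield = UNIV" "\<zero>\<^bsub>lfield\<^esub> = 0" "x \<oplus>\<^bsub>lfield\<^esub> y = x + y"
  by (simp_all add: lfield_def)

lemma (in skew) lfield_smult:
  "a \<in> carrier R \<Longrightarrow> a \<odot>\<^bsub>lfield\<^esub> c = (\<Sum>g\<in>K. a g * snd g c)"
  unfolding lfield_def by (simp, rule sum.mono_neutral_left) (auto simp: R_simps finite_K)

lemma (in skew) skew_module_lfield: "skew_module K lfield"
proof -
  have "left_module R lfield"
  proof (rule left_moduleI)
    fix a b c assume a: "a \<in> carrier R" "b \<in> carrier R"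
    have "(a \<otimes>\<^bsub>R\<^esub> b) \<odot>\<^bsub>lfield\<^esub> c = (\<Sum>x\<in>K. (a \<otimes>\<^bsub>R\<^esub> b) x * snd x c)"
      by (simp add: lfield_smult R_mult_closed)
    also have "\<dots> = (\<Sum>h\<in>K. \<Sum>h'\<in>K. a h * snd h (b h') * snd (semilin_mult h h') c)"
      by (rule sum_R_mult[of "\<lambda>x y. y * snd x c"]) (simp_all add: distrib_right)
    also have "\<dots> = a \<odot>\<^bsub>lfield\<^esub> (b \<odot>\<^bsub>lfield\<^esub> c)"
      using a by (simp add: lfield_smult field_aut_sum[OF aut_K] field_aut_mult[OF aut_K] sum_distrib_left mult.assoc)
    finally show "(a \<otimes>\<^bsub>R\<^esub> b) \<odot>\<^bsub>lfield\<^esub> c = a \<odot>\<^bsub>lfield\<^esub> (b \<odot>\<^bsub>lfield\<^esub> c)" .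
  next
    fix a b c assume a: "a \<in> carrier R" "b \<in> carrier R"
    then have "a \<oplus>\<^bsub>R\<^esub> b \<in> carrier R" by (rule R.add.m_closed)
    then show "(a \<oplus>\<^bsub>R\<^esub> b) \<odot>\<^bsub>lfield\<^esub> c = a \<odot>\<^bsub>lfield\<^esub> c \<oplus>\<^bsub>lfield\<^esub> b \<odot>\<^bsub>lfield\<^esub> c"
      using a by (simp add: lfield_smult lfield_simps R_simps(4) distrib_right sum.distrib)
  next
    fix a x y assume a: "a \<in> carrier R"
    show "a \<odot>\<^bsub>lfield\<^esub> (x \<oplus>\<^bsub>lfield\<^esub> y) = a \<odot>\<^bsub>lfield\<^esub> x \<oplus>\<^bsub>lfield\<^esub> a \<odot>\<^bsub>lfield\<^esub> y"
      using a by (simp add: lfield_smult lfield_simps field_aut_add[OF aut_K] distrib_left sum.distrib)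
  next
    fix x
    show "\<one>\<^bsub>R\<^esub> \<odot>\<^bsub>lfield\<^esub> x = x"
      unfolding lfield_smult[OF R.one_closed]
      by (simp add: R_simps skew_elt_def if_distrib[of "\<lambda>c. c * _"] sum.delta finite_K cong: if_cong)
  next
    fix x show "\<exists>y\<in>carrier lfield. y \<oplus>\<^bsub>lfield\<^esub> x = \<zero>\<^bsub>lfield\<^esub>"
      by (intro bexI[of _ "- x"]) (simp_all add: lfield_simps)
  qed (simp_all add: lfield_simps ring_R)
  then show ?thesis by (simp add: skew_module_def skew_axioms)
qed

lemma scal_lfield: "scal (lfield :: (('l::field, 'd::finite) semilin \<Rightarrow> 'l, 'l) module) c x = c * x"
proof -
  \<comment> \<open>For \<open>c = 0\<close> the support of the monomial is empty, hence the case
    distinction in the index set.\<close>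
  have "scal (lfield :: (('l, 'd) semilin \<Rightarrow> 'l, 'l) module) c x =
    (\<Sum>g\<in>(if c = 0 then {} else {semilin_one :: ('l, 'd) semilin}). (if g = semilin_one then c else 0) * snd g x)"
    unfolding scal_def lfield_def module.simps skew_elt_def by (rule sum.cong) auto
  then show ?thesis by simp
qed

lemma act_lfield: "act lfield g x = snd g x"
proof -
  have "act lfield g x = (\<Sum>h\<in>{g}. snd h x)"
    unfolding act_def lfield_def module.simps skew_elt_def by (rule sum.cong) auto
  then show ?thesis by simp
qed

lemma finsum_lfield: "finsum lfield f A = sum f A"
proof -
  interpret skew_module "{semilin_one}" lfield by (rule skew.skew_module_lfield[OF skew_trivial])
  show ?thesis
    by (induction A rule: infinite_finite_induct) (simp_all add: lfield_simps Pi_def)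
qed

text \<open>
  If \<open>E\<close> has an \<open>l\<close>-basis \<open>(e\<^sub>i)\<close> with \<open>g e\<^sub>j = \<Sum>i. \<rho> g i j e\<^sub>i\<close>, then \<open>tmod I \<rho> N\<close> is \<open>E \<otimes> N\<close> in the
  coordinates \<open>\<Sum>i. e\<^sub>i \<otimes> v\<^sub>i\<close>, and \<open>tmod I \<rho> lfield\<close> is \<open>E\<close> itself.
\<close>

definition tmod ::
  "'i set \<Rightarrow> (('l::field, 'd::finite) semilin \<Rightarrow> 'i \<Rightarrow> 'i \<Rightarrow> 'l) \<Rightarrow> (('l, 'd) semilin \<Rightarrow> 'l, 'b) module \<Rightarrow>
   (('l, 'd) semilin \<Rightarrow> 'l, 'i \<Rightarrow> 'b) module"
  where "tmod I \<rho> N = (direct_sum I (\<lambda>_. N))\<lparr>smult :=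
    (\<lambda>a v. \<lambda>i\<in>I. finsum N (\<lambda>j. (\<lambda>g. a g * \<rho> g i j) \<odot>\<^bsub>N\<^esub> v j) I)\<rparr>"

lemma tmod_simps:
  "carrier (tmod I \<rho> N) = (\<Pi>\<^sub>E i\<in>I. carrier N)"
  "\<zero>\<^bsub>tmod I \<rho> N\<^esub> = (\<lambda>i\<in>I. \<zero>\<^bsub>N\<^esub>)"
  "f \<oplus>\<^bsub>tmod I \<rho> N\<^esub> g = (\<lambda>i\<in>I. f i \<oplus>\<^bsub>N\<^esub> g i)"
  "a \<odot>\<^bsub>tmod I \<rho> N\<^esub> v = (\<lambda>i\<in>I. finsum N (\<lambda>j. (\<lambda>g. a g * \<rho> g i j) \<odot>\<^bsub>N\<^esub> v j) I)"
  by (simp_all add: tmod_def direct_sum_simps)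

text \<open>The matrix form of \<open>g (h e_j) = (g h) e_j\<close> for a semilinear action: when
  \<open>g\<close> is applied, the coefficients of \<open>h e_j\<close> are moved by its
  automorphism.\<close>

definition cocycle ::
  "('l::field, 'd::finite) semilin set \<Rightarrow> 'i set \<Rightarrow> (('l, 'd) semilin \<Rightarrow> 'i \<Rightarrow> 'i \<Rightarrow> 'l) \<Rightarrow> bool"
  where "cocycle K I \<rho> \<longleftrightarrow>
    (\<forall>i\<in>I. \<forall>j\<in>I. \<rho> semilin_one i j = (if i = j then 1 else 0)) \<and>
    (\<forall>g\<in>K. \<forall>h\<in>K. \<forall>i\<in>I. \<forall>j\<in>I. \<rho> (semilin_mult g h) i j = (\<Sum>k\<in>I. \<rho> g i k * snd g (\<rho> h k j)))"

context skew_module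
begin

lemma R_mult_pointwise: "a \<in> carrier R \<Longrightarrow> (\<lambda>g. a g * r g) \<in> carrier R"
  by (simp add: R_simps)

lemma tmod_smult_closed:
  assumes "a \<in> carrier R" "v \<in> carrier (tmod I \<rho> M)"
  shows "finsum M (\<lambda>j. (\<lambda>g. a g * \<rho> g i j) \<odot>\<^bsub>M\<^esub> v j) I \<in> carrier M"
  using assms by (intro M.finsum_closed) (auto simp: tmod_simps PiE_iff smult_closed R_mult_pointwise)

text \<open>Weighting the coefficients of \<open>a\<close> by the matrix entries turns
  \<open>a\<close> into a matrix over the skew group ring, which then acts on families in
  \<open>M\<close> by the usual matrix formula. The cocycle condition makes this compatible with
  products and the unit.\<close>

lemma skew_module_tmod:
  assumes I: "finite I" and \<rho>: "cocycle K I \<rho>"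
  shows "skew_module K (tmod I \<rho> M)"
proof -
  interpret D: left_module R "direct_sum I (\<lambda>_. M)"
    by (rule left_module_direct_sum) (simp_all add: ring_R left_module_axioms)
  have v: "v j \<in> carrier M" if "v \<in> carrier (tmod I \<rho> M)" "j \<in> I" for v j
    using that by (auto simp: tmod_simps)
  have "left_module R (tmod I \<rho> M)"
  proof (intro left_module.intro left_module_axioms.intro ring_R)
    show "abelian_group (tmod I \<rho> M)"
    proof (rule abelian_groupI)
      fix x assume "x \<in> carrier (tmod I \<rho> M)"
      then show "\<exists>y\<in>carrier (tmod I \<rho> M). y \<oplus>\<^bsub>tmod I \<rho> M\<^esub> x = \<zero>\<^bsub>tmod I \<rho> M\<^esub>"
        by (intro bexI[of _ "\<ominus>\<^bsub>direct_sum I (\<lambda>_. M)\<^esub> x"]) (simp_all add: tmod_def D.M.l_neg)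
    next
      fix x y assume "x \<in> carrier (tmod I \<rho> M)" "y \<in> carrier (tmod I \<rho> M)"
      then show "x \<oplus>\<^bsub>tmod I \<rho> M\<^esub> y = y \<oplus>\<^bsub>tmod I \<rho> M\<^esub> x"
        using D.M.a_comm[of x y] by (simp add: tmod_def)
    qed (simp_all add: tmod_def D.M.a_assoc)
  next
    fix a x assume "a \<in> carrier R" "x \<in> carrier (tmod I \<rho> M)"
    from tmod_smult_closed[OF this] show "a \<odot>\<^bsub>tmod I \<rho> M\<^esub> x \<in> carrier (tmod I \<rho> M)"
      by (simp add: tmod_simps restrict_PiE_iff)
  next
    fix a b x assume a: "a \<in> carrier R" "b \<in> carrier R" and x: "x \<in> carrier (tmod I \<rho> M)"
    have "finsum M (\<lambda>j. (\<lambda>g. (a \<oplus>\<^bsub>R\<^esub> b) g * \<rho> g i j) \<odot>\<^bsub>M\<^esub> x j) I =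
      finsum M (\<lambda>j. (\<lambda>g. a g * \<rho> g i j) \<odot>\<^bsub>M\<^esub> x j) I \<oplus>\<^bsub>M\<^esub> finsum M (\<lambda>j. (\<lambda>g. b g * \<rho> g i j) \<odot>\<^bsub>M\<^esub> x j) I" for i
    proof -
      have "finsum M (\<lambda>j. (\<lambda>g. (a \<oplus>\<^bsub>R\<^esub> b) g * \<rho> g i j) \<odot>\<^bsub>M\<^esub> x j) I =
        finsum M (\<lambda>j. (\<lambda>g. a g * \<rho> g i j) \<odot>\<^bsub>M\<^esub> x j \<oplus>\<^bsub>M\<^esub> (\<lambda>g. b g * \<rho> g i j) \<odot>\<^bsub>M\<^esub> x j) I"
      proof (rule M.finsum_cong'[OF refl])
        fix j assume j: "j \<in> I"
        have "(\<lambda>g. (a \<oplus>\<^bsub>R\<^esub> b) g * \<rho> g i j) = (\<lambda>g. a g * \<rho> g i j) \<oplus>\<^bsub>R\<^esub> (\<lambda>g. b g * \<rho> g i j)"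
          by (simp add: R_simps distrib_right)
        then show "(\<lambda>g. (a \<oplus>\<^bsub>R\<^esub> b) g * \<rho> g i j) \<odot>\<^bsub>M\<^esub> x j =
          (\<lambda>g. a g * \<rho> g i j) \<odot>\<^bsub>M\<^esub> x j \<oplus>\<^bsub>M\<^esub> (\<lambda>g. b g * \<rho> g i j) \<odot>\<^bsub>M\<^esub> x j"
          using smult_l_distr[OF R_mult_pointwise[OF a(1)] R_mult_pointwise[OF a(2)] v[OF x j]] by simp
      qed (use a v[OF x] in \<open>auto simp: smult_closed R_mult_pointwise\<close>)
      also have "\<dots> = finsum M (\<lambda>j. (\<lambda>g. a g * \<rho> g i j) \<odot>\<^bsub>M\<^esub> x j) I \<oplus>\<^bsub>M\<^esub> finsum M (\<lambda>j. (\<lambda>g. b g * \<rho> g i j) \<odot>\<^bsub>M\<^esub> x j) I"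
        using a v[OF x] by (intro M.finsum_addf) (auto simp: smult_closed R_mult_pointwise)
      finally show ?thesis .
    qed
    then show "(a \<oplus>\<^bsub>R\<^esub> b) \<odot>\<^bsub>tmod I \<rho> M\<^esub> x = a \<odot>\<^bsub>tmod I \<rho> M\<^esub> x \<oplus>\<^bsub>tmod I \<rho> M\<^esub> b \<odot>\<^bsub>tmod I \<rho> M\<^esub> x"
      unfolding tmod_simps by (intro restrict_ext) simp
  next
    fix a x y assume a: "a \<in> carrier R" and x: "x \<in> carrier (tmod I \<rho> M)" and y: "y \<in> carrier (tmod I \<rho> M)"
    have "finsum M (\<lambda>j. (\<lambda>g. a g * \<rho> g i j) \<odot>\<^bsub>M\<^esub> (x \<oplus>\<^bsub>tmod I \<rho> M\<^esub> y) j) I =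
      finsum M (\<lambda>j. (\<lambda>g. a g * \<rho> g i j) \<odot>\<^bsub>M\<^esub> x j) I \<oplus>\<^bsub>M\<^esub> finsum M (\<lambda>j. (\<lambda>g. a g * \<rho> g i j) \<odot>\<^bsub>M\<^esub> y j) I" for i
    proof -
      have "finsum M (\<lambda>j. (\<lambda>g. a g * \<rho> g i j) \<odot>\<^bsub>M\<^esub> (x \<oplus>\<^bsub>tmod I \<rho> M\<^esub> y) j) I =
        finsum M (\<lambda>j. (\<lambda>g. a g * \<rho> g i j) \<odot>\<^bsub>M\<^esub> x j \<oplus>\<^bsub>M\<^esub> (\<lambda>g. a g * \<rho> g i j) \<odot>\<^bsub>M\<^esub> y j) I"
        using a v[OF x] v[OF y]
        by (intro M.finsum_cong'[OF refl]) (auto simp: smult_closed R_mult_pointwise tmod_simps smult_r_distr)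
      also have "\<dots> = finsum M (\<lambda>j. (\<lambda>g. a g * \<rho> g i j) \<odot>\<^bsub>M\<^esub> x j) I \<oplus>\<^bsub>M\<^esub> finsum M (\<lambda>j. (\<lambda>g. a g * \<rho> g i j) \<odot>\<^bsub>M\<^esub> y j) I"
        using a v[OF x] v[OF y] by (intro M.finsum_addf) (auto simp: smult_closed R_mult_pointwise)
      finally show ?thesis .
    qed
    then show "a \<odot>\<^bsub>tmod I \<rho> M\<^esub> (x \<oplus>\<^bsub>tmod I \<rho> M\<^esub> y) = a \<odot>\<^bsub>tmod I \<rho> M\<^esub> x \<oplus>\<^bsub>tmod I \<rho> M\<^esub> a \<odot>\<^bsub>tmod I \<rho> M\<^esub> y"
      unfolding tmod_simps(4) tmod_simps(3)[of I \<rho> M "restrict _ I"] by (intro restrict_ext) simp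
  next
    fix a b x assume a: "a \<in> carrier R" "b \<in> carrier R" and x: "x \<in> carrier (tmod I \<rho> M)"
    \<comment> \<open>The assignment of matrices over the ring is multiplicative: the entries of the
      product are the convolutions prescribed by the cocycle condition.\<close>
    have r: "(\<lambda>g. (a \<otimes>\<^bsub>R\<^esub> b) g * \<rho> g i j) =
        finsum R (\<lambda>k. (\<lambda>g. a g * \<rho> g i k) \<otimes>\<^bsub>R\<^esub> (\<lambda>g. b g * \<rho> g k j)) I" if "i \<in> I" "j \<in> I" for i j
    proof
      fix g
      have "finsum R (\<lambda>k. (\<lambda>g. a g * \<rho> g i k) \<otimes>\<^bsub>R\<^esub> (\<lambda>g. b g * \<rho> g k j)) I g =
        (\<Sum>k\<in>I. ((\<lambda>g. a g * \<rho> g i k) \<otimes>\<^bsub>R\<^esub> (\<lambda>g. b g * \<rho> g k j)) g)"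
        by (subst finsum_R) (auto simp: R_mult_closed)
      also have "\<dots> = (\<Sum>h\<in>K. \<Sum>k\<in>I. \<Sum>h'\<in>K. if semilin_mult h h' = g then a h * \<rho> h i k * snd h (b h' * \<rho> h' k j) else 0)"
        unfolding R_mult by (rule sum.swap)
      also have "\<dots> = (\<Sum>h\<in>K. \<Sum>h'\<in>K. \<Sum>k\<in>I. if semilin_mult h h' = g then a h * \<rho> h i k * snd h (b h' * \<rho> h' k j) else 0)"
        by (rule sum.cong[OF refl], rule sum.swap)
      also have "\<dots> = (\<Sum>h\<in>K. \<Sum>h'\<in>K. (if semilin_mult h h' = g then a h * snd h (b h') else 0) * \<rho> g i j)"
      proof (rule sum.cong[OF refl], rule sum.cong[OF refl])
        fix h h' assume h: "h \<in> K" "h' \<in> K"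
        show "(\<Sum>k\<in>I. if semilin_mult h h' = g then a h * \<rho> h i k * snd h (b h' * \<rho> h' k j) else 0) =
          (if semilin_mult h h' = g then a h * snd h (b h') else 0) * \<rho> g i j"
        proof (cases "semilin_mult h h' = g")
          case True
          have "\<rho> g i j = (\<Sum>k\<in>I. \<rho> h i k * snd h (\<rho> h' k j))"
            using \<rho> h that True[symmetric] by (simp add: cocycle_def)
          then show ?thesis using True h
            by (simp add: sum_distrib_left field_aut_mult[OF aut_K] mult_ac)
        qed simp
      qed
      also have "\<dots> = (a \<otimes>\<^bsub>R\<^esub> b) g * \<rho> g i j" by (simp only: R_mult sum_distrib_right)
      finally show "(a \<otimes>\<^bsub>R\<^esub> b) g * \<rho> g i j = finsum R (\<lambda>k. (\<lambda>g. a g * \<rho> g i k) \<otimes>\<^bsub>R\<^esub> (\<lambda>g. b g * \<rho> g k j)) I g" ..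
    qed
    have "finsum M (\<lambda>j. (\<lambda>g. (a \<otimes>\<^bsub>R\<^esub> b) g * \<rho> g i j) \<odot>\<^bsub>M\<^esub> x j) I =
      finsum M (\<lambda>k. (\<lambda>g. a g * \<rho> g i k) \<odot>\<^bsub>M\<^esub> (b \<odot>\<^bsub>tmod I \<rho> M\<^esub> x) k) I" if i: "i \<in> I" for i
    proof -
      have c: "(\<lambda>g. a g * \<rho> g i k) \<odot>\<^bsub>M\<^esub> ((\<lambda>g. b g * \<rho> g k j) \<odot>\<^bsub>M\<^esub> x j) \<in> carrier M" if "j \<in> I" for k j
        using a v[OF x that] by (simp add: smult_closed R_mult_pointwise)
      have "finsum M (\<lambda>j. (\<lambda>g. (a \<otimes>\<^bsub>R\<^esub> b) g * \<rho> g i j) \<odot>\<^bsub>M\<^esub> x j) I =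
        finsum M (\<lambda>j. finsum M (\<lambda>k. (\<lambda>g. a g * \<rho> g i k) \<odot>\<^bsub>M\<^esub> ((\<lambda>g. b g * \<rho> g k j) \<odot>\<^bsub>M\<^esub> x j)) I) I"
      proof (rule M.finsum_cong'[OF refl])
        fix j assume j: "j \<in> I"
        have "(\<lambda>g. (a \<otimes>\<^bsub>R\<^esub> b) g * \<rho> g i j) \<odot>\<^bsub>M\<^esub> x j =
          finsum M (\<lambda>k. ((\<lambda>g. a g * \<rho> g i k) \<otimes>\<^bsub>R\<^esub> (\<lambda>g. b g * \<rho> g k j)) \<odot>\<^bsub>M\<^esub> x j) I"
          unfolding r[OF i j] by (rule smult_finsum_l) (use v[OF x j] I in \<open>auto simp: R_mult_closed\<close>)
        also have "\<dots> = finsum M (\<lambda>k. (\<lambda>g. a g * \<rho> g i k) \<odot>\<^bsub>M\<^esub> ((\<lambda>g. b g * \<rho> g k j) \<odot>\<^bsub>M\<^esub> x j)) I"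
          by (rule M.finsum_cong'[OF refl]) (use a c j v[OF x j] in \<open>auto simp: smult_assoc1 R_mult_pointwise\<close>)
        finally show "(\<lambda>g. (a \<otimes>\<^bsub>R\<^esub> b) g * \<rho> g i j) \<odot>\<^bsub>M\<^esub> x j =
          finsum M (\<lambda>k. (\<lambda>g. a g * \<rho> g i k) \<odot>\<^bsub>M\<^esub> ((\<lambda>g. b g * \<rho> g k j) \<odot>\<^bsub>M\<^esub> x j)) I" .
      qed (use c in auto)
      also have "\<dots> = finsum M (\<lambda>k. finsum M (\<lambda>j. (\<lambda>g. a g * \<rho> g i k) \<odot>\<^bsub>M\<^esub> ((\<lambda>g. b g * \<rho> g k j) \<odot>\<^bsub>M\<^esub> x j)) I) I"
        by (rule M.finsum_swap) (use I c in auto)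
      also have "\<dots> = finsum M (\<lambda>k. (\<lambda>g. a g * \<rho> g i k) \<odot>\<^bsub>M\<^esub> (b \<odot>\<^bsub>tmod I \<rho> M\<^esub> x) k) I"
      proof (rule M.finsum_cong'[OF refl])
        fix k assume k: "k \<in> I"
        show "finsum M (\<lambda>j. (\<lambda>g. a g * \<rho> g i k) \<odot>\<^bsub>M\<^esub> ((\<lambda>g. b g * \<rho> g k j) \<odot>\<^bsub>M\<^esub> x j)) I =
          (\<lambda>g. a g * \<rho> g i k) \<odot>\<^bsub>M\<^esub> (b \<odot>\<^bsub>tmod I \<rho> M\<^esub> x) k"
          using k a v[OF x] I unfolding tmod_simps
          by (simp, subst smult_finsum) (auto simp: smult_closed R_mult_pointwise)
      next
        show "(\<lambda>k. (\<lambda>g. a g * \<rho> g i k) \<odot>\<^bsub>M\<^esub> (b \<odot>\<^bsub>tmod I \<rho> M\<^esub> x) k) \<in> I \<rightarrow> carrier M"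
          using a tmod_smult_closed[OF a(2) x] by (auto simp: tmod_simps(4) smult_closed R_mult_pointwise)
      qed
      finally show ?thesis .
    qed
    then show "(a \<otimes>\<^bsub>R\<^esub> b) \<odot>\<^bsub>tmod I \<rho> M\<^esub> x = a \<odot>\<^bsub>tmod I \<rho> M\<^esub> (b \<odot>\<^bsub>tmod I \<rho> M\<^esub> x)"
      unfolding tmod_simps(4)[of I \<rho> M "a \<otimes>\<^bsub>R\<^esub> b"] tmod_simps(4)[of I \<rho> M "a"] by (rule restrict_ext)
  next
    fix x assume x: "x \<in> carrier (tmod I \<rho> M)"
    have "finsum M (\<lambda>j. (\<lambda>g. \<one>\<^bsub>R\<^esub> g * \<rho> g i j) \<odot>\<^bsub>M\<^esub> x j) I = x i" if i: "i \<in> I" for i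
    proof -
      have "finsum M (\<lambda>j. (\<lambda>g. \<one>\<^bsub>R\<^esub> g * \<rho> g i j) \<odot>\<^bsub>M\<^esub> x j) I = finsum M (\<lambda>j. if i = j then x j else \<zero>\<^bsub>M\<^esub>) I"
      proof (rule M.finsum_cong'[OF refl])
        fix j assume j: "j \<in> I"
        have "(\<lambda>g. \<one>\<^bsub>R\<^esub> g * \<rho> g i j) = skew_elt (if i = j then 1 else 0) semilin_one"
          using \<rho> i j by (auto simp: R_simps skew_elt_def cocycle_def)
        then show "(\<lambda>g. \<one>\<^bsub>R\<^esub> g * \<rho> g i j) \<odot>\<^bsub>M\<^esub> x j = (if i = j then x j else \<zero>\<^bsub>M\<^esub>)"
          using v[OF x j] scal_0_l[OF v[OF x j]] by (auto simp: scal_def[symmetric])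
      qed (use v[OF x] in auto)
      also have "\<dots> = x i" by (rule M.finsum_singleton) (use i I v[OF x] in auto)
      finally show ?thesis .
    qed
    then show "\<one>\<^bsub>R\<^esub> \<odot>\<^bsub>tmod I \<rho> M\<^esub> x = x"
      using x by (auto simp: tmod_simps fun_eq_iff PiE_iff extensional_def)
  qed
  then show ?thesis by (simp add: skew_module_def skew_axioms)
qed

lemma act_tmod:
  assumes g: "g \<in> K" and x: "x \<in> carrier (tmod I \<rho> M)"
  shows "act (tmod I \<rho> M) g x = (\<lambda>i\<in>I. finsum M (\<lambda>j. scal M (\<rho> g i j) (act M g (x j))) I)"
  unfolding act_def[of "tmod I \<rho> M"] tmod_simps
proof (intro restrict_ext M.finsum_cong'[OF refl])
  have v: "x j \<in> carrier M" if "j \<in> I" for j using x that by (auto simp: tmod_simps)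
  fix i assume "i \<in> I"
  show "(\<lambda>j. scal M (\<rho> g i j) (act M g (x j))) \<in> I \<rightarrow> carrier M" using v g by auto
  fix j assume "j \<in> I"
  have "(\<lambda>h. skew_elt 1 g h * \<rho> h i j) = skew_elt (\<rho> g i j) g" by (auto simp: skew_elt_def)
  then show "(\<lambda>h. skew_elt 1 g h * \<rho> h i j) \<odot>\<^bsub>M\<^esub> x j = scal M (\<rho> g i j) (act M g (x j))"
    using skew_elt_smult[OF g v[OF \<open>j \<in> I\<close>]] by simp
qed

lemma scal_tmod:
  assumes I: "finite I" and \<rho>: "cocycle K I \<rho>" and x: "x \<in> carrier (tmod I \<rho> M)"
  shows "scal (tmod I \<rho> M) c x = (\<lambda>i\<in>I. scal M c (x i))"
  unfolding scal_def[of "tmod I \<rho> M"] tmod_simps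
proof (rule restrict_ext)
  have v: "x j \<in> carrier M" if "j \<in> I" for j using x that by (auto simp: tmod_simps)
  fix i assume i: "i \<in> I"
  have "finsum M (\<lambda>j. (\<lambda>g. skew_elt c semilin_one g * \<rho> g i j) \<odot>\<^bsub>M\<^esub> x j) I =
    finsum M (\<lambda>j. if i = j then scal M c (x j) else \<zero>\<^bsub>M\<^esub>) I"
  proof (rule M.finsum_cong'[OF refl])
    fix j assume j: "j \<in> I"
    have "(\<lambda>g. skew_elt c semilin_one g * \<rho> g i j) = skew_elt (if i = j then c else 0) semilin_one"
      using \<rho> i j by (auto simp: skew_elt_def cocycle_def)
    then show "(\<lambda>g. skew_elt c semilin_one g * \<rho> g i j) \<odot>\<^bsub>M\<^esub> x j = (if i = j then scal M c (x j) else \<zero>\<^bsub>M\<^esub>)"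
      using v[OF j] scal_0_l[OF v[OF j]] by (auto simp: scal_def[symmetric])
  qed (use v in auto)
  also have "\<dots> = scal M c (x i)" by (rule M.finsum_singleton) (use i I v in auto)
  finally show "finsum M (\<lambda>j. (\<lambda>g. skew_elt c semilin_one g * \<rho> g i j) \<odot>\<^bsub>M\<^esub> x j) I = scal M c (x i)" .
qed

end

text \<open>\<open>E\<close> is congruence modulo \<open>N\<close> in whatever form is easiest to
  decide: equality of images under a homomorphism, or a difference lying in \<open>N\<close>. The
  module laws are demanded only up to \<open>E\<close>, since \<open>M\<close> itself may not be
  known to be a module.\<close>

lemma quotient_lmod_left_module:
  assumes R: "ring R" and M: "abelian_group M" and N: "subgroup N (add_monoid M)"
    and cl: "\<And>a x. a \<in> carrier R \<Longrightarrow> x \<in> carrier M \<Longrightarrow> a \<odot>\<^bsub>M\<^esub> x \<in> carrier M"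
    and eq: "\<And>x y. x \<in> carrier M \<Longrightarrow> y \<in> carrier M \<Longrightarrow> E x y \<longleftrightarrow> N +>\<^bsub>M\<^esub> x = N +>\<^bsub>M\<^esub> y"
    and cong: "\<And>a x y. a \<in> carrier R \<Longrightarrow> x \<in> carrier M \<Longrightarrow> y \<in> carrier M \<Longrightarrow> E x y \<Longrightarrow> E (a \<odot>\<^bsub>M\<^esub> x) (a \<odot>\<^bsub>M\<^esub> y)"
    and ld: "\<And>a b x. a \<in> carrier R \<Longrightarrow> b \<in> carrier R \<Longrightarrow> x \<in> carrier M \<Longrightarrow>
        E ((a \<oplus>\<^bsub>R\<^esub> b) \<odot>\<^bsub>M\<^esub> x) (a \<odot>\<^bsub>M\<^esub> x \<oplus>\<^bsub>M\<^esub> b \<odot>\<^bsub>M\<^esub> x)"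
    and rd: "\<And>a x y. a \<in> carrier R \<Longrightarrow> x \<in> carrier M \<Longrightarrow> y \<in> carrier M \<Longrightarrow>
        E (a \<odot>\<^bsub>M\<^esub> (x \<oplus>\<^bsub>M\<^esub> y)) (a \<odot>\<^bsub>M\<^esub> x \<oplus>\<^bsub>M\<^esub> a \<odot>\<^bsub>M\<^esub> y)"
    and as: "\<And>a b x. a \<in> carrier R \<Longrightarrow> b \<in> carrier R \<Longrightarrow> x \<in> carrier M \<Longrightarrow>
        E ((a \<otimes>\<^bsub>R\<^esub> b) \<odot>\<^bsub>M\<^esub> x) (a \<odot>\<^bsub>M\<^esub> (b \<odot>\<^bsub>M\<^esub> x))"
    and on: "\<And>x. x \<in> carrier M \<Longrightarrow> E (\<one>\<^bsub>R\<^esub> \<odot>\<^bsub>M\<^esub> x) x"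
  shows "left_module R (quotient_lmod M N)"
    and "\<And>x y. x \<in> carrier M \<Longrightarrow> y \<in> carrier M \<Longrightarrow>
      (N +>\<^bsub>M\<^esub> x) \<oplus>\<^bsub>quotient_lmod M N\<^esub> (N +>\<^bsub>M\<^esub> y) = N +>\<^bsub>M\<^esub> (x \<oplus>\<^bsub>M\<^esub> y)"
    and "\<And>a x. a \<in> carrier R \<Longrightarrow> x \<in> carrier M \<Longrightarrow> a \<odot>\<^bsub>quotient_lmod M N\<^esub> (N +>\<^bsub>M\<^esub> x) = N +>\<^bsub>M\<^esub> (a \<odot>\<^bsub>M\<^esub> x)"
    and "carrier (quotient_lmod M N) = (\<lambda>x. N +>\<^bsub>M\<^esub> x) ` carrier M"
proof -
  interpret R: ring R by fact
  interpret M: abelian_group M by fact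
  interpret N: abelian_subgroup N M
    by (rule abelian_subgroupI3) (simp_all add: M additive_subgroup_def N)
  let ?Q = "quotient_lmod M N"
  show add: "(N +>\<^bsub>M\<^esub> x) \<oplus>\<^bsub>?Q\<^esub> (N +>\<^bsub>M\<^esub> y) = N +>\<^bsub>M\<^esub> (x \<oplus>\<^bsub>M\<^esub> y)"
    if "x \<in> carrier M" "y \<in> carrier M" for x y
    using N.a_rcos_sum[OF that] by (simp add: quotient_lmod_def)
  show car: "carrier ?Q = (\<lambda>x. N +>\<^bsub>M\<^esub> x) ` carrier M"
    by (auto simp: quotient_lmod_def A_RCOSETS_def')
  have zero: "\<zero>\<^bsub>?Q\<^esub> = N +>\<^bsub>M\<^esub> \<zero>\<^bsub>M\<^esub>"
    using N.a_subset by (simp add: quotient_lmod_def M.a_coset_add_zero)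
  show smult: "a \<odot>\<^bsub>?Q\<^esub> (N +>\<^bsub>M\<^esub> x) = N +>\<^bsub>M\<^esub> (a \<odot>\<^bsub>M\<^esub> x)"
    if a: "a \<in> carrier R" and x: "x \<in> carrier M" for a x
  proof -
    have *: "N +>\<^bsub>M\<^esub> (a \<odot>\<^bsub>M\<^esub> y) = N +>\<^bsub>M\<^esub> (a \<odot>\<^bsub>M\<^esub> x)" if "y \<in> N +>\<^bsub>M\<^esub> x" for y
    proof -
      have y: "y \<in> carrier M" using that x N.a_subset by (auto simp: a_r_coset_def')
      have "N +>\<^bsub>M\<^esub> x = N +>\<^bsub>M\<^esub> y" by (rule M.a_repr_independence[OF that x N.a_subgroup])
      then have "E y x" by (simp add: eq[OF y x])
      then have "E (a \<odot>\<^bsub>M\<^esub> y) (a \<odot>\<^bsub>M\<^esub> x)" by (rule cong[OF a y x])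
      then show ?thesis by (simp add: eq[OF cl[OF a y] cl[OF a x]])
    qed
    have ne: "N +>\<^bsub>M\<^esub> x \<noteq> {}" using N.a_rcos_self[OF x] by blast
    have "a \<odot>\<^bsub>?Q\<^esub> (N +>\<^bsub>M\<^esub> x) = (\<Union>y\<in>N +>\<^bsub>M\<^esub> x. N +>\<^bsub>M\<^esub> (a \<odot>\<^bsub>M\<^esub> y))" by (simp add: quotient_lmod_def)
    also have "\<dots> = (\<Union>y\<in>N +>\<^bsub>M\<^esub> x. N +>\<^bsub>M\<^esub> (a \<odot>\<^bsub>M\<^esub> x))" using * by (rule SUP_cong[OF refl])
    also have "\<dots> = N +>\<^bsub>M\<^esub> (a \<odot>\<^bsub>M\<^esub> x)" using ne by (rule cSUP_const)
    finally show ?thesis .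
  qed
  show "left_module R ?Q"
  proof (rule left_moduleI)
    fix X assume "X \<in> carrier ?Q"
    then obtain x where "x \<in> carrier M" "X = N +>\<^bsub>M\<^esub> x" using car by auto
    then show "\<exists>Y\<in>carrier ?Q. Y \<oplus>\<^bsub>?Q\<^esub> X = \<zero>\<^bsub>?Q\<^esub>"
      by (intro bexI[of _ "N +>\<^bsub>M\<^esub> (\<ominus>\<^bsub>M\<^esub> x)"]) (auto simp: add zero car M.l_neg)
  next
    fix X Y assume "X \<in> carrier ?Q" "Y \<in> carrier ?Q"
    then obtain x y where "x \<in> carrier M" "X = N +>\<^bsub>M\<^esub> x" "y \<in> carrier M" "Y = N +>\<^bsub>M\<^esub> y" using car by auto
    then show "X \<oplus>\<^bsub>?Q\<^esub> Y = Y \<oplus>\<^bsub>?Q\<^esub> X" using M.a_comm[of x y] by (simp add: add)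
  qed (use R ld rd as on eq cl in \<open>auto simp: car add zero smult M.a_assoc\<close>)
qed

text \<open>The first isomorphism theorem for an \<open>M\<close> that is only an abelian group
  closed under scalars: the quotient inherits its module laws from \<open>P\<close> through
  \<open>f\<close>. The cotangent module is obtained in this way.\<close>

lemma quotient_lmod_iso:
  assumes M: "abelian_group M" and P: "left_module R P"
    and cl: "\<And>a x. a \<in> carrier R \<Longrightarrow> x \<in> carrier M \<Longrightarrow> a \<odot>\<^bsub>M\<^esub> x \<in> carrier M"
    and f: "f \<in> lhom R M P" "f ` carrier M = carrier P"
    and N: "N = {x \<in> carrier M. f x = \<zero>\<^bsub>P\<^esub>}"
  shows "left_module R (quotient_lmod M N)" "lmod_iso R (quotient_lmod M N) P"
proof -
  interpret M: abelian_group M by fact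
  interpret P: left_module R P by fact
  note f' = lhomD[OF f(1)]
  have f0: "f \<zero>\<^bsub>M\<^esub> = \<zero>\<^bsub>P\<^esub>"
    using f'(2)[of "\<zero>\<^bsub>M\<^esub>" "\<zero>\<^bsub>M\<^esub>"] f'(1)[of "\<zero>\<^bsub>M\<^esub>"] by simp
  have fm: "f (\<ominus>\<^bsub>M\<^esub> x) = \<ominus>\<^bsub>P\<^esub> f x" if "x \<in> carrier M" for x
    by (rule P.M.minus_equality[symmetric]) (use f'(2)[of "\<ominus>\<^bsub>M\<^esub> x" x] f'(1) f0 that in \<open>auto simp: M.l_neg\<close>)
  have sN: "subgroup N (add_monoid M)"
    by (rule M.add.subgroupI) (use f0 fm f' N in auto)
  interpret N: abelian_subgroup N M
    by (rule abelian_subgroupI3) (simp_all add: M additive_subgroup_def sN)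
  have eq: "f x = f y \<longleftrightarrow> N +>\<^bsub>M\<^esub> x = N +>\<^bsub>M\<^esub> y" if "x \<in> carrier M" "y \<in> carrier M" for x y
  proof -
    have "f (x \<ominus>\<^bsub>M\<^esub> y) = f x \<ominus>\<^bsub>P\<^esub> f y" using that f' fm by (simp add: a_minus_def)
    then have "f x = f y \<longleftrightarrow> x \<ominus>\<^bsub>M\<^esub> y \<in> N"
      using that f'(1) unfolding N
      by (auto simp: P.M.r_neg a_minus_def) (metis P.M.add.inv_closed P.M.add.inv_equality P.M.add.inv_inv)
    also have "\<dots> \<longleftrightarrow> x \<in> N +>\<^bsub>M\<^esub> y" using N.a_rcos_module[of y x] that by (simp add: a_minus_def)
    also have "\<dots> \<longleftrightarrow> N +>\<^bsub>M\<^esub> x = N +>\<^bsub>M\<^esub> y"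
      using M.a_repr_independence[OF _ that(2) N.a_subgroup] N.a_rcos_self[OF that(1)] by metis
    finally show ?thesis .
  qed
  note Q = quotient_lmod_left_module[OF P.R.ring_axioms M sN cl, of "\<lambda>x y. f x = f y", OF _ _ eq]
  have Q: "left_module R (quotient_lmod M N)"
    "\<And>x y. x \<in> carrier M \<Longrightarrow> y \<in> carrier M \<Longrightarrow>
      (N +>\<^bsub>M\<^esub> x) \<oplus>\<^bsub>quotient_lmod M N\<^esub> (N +>\<^bsub>M\<^esub> y) = N +>\<^bsub>M\<^esub> (x \<oplus>\<^bsub>M\<^esub> y)"
    "\<And>a x. a \<in> carrier R \<Longrightarrow> x \<in> carrier M \<Longrightarrow> a \<odot>\<^bsub>quotient_lmod M N\<^esub> (N +>\<^bsub>M\<^esub> x) = N +>\<^bsub>M\<^esub> (a \<odot>\<^bsub>M\<^esub> x)"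
    "carrier (quotient_lmod M N) = (\<lambda>x. N +>\<^bsub>M\<^esub> x) ` carrier M"
    by (rule Q; (simp add: f' cl P.smult_l_distr P.smult_r_distr P.smult_assoc1 P.smult_one; fail)?)+
  show "left_module R (quotient_lmod M N)" by (rule Q(1))
  define g where "g X = f (SOME x. x \<in> carrier M \<and> X = N +>\<^bsub>M\<^esub> x)" for X
  have g: "g (N +>\<^bsub>M\<^esub> x) = f x" if "x \<in> carrier M" for x
  proof -
    have "\<exists>y. y \<in> carrier M \<and> N +>\<^bsub>M\<^esub> x = N +>\<^bsub>M\<^esub> y" using that by blast
    from someI_ex[OF this] show ?thesis unfolding g_def using eq that by metis
  qed
  show "lmod_iso R (quotient_lmod M N) P"
  proof (rule lmod_isoI[of g])
    show "g \<in> lhom R (quotient_lmod M N) P"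
      by (rule lhomI) (auto simp: Q(2-4) g f' cl)
    have "inj_on g (carrier (quotient_lmod M N))"
      by (rule inj_onI) (auto simp: Q(4) g eq)
    moreover have "g ` carrier (quotient_lmod M N) = carrier P"
      unfolding Q(4) f(2)[symmetric] image_image by (rule image_cong) (simp_all add: g)
    ultimately show "bij_betw g (carrier (quotient_lmod M N)) (carrier P)" by (simp add: bij_betw_def)
  qed
qed

text \<open>Serves the exterior powers of arbitrary degree, for which no coordinate model is at hand
  to act as a target of the first isomorphism theorem.\<close>

lemma quotient_lmod_submodule:
  assumes M: "left_module R M" and N: "submodule N R M"
  shows "left_module R (quotient_lmod M N)"
    "(\<lambda>x. N +>\<^bsub>M\<^esub> x) \<in> lhom R M (quotient_lmod M N)"
    "(\<lambda>x. N +>\<^bsub>M\<^esub> x) ` carrier M = carrier (quotient_lmod M N)"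
proof -
  interpret M: left_module R M by fact
  interpret N: abelian_subgroup N M
    by (rule abelian_subgroupI3) (use N in \<open>simp_all add: M.abelian_group_axioms additive_subgroup_def submodule_def\<close>)
  have eq: "x \<ominus>\<^bsub>M\<^esub> y \<in> N \<longleftrightarrow> N +>\<^bsub>M\<^esub> x = N +>\<^bsub>M\<^esub> y" if "x \<in> carrier M" "y \<in> carrier M" for x y
  proof -
    have "x \<ominus>\<^bsub>M\<^esub> y \<in> N \<longleftrightarrow> x \<in> N +>\<^bsub>M\<^esub> y" using N.a_rcos_module[of y x] that by (simp add: a_minus_def)
    also have "\<dots> \<longleftrightarrow> N +>\<^bsub>M\<^esub> x = N +>\<^bsub>M\<^esub> y"
      using M.a_repr_independence[OF _ that(2) N.a_subgroup] N.a_rcos_self[OF that(1)] by metis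
    finally show ?thesis .
  qed
  have refl: "x \<ominus>\<^bsub>M\<^esub> x \<in> N" if "x \<in> carrier M" for x
    using that submodule_zero[OF N] by (simp add: a_minus_def M.M.r_neg)
  have cong: "a \<odot>\<^bsub>M\<^esub> x \<ominus>\<^bsub>M\<^esub> a \<odot>\<^bsub>M\<^esub> y \<in> N"
    if "a \<in> carrier R" "x \<in> carrier M" "y \<in> carrier M" "x \<ominus>\<^bsub>M\<^esub> y \<in> N" for a x y
    using submodule_smult[OF N that(1,4)] that(1-3)
    by (simp add: a_minus_def M.smult_r_distr M.smult_minus_r)
  have sN: "subgroup N (add_monoid M)" using N by (simp add: submodule_def)
  note Q = quotient_lmod_left_module[OF M.R.ring_axioms M.abelian_group_axioms sN M.smult_closed,
      of "\<lambda>x y. x \<ominus>\<^bsub>M\<^esub> y \<in> N", OF _ _ eq cong]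
  have Q: "left_module R (quotient_lmod M N)"
    "\<And>x y. x \<in> carrier M \<Longrightarrow> y \<in> carrier M \<Longrightarrow>
      (N +>\<^bsub>M\<^esub> x) \<oplus>\<^bsub>quotient_lmod M N\<^esub> (N +>\<^bsub>M\<^esub> y) = N +>\<^bsub>M\<^esub> (x \<oplus>\<^bsub>M\<^esub> y)"
    "\<And>a x. a \<in> carrier R \<Longrightarrow> x \<in> carrier M \<Longrightarrow> a \<odot>\<^bsub>quotient_lmod M N\<^esub> (N +>\<^bsub>M\<^esub> x) = N +>\<^bsub>M\<^esub> (a \<odot>\<^bsub>M\<^esub> x)"
    "carrier (quotient_lmod M N) = (\<lambda>x. N +>\<^bsub>M\<^esub> x) ` carrier M"
    by (rule Q; (simp add: refl M.smult_closed M.smult_l_distr M.smult_r_distr M.smult_assoc1 M.smult_one; fail)?)+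
  show "left_module R (quotient_lmod M N)" by (rule Q(1))
  show "(\<lambda>x. N +>\<^bsub>M\<^esub> x) \<in> lhom R M (quotient_lmod M N)" by (rule lhomI) (auto simp: Q)
  show "(\<lambda>x. N +>\<^bsub>M\<^esub> x) ` carrier M = carrier (quotient_lmod M N)" by (simp add: Q)
qed

section \<open>Tensor products\<close>

text \<open>Subspaces of the space of all functions, without a carrier: congruences between formal
  sums can be manipulated before it is checked that the sums lie in the free module.\<close>

definition fsubspace :: "('x \<Rightarrow> 'l::field) set \<Rightarrow> bool"
  where "fsubspace T \<longleftrightarrow> (\<lambda>_. 0) \<in> T \<and> (\<forall>f\<in>T. \<forall>g\<in>T. (\<lambda>y. f y + g y) \<in> T) \<and> (\<forall>c. \<forall>f\<in>T. (\<lambda>y. c * f y) \<in> T)"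

definition mod_eq :: "('x \<Rightarrow> 'l::field) set \<Rightarrow> ('x \<Rightarrow> 'l) \<Rightarrow> ('x \<Rightarrow> 'l) \<Rightarrow> bool"
  where "mod_eq T f g \<longleftrightarrow> (\<lambda>y. f y - g y) \<in> T"

context
  fixes T :: "('x \<Rightarrow> 'l::field) set"
  assumes T: "fsubspace T"
begin

lemma fsubspace_0: "(\<lambda>_. 0) \<in> T" and fsubspace_add: "f \<in> T \<Longrightarrow> g \<in> T \<Longrightarrow> (\<lambda>y. f y + g y) \<in> T"
  and fsubspace_scale: "f \<in> T \<Longrightarrow> (\<lambda>y. c * f y) \<in> T"
  using T by (auto simp: fsubspace_def)

lemma fsubspace_diff: "f \<in> T \<Longrightarrow> g \<in> T \<Longrightarrow> (\<lambda>y. f y - g y) \<in> T"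
  using fsubspace_add[of f "\<lambda>y. - 1 * g y"] fsubspace_scale[of g "- 1"] by simp

lemma fsubspace_sum: "(\<And>i. i \<in> A \<Longrightarrow> f i \<in> T) \<Longrightarrow> (\<lambda>y. \<Sum>i\<in>A. f i y) \<in> T"
  by (induction A rule: infinite_finite_induct) (auto intro: fsubspace_0 fsubspace_add)

lemma mod_eq_refl: "mod_eq T f f"
  by (simp add: mod_eq_def fsubspace_0)

lemma mod_eq_sym: "mod_eq T f g \<Longrightarrow> mod_eq T g f"
  using fsubspace_scale[of "\<lambda>y. f y - g y" "- 1"] by (simp add: mod_eq_def)

lemma mod_eq_trans: "mod_eq T f g \<Longrightarrow> mod_eq T g h \<Longrightarrow> mod_eq T f h"
  using fsubspace_add[of "\<lambda>y. f y - g y" "\<lambda>y. g y - h y"] by (simp add: mod_eq_def)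

lemma mod_eq_add: "mod_eq T f g \<Longrightarrow> mod_eq T f' g' \<Longrightarrow> mod_eq T (\<lambda>y. f y + f' y) (\<lambda>y. g y + g' y)"
  using fsubspace_add[of "\<lambda>y. f y - g y" "\<lambda>y. f' y - g' y"] by (simp add: mod_eq_def algebra_simps)

lemma mod_eq_scale: "mod_eq T f g \<Longrightarrow> mod_eq T (\<lambda>y. c * f y) (\<lambda>y. c * g y)"
  using fsubspace_scale[of "\<lambda>y. f y - g y" c] by (simp add: mod_eq_def algebra_simps)

lemma mod_eq_sum: "(\<And>i. i \<in> A \<Longrightarrow> mod_eq T (f i) (g i)) \<Longrightarrow> mod_eq T (\<lambda>y. \<Sum>i\<in>A. f i y) (\<lambda>y. \<Sum>i\<in>A. g i y)"
  using fsubspace_sum[of A "\<lambda>i y. f i y - g i y"] by (simp add: mod_eq_def sum_subtractf)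

lemma mod_eq_mem: "mod_eq T f g \<Longrightarrow> g \<in> T \<Longrightarrow> f \<in> T"
  using fsubspace_add[of "\<lambda>y. f y - g y" g] by (simp add: mod_eq_def)

end

lemma free_lmod_simps:
  "carrier (free_lmod K p X) = {f. finite {x. f x \<noteq> 0} \<and> {x. f x \<noteq> 0} \<subseteq> X}"
  "\<zero>\<^bsub>free_lmod K p X\<^esub> = (\<lambda>x. 0)" "f \<oplus>\<^bsub>free_lmod K p X\<^esub> g = (\<lambda>x. f x + g x)"
  by (simp_all add: free_lmod_def)

lemma delta_in_free: "x \<in> X \<Longrightarrow> delta x \<in> carrier (free_lmod K p X)"
  by (auto simp: free_lmod_simps delta_def)

text \<open>Induction for free modules, an element being a finite combination of the functions
  \<open>delta x\<close>. \<open>T\<close> may be a kernel, a set of elements with a normal form, or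
  any other subspace.\<close>

lemma free_lmod_induct:
  assumes T: "fsubspace T" and d: "\<And>x. x \<in> X \<Longrightarrow> delta x \<in> T"
  shows "carrier (free_lmod K p X) \<subseteq> T"
proof
  fix f assume f: "f \<in> carrier (free_lmod K p X)"
  let ?A = "{x. f x \<noteq> 0}"
  have A: "finite ?A" "?A \<subseteq> X" using f by (auto simp: free_lmod_simps)
  have "(\<lambda>y. \<Sum>x\<in>?A. f x * delta x y) \<in> T"
    using A d by (intro fsubspace_sum[OF T] fsubspace_scale[OF T]) auto
  moreover have "(\<lambda>y. \<Sum>x\<in>?A. f x * delta x y) = f"
    using A(1) by (auto simp: fun_eq_iff delta_def if_distrib[of "\<lambda>c. _ * c"] sum.delta cong: if_cong)
  ultimately show "f \<in> T" by simp
qed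

text \<open>Common ground for tensor products, where \<open>X\<close> consists of pairs, and
  exterior powers, where it consists of lists.\<close>

locale free_module = skew K for K :: "('l::field, 'd::finite) semilin set" +
  fixes p :: "('l, 'd) semilin \<Rightarrow> 'x \<Rightarrow> 'x" and X :: "'x set"
  assumes p_closed: "g \<in> K \<Longrightarrow> x \<in> X \<Longrightarrow> p g x \<in> X"
    and p_one: "x \<in> X \<Longrightarrow> p semilin_one x = x"
    and p_mult: "g \<in> K \<Longrightarrow> h \<in> K \<Longrightarrow> x \<in> X \<Longrightarrow> p (semilin_mult g h) x = p g (p h x)"
begin

abbreviation "F \<equiv> free_lmod K p X"

lemma p_inv:
  assumes "g \<in> K" "x \<in> X"
  shows "p (ginv g) (p g x) = x" "p g (p (ginv g) x) = x"
  using assms by (simp_all flip: p_mult add: p_one)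

lemma F_supp: "f \<in> carrier F \<Longrightarrow> f x \<noteq> 0 \<Longrightarrow> x \<in> X"
  by (auto simp: free_lmod_simps)

text \<open>Each \<open>p g\<close> permutes \<open>X\<close>, so the inner sum in
  \<open>free_lmod\<close> over the fibre above \<open>y\<close> has at most one term, located at
  the translate of \<open>y\<close> by the inverse of \<open>g\<close>.\<close>

lemma F_smult:
  assumes f: "f \<in> carrier F"
  shows "(a \<odot>\<^bsub>F\<^esub> f) = (\<lambda>y. if y \<in> X then \<Sum>g\<in>K. a g * snd g (f (p (ginv g) y)) else 0)"
proof
  fix y
  have "(\<Sum>x | f x \<noteq> 0 \<and> p g x = y. snd g (f x)) = (if y \<in> X then snd g (f (p (ginv g) y)) else 0)" if g: "g \<in> K" for g
  proof (cases "y \<in> X \<and> f (p (ginv g) y) \<noteq> 0")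
    case True
    have "{x. f x \<noteq> 0 \<and> p g x = y} = {p (ginv g) y}"
    proof (rule equalityI; rule subsetI)
      fix x assume "x \<in> {x. f x \<noteq> 0 \<and> p g x = y}"
      then show "x \<in> {p (ginv g) y}" using p_inv(1)[OF g F_supp[OF f, of x]] by auto
    next
      fix x assume "x \<in> {p (ginv g) y}"
      then show "x \<in> {x. f x \<noteq> 0 \<and> p g x = y}" using True p_inv(2)[OF g, of y] by simp
    qed
    then show ?thesis using True by simp
  next
    case False
    have e: "{x. f x \<noteq> 0 \<and> p g x = y} = {}"
    proof (rule ccontr)
      assume "{x. f x \<noteq> 0 \<and> p g x = y} \<noteq> {}"
      then obtain x where x: "f x \<noteq> 0" "p g x = y" by blast
      then show False using False p_inv(1)[OF g F_supp[OF f x(1)]] p_closed[OF g F_supp[OF f x(1)]] by simp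
    qed
    have "(if y \<in> X then snd g (f (p (ginv g) y)) else 0) = 0" using False field_aut_0[OF aut_K[OF g]] by auto
    then show ?thesis by (simp only: e sum.empty)
  qed
  then show "(a \<odot>\<^bsub>F\<^esub> f) y = (if y \<in> X then \<Sum>g\<in>K. a g * snd g (f (p (ginv g) y)) else 0)"
    by (simp add: free_lmod_def)
qed

lemma ginv_mult: "g \<in> K \<Longrightarrow> h \<in> K \<Longrightarrow> ginv (semilin_mult g h) = semilin_mult (ginv h) (ginv g)"
proof -
  assume gh: "g \<in> K" "h \<in> K"
  have "semilin_mult (semilin_mult g h) (semilin_mult (ginv h) (ginv g)) = semilin_one"
    using gh by (simp add: assoc_K ginv_cancel)
  then show ?thesis
    using ginv_cancel(1)[OF mult_K[OF gh], of "semilin_mult (ginv h) (ginv g)"] ginv_K[OF mult_K[OF gh]]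
    by simp
qed

lemma ginv_one: "ginv semilin_one = semilin_one"
  using ginv_left[OF one_K] one_right_K[OF ginv_K[OF one_K]] by simp

lemma F_smult_closed:
  assumes a: "a \<in> carrier R" and f: "f \<in> carrier F"
  shows "a \<odot>\<^bsub>F\<^esub> f \<in> carrier F"
proof -
  have "{y. (a \<odot>\<^bsub>F\<^esub> f) y \<noteq> 0} \<subseteq> (\<Union>g\<in>K. p g ` {x. f x \<noteq> 0})"
  proof
    fix y assume "y \<in> {y. (a \<odot>\<^bsub>F\<^esub> f) y \<noteq> 0}"
    then have y: "y \<in> X" "(\<Sum>g\<in>K. a g * snd g (f (p (ginv g) y))) \<noteq> 0"
      by (auto simp: F_smult[OF f] split: if_splits)
    then obtain g where g: "g \<in> K" "a g * snd g (f (p (ginv g) y)) \<noteq> 0" by (meson sum.not_neutral_contains_not_neutral)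
    then have "f (p (ginv g) y) \<noteq> 0" using field_aut_0[OF aut_K[OF g(1)]] by auto
    moreover have "y = p g (p (ginv g) y)" using p_inv g y by simp
    ultimately show "y \<in> (\<Union>g\<in>K. p g ` {x. f x \<noteq> 0})" using g(1) by blast
  qed
  moreover have "finite (\<Union>g\<in>K. p g ` {x. f x \<noteq> 0})" using f finite_K by (auto simp: free_lmod_simps)
  ultimately have "finite {y. (a \<odot>\<^bsub>F\<^esub> f) y \<noteq> 0}" by (rule finite_subset)
  moreover have "{y. (a \<odot>\<^bsub>F\<^esub> f) y \<noteq> 0} \<subseteq> X" by (auto simp: F_smult[OF f] split: if_splits)
  ultimately show ?thesis by (simp add: free_lmod_simps)
qed

lemma F_add_closed: "f \<in> carrier F \<Longrightarrow> g \<in> carrier F \<Longrightarrow> f \<oplus>\<^bsub>F\<^esub> g \<in> carrier F"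
proof -
  assume "f \<in> carrier F" "g \<in> carrier F"
  then have "finite ({x. f x \<noteq> 0} \<union> {x. g x \<noteq> 0})" "{x. f x \<noteq> 0} \<union> {x. g x \<noteq> 0} \<subseteq> X"
    by (simp_all add: free_lmod_simps)
  moreover have "{x. f x + g x \<noteq> 0} \<subseteq> {x. f x \<noteq> 0} \<union> {x. g x \<noteq> 0}" by auto
  ultimately show "f \<oplus>\<^bsub>F\<^esub> g \<in> carrier F"
    by (simp add: free_lmod_simps) (meson finite_subset finite_UnI Un_least subset_trans)
qed

lemma skew_module_F: "skew_module K F"
proof -
  have "left_module R F"
  proof (rule left_moduleI)
    fix f assume f: "f \<in> carrier F"
    then show "\<exists>g\<in>carrier F. g \<oplus>\<^bsub>F\<^esub> f = \<zero>\<^bsub>F\<^esub>"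
      by (intro bexI[of _ "\<lambda>x. - f x"]) (auto simp: free_lmod_simps)
  next
    fix a b f assume a: "a \<in> carrier R" "b \<in> carrier R" and f: "f \<in> carrier F"
    show "(a \<oplus>\<^bsub>R\<^esub> b) \<odot>\<^bsub>F\<^esub> f = a \<odot>\<^bsub>F\<^esub> f \<oplus>\<^bsub>F\<^esub> b \<odot>\<^bsub>F\<^esub> f"
      by (simp add: F_smult[OF f] free_lmod_simps R_simps fun_eq_iff distrib_right sum.distrib)
  next
    fix a f g assume a: "a \<in> carrier R" and f: "f \<in> carrier F" and g: "g \<in> carrier F"
    show "a \<odot>\<^bsub>F\<^esub> (f \<oplus>\<^bsub>F\<^esub> g) = a \<odot>\<^bsub>F\<^esub> f \<oplus>\<^bsub>F\<^esub> a \<odot>\<^bsub>F\<^esub> g"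
      unfolding F_smult[OF f] F_smult[OF g] F_smult[OF F_add_closed[OF f g]]
      by (auto simp: free_lmod_simps fun_eq_iff field_aut_add[OF aut_K] distrib_left sum.distrib)
  next
    fix a b f assume a: "a \<in> carrier R" "b \<in> carrier R" and f: "f \<in> carrier F"
    show "(a \<otimes>\<^bsub>R\<^esub> b) \<odot>\<^bsub>F\<^esub> f = a \<odot>\<^bsub>F\<^esub> (b \<odot>\<^bsub>F\<^esub> f)"
    proof
      fix y
      have "(\<Sum>x\<in>K. (a \<otimes>\<^bsub>R\<^esub> b) x * snd x (f (p (ginv x) y))) =
        (\<Sum>h\<in>K. a h * snd h (\<Sum>h'\<in>K. b h' * snd h' (f (p (ginv h') (p (ginv h) y)))))" if y: "y \<in> X"
      proof -
        have "(\<Sum>x\<in>K. (a \<otimes>\<^bsub>R\<^esub> b) x * snd x (f (p (ginv x) y))) =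
          (\<Sum>h\<in>K. \<Sum>h'\<in>K. a h * snd h (b h') * snd (semilin_mult h h') (f (p (ginv (semilin_mult h h')) y)))"
          by (rule sum_R_mult[of "\<lambda>x z. z * snd x (f (p (ginv x) y))"]) (simp_all add: distrib_right)
        also have "\<dots> = (\<Sum>h\<in>K. \<Sum>h'\<in>K. a h * snd h (b h' * snd h' (f (p (ginv h') (p (ginv h) y)))))"
          by (intro sum.cong refl) (simp add: ginv_mult p_mult y field_aut_mult[OF aut_K] mult.assoc)
        finally show ?thesis by (simp add: field_aut_sum[OF aut_K] sum_distrib_left)
      qed
      moreover have "p (ginv h) y \<in> X" if "y \<in> X" "h \<in> K" for h using that by (simp add: p_closed)
      ultimately show "((a \<otimes>\<^bsub>R\<^esub> b) \<odot>\<^bsub>F\<^esub> f) y = (a \<odot>\<^bsub>F\<^esub> (b \<odot>\<^bsub>F\<^esub> f)) y"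
        by (simp add: fun_cong[OF F_smult[OF F_smult_closed[OF a(2) f]]] fun_cong[OF F_smult[OF f]] cong: sum.cong)
    qed
  next
    fix f assume f: "f \<in> carrier F"
    show "\<one>\<^bsub>R\<^esub> \<odot>\<^bsub>F\<^esub> f = f"
      unfolding F_smult[OF f] R_simps skew_elt_def
      using F_supp[OF f] by (auto simp: fun_eq_iff if_distrib[of "\<lambda>c. c * _"] sum.delta finite_K ginv_one p_one cong: if_cong)
  qed (use F_smult_closed ring_R F_add_closed in \<open>auto simp: free_lmod_simps add_ac\<close>)
  then show ?thesis by (simp add: skew_module_def skew_axioms)
qed

sublocale F: skew_module K F by (rule skew_module_F)

lemma scal_F: "f \<in> carrier F \<Longrightarrow> scal F c f = (\<lambda>y. c * f y)"
  unfolding scal_def F_smult skew_elt_def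
  using F_supp[of f] by (auto simp: fun_eq_iff if_distrib[of "\<lambda>c. c * _"] sum.delta finite_K ginv_one p_one cong: if_cong)

lemma act_F: "g \<in> K \<Longrightarrow> f \<in> carrier F \<Longrightarrow> act F g f = (\<lambda>y. if y \<in> X then snd g (f (p (ginv g) y)) else 0)"
  unfolding act_def F_smult skew_elt_def
  by (auto simp: fun_eq_iff if_distrib[of "\<lambda>c. c * _"] sum.delta finite_K cong: if_cong)

lemma act_delta:
  assumes g: "g \<in> K" and x: "x \<in> X"
  shows "act F g (delta x) = delta (p g x)"
proof
  fix y
  have "p (ginv g) y = x \<longleftrightarrow> y = p g x" if "y \<in> X" using p_inv[OF g] that x by metis
  then show "act F g (delta x) y = delta (p g x) y"
    unfolding act_F[OF g delta_in_free[OF x]]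
    using p_closed[OF g x] by (auto simp: delta_def field_aut_0[OF aut_K[OF g]] field_aut_1[OF aut_K[OF g]])
qed

lemma l_submodule_F: "F.l_submodule T \<longleftrightarrow> T \<subseteq> carrier F \<and> fsubspace T"
proof -
  have "F.l_submodule T \<longleftrightarrow> T \<subseteq> carrier F \<and> (\<lambda>_. 0) \<in> T \<and> (\<forall>f\<in>T. \<forall>g\<in>T. (\<lambda>y. f y + g y) \<in> T) \<and> (\<forall>c. \<forall>f\<in>T. scal F c f \<in> T)"
    unfolding F.l_submodule_iff by (simp add: free_lmod_simps)
  also have "\<dots> \<longleftrightarrow> T \<subseteq> carrier F \<and> fsubspace T"
  proof (rule conj_cong[OF refl])
    assume TF: "T \<subseteq> carrier F"
    have "scal F c f = (\<lambda>y. c * f y)" if "f \<in> T" for c f using scal_F TF that by blast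
    then show "((\<lambda>_. 0) \<in> T \<and> (\<forall>f\<in>T. \<forall>g\<in>T. (\<lambda>y. f y + g y) \<in> T) \<and> (\<forall>c. \<forall>f\<in>T. scal F c f \<in> T)) = fsubspace T"
      unfolding fsubspace_def by simp
  qed
  finally show ?thesis .
qed

lemma fsubspace_F: "fsubspace (carrier F)"
  using l_submodule_F[of "carrier F"] F.l_submodule_iff[of "carrier F"] by auto

lemma F_diff: "f \<in> carrier F \<Longrightarrow> g \<in> carrier F \<Longrightarrow> (\<lambda>y. f y - g y) \<in> carrier F"
  by (rule fsubspace_diff[OF fsubspace_F])

lemma l_span_F:
  assumes "B \<subseteq> carrier F"
  shows l_span_fsubspace: "fsubspace (l_span F B)" and l_span_superset: "B \<subseteq> l_span F B"
    and l_span_carrier: "l_span F B \<subseteq> carrier F"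
    and l_span_minimal: "\<And>T. fsubspace T \<Longrightarrow> T \<subseteq> carrier F \<Longrightarrow> B \<subseteq> T \<Longrightarrow> l_span F B \<subseteq> T"
proof -
  have s: "l_span F B = \<Inter>{T. T \<subseteq> carrier F \<and> fsubspace T \<and> B \<subseteq> T}"
    unfolding l_span_def l_submodule_F by (simp add: conj_assoc)
  show "fsubspace (l_span F B)" unfolding s by (auto simp: fsubspace_def)
  show "B \<subseteq> l_span F B" unfolding s by blast
  show "l_span F B \<subseteq> carrier F" unfolding s using assms fsubspace_F by blast
  show "\<And>T. fsubspace T \<Longrightarrow> T \<subseteq> carrier F \<Longrightarrow> B \<subseteq> T \<Longrightarrow> l_span F B \<subseteq> T" unfolding s by blast
qed

text \<open>The linear extension of \<open>\<phi>\<close> provided by the universal property of the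
  free module.\<close>

definition lin :: "(('l, 'd) semilin \<Rightarrow> 'l, 'b) module \<Rightarrow> ('x \<Rightarrow> 'b) \<Rightarrow> ('x \<Rightarrow> 'l) \<Rightarrow> 'b"
  where "lin P \<phi> f = finsum P (\<lambda>x. scal P (f x) (\<phi> x)) {x. f x \<noteq> 0}"

context
  fixes P :: "(('l, 'd) semilin \<Rightarrow> 'l, 'b) module" and \<phi> :: "'x \<Rightarrow> 'b"
  assumes P: "skew_module K P" and \<phi>: "\<And>x. x \<in> X \<Longrightarrow> \<phi> x \<in> carrier P"
begin

interpretation P: skew_module K P by (rule P)

lemma lin_eq:
  assumes "f \<in> carrier F" "finite A" "A \<subseteq> X" "{x. f x \<noteq> 0} \<subseteq> A"
  shows "lin P \<phi> f = finsum P (\<lambda>x. scal P (f x) (\<phi> x)) A"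
  unfolding lin_def
proof (rule P.M.add.finprod_mono_neutral_cong_left)
  fix x assume "x \<in> A - {x. f x \<noteq> 0}"
  then show "scal P (f x) (\<phi> x) = \<zero>\<^bsub>P\<^esub>" using \<phi> assms(3) by auto
qed (use assms \<phi> in auto)

lemma lin_closed: "f \<in> carrier F \<Longrightarrow> lin P \<phi> f \<in> carrier P"
  unfolding lin_def by (rule P.M.finsum_closed) (use \<phi> F_supp in auto)

lemma lin_delta: "x \<in> X \<Longrightarrow> lin P \<phi> (delta x) = \<phi> x"
  by (subst lin_eq[of _ "{x}"]) (auto simp: delta_in_free \<phi>, auto simp: delta_def \<phi> split: if_splits)

lemma lin_add:
  assumes "f \<in> carrier F" "g \<in> carrier F"
  shows "lin P \<phi> (\<lambda>y. f y + g y) = lin P \<phi> f \<oplus>\<^bsub>P\<^esub> lin P \<phi> g"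
proof -
  let ?A = "{x. f x \<noteq> 0} \<union> {x. g x \<noteq> 0}"
  have A: "finite ?A" "?A \<subseteq> X" using assms by (auto simp: free_lmod_simps)
  have \<phi>A: "\<phi> x \<in> carrier P" if "x \<in> ?A" for x using that A \<phi> by blast
  have fg: "(\<lambda>y. f y + g y) \<in> carrier F" using F_add_closed[OF assms] by (simp add: free_lmod_simps(3))
  have "lin P \<phi> (\<lambda>y. f y + g y) = finsum P (\<lambda>x. scal P (f x + g x) (\<phi> x)) ?A"
    by (rule lin_eq[OF fg A]) auto
  also have "\<dots> = finsum P (\<lambda>x. scal P (f x) (\<phi> x) \<oplus>\<^bsub>P\<^esub> scal P (g x) (\<phi> x)) ?A"
    by (rule P.M.finsum_cong'[OF refl]) (use \<phi>A in \<open>auto simp: P.scal_add_l\<close>)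
  also have "\<dots> = finsum P (\<lambda>x. scal P (f x) (\<phi> x)) ?A \<oplus>\<^bsub>P\<^esub> finsum P (\<lambda>x. scal P (g x) (\<phi> x)) ?A"
    by (rule P.M.finsum_addf) (use \<phi>A in auto)
  also have "finsum P (\<lambda>x. scal P (f x) (\<phi> x)) ?A = lin P \<phi> f"
    by (rule lin_eq[OF assms(1) A, symmetric]) auto
  also have "finsum P (\<lambda>x. scal P (g x) (\<phi> x)) ?A = lin P \<phi> g"
    by (rule lin_eq[OF assms(2) A, symmetric]) auto
  finally show ?thesis .
qed

lemma lin_scale:
  assumes f: "f \<in> carrier F"
  shows "lin P \<phi> (\<lambda>y. c * f y) = scal P c (lin P \<phi> f)"
proof -
  let ?A = "{x. f x \<noteq> 0}"
  have A: "finite ?A" "?A \<subseteq> X" using assms by (auto simp: free_lmod_simps)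
  have cf: "(\<lambda>y. c * f y) \<in> carrier F" using fsubspace_scale[OF fsubspace_F f] .
  have \<phi>A: "\<phi> x \<in> carrier P" if "f x \<noteq> 0" for x using that A \<phi> by blast
  have "lin P \<phi> (\<lambda>y. c * f y) = finsum P (\<lambda>x. scal P (c * f x) (\<phi> x)) ?A"
    by (rule lin_eq[OF cf A]) auto
  also have "\<dots> = finsum P (\<lambda>x. scal P c (scal P (f x) (\<phi> x))) ?A"
    by (rule P.M.finsum_cong'[OF refl]) (use \<phi>A in \<open>auto simp: P.scal_scal\<close>)
  also have "\<dots> = scal P c (lin P \<phi> f)"
    unfolding lin_def by (rule P.scal_finsum[symmetric]) (use \<phi>A A in auto)
  finally show ?thesis .
qed

lemma lin_kernel_fsubspace: "fsubspace {f \<in> carrier F. lin P \<phi> f = \<zero>\<^bsub>P\<^esub>}"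
proof -
  have "lin P \<phi> (\<lambda>_. 0) = \<zero>\<^bsub>P\<^esub>" by (simp add: lin_def)
  then show ?thesis
    using fsubspace_F unfolding fsubspace_def
    by (auto simp: lin_add lin_scale)
qed

lemma lin_diff:
  assumes "f \<in> carrier F" "g \<in> carrier F"
  shows "lin P \<phi> (\<lambda>y. f y - g y) = lin P \<phi> f \<ominus>\<^bsub>P\<^esub> lin P \<phi> g"
proof -
  have "lin P \<phi> (\<lambda>y. f y + - 1 * g y) = lin P \<phi> f \<oplus>\<^bsub>P\<^esub> scal P (- 1) (lin P \<phi> g)"
    using assms fsubspace_scale[OF fsubspace_F assms(2)] by (simp only: lin_add lin_scale)
  then show ?thesis using lin_closed[OF assms(2)] by (simp add: P.scal_minus_1 a_minus_def)
qed

text \<open>The support of a translate is contained in the translate of the support, over which the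
  sum is reindexed; semilinearity of the action on \<open>P\<close> accounts for the twisted
  coefficients.\<close>

lemma lin_lhom:
  assumes eqv: "\<And>g x. g \<in> K \<Longrightarrow> x \<in> X \<Longrightarrow> \<phi> (p g x) = act P g (\<phi> x)"
  shows "lin P \<phi> \<in> lhom R F P"
proof (rule skew_lhomI[OF skew_module_F P])
  fix f g assume f: "f \<in> carrier F" "g \<in> carrier F"
  then show "lin P \<phi> (f \<oplus>\<^bsub>F\<^esub> g) = lin P \<phi> f \<oplus>\<^bsub>P\<^esub> lin P \<phi> g" by (simp add: free_lmod_simps(3) lin_add)
next
  fix c f assume f: "f \<in> carrier F"
  then show "lin P \<phi> (scal F c f) = scal P c (lin P \<phi> f)" by (simp add: scal_F lin_scale)
next
  fix g f assume g: "g \<in> K" and f: "f \<in> carrier F"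
  let ?A = "{x. f x \<noteq> 0}"
  have A: "finite ?A" "?A \<subseteq> X" using f by (auto simp: free_lmod_simps)
  have \<phi>A: "\<phi> x \<in> carrier P" if "f x \<noteq> 0" for x using that A \<phi> by blast
  have inj: "inj_on (p g) ?A" by (rule inj_onI) (use A p_inv(1)[OF g] in \<open>metis subsetD\<close>)
  have s: "{y. act F g f y \<noteq> 0} \<subseteq> p g ` ?A"
  proof
    fix y assume "y \<in> {y. act F g f y \<noteq> 0}"
    then have y: "y \<in> X" "snd g (f (p (ginv g) y)) \<noteq> 0" by (auto simp: act_F[OF g f] split: if_splits)
    then have "f (p (ginv g) y) \<noteq> 0" using field_aut_0[OF aut_K[OF g]] by auto
    then show "y \<in> p g ` ?A" using p_inv(2)[OF g y(1)] by (metis (mono_tags) imageI mem_Collect_eq)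
  qed
  have v: "act F g f (p g x) = snd g (f x)" if "x \<in> ?A" for x
  proof -
    have "x \<in> X" using that A by blast
    then show ?thesis by (simp add: act_F[OF g f] p_inv(1)[OF g] p_closed[OF g])
  qed
  have "lin P \<phi> (act F g f) = finsum P (\<lambda>x. scal P (act F g f x) (\<phi> x)) (p g ` ?A)"
    by (rule lin_eq) (use F.act_closed[OF g f] A p_closed[OF g] s in auto)
  also have "\<dots> = finsum P (\<lambda>x. scal P (act F g f (p g x)) (\<phi> (p g x))) ?A"
    by (rule P.M.finsum_reindex[OF _ inj]) (use A \<phi> p_closed[OF g] in auto)
  also have "\<dots> = finsum P (\<lambda>x. act P g (scal P (f x) (\<phi> x))) ?A"
    by (rule P.M.finsum_cong'[OF refl]) (use \<phi>A g A v eqv in \<open>auto simp: P.act_scal subset_iff\<close>)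
  also have "\<dots> = act P g (lin P \<phi> f)"
    unfolding lin_def by (rule P.act_finsum[symmetric]) (use \<phi>A g A in auto)
  finally show "lin P \<phi> (act F g f) = act P g (lin P \<phi> f)" .
qed (rule lin_closed)

end

end

text \<open>Extracts the basis \<open>e\<close> and the coordinate map \<open>\<psi>\<close> from an
  abstract isomorphism. The expansion of \<open>u\<close> holds because both sides have the same
  coordinates and \<open>\<psi>\<close> is injective.\<close>

lemma (in skew_module) tmod_unit_vectors:
  assumes I: "finite I" and \<rho>: "cocycle K I \<rho>" and iso: "lmod_iso R M (tmod I \<rho> lfield)"
  shows "\<exists>\<psi> e. \<psi> \<in> lhom R M (tmod I \<rho> lfield) \<and> bij_betw \<psi> (carrier M) (carrier (tmod I \<rho> lfield)) \<and>
    (\<forall>j. e j \<in> carrier M) \<and> (\<forall>j. \<psi> (e j) = (\<lambda>i\<in>I. if i = j then 1 else 0)) \<and>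
    (\<forall>u\<in>carrier M. finsum M (\<lambda>i. scal M (\<psi> u i) (e i)) I = u)"
proof -
  let ?L = "tmod I \<rho> lfield"
  interpret l: skew_module K lfield by (rule skew_module_lfield)
  interpret L: skew_module K ?L by (rule l.skew_module_tmod[OF I \<rho>])
  obtain \<psi> where \<psi>: "\<psi> \<in> lhom R M ?L" and b\<psi>: "bij_betw \<psi> (carrier M) (carrier ?L)"
    using iso by (auto simp: lmod_iso_lhom)
  note \<psi>D = lhomD[OF \<psi>] lhom_scal[OF skew_axioms \<psi>]
  have unit: "(\<lambda>i\<in>I. if i = j then 1 else 0) \<in> carrier ?L" for j by (auto simp: tmod_simps lfield_simps)
  \<comment> \<open>For \<open>j\<close> outside \<open>I\<close> the prescribed coordinates are all
    zero, so \<open>e j\<close> lies in \<open>M\<close> for every \<open>j\<close> and no side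
    condition is carried along.\<close>
  define e where "e j = inv_into (carrier M) \<psi> (\<lambda>i\<in>I. if i = j then 1 else 0)" for j
  have e: "e j \<in> carrier M" "\<psi> (e j) = (\<lambda>i\<in>I. if i = j then 1 else 0)" for j
    using b\<psi> unit[of j] unfolding e_def
    by (metis bij_betw_def inv_into_into, metis bij_betw_def f_inv_into_f)
  have "finsum M (\<lambda>i. scal M (\<psi> u i) (e i)) I = u" if u: "u \<in> carrier M" for u
  proof -
    have cl: "finsum M (\<lambda>i. scal M (\<psi> u i) (e i)) I \<in> carrier M" using e by (intro M.finsum_closed) auto
    have fin: "finsum ?L f A = (\<lambda>i\<in>I. \<Sum>j\<in>A. f j i)" if "finite A" "f \<in> A \<rightarrow> carrier ?L" for f and A :: "'a set"
      using that
    proof (induction A)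
      case (insert a A)
      have "finsum ?L f (insert a A) = f a \<oplus>\<^bsub>?L\<^esub> finsum ?L f A"
        using insert by (intro L.M.finsum_insert) auto
      also have "\<dots> = (\<lambda>i\<in>I. f a i + (\<Sum>j\<in>A. f j i))"
        using insert unfolding tmod_simps(3) lfield_simps by (intro restrict_ext) (simp add: Pi_def)
      finally show ?case using insert by simp
    qed (simp add: tmod_simps lfield_simps)
    have "\<psi> (finsum M (\<lambda>i. scal M (\<psi> u i) (e i)) I) = finsum ?L (\<lambda>i. \<psi> (scal M (\<psi> u i) (e i))) I"
      by (rule lhom_finsum[OF left_module_axioms L.left_module_axioms \<psi> I]) (use e in auto)
    also have "\<dots> = (\<lambda>i\<in>I. \<Sum>j\<in>I. \<psi> (scal M (\<psi> u j) (e j)) i)"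
      using e \<psi>D(1) I by (intro fin) auto
    also have "\<dots> = (\<lambda>i\<in>I. \<psi> u i)"
    proof (rule restrict_ext)
      fix i assume i: "i \<in> I"
      have "(\<Sum>j\<in>I. \<psi> (scal M (\<psi> u j) (e j)) i) = (\<Sum>j\<in>I. if i = j then \<psi> u j else 0)"
        using i by (intro sum.cong refl) (simp add: \<psi>D(4)[OF e(1)] e(2) l.scal_tmod[OF I \<rho> unit] scal_lfield)
      then show "(\<Sum>j\<in>I. \<psi> (scal M (\<psi> u j) (e j)) i) = \<psi> u i" using i I by simp
    qed
    also have "\<dots> = \<psi> u" using \<psi>D(1)[OF u] by (simp add: tmod_simps)
    finally show ?thesis using b\<psi> cl u by (meson bij_betw_def inj_onD)
  qed
  then show ?thesis
    by (intro exI[of _ \<psi>] exI[of _ e] conjI allI ballI \<psi> b\<psi> e)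
qed

locale tensor_modules = M: skew_module K M + N: skew_module K N
  for K :: "('l::field, 'd::finite) semilin set" and M :: "(('l, 'd) semilin \<Rightarrow> 'l, 'b) module"
    and N :: "(('l, 'd) semilin \<Rightarrow> 'l, 'c) module"
begin

abbreviation tact :: "('l, 'd) semilin \<Rightarrow> 'b \<times> 'c \<Rightarrow> 'b \<times> 'c"
  where "tact g uv \<equiv> (case uv of (u, v) \<Rightarrow> (skew_elt 1 g \<odot>\<^bsub>M\<^esub> u, skew_elt 1 g \<odot>\<^bsub>N\<^esub> v))"

lemma tact: "tact g (u, v) = (act M g u, act N g v)"
  by (simp add: act_def)

sublocale free_module K tact "carrier M \<times> carrier N"
  by unfold_locales (auto simp: act_def[symmetric] M.act_act N.act_act)

abbreviation "S \<equiv> l_span F (tensor_relations M N)"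

lemma tensor_eq: "tensor K M N = quotient_lmod F S"
  by (simp add: tensor_def Let_def)

lemma relations_F: "tensor_relations M N \<subseteq> carrier F"
proof -
  have d: "delta (u, v) \<in> carrier F" if "u \<in> carrier M" "v \<in> carrier N" for u v
    using that by (auto intro: delta_in_free)
  note * = F_diff fsubspace_scale[OF fsubspace_F] d
  show ?thesis
    unfolding tensor_relations_def scal_def[symmetric]
    by (intro Un_least subsetI; elim CollectE exE conjE; hypsubst; intro *; simp)
qed

lemmas S = l_span_F[OF relations_F]

lemma S_add1: "u \<in> carrier M \<Longrightarrow> u' \<in> carrier M \<Longrightarrow> v \<in> carrier N \<Longrightarrow>
    mod_eq S (delta (u \<oplus>\<^bsub>M\<^esub> u', v)) (\<lambda>y. delta (u, v) y + delta (u', v) y)"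
  and S_add2: "u \<in> carrier M \<Longrightarrow> v \<in> carrier N \<Longrightarrow> v' \<in> carrier N \<Longrightarrow>
    mod_eq S (delta (u, v \<oplus>\<^bsub>N\<^esub> v')) (\<lambda>y. delta (u, v) y + delta (u, v') y)"
  and S_scal1: "u \<in> carrier M \<Longrightarrow> v \<in> carrier N \<Longrightarrow> mod_eq S (delta (scal M c u, v)) (\<lambda>y. c * delta (u, v) y)"
  and S_scal2: "u \<in> carrier M \<Longrightarrow> v \<in> carrier N \<Longrightarrow> mod_eq S (delta (u, scal N c v)) (\<lambda>y. c * delta (u, v) y)"
proof -
  note * = subsetD[OF S(2)]
  show "u \<in> carrier M \<Longrightarrow> u' \<in> carrier M \<Longrightarrow> v \<in> carrier N \<Longrightarrow>
    mod_eq S (delta (u \<oplus>\<^bsub>M\<^esub> u', v)) (\<lambda>y. delta (u, v) y + delta (u', v) y)"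
    unfolding mod_eq_def diff_diff_add[symmetric] by (rule *) (unfold tensor_relations_def, blast)
  show "u \<in> carrier M \<Longrightarrow> v \<in> carrier N \<Longrightarrow> v' \<in> carrier N \<Longrightarrow>
    mod_eq S (delta (u, v \<oplus>\<^bsub>N\<^esub> v')) (\<lambda>y. delta (u, v) y + delta (u, v') y)"
    unfolding mod_eq_def diff_diff_add[symmetric] by (rule *) (unfold tensor_relations_def, blast)
  show "u \<in> carrier M \<Longrightarrow> v \<in> carrier N \<Longrightarrow> mod_eq S (delta (scal M c u, v)) (\<lambda>y. c * delta (u, v) y)"
    unfolding mod_eq_def scal_def by (rule *) (unfold tensor_relations_def, blast)
  show "u \<in> carrier M \<Longrightarrow> v \<in> carrier N \<Longrightarrow> mod_eq S (delta (u, scal N c v)) (\<lambda>y. c * delta (u, v) y)"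
    unfolding mod_eq_def scal_def by (rule *) (unfold tensor_relations_def, blast)
qed

lemma delta_finsum:
  assumes "finite A" "\<And>i. i \<in> A \<Longrightarrow> u i \<in> carrier M" "v \<in> carrier N"
  shows "mod_eq S (delta (finsum M u A, v)) (\<lambda>y. \<Sum>i\<in>A. delta (u i, v) y)"
  using assms(1,2)
proof (induction A)
  case empty
  then show ?case using S_scal1[of "\<zero>\<^bsub>M\<^esub>" v 0] assms(3) by simp
next
  case (insert a A)
  have c: "finsum M u A \<in> carrier M" using insert by (intro M.M.finsum_closed) auto
  have "mod_eq S (delta (u a \<oplus>\<^bsub>M\<^esub> finsum M u A, v)) (\<lambda>y. delta (u a, v) y + delta (finsum M u A, v) y)"
    using S_add1 insert c assms(3) by auto
  moreover have "mod_eq S (\<lambda>y. delta (u a, v) y + delta (finsum M u A, v) y)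
    (\<lambda>y. delta (u a, v) y + (\<Sum>i\<in>A. delta (u i, v) y))"
    using insert by (intro mod_eq_add[OF S(1)] mod_eq_refl[OF S(1)]) auto
  ultimately have "mod_eq S (delta (u a \<oplus>\<^bsub>M\<^esub> finsum M u A, v)) (\<lambda>y. delta (u a, v) y + (\<Sum>i\<in>A. delta (u i, v) y))"
    by (rule mod_eq_trans[OF S(1)])
  then show ?case using insert by (simp add: Pi_def)
qed

text \<open>The bilinear map sends \<open>(u, v)\<close> to the family of multiples of
  \<open>v\<close> by the coordinates of \<open>u\<close>. Its linear extension kills the tensor
  relations; conversely every formal sum is congruent to the normal form determined by its image, so
  the kernel is exactly the span of the relations.\<close>

theorem tensor_tmod:
  assumes I: "finite I" and \<rho>: "cocycle K I \<rho>" and iso: "lmod_iso M.R M (tmod I \<rho> lfield)"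
  shows "left_module M.R (tensor K M N)" "lmod_iso M.R (tensor K M N) (tmod I \<rho> N)"
proof -
  let ?L = "tmod I \<rho> lfield" and ?P = "tmod I \<rho> N"
  have P: "skew_module K ?P" by (rule N.skew_module_tmod[OF I \<rho>])
  interpret P: skew_module K "?P" by (rule P)
  interpret l: skew_module K "lfield" by (rule M.skew_module_lfield)
  from M.tmod_unit_vectors[OF I \<rho> iso] obtain \<psi> and e :: "'a \<Rightarrow> 'b" where *:
    "\<psi> \<in> lhom M.R M ?L \<and> bij_betw \<psi> (carrier M) (carrier ?L) \<and>
    (\<forall>j. e j \<in> carrier M) \<and> (\<forall>j. \<psi> (e j) = (\<lambda>i\<in>I. if i = j then 1 else 0)) \<and>
    (\<forall>u\<in>carrier M. finsum M (\<lambda>i. scal M (\<psi> u i) (e i)) I = u)" by iprover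
  have \<psi>: "\<psi> \<in> lhom M.R M ?L" and b\<psi>: "bij_betw \<psi> (carrier M) (carrier ?L)" using * by simp_all
  have e: "e j \<in> carrier M" "\<psi> (e j) = (\<lambda>i\<in>I. if i = j then 1 else 0)" for j using * by simp_all
  note \<psi>D = lhomD[OF \<psi>] lhom_scal[OF M.skew_axioms \<psi>] lhom_act[OF M.skew_axioms \<psi>]
  define \<phi> where "\<phi> x = (\<lambda>i\<in>I. scal N (\<psi> (fst x) i) (snd x))" for x
  have \<phi>_closed: "\<phi> x \<in> carrier ?P" if "x \<in> carrier M \<times> carrier N" for x
    using that by (auto simp: \<phi>_def tmod_simps)
  have \<phi>_uv: "\<phi> (u, v) = (\<lambda>i\<in>I. scal N (\<psi> u i) v)" for u v by (simp add: \<phi>_def)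
  have eqv: "\<phi> (tact g x) = act ?P g (\<phi> x)" if g: "g \<in> K" and x: "x \<in> carrier M \<times> carrier N" for g x
  proof -
    obtain u v where uv: "x = (u, v)" "u \<in> carrier M" "v \<in> carrier N" using x by auto
    have "act ?P g (\<phi> x) = (\<lambda>i\<in>I. finsum N (\<lambda>j. scal N (\<rho> g i j) (act N g (\<phi> x j))) I)"
      by (rule N.act_tmod[OF g \<phi>_closed[OF x]])
    also have "\<dots> = (\<lambda>i\<in>I. scal N (\<psi> (act M g u) i) (act N g v))"
    proof (rule restrict_ext)
      fix i assume i: "i \<in> I"
      have "\<psi> (act M g u) i = (\<Sum>j\<in>I. \<rho> g i j * snd g (\<psi> u j))"
        using \<psi>D(5)[OF uv(2) g] l.act_tmod[OF g \<psi>D(1)[OF uv(2)]] i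
        by (simp add: finsum_lfield scal_lfield act_lfield)
      then have "scal N (\<psi> (act M g u) i) (act N g v) = finsum N (\<lambda>j. scal N (\<rho> g i j * snd g (\<psi> u j)) (act N g v)) I"
        using g uv I by (simp add: N.finsum_scal)
      also have "\<dots> = finsum N (\<lambda>j. scal N (\<rho> g i j) (act N g (\<phi> x j))) I"
        by (rule N.M.finsum_cong'[OF refl])
           (use g uv in \<open>auto simp: \<phi>_def N.act_scal N.scal_scal\<close>)
      finally show "finsum N (\<lambda>j. scal N (\<rho> g i j) (act N g (\<phi> x j))) I = scal N (\<psi> (act M g u) i) (act N g v)" ..
    qed
    finally show ?thesis by (simp add: uv tact \<phi>_uv act_def[symmetric])
  qed
  let ?\<Phi> = "lin ?P \<phi>"
  have \<Phi>: "?\<Phi> \<in> lhom M.R F ?P" by (rule lin_lhom[OF P \<phi>_closed eqv])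
  have lin: "f \<in> carrier F \<Longrightarrow> g \<in> carrier F \<Longrightarrow> ?\<Phi> (\<lambda>y. f y + g y) = ?\<Phi> f \<oplus>\<^bsub>?P\<^esub> ?\<Phi> g"
    "f \<in> carrier F \<Longrightarrow> ?\<Phi> (\<lambda>y. c * f y) = scal ?P c (?\<Phi> f)"
    "f \<in> carrier F \<Longrightarrow> g \<in> carrier F \<Longrightarrow> ?\<Phi> (\<lambda>y. f y - g y) = ?\<Phi> f \<ominus>\<^bsub>?P\<^esub> ?\<Phi> g"
    "x \<in> carrier M \<times> carrier N \<Longrightarrow> ?\<Phi> (delta x) = \<phi> x"
    and linF: "f \<in> carrier F \<Longrightarrow> ?\<Phi> f \<in> carrier ?P"
    and ker: "fsubspace {f \<in> carrier F. ?\<Phi> f = \<zero>\<^bsub>?P\<^esub>}" for f g c x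
    using lin_add[of ?P \<phi> f g] lin_scale[of ?P \<phi> f c] lin_diff[of ?P \<phi> f g] lin_delta[of ?P \<phi> x]
      lin_closed[of ?P \<phi> f] lin_kernel_fsubspace[of ?P \<phi>] P \<phi>_closed by blast+
  \<comment> \<open>The normal form: the sum of the tensors of \<open>e i\<close> with
    \<open>w i\<close>. It is a section of the linear extension of \<open>\<phi>\<close>.\<close>
  define D where "D w = (\<lambda>y. \<Sum>i\<in>I. delta (e i, w i) y :: 'l)" for w :: "'a \<Rightarrow> 'c"
  have D_F: "D w \<in> carrier F" if "w \<in> carrier ?P" for w
    unfolding D_def using that e(1) by (intro fsubspace_sum[OF fsubspace_F] delta_in_free) (auto simp: tmod_simps)
  have wN: "w i \<in> carrier N" if "w \<in> carrier ?P" "i \<in> I" for w i using that by (auto simp: tmod_simps)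
  \<comment> \<open>The elements congruent to their normal form are a subspace containing all pairs,
    so they exhaust the free module. For elements of the kernel the normal form is that of
    zero.\<close>
  have reduce: "mod_eq S f (D (?\<Phi> f))" if f: "f \<in> carrier F" for f
  proof -
    let ?T = "{f \<in> carrier F. mod_eq S f (D (?\<Phi> f))}"
    have "fsubspace ?T"
      unfolding fsubspace_def
    proof (intro conjI ballI allI)
      have "?\<Phi> (\<lambda>_. 0) = \<zero>\<^bsub>?P\<^esub>" by (simp add: lin_def)
      \<comment> \<open>A tensor with zero second entry is formally not zero, but the scalar
        relation for \<open>c = 0\<close> puts it into \<open>S\<close>.\<close>
      moreover have "D \<zero>\<^bsub>?P\<^esub> \<in> S"
        unfolding D_def
      proof (rule fsubspace_sum[OF S(1)])
        fix i assume i: "i \<in> I"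
        show "delta (e i, \<zero>\<^bsub>?P\<^esub> i) \<in> S"
          using S_scal2[OF e(1)[of i] N.M.zero_closed, of 0] i by (simp add: tmod_simps mod_eq_def)
      qed
      ultimately have "mod_eq S (\<lambda>_. 0) (D (?\<Phi> (\<lambda>_. 0)))"
        using fsubspace_scale[OF S(1), of _ "- 1"] by (simp add: mod_eq_def)
      then show "(\<lambda>_. 0) \<in> ?T" using fsubspace_0[OF fsubspace_F] by simp
    next
      fix f g assume "f \<in> ?T" "g \<in> ?T"
      then have fg: "f \<in> carrier F" "g \<in> carrier F" "mod_eq S f (D (?\<Phi> f))" "mod_eq S g (D (?\<Phi> g))" by auto
      have "mod_eq S (\<lambda>y. D (?\<Phi> f) y + D (?\<Phi> g) y) (D (?\<Phi> f \<oplus>\<^bsub>?P\<^esub> ?\<Phi> g))"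
        unfolding D_def sum.distrib[symmetric]
      proof (rule mod_eq_sum[OF S(1)], rule mod_eq_sym[OF S(1)])
        fix i assume i: "i \<in> I"
        show "mod_eq S (delta (e i, (?\<Phi> f \<oplus>\<^bsub>?P\<^esub> ?\<Phi> g) i)) (\<lambda>y. delta (e i, ?\<Phi> f i) y + delta (e i, ?\<Phi> g i) y)"
          using S_add2[OF e(1) wN[OF linF[OF fg(1)] i] wN[OF linF[OF fg(2)] i]] i by (simp add: tmod_simps)
      qed
      then have "mod_eq S (\<lambda>y. f y + g y) (D (?\<Phi> (\<lambda>y. f y + g y)))"
        using mod_eq_trans[OF S(1) mod_eq_add[OF S(1) fg(3,4)]] by (simp add: lin fg)
      then show "(\<lambda>y. f y + g y) \<in> ?T" using fsubspace_add[OF fsubspace_F] fg by simp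
    next
      fix c f assume "f \<in> ?T"
      then have f: "f \<in> carrier F" "mod_eq S f (D (?\<Phi> f))" by auto
      have "mod_eq S (\<lambda>y. c * D (?\<Phi> f) y) (D (scal ?P c (?\<Phi> f)))"
        unfolding D_def sum_distrib_left
      proof (rule mod_eq_sum[OF S(1)], rule mod_eq_sym[OF S(1)])
        fix i assume i: "i \<in> I"
        show "mod_eq S (delta (e i, scal ?P c (?\<Phi> f) i)) (\<lambda>y. c * delta (e i, ?\<Phi> f i) y)"
          using S_scal2[OF e(1) wN[OF linF[OF f(1)] i]] i by (simp add: N.scal_tmod[OF I \<rho> linF[OF f(1)]])
      qed
      then have "mod_eq S (\<lambda>y. c * f y) (D (?\<Phi> (\<lambda>y. c * f y)))"
        using mod_eq_trans[OF S(1) mod_eq_scale[OF S(1) f(2)]] by (simp add: lin f)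
      then show "(\<lambda>y. c * f y) \<in> ?T" using fsubspace_scale[OF fsubspace_F] f by simp
    qed
    moreover have "delta x \<in> ?T" if x: "x \<in> carrier M \<times> carrier N" for x
    proof -
      obtain u v where uv: "x = (u, v)" "u \<in> carrier M" "v \<in> carrier N" using x by auto
      let ?c = "\<psi> u"
      have cu: "finsum M (\<lambda>i. scal M (?c i) (e i)) I = u" using * uv(2) by simp
      have "mod_eq S (delta (u, v)) (\<lambda>y. \<Sum>i\<in>I. delta (scal M (?c i) (e i), v) y)"
        using delta_finsum[OF I, of "\<lambda>i. scal M (?c i) (e i)" v] e uv by (simp add: cu)
      moreover have "mod_eq S (\<lambda>y. \<Sum>i\<in>I. delta (scal M (?c i) (e i), v) y) (D (\<phi> (u, v)))"
        unfolding D_def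
      proof (rule mod_eq_sum[OF S(1)])
        fix i assume i: "i \<in> I"
        have 1: "mod_eq S (delta (e i, scal N (?c i) v)) (\<lambda>y. ?c i * delta (e i, v) y)"
          by (rule S_scal2[OF e(1) uv(3)])
        have 2: "mod_eq S (delta (scal M (?c i) (e i), v)) (\<lambda>y. ?c i * delta (e i, v) y)"
          by (rule S_scal1[OF e(1) uv(3)])
        have "mod_eq S (delta (scal M (?c i) (e i), v)) (delta (e i, scal N (?c i) v))"
          by (rule mod_eq_trans[OF S(1) 2 mod_eq_sym[OF S(1) 1]])
        then show "mod_eq S (delta (scal M (?c i) (e i), v)) (delta (e i, \<phi> (u, v) i))"
          using i by (simp add: \<phi>_uv)
      qed
      ultimately have "mod_eq S (delta x) (D (\<phi> x))" unfolding uv(1) by (rule mod_eq_trans[OF S(1)])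
      then show ?thesis using x by (simp add: lin delta_in_free)
    qed
    ultimately have "carrier F \<subseteq> ?T" by (rule free_lmod_induct)
    then show ?thesis using f by blast
  qed
  have S_ker: "S = {f \<in> carrier F. ?\<Phi> f = \<zero>\<^bsub>?P\<^esub>}"
  proof
    have d: "delta (u, v) \<in> carrier F" if "u \<in> carrier M" "v \<in> carrier N" for u v
      using that by (auto intro: delta_in_free)
    have sub0: "f \<ominus>\<^bsub>?P\<^esub> g \<ominus>\<^bsub>?P\<^esub> h = \<zero>\<^bsub>?P\<^esub>" if "f = g \<oplus>\<^bsub>?P\<^esub> h" "g \<in> carrier ?P" "h \<in> carrier ?P" for f g h
      using that by (simp add: a_minus_def P.M.a_assoc P.M.a_comm[of g h] P.M.r_neg P.M.r_neg2)
    have sub1: "f \<ominus>\<^bsub>?P\<^esub> f = \<zero>\<^bsub>?P\<^esub>" if "f \<in> carrier ?P" for f using that by (simp add: a_minus_def P.M.r_neg)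
    have dv: "?\<Phi> (delta (u, v)) = \<phi> (u, v)" if "u \<in> carrier M" "v \<in> carrier N" for u v
      using that by (simp add: lin)
    have \<phi>c: "\<phi> (u, v) \<in> carrier ?P" if "u \<in> carrier M" "v \<in> carrier N" for u v using \<phi>_closed that by simp
    have \<phi>1: "\<phi> (u \<oplus>\<^bsub>M\<^esub> u', v) = \<phi> (u, v) \<oplus>\<^bsub>?P\<^esub> \<phi> (u', v)"
      if "u \<in> carrier M" "u' \<in> carrier M" "v \<in> carrier N" for u u' v
      unfolding \<phi>_uv tmod_simps using that
      by (intro restrict_ext) (simp add: \<psi>D(2) tmod_simps lfield_simps N.scal_add_l)
    have \<phi>2: "\<phi> (u, v \<oplus>\<^bsub>N\<^esub> v') = \<phi> (u, v) \<oplus>\<^bsub>?P\<^esub> \<phi> (u, v')"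
      if "u \<in> carrier M" "v \<in> carrier N" "v' \<in> carrier N" for u v v'
      unfolding \<phi>_uv tmod_simps using that by (intro restrict_ext) (simp add: N.scal_add_r)
    have \<phi>3: "\<phi> (scal M c u, v) = scal ?P c (\<phi> (u, v))" if "u \<in> carrier M" "v \<in> carrier N" for c u v
      unfolding N.scal_tmod[OF I \<rho> \<phi>c[OF that]] unfolding \<phi>_uv \<psi>D(4)[OF that(1)] l.scal_tmod[OF I \<rho> \<psi>D(1)[OF that(1)]]
      by (rule restrict_ext) (simp add: scal_lfield N.scal_scal that)
    have \<phi>4: "\<phi> (u, scal N c v) = scal ?P c (\<phi> (u, v))" if "u \<in> carrier M" "v \<in> carrier N" for c u v
      unfolding N.scal_tmod[OF I \<rho> \<phi>c[OF that]] unfolding \<phi>_uv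
      by (rule restrict_ext) (simp add: N.scal_scal mult.commute that)
    have "tensor_relations M N \<subseteq> {f \<in> carrier F. ?\<Phi> f = \<zero>\<^bsub>?P\<^esub>}"
    proof
      fix r assume r: "r \<in> tensor_relations M N"
      have "?\<Phi> r = \<zero>\<^bsub>?P\<^esub>"
        using r unfolding tensor_relations_def scal_def[symmetric]
      proof (elim UnE CollectE exE conjE)
        fix u u' v
        assume r: "r = (\<lambda>y. delta (u \<oplus>\<^bsub>M\<^esub> u', v) y - delta (u, v) y - delta (u', v) y)"
          and u: "u \<in> carrier M" "u' \<in> carrier M" "v \<in> carrier N"
        then show ?thesis unfolding r
          by (simp add: lin(3) F_diff d dv) (rule sub0; simp add: \<phi>1 \<phi>c)
      next
        fix u v v'
        assume r: "r = (\<lambda>y. delta (u, v \<oplus>\<^bsub>N\<^esub> v') y - delta (u, v) y - delta (u, v') y)"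
          and u: "u \<in> carrier M" "v \<in> carrier N" "v' \<in> carrier N"
        then show ?thesis unfolding r
          by (simp add: lin(3) F_diff d dv) (rule sub0; simp add: \<phi>2 \<phi>c)
      next
        fix c u v
        assume r: "r = (\<lambda>y. delta (scal M c u, v) y - c * delta (u, v) y)"
          and u: "u \<in> carrier M" "v \<in> carrier N"
        then show ?thesis unfolding r
          by (simp add: lin(2,3) fsubspace_scale[OF fsubspace_F] d dv \<phi>3) (rule sub1; simp add: \<phi>c)
      next
        fix c u v
        assume r: "r = (\<lambda>y. delta (u, scal N c v) y - c * delta (u, v) y)"
          and u: "u \<in> carrier M" "v \<in> carrier N"
        then show ?thesis unfolding r
          by (simp add: lin(2,3) fsubspace_scale[OF fsubspace_F] d dv \<phi>4) (rule sub1; simp add: \<phi>c)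
      qed
      then show "r \<in> {f \<in> carrier F. ?\<Phi> f = \<zero>\<^bsub>?P\<^esub>}" using r relations_F by auto
    qed
    then show "S \<subseteq> {f \<in> carrier F. ?\<Phi> f = \<zero>\<^bsub>?P\<^esub>}" by (intro S(4) ker) auto
    show "{f \<in> carrier F. ?\<Phi> f = \<zero>\<^bsub>?P\<^esub>} \<subseteq> S"
    proof
      fix f assume f: "f \<in> {f \<in> carrier F. ?\<Phi> f = \<zero>\<^bsub>?P\<^esub>}"
      have "D \<zero>\<^bsub>?P\<^esub> \<in> S"
        unfolding D_def
      proof (rule fsubspace_sum[OF S(1)])
        fix i assume i: "i \<in> I"
        show "delta (e i, \<zero>\<^bsub>?P\<^esub> i) \<in> S"
          using S_scal2[OF e(1)[of i] N.M.zero_closed, of 0] i by (simp add: tmod_simps mod_eq_def)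
      qed
      then show "f \<in> S" using reduce[of f] f mod_eq_mem[OF S(1)] by auto
    qed
  qed
  have surj: "?\<Phi> ` carrier F = carrier ?P"
  proof
    show "?\<Phi> ` carrier F \<subseteq> carrier ?P" using linF by auto
    show "carrier ?P \<subseteq> ?\<Phi> ` carrier F"
    proof
      fix w assume w: "w \<in> carrier ?P"
      \<comment> \<open>The claim for the normal form is proved for partial sums over
        \<open>A\<close>, whose image is \<open>w\<close> cut down to \<open>A\<close>.\<close>
      have sum: "?\<Phi> (\<lambda>y. \<Sum>i\<in>A. delta (e i, w i) y) = (\<lambda>i\<in>I. if i \<in> A then w i else \<zero>\<^bsub>N\<^esub>)"
        if "A \<subseteq> I" for A
        using finite_subset[OF that I] that
      proof (induction A)
        case empty
        then show ?case by (simp add: lin_def tmod_simps)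
      next
        case (insert a A)
        have dF: "delta (e i, w i) \<in> carrier F" if "i \<in> I" for i
          using e(1) wN[OF w that] by (intro delta_in_free) auto
        have "(\<lambda>y. \<Sum>i\<in>A. delta (e i, w i) y) \<in> carrier F"
          using insert.prems dF by (intro fsubspace_sum[OF fsubspace_F]) auto
        then have "?\<Phi> (\<lambda>y. \<Sum>i\<in>insert a A. delta (e i, w i) y) =
          \<phi> (e a, w a) \<oplus>\<^bsub>?P\<^esub> ?\<Phi> (\<lambda>y. \<Sum>i\<in>A. delta (e i, w i) y)"
          using insert.hyps insert.prems dF e(1) wN[OF w] by (simp add: lin)
        also have "?\<Phi> (\<lambda>y. \<Sum>i\<in>A. delta (e i, w i) y) = (\<lambda>i\<in>I. if i \<in> A then w i else \<zero>\<^bsub>N\<^esub>)"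
          by (rule insert.IH) (use insert.prems in blast)
        also have "\<phi> (e a, w a) \<oplus>\<^bsub>?P\<^esub> (\<lambda>i\<in>I. if i \<in> A then w i else \<zero>\<^bsub>N\<^esub>) =
          (\<lambda>i\<in>I. if i \<in> insert a A then w i else \<zero>\<^bsub>N\<^esub>)"
          unfolding \<phi>_uv tmod_simps
        proof (rule restrict_ext)
          fix i assume i: "i \<in> I"
          have ps: "\<psi> (e a) i = (if i = a then 1 else 0)" using i by (simp add: e(2))
          have wa: "w a \<in> carrier N" "w i \<in> carrier N" using wN[OF w] i insert.prems by auto
          show "(\<lambda>i\<in>I. scal N (\<psi> (e a) i) (w a)) i \<oplus>\<^bsub>N\<^esub> (\<lambda>i\<in>I. if i \<in> A then w i else \<zero>\<^bsub>N\<^esub>) i =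
            (if i \<in> insert a A then w i else \<zero>\<^bsub>N\<^esub>)"
          proof (cases "i = a")
            case True
            then show ?thesis using i ps insert.hyps(2) wa by simp
          next
            case False
            then show ?thesis using i ps wa by simp
          qed
        qed
        finally show ?case .
      qed
      have "?\<Phi> (D w) = w"
        using sum[of I] w unfolding D_def by (simp add: tmod_simps cong: restrict_cong)
      then show "w \<in> ?\<Phi> ` carrier F" using imageI[OF D_F[OF w], of ?\<Phi>] by simp
    qed
  qed
  show "left_module M.R (tensor K M N)" "lmod_iso M.R (tensor K M N) ?P"
    unfolding tensor_eq
    by (rule quotient_lmod_iso[OF F.M.abelian_group_axioms P.left_module_axioms F.smult_closed \<Phi> surj S_ker]; assumption)+
qed

end

section \<open>Finite dimension and Maschke's theorem\<close>

text \<open>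
  Finite dimension over \<open>l\<close>, whose subspaces are the submodules over \<open>skew_group_ring {semilin_one}\<close>.
\<close>

definition lfin :: "(('l::field, 'd::finite) semilin \<Rightarrow> 'l, 'b) module \<Rightarrow> bool"
  where "lfin M \<longleftrightarrow> (\<exists>B. finite B \<and> B \<subseteq> carrier M \<and>
    (\<forall>N. submodule N (skew_group_ring {semilin_one}) M \<and> B \<subseteq> N \<longrightarrow> N = carrier M))"

text \<open>The images of generators generate, because the preimage of a subspace is a
  subspace.\<close>

lemma lfin_surj:
  assumes M: "skew_module K M" and M': "skew_module K M'"
    and f: "f \<in> lhom (skew_group_ring K) M M'" "f ` carrier M = carrier M'" and fin: "lfin M"
  shows "lfin M'"
proof -
  interpret M: skew_module K M by fact
  interpret M': skew_module K M' by fact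
  obtain B where B: "finite B" "B \<subseteq> carrier M" "\<And>N. M.l_submodule N \<Longrightarrow> B \<subseteq> N \<Longrightarrow> N = carrier M"
    using fin unfolding lfin_def by blast
  have f': "f \<in> lhom (skew_group_ring {semilin_one}) M M'"
    by (rule skew_lhomI[OF M.l_module M'.l_module])
       (auto simp: lhomD[OF f(1)] lhom_scal[OF M.skew_axioms f(1)])
  show ?thesis
    unfolding lfin_def
  proof (intro exI[of _ "f ` B"] conjI allI impI)
    fix N assume N: "M'.l_submodule N \<and> f ` B \<subseteq> N"
    have "M.l_submodule {x \<in> carrier M. f x \<in> N}"
      by (rule submodule_vimage[OF _ _ f'])
         (use N M.l_module M'.l_module in \<open>auto simp: skew_module_def\<close>)
    then have "{x \<in> carrier M. f x \<in> N} = carrier M" using B N by (intro B(3)) auto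
    then have "f x \<in> N" if "x \<in> carrier M" for x using that by (metis (mono_tags, lifting) mem_Collect_eq)
    then have "carrier M' \<subseteq> N" unfolding f(2)[symmetric] by (rule image_subsetI)
    then show "N = carrier M'" using N submodule_subset by blast
  qed (use B f(2) in auto)
qed

lemma lfin_iso:
  assumes "skew_module K M" "skew_module K M'" "lmod_iso (skew_group_ring K) M M'" "lfin M"
  shows "lfin M'"
  using assms lfin_surj[OF assms(1,2) _ _ assms(4)] by (auto simp: lmod_iso_lhom bij_betw_def)

context skew_module
begin

lemma l_submodule_finsum:
  assumes "l_submodule N" "finite A" "\<And>i. i \<in> A \<Longrightarrow> f i \<in> N"
  shows "finsum M f A \<in> N"
  using assms(2,3)
proof (induction A)
  case (insert a A)
  have "f \<in> A \<rightarrow> carrier M" "f a \<in> carrier M" using insert submodule_subset[OF assms(1)] by auto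
  then show ?case using insert submodule_add[OF assms(1)] by simp
qed (use submodule_zero[OF assms(1)] in simp)

text \<open>A simple module consists of the multiples of one nonzero \<open>x\<close>, hence is
  spanned over l by the finitely many translates of \<open>x\<close>.\<close>

lemma lfin_simple:
  assumes "simple_lmod R M"
  shows "lfin M"
proof -
  obtain x where x: "x \<in> carrier M" "x \<noteq> \<zero>\<^bsub>M\<^esub>" using simple_nonzero[OF assms] by blast
  let ?A = "(\<lambda>a. a \<odot>\<^bsub>M\<^esub> x) ` carrier R"
  have "submodule ?A R M"
  proof (rule submoduleI)
    show "\<zero>\<^bsub>M\<^esub> \<in> ?A" using smult_zero_l[OF x(1)] R.zero_closed by (metis image_eqI)
  next
    fix u v assume "u \<in> ?A" "v \<in> ?A"
    then obtain a b where "a \<in> carrier R" "b \<in> carrier R" "u = a \<odot>\<^bsub>M\<^esub> x" "v = b \<odot>\<^bsub>M\<^esub> x" by blast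
    then show "u \<oplus>\<^bsub>M\<^esub> v \<in> ?A" using x smult_l_distr[of a b x] R.add.m_closed[of a b] by (metis image_eqI)
  next
    fix a u assume "a \<in> carrier R" "u \<in> ?A"
    then obtain b where "a \<in> carrier R" "b \<in> carrier R" "u = b \<odot>\<^bsub>M\<^esub> x" by blast
    then show "a \<odot>\<^bsub>M\<^esub> u \<in> ?A" using x smult_assoc1[of a b x] R_mult_closed[of a b] by (metis image_eqI)
  qed (use x smult_closed in auto)
  moreover have "x \<in> ?A" using smult_one[OF x(1)] R.one_closed by (metis image_eqI)
  ultimately have A: "?A = carrier M" using simple_submodule[OF assms, of ?A] x by blast
  show ?thesis
    unfolding lfin_def
  proof (intro exI[of _ "(\<lambda>g. act M g x) ` K"] conjI allI impI)
    fix N assume N: "l_submodule N \<and> (\<lambda>g. act M g x) ` K \<subseteq> N"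
    have "a \<odot>\<^bsub>M\<^esub> x \<in> N" if "a \<in> carrier R" for a
      unfolding smult_expand[OF that x(1)]
      by (rule l_submodule_finsum) (use N l_submodule_iff[of N] finite_K in auto)
    then have "carrier M \<subseteq> N" unfolding A[symmetric] by (rule image_subsetI)
    moreover have "N \<subseteq> carrier M" using N by (intro submodule_subset) (rule conjunct1)
    ultimately show "N = carrier M" by (rule equalityI[rotated])
  qed (use finite_K x in auto)
qed

text \<open>Generated by the families with one entry from \<open>B\<close> and zeros elsewhere: for
  fixed \<open>i\<close> the \<open>v\<close> whose family \<open>u i v\<close> lies in
  \<open>N\<close> form a subspace containing \<open>B\<close>.\<close>

lemma lfin_tmod:
  assumes I: "finite I" and \<rho>: "cocycle K I \<rho>" and fin: "lfin M"
  shows "lfin (tmod I \<rho> M)"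
proof -
  let ?P = "tmod I \<rho> M"
  interpret P: skew_module K ?P by (rule skew_module_tmod[OF I \<rho>])
  obtain B where B: "finite B" "B \<subseteq> carrier M" "\<And>N. l_submodule N \<Longrightarrow> B \<subseteq> N \<Longrightarrow> N = carrier M"
    using fin unfolding lfin_def by blast
  define u where "u i v = (\<lambda>j\<in>I. if j = i then v else \<zero>\<^bsub>M\<^esub>)" for i v
  have uP: "u i v \<in> carrier ?P" if "v \<in> carrier M" for i v
    using that by (simp add: u_def tmod_simps restrict_PiE_iff)
  show ?thesis
    unfolding lfin_def
  proof (intro exI[of _ "(\<lambda>(i, b). u i b) ` (I \<times> B)"] conjI allI impI)
    show "(\<lambda>(i, b). u i b) ` (I \<times> B) \<subseteq> carrier ?P" using uP B(2) by auto
  next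
    fix N assume N: "P.l_submodule N \<and> (\<lambda>(i, b). u i b) ` (I \<times> B) \<subseteq> N"
    then have N': "N \<subseteq> carrier ?P" "\<zero>\<^bsub>?P\<^esub> \<in> N" "\<And>x y. x \<in> N \<Longrightarrow> y \<in> N \<Longrightarrow> x \<oplus>\<^bsub>?P\<^esub> y \<in> N" "\<And>c x. x \<in> N \<Longrightarrow> scal ?P c x \<in> N"
      using P.l_submodule_iff by auto
    have uN: "u i v \<in> N" if i: "i \<in> I" and v: "v \<in> carrier M" for i v
    proof -
      have "l_submodule {v \<in> carrier M. u i v \<in> N}"
        unfolding l_submodule_iff
      proof (intro conjI ballI allI)
        have "u i \<zero>\<^bsub>M\<^esub> = \<zero>\<^bsub>?P\<^esub>" by (simp add: u_def tmod_simps cong: restrict_cong)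
        then show "\<zero>\<^bsub>M\<^esub> \<in> {v \<in> carrier M. u i v \<in> N}" using N' by simp
      next
        fix v w assume vw: "v \<in> {v \<in> carrier M. u i v \<in> N}" "w \<in> {v \<in> carrier M. u i v \<in> N}"
        have "u i (v \<oplus>\<^bsub>M\<^esub> w) = u i v \<oplus>\<^bsub>?P\<^esub> u i w"
          unfolding u_def tmod_simps by (rule restrict_ext) (use vw in simp)
        then show "v \<oplus>\<^bsub>M\<^esub> w \<in> {v \<in> carrier M. u i v \<in> N}" using vw N' by simp
      next
        fix c v assume v: "v \<in> {v \<in> carrier M. u i v \<in> N}"
        then have vM: "v \<in> carrier M" by simp
        have "u i (scal M c v) = scal ?P c (u i v)"
          unfolding scal_tmod[OF I \<rho> uP[OF vM]] unfolding u_def by (rule restrict_ext) simp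
        then show "scal M c v \<in> {v \<in> carrier M. u i v \<in> N}" using v N' by simp
      qed auto
      then have "{v \<in> carrier M. u i v \<in> N} = carrier M" using N B(2) i by (intro B(3)) auto
      then show ?thesis using v by blast
    qed
    have "carrier ?P \<subseteq> N"
    proof
      fix w assume w: "w \<in> carrier ?P"
      have wM: "w i \<in> carrier M" if "i \<in> I" for i using w that by (auto simp: tmod_simps)
      have "(\<lambda>i\<in>I. if i \<in> A then w i else \<zero>\<^bsub>M\<^esub>) \<in> N" if "A \<subseteq> I" for A
        using finite_subset[OF that I] that
      proof (induction A)
        case empty
        have "(\<lambda>i\<in>I. if i \<in> {} then w i else \<zero>\<^bsub>M\<^esub>) = \<zero>\<^bsub>?P\<^esub>" by (simp only: tmod_simps empty_iff if_False)
        then show ?case using N'(2) by (simp only:)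
      next
        case (insert a A)
        have 1: "u a (w a) \<in> N" using uN wM insert.prems by blast
        have 2: "(\<lambda>i\<in>I. if i \<in> A then w i else \<zero>\<^bsub>M\<^esub>) \<in> N" by (rule insert.IH) (use insert.prems in blast)
        have "(\<lambda>i\<in>I. if i \<in> insert a A then w i else \<zero>\<^bsub>M\<^esub>) = u a (w a) \<oplus>\<^bsub>?P\<^esub> (\<lambda>i\<in>I. if i \<in> A then w i else \<zero>\<^bsub>M\<^esub>)"
          unfolding u_def tmod_simps
        proof (rule restrict_ext)
          fix i assume i: "i \<in> I"
          show "(if i \<in> insert a A then w i else \<zero>\<^bsub>M\<^esub>) =
            (\<lambda>j\<in>I. if j = a then w a else \<zero>\<^bsub>M\<^esub>) i \<oplus>\<^bsub>M\<^esub> (\<lambda>i\<in>I. if i \<in> A then w i else \<zero>\<^bsub>M\<^esub>) i"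
            using i wM[OF i] insert.hyps(2) by (cases "i = a") simp_all
        qed
        then show ?case using N'(3)[OF 1 2] by (simp only:)
      qed
      from this[of I] show "w \<in> N" using w by (simp add: tmod_simps cong: restrict_cong)
    qed
    then show "N = carrier ?P" using N'(1) by blast
  qed (use I B in auto)
qed

lemma comb_submodule:
  assumes B: "finite B" "b \<in> B \<rightarrow> carrier M"
  shows "l_submodule {finsum M (\<lambda>i. scal M (c i) (b i)) B | c. True}" (is "l_submodule ?N")
    and "\<And>i. i \<in> B \<Longrightarrow> b i \<in> {finsum M (\<lambda>i. scal M (c i) (b i)) B | c. True}"
proof -
  have bM: "b i \<in> carrier M" if "i \<in> B" for i using B that by auto
  show "l_submodule ?N"
    unfolding l_submodule_iff
  proof (intro conjI ballI allI)
    show "?N \<subseteq> carrier M" using bM by (auto intro!: M.finsum_closed)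
    have "finsum M (\<lambda>i. scal M 0 (b i)) B = \<zero>\<^bsub>M\<^esub>"
      by (rule M.add.finprod_one_eqI) (use bM in simp)
    then show "\<zero>\<^bsub>M\<^esub> \<in> ?N" by (auto intro!: exI[of _ "\<lambda>_. 0"])
  next
    fix x y assume "x \<in> ?N" "y \<in> ?N"
    then obtain c c' where c: "x = finsum M (\<lambda>i. scal M (c i) (b i)) B" "y = finsum M (\<lambda>i. scal M (c' i) (b i)) B" by blast
    have "finsum M (\<lambda>i. scal M (c i + c' i) (b i)) B = finsum M (\<lambda>i. scal M (c i) (b i) \<oplus>\<^bsub>M\<^esub> scal M (c' i) (b i)) B"
      by (rule M.finsum_cong'[OF refl]) (use bM in \<open>auto simp: scal_add_l\<close>)
    also have "\<dots> = x \<oplus>\<^bsub>M\<^esub> y" unfolding c by (rule M.finsum_addf) (use bM in auto)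
    finally show "x \<oplus>\<^bsub>M\<^esub> y \<in> ?N" by (auto intro!: exI[of _ "\<lambda>i. c i + c' i"])
  next
    fix a x assume "x \<in> ?N"
    then obtain c where c: "x = finsum M (\<lambda>i. scal M (c i) (b i)) B" by blast
    have "scal M a x = finsum M (\<lambda>i. scal M a (scal M (c i) (b i))) B"
      unfolding c by (rule scal_finsum) (use bM B in auto)
    also have "\<dots> = finsum M (\<lambda>i. scal M (a * c i) (b i)) B"
      by (rule M.finsum_cong'[OF refl]) (use bM in \<open>auto simp: scal_scal\<close>)
    finally show "scal M a x \<in> ?N" by (auto intro!: exI[of _ "\<lambda>i. a * c i"])
  qed
  fix j assume j: "j \<in> B"
  have "finsum M (\<lambda>i. scal M (if i = j then 1 else 0) (b i)) B = finsum M (\<lambda>i. if j = i then b i else \<zero>\<^bsub>M\<^esub>) B"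
    by (rule M.finsum_cong'[OF refl]) (use bM in auto)
  also have "\<dots> = b j" by (rule M.finsum_singleton) (use bM B j in auto)
  finally show "b j \<in> ?N" by (auto intro!: exI[of _ "\<lambda>i. if i = j then 1 else 0"])
qed

text \<open>Numbering the spanning vectors provides the order that leading positions refer
  to.\<close>

lemma lfin_span:
  assumes "lfin M"
  shows "\<exists>(n::nat) b. (\<forall>i<n. b i \<in> carrier M) \<and>
    (\<forall>x\<in>carrier M. \<exists>c. x = finsum M (\<lambda>i. scal M (c i) (b i)) {..<n})"
proof -
  obtain B where B: "finite B" "B \<subseteq> carrier M" "\<And>N. l_submodule N \<Longrightarrow> B \<subseteq> N \<Longrightarrow> N = carrier M"
    using assms unfolding lfin_def by blast
  obtain b where b: "bij_betw b {..<card B} B"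
    using ex_bij_betw_nat_finite[OF B(1)] by (auto simp: atLeast0LessThan)
  have bM: "b \<in> {..<card B} \<rightarrow> carrier M" using b B(2) by (auto simp: bij_betw_def)
  note N = comb_submodule[OF finite_lessThan bM]
  have "B \<subseteq> {finsum M (\<lambda>i. scal M (c i) (b i)) {..<card B} | c. True}"
  proof
    fix x assume "x \<in> B"
    then obtain i where "i \<in> {..<card B}" "x = b i" using b by (auto simp: bij_betw_def)
    then show "x \<in> {finsum M (\<lambda>i. scal M (c i) (b i)) {..<card B} | c. True}" using N(2) by simp
  qed
  then have "{finsum M (\<lambda>i. scal M (c i) (b i)) {..<card B} | c. True} = carrier M" by (rule B(3)[OF N(1)])
  then have "\<exists>c. x = finsum M (\<lambda>i. scal M (c i) (b i)) {..<card B}" if "x \<in> carrier M" for x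
    using that by blast
  then show ?thesis by (intro exI[of _ "card B"] exI[of _ b] conjI ballI) (use bM in auto)
qed

text \<open>
  The number of leading positions of elements of \<open>N\<close> with respect to a spanning sequence replaces
  the dimension of \<open>N\<close>.
\<close>

lemma lfin_measure:
  assumes "lfin M"
  shows "\<exists>(\<mu> :: 'b set \<Rightarrow> nat) n. (\<forall>N N'. l_submodule N \<longrightarrow> l_submodule N' \<longrightarrow> N \<subset> N' \<longrightarrow> \<mu> N < \<mu> N') \<and> (\<forall>N. \<mu> N \<le> n)"
proof -
  from lfin_span[OF assms] obtain n :: nat and b where
    nb: "(\<forall>i<n. b i \<in> carrier M) \<and> (\<forall>x\<in>carrier M. \<exists>c. x = finsum M (\<lambda>i. scal M (c i) (b i)) {..<n})"
    by iprover
  have b: "b i \<in> carrier M" if "i < n" for i using nb that by simp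
  have span: "\<exists>c. x = finsum M (\<lambda>i. scal M (c i) (b i)) {..<n}" if "x \<in> carrier M" for x
    by (rule nb[THEN conjunct2, THEN bspec, OF that])
  define comb where "comb c m = finsum M (\<lambda>i. scal M (c i) (b i)) {..<m}" for c and m :: nat
  define P where "P N = {i. i < n \<and> (\<exists>c. comb c i \<oplus>\<^bsub>M\<^esub> b i \<in> N)}" for N
  have comb_closed: "comb c m \<in> carrier M" if "m \<le> n" for c m
    unfolding comb_def using b that by (intro M.finsum_closed) auto
  have comb_Suc: "comb c (Suc m) = comb c m \<oplus>\<^bsub>M\<^esub> scal M (c m) (b m)" if "m < n" for c m
  proof -
    have "comb c (Suc m) = scal M (c m) (b m) \<oplus>\<^bsub>M\<^esub> comb c m"
      unfolding comb_def lessThan_Suc by (rule M.finsum_insert) (use b that in auto)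
    then show ?thesis using b[OF that] comb_closed[of m c] that by (simp add: M.a_comm)
  qed
  have comb_add: "comb c m \<oplus>\<^bsub>M\<^esub> comb c' m = comb (\<lambda>i. c i + c' i) m" if "m \<le> n" for c c' m
  proof -
    have "comb (\<lambda>i. c i + c' i) m = finsum M (\<lambda>i. scal M (c i) (b i) \<oplus>\<^bsub>M\<^esub> scal M (c' i) (b i)) {..<m}"
      unfolding comb_def by (rule M.finsum_cong'[OF refl]) (use b that in \<open>auto simp: scal_add_l\<close>)
    also have "\<dots> = comb c m \<oplus>\<^bsub>M\<^esub> comb c' m"
      unfolding comb_def by (rule M.finsum_addf) (use b that in auto)
    finally show ?thesis ..
  qed
  have comb_scal: "scal M a (comb c m) = comb (\<lambda>i. a * c i) m" if "m \<le> n" for a c m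
  proof -
    have "scal M a (comb c m) = finsum M (\<lambda>i. scal M a (scal M (c i) (b i))) {..<m}"
      unfolding comb_def by (rule scal_finsum) (use b that in auto)
    also have "\<dots> = comb (\<lambda>i. a * c i) m"
      unfolding comb_def by (rule M.finsum_cong'[OF refl]) (use b that in \<open>auto simp: scal_scal\<close>)
    finally show ?thesis .
  qed
  \<comment> \<open>Elimination from the top: if the last coefficient of an element of
    \<open>N'\<close> is nonzero, its position is also a leading position for \<open>N\<close>, and
    subtracting a suitable element of \<open>N\<close> shortens the combination without leaving
    \<open>N'\<close>.\<close>
  have eqI: "N' \<subseteq> N"
    if N: "l_submodule N" and N': "l_submodule N'" and sub: "N \<subseteq> N'" and P: "P N' \<subseteq> P N" for N N'
  proof
    note N1 = N[unfolded l_submodule_iff] and N1' = N'[unfolded l_submodule_iff]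
    have *: "m \<le> n \<Longrightarrow> comb c m \<in> N' \<Longrightarrow> comb c m \<in> N" for c m
    proof (induction m arbitrary: c)
      case 0
      then show ?case using N1 by (simp add: comb_def)
    next
      case (Suc m)
      then have m: "m < n" "m \<le> n" by auto
      have bm: "b m \<in> carrier M" using b m by simp
      show ?case
      proof (cases "c m = 0")
        case True
        then have "comb c (Suc m) = comb c m" using comb_Suc[OF m(1), of c] bm comb_closed[OF m(2)] by simp
        then show ?thesis using Suc m by simp
      next
        case False
        have "scal M (1 / c m) (comb c (Suc m)) \<in> N'" using N1' Suc.prems by blast
        moreover have "scal M (1 / c m) (comb c (Suc m)) = comb (\<lambda>i. 1 / c m * c i) m \<oplus>\<^bsub>M\<^esub> b m"
          using False bm comb_closed[OF m(2)]
          by (simp add: comb_Suc[OF m(1)] scal_add_r comb_scal[OF m(2)] scal_scal)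
        ultimately have "m \<in> P N'" using m(1) unfolding P_def by auto
        then have "m \<in> P N" using P by blast
        then obtain c' where y: "comb c' m \<oplus>\<^bsub>M\<^esub> b m \<in> N" unfolding P_def by blast
        then have y': "scal M (c m) (comb c' m \<oplus>\<^bsub>M\<^esub> b m) \<in> N" using N1 by blast
        have yv: "scal M (c m) (comb c' m \<oplus>\<^bsub>M\<^esub> b m) = comb (\<lambda>i. c m * c' i) m \<oplus>\<^bsub>M\<^esub> scal M (c m) (b m)"
          using bm comb_closed[OF m(2)] by (simp add: scal_add_r comb_scal[OF m(2)])
        have d: "comb c (Suc m) = comb (\<lambda>i. c i - c m * c' i) m \<oplus>\<^bsub>M\<^esub> scal M (c m) (comb c' m \<oplus>\<^bsub>M\<^esub> b m)"
        proof -
          have "comb (\<lambda>i. c i - c m * c' i) m \<oplus>\<^bsub>M\<^esub> scal M (c m) (comb c' m \<oplus>\<^bsub>M\<^esub> b m) =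
            (comb (\<lambda>i. c i - c m * c' i) m \<oplus>\<^bsub>M\<^esub> comb (\<lambda>i. c m * c' i) m) \<oplus>\<^bsub>M\<^esub> scal M (c m) (b m)"
            unfolding yv using bm comb_closed[OF m(2)] by (simp add: M.a_assoc)
          then show ?thesis by (simp add: comb_add[OF m(2)] comb_Suc[OF m(1)])
        qed
        have "comb (\<lambda>i. c i - c m * c' i) m =
            comb c (Suc m) \<ominus>\<^bsub>M\<^esub> scal M (c m) (comb c' m \<oplus>\<^bsub>M\<^esub> b m)"
          unfolding d using bm comb_closed[OF m(2)] by (simp add: a_minus_def M.a_assoc M.r_neg)
        also have "\<dots> \<in> N'" using submodule_diff[OF N' Suc.prems(2)] y' sub by blast
        finally have "comb (\<lambda>i. c i - c m * c' i) m \<in> N" by (rule Suc.IH[OF m(2)])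
        then show ?thesis unfolding d using y' N1 by blast
      qed
    qed
    fix x assume x: "x \<in> N'"
    then obtain c where "x = comb c n" using span N1' unfolding comb_def by blast
    then show "x \<in> N" using *[of n c] x by simp
  qed
  have fin: "finite (P N)" for N unfolding P_def by simp
  have mono: "P N \<subseteq> P N'" if "N \<subseteq> N'" for N N' unfolding P_def using that by blast
  have "card (P N) < card (P N')" if "l_submodule N" "l_submodule N'" "N \<subset> N'" for N N'
    using eqI[OF that(1,2)] that(3) mono[of N N'] fin by (intro psubset_card_mono) blast+
  moreover have "card (P N) \<le> n" for N
  proof -
    have "P N \<subseteq> {..<n}" unfolding P_def by auto
    then show ?thesis using card_mono[of "{..<n}" "P N"] by simp
  qed
  ultimately show ?thesis by (intro exI[of _ "\<lambda>N. card (P N)"] exI[of _ n] conjI allI impI)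
qed

text \<open>Among the subspaces meeting \<open>N\<close> trivially take one of largest measure. Were
  \<open>x\<close> outside the sum of \<open>N\<close> and \<open>C\<close>, adjoining the line of
  \<open>x\<close> to \<open>C\<close> would keep the intersection trivial and raise the
  measure.\<close>

lemma l_complement:
  assumes "lfin M" and N: "l_submodule N"
  obtains C where "l_submodule C" "N \<inter> C = {\<zero>\<^bsub>M\<^esub>}" "\<And>x. x \<in> carrier M \<Longrightarrow> \<exists>u\<in>N. \<exists>v\<in>C. x = u \<oplus>\<^bsub>M\<^esub> v"
proof -
  from lfin_measure[OF assms(1)] obtain \<mu> :: "'b set \<Rightarrow> nat" and n0 where
    m: "(\<forall>N N'. l_submodule N \<longrightarrow> l_submodule N' \<longrightarrow> N \<subset> N' \<longrightarrow> \<mu> N < \<mu> N') \<and> (\<forall>N. \<mu> N \<le> n0)"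
    by iprover
  have \<mu>: "l_submodule N \<Longrightarrow> l_submodule N' \<Longrightarrow> N \<subset> N' \<Longrightarrow> \<mu> N < \<mu> N'" "\<mu> N \<le> n0" for N N'
    using m by simp_all
  note N1 = N[unfolded l_submodule_iff]
  let ?Q = "\<lambda>C. l_submodule C \<and> N \<inter> C = {\<zero>\<^bsub>M\<^esub>}"
  have "?Q {\<zero>\<^bsub>M\<^esub>}" using N1 by (auto simp: l_submodule_iff)
  \<comment> \<open>As \<open>\<mu>\<close> is bounded by \<open>n0\<close>, minimising
    \<open>n0 - \<mu> C\<close> selects a \<open>C\<close> of largest measure.\<close>
  from ex_has_least_nat[of ?Q, OF this, of "\<lambda>C. n0 - \<mu> C"]
  obtain C where C: "l_submodule C" "N \<inter> C = {\<zero>\<^bsub>M\<^esub>}" and max: "\<And>C'. ?Q C' \<Longrightarrow> n0 - \<mu> C \<le> n0 - \<mu> C'" by blast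
  note C1 = C(1)[unfolded l_submodule_iff]
  have "\<exists>u\<in>N. \<exists>v\<in>C. x = u \<oplus>\<^bsub>M\<^esub> v" if x: "x \<in> carrier M" for x
  proof (rule ccontr)
    assume no: "\<not> (\<exists>u\<in>N. \<exists>v\<in>C. x = u \<oplus>\<^bsub>M\<^esub> v)"
    have CM: "v \<in> carrier M" if "v \<in> C" for v using C1 that by blast
    have NM: "v \<in> carrier M" if "v \<in> N" for v using N1 that by blast
    let ?C = "{v \<oplus>\<^bsub>M\<^esub> scal M c x | v c. v \<in> C}"
    have C': "l_submodule ?C"
      unfolding l_submodule_iff
    proof (intro conjI ballI allI)
      show "?C \<subseteq> carrier M" using CM x by auto
      show "\<zero>\<^bsub>M\<^esub> \<in> ?C" using C1 x by (auto intro!: exI[of _ "\<zero>\<^bsub>M\<^esub>"] exI[of _ 0])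
    next
      fix y z assume "y \<in> ?C" "z \<in> ?C"
      then obtain v c v' c' where "y = v \<oplus>\<^bsub>M\<^esub> scal M c x" "v \<in> C" "z = v' \<oplus>\<^bsub>M\<^esub> scal M c' x" "v' \<in> C" by blast
      moreover from this have "(v \<oplus>\<^bsub>M\<^esub> scal M c x) \<oplus>\<^bsub>M\<^esub> (v' \<oplus>\<^bsub>M\<^esub> scal M c' x) = (v \<oplus>\<^bsub>M\<^esub> v') \<oplus>\<^bsub>M\<^esub> scal M (c + c') x"
        using CM x by (simp add: scal_add_l M.a_assoc M.a_lcomm)
      moreover have "v \<oplus>\<^bsub>M\<^esub> v' \<in> C" using calculation C1 by blast
      ultimately show "y \<oplus>\<^bsub>M\<^esub> z \<in> ?C" by blast
    next
      fix a y assume "y \<in> ?C"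
      then obtain v c where "y = v \<oplus>\<^bsub>M\<^esub> scal M c x" "v \<in> C" by blast
      moreover from this have "scal M a (v \<oplus>\<^bsub>M\<^esub> scal M c x) = scal M a v \<oplus>\<^bsub>M\<^esub> scal M (a * c) x"
        using CM x by (simp add: scal_add_r scal_scal)
      moreover have "scal M a v \<in> C" using calculation C1 by blast
      ultimately show "scal M a y \<in> ?C" by blast
    qed
    have "N \<inter> ?C = {\<zero>\<^bsub>M\<^esub>}"
    proof
      show "N \<inter> ?C \<subseteq> {\<zero>\<^bsub>M\<^esub>}"
      proof
        fix y assume y: "y \<in> N \<inter> ?C"
        then obtain v c where v: "y = v \<oplus>\<^bsub>M\<^esub> scal M c x" "v \<in> C" "y \<in> N" by blast
        show "y \<in> {\<zero>\<^bsub>M\<^esub>}"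
        proof (cases "c = 0")
          case True
          then have "y \<in> N \<inter> C" using v CM x by simp
          then show ?thesis using C(2) by simp
        next
          case False
          \<comment> \<open>With a nonzero coefficient \<open>c\<close> the equation can be solved
            for \<open>x\<close>, which then lies in the sum of \<open>N\<close> and
            \<open>C\<close>.\<close>
          have "x = scal M (1 / c) (scal M c x)" using False x by (simp add: scal_scal)
          also have "scal M c x = y \<oplus>\<^bsub>M\<^esub> scal M (- 1) v"
            using v CM x by (simp add: scal_minus_1 M.a_comm[of v] M.a_assoc M.r_neg)
          also have "scal M (1 / c) (y \<oplus>\<^bsub>M\<^esub> scal M (- 1) v) = scal M (1 / c) y \<oplus>\<^bsub>M\<^esub> scal M (1 / c) (scal M (- 1) v)"
            by (rule scal_add_r) (use v CM NM in auto)
          finally have "x = scal M (1 / c) y \<oplus>\<^bsub>M\<^esub> scal M (1 / c) (scal M (- 1) v)" .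
          moreover have "scal M (1 / c) y \<in> N" using N1 v by blast
          moreover have "scal M (1 / c) (scal M (- 1) v) \<in> C" using C1 v by blast
          ultimately show ?thesis using no by blast
        qed
      qed
      show "{\<zero>\<^bsub>M\<^esub>} \<subseteq> N \<inter> ?C" using C' N1 l_submodule_iff[of ?C] by blast
    qed
    then have le: "n0 - \<mu> C \<le> n0 - \<mu> ?C" using max C' by blast
    have "C \<subseteq> ?C"
    proof
      fix v assume "v \<in> C"
      then show "v \<in> ?C" using CM x by (auto intro!: exI[of _ v] exI[of _ 0])
    qed
    moreover have "x \<in> ?C" using C1 x by (auto intro!: exI[of _ "\<zero>\<^bsub>M\<^esub>"] exI[of _ 1])
    moreover have "x \<notin> C"
    proof
      assume "x \<in> C"
      moreover have "\<zero>\<^bsub>M\<^esub> \<in> N" "x = \<zero>\<^bsub>M\<^esub> \<oplus>\<^bsub>M\<^esub> x" using N1 x by auto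
      ultimately show False using no by blast
    qed
    ultimately have "C \<subset> ?C" by blast
    then have "\<mu> C < \<mu> ?C" by (rule \<mu>(1)[OF C(1) C'])
    then show False using le \<mu>(2)[of ?C] by linarith
  qed
  then show ?thesis using that C by blast
qed

text \<open>The l-linear projection along a complement is averaged over the group. The average is
  linear over \<open>l*K\<close> and still the identity on \<open>N\<close>, so its kernel is a
  stable complement.\<close>

lemma Maschke:
  assumes "lfin M" and char: "of_nat (card K) \<noteq> (0::'l)" and N: "submodule N R M"
  obtains C where "submodule C R M" "N \<inter> C = {\<zero>\<^bsub>M\<^esub>}" "\<And>x. x \<in> carrier M \<Longrightarrow> \<exists>u\<in>N. \<exists>v\<in>C. x = u \<oplus>\<^bsub>M\<^esub> v"
proof -
  note N1 = N[unfolded submodule_iff]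
  obtain C where C: "l_submodule C" "N \<inter> C = {\<zero>\<^bsub>M\<^esub>}" "\<And>x. x \<in> carrier M \<Longrightarrow> \<exists>u\<in>N. \<exists>v\<in>C. x = u \<oplus>\<^bsub>M\<^esub> v"
    by (rule l_complement[OF assms(1) submodule_l[OF N]]) (rule that; blast)
  note C1 = C(1)[unfolded l_submodule_iff]
  have "\<forall>x\<in>carrier M. \<exists>u. u \<in> N \<and> (\<exists>v\<in>C. x = u \<oplus>\<^bsub>M\<^esub> v)" using C(3) by blast
  then obtain \<pi> where \<pi>: "\<And>x. x \<in> carrier M \<Longrightarrow> \<pi> x \<in> N" "\<And>x. x \<in> carrier M \<Longrightarrow> \<exists>v\<in>C. x = \<pi> x \<oplus>\<^bsub>M\<^esub> v" by metis
  have NM: "u \<in> carrier M" if "u \<in> N" for u using N1 that by blast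
  have CM: "u \<in> carrier M" if "u \<in> C" for u using C1 that by blast
  \<comment> \<open>\<open>\<pi>\<close> is only a choice of components in \<open>N\<close>; their
    uniqueness, a consequence of the trivial intersection with \<open>C\<close>, is what makes
    \<open>\<pi>\<close> additive and l-linear.\<close>
  have uniq: "\<pi> (u \<oplus>\<^bsub>M\<^esub> v) = u" if uv: "u \<in> N" "v \<in> C" for u v
  proof -
    have "u \<oplus>\<^bsub>M\<^esub> v \<in> carrier M" using uv NM CM by simp
    then obtain v' where v': "v' \<in> C" "u \<oplus>\<^bsub>M\<^esub> v = \<pi> (u \<oplus>\<^bsub>M\<^esub> v) \<oplus>\<^bsub>M\<^esub> v'" and pN: "\<pi> (u \<oplus>\<^bsub>M\<^esub> v) \<in> N" using \<pi> by blast
    let ?p = "\<pi> (u \<oplus>\<^bsub>M\<^esub> v)"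
    have c: "u \<in> carrier M" "v \<in> carrier M" "v' \<in> carrier M" "?p \<in> carrier M" using uv v'(1) pN NM CM by auto
    have "u \<ominus>\<^bsub>M\<^esub> ?p = (u \<oplus>\<^bsub>M\<^esub> v) \<oplus>\<^bsub>M\<^esub> (\<ominus>\<^bsub>M\<^esub> v \<ominus>\<^bsub>M\<^esub> ?p)"
      using c by (simp add: a_minus_def M.a_assoc M.r_neg2)
    also have "\<dots> = (?p \<oplus>\<^bsub>M\<^esub> v') \<oplus>\<^bsub>M\<^esub> (\<ominus>\<^bsub>M\<^esub> v \<ominus>\<^bsub>M\<^esub> ?p)" using v'(2) by simp
    also have "\<dots> = v' \<ominus>\<^bsub>M\<^esub> v"
      using c by (simp add: a_minus_def M.a_comm[of ?p v'] M.a_comm[of "\<ominus>\<^bsub>M\<^esub> v" "\<ominus>\<^bsub>M\<^esub> ?p"] M.a_assoc M.r_neg2)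
    finally have e: "u \<ominus>\<^bsub>M\<^esub> ?p = v' \<ominus>\<^bsub>M\<^esub> v" .
    have "u \<ominus>\<^bsub>M\<^esub> ?p \<in> N \<inter> C"
      using submodule_diff[OF N uv(1) pN] submodule_diff[OF C(1) v'(1) uv(2)] e by simp
    then have "u \<ominus>\<^bsub>M\<^esub> ?p = \<zero>\<^bsub>M\<^esub>" using C(2) by simp
    moreover have "u = (u \<ominus>\<^bsub>M\<^esub> ?p) \<oplus>\<^bsub>M\<^esub> ?p" using c by (simp add: a_minus_def M.a_assoc M.l_neg)
    ultimately show ?thesis using c by simp
  qed
  have \<pi>_add: "\<pi> (x \<oplus>\<^bsub>M\<^esub> y) = \<pi> x \<oplus>\<^bsub>M\<^esub> \<pi> y" if xy: "x \<in> carrier M" "y \<in> carrier M" for x y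
  proof -
    obtain v w where vw: "v \<in> C" "x = \<pi> x \<oplus>\<^bsub>M\<^esub> v" "w \<in> C" "y = \<pi> y \<oplus>\<^bsub>M\<^esub> w" using \<pi>(2) xy by metis
    have c: "\<pi> x \<in> carrier M" "\<pi> y \<in> carrier M" "v \<in> carrier M" "w \<in> carrier M" using vw xy \<pi>(1) NM CM by auto
    have "x \<oplus>\<^bsub>M\<^esub> y = (\<pi> x \<oplus>\<^bsub>M\<^esub> v) \<oplus>\<^bsub>M\<^esub> (\<pi> y \<oplus>\<^bsub>M\<^esub> w)" using vw by simp
    also have "\<dots> = (\<pi> x \<oplus>\<^bsub>M\<^esub> \<pi> y) \<oplus>\<^bsub>M\<^esub> (v \<oplus>\<^bsub>M\<^esub> w)" using c by (simp add: M.a_assoc M.a_lcomm)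
    finally have "x \<oplus>\<^bsub>M\<^esub> y = (\<pi> x \<oplus>\<^bsub>M\<^esub> \<pi> y) \<oplus>\<^bsub>M\<^esub> (v \<oplus>\<^bsub>M\<^esub> w)" .
    moreover have "\<pi> x \<oplus>\<^bsub>M\<^esub> \<pi> y \<in> N" "v \<oplus>\<^bsub>M\<^esub> w \<in> C" using N1 C1 vw \<pi>(1) xy by blast+
    ultimately show ?thesis using uniq by simp
  qed
  have \<pi>_scal: "\<pi> (scal M c x) = scal M c (\<pi> x)" if x: "x \<in> carrier M" for c x
  proof -
    obtain v where v: "v \<in> C" "x = \<pi> x \<oplus>\<^bsub>M\<^esub> v" using \<pi>(2) x by metis
    have "scal M c (\<pi> x \<oplus>\<^bsub>M\<^esub> v) = scal M c (\<pi> x) \<oplus>\<^bsub>M\<^esub> scal M c v"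
      by (rule scal_add_r) (use v x \<pi>(1) NM CM in auto)
    then have "scal M c x = scal M c (\<pi> x) \<oplus>\<^bsub>M\<^esub> scal M c v" using v(2) by simp
    moreover have "scal M c (\<pi> x) \<in> N" "scal M c v \<in> C" using N1 C1 v \<pi>(1) x by blast+
    ultimately show ?thesis using uniq by simp
  qed
  have \<pi>_N: "\<pi> u = u" if "u \<in> N" for u
    using uniq[of u "\<zero>\<^bsub>M\<^esub>"] that C1 NM by simp
  \<comment> \<open>Conjugates of the projection. They are l-linear although the group acts
    semilinearly, because the automorphisms of \<open>g\<close> and of its inverse cancel on
    scalars.\<close>
  define q where "q x = (\<lambda>g. act M g (\<pi> (act M (ginv g) x)))" for x
  have qN: "q x g \<in> N" if "x \<in> carrier M" "g \<in> K" for x g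
    unfolding q_def using that \<pi>(1) N1 by simp
  have qM: "q x g \<in> carrier M" if "x \<in> carrier M" "g \<in> K" for x g using qN NM that by blast
  define p where "p x = scal M (1 / of_nat (card K)) (finsum M (q x) K)" for x
  have sumM: "finsum M (q x) K \<in> carrier M" if "x \<in> carrier M" for x using qM that by (intro M.finsum_closed) auto
  have pN: "p x \<in> N" if "x \<in> carrier M" for x
  proof -
    have "finsum M (q x) K \<in> N" by (rule l_submodule_finsum[OF submodule_l[OF N] finite_K]) (rule qN[OF that])
    then show ?thesis unfolding p_def using N1 by blast
  qed
  have M: "skew_module K M" by (rule skew_module_axioms)
  have p: "p \<in> lhom R M M"
  proof (rule skew_lhomI[OF M M])
    fix x y assume xy: "x \<in> carrier M" "y \<in> carrier M"
    have "finsum M (q (x \<oplus>\<^bsub>M\<^esub> y)) K = finsum M (\<lambda>g. q x g \<oplus>\<^bsub>M\<^esub> q y g) K"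
    proof (rule M.finsum_cong'[OF refl])
      fix g assume g: "g \<in> K"
      show "q (x \<oplus>\<^bsub>M\<^esub> y) g = q x g \<oplus>\<^bsub>M\<^esub> q y g"
        unfolding q_def using g xy \<pi>(1) NM by (simp add: act_add \<pi>_add)
    qed (use qM xy in auto)
    also have "\<dots> = finsum M (q x) K \<oplus>\<^bsub>M\<^esub> finsum M (q y) K"
      by (rule M.finsum_addf) (use qM xy in auto)
    finally show "p (x \<oplus>\<^bsub>M\<^esub> y) = p x \<oplus>\<^bsub>M\<^esub> p y" unfolding p_def using sumM xy by (simp add: scal_add_r)
  next
    fix c x assume x: "x \<in> carrier M"
    have "finsum M (q (scal M c x)) K = finsum M (\<lambda>g. scal M c (q x g)) K"
    proof (rule M.finsum_cong'[OF refl])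
      fix g assume g: "g \<in> K"
      have "snd g (snd (ginv g) c) = c"
        using g ginv_right[OF g] snd_semilin_mult[of g "ginv g"] by (metis comp_apply id_apply snd_semilin_one)
      then show "q (scal M c x) g = scal M c (q x g)"
        unfolding q_def using g x \<pi>(1) NM by (simp add: act_scal \<pi>_scal)
    qed (use qM x in auto)
    also have "\<dots> = scal M c (finsum M (q x) K)"
      by (rule scal_finsum[symmetric]) (use qM x finite_K in auto)
    finally show "p (scal M c x) = scal M c (p x)"
      unfolding p_def using sumM[OF x] by (simp add: scal_scal mult.commute)
  next
    fix h x assume h: "h \<in> K" and x: "x \<in> carrier M"
    have "finsum M (q (act M h x)) K = finsum M (q (act M h x)) (semilin_mult h ` K)"
      using bij_mult_left[OF h] by (simp add: bij_betw_def)
    also have "\<dots> = finsum M (\<lambda>g. q (act M h x) (semilin_mult h g)) K"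
    proof (rule M.finsum_reindex)
      show "inj_on (semilin_mult h) K" using bij_mult_left[OF h] by (simp add: bij_betw_def)
      show "q (act M h x) \<in> semilin_mult h ` K \<rightarrow> carrier M"
        unfolding bij_betw_imp_surj_on[OF bij_mult_left[OF h]] using qM[OF act_closed[OF h x]] by (rule Pi_I)
    qed
    also have "\<dots> = finsum M (\<lambda>g. act M h (q x g)) K"
    proof (rule M.finsum_cong'[OF refl])
      fix g assume g: "g \<in> K"
      have "semilin_mult (semilin_mult h g) (semilin_mult (ginv g) (ginv h)) = semilin_one"
        using g h by (simp add: assoc_K ginv_cancel)
      then have "ginv (semilin_mult h g) = semilin_mult (ginv g) (ginv h)"
        using ginv_cancel(1)[OF mult_K[OF h g], of "semilin_mult (ginv g) (ginv h)"] ginv_K[OF mult_K[OF h g]] by simp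
      then show "q (act M h x) (semilin_mult h g) = act M h (q x g)"
        unfolding q_def using g h x \<pi>(1) NM by (simp add: act_act assoc_K)
    qed (use qM h x in auto)
    also have "\<dots> = act M h (finsum M (q x) K)"
      by (rule act_finsum[symmetric]) (use qM x h finite_K in auto)
    finally have e: "finsum M (q (act M h x)) K = act M h (finsum M (q x) K)" .
    \<comment> \<open>Since \<open>h\<close> acts semilinearly, the scalar in front of the average
      must be fixed by its automorphism. It lies in the prime field.\<close>
    have "snd h (1 / of_nat (card K)) = 1 / of_nat (card K)"
    proof -
      have a: "field_aut (snd h)" using h by (rule aut_K)
      have n: "snd h (of_nat m) = of_nat m" for m
        by (induction m) (simp_all add: field_aut_0[OF a] field_aut_1[OF a] field_aut_add[OF a])
      have "snd h (1 / of_nat (card K)) * snd h (of_nat (card K)) = 1"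
        using char by (simp flip: field_aut_mult[OF a] add: field_aut_1[OF a])
      then show ?thesis using char unfolding n by (simp add: field_simps)
    qed
    then show "p (act M h x) = act M h (p x)"
      unfolding p_def e using sumM[OF x] h by (simp add: act_scal)
  qed (use pN NM in auto)
  have p_N: "p u = u" if u: "u \<in> N" for u
  proof -
    have "finsum M (q u) K = finsum M (\<lambda>_. scal M 1 u) K"
    proof (rule M.finsum_cong'[OF refl])
      fix g assume g: "g \<in> K"
      have "act M (ginv g) u \<in> N" using N1 g u by simp
      then show "q u g = scal M 1 u" unfolding q_def using g u NM by (simp add: \<pi>_N act_act)
    qed (use u NM in auto)
    also have "\<dots> = scal M (of_nat (card K)) u"
      using finsum_scal[OF finite_K NM[OF u], of "\<lambda>_. 1"] by simp
    finally show ?thesis unfolding p_def using char u NM by (simp add: scal_scal)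
  qed
  let ?C = "{x \<in> carrier M. p x = \<zero>\<^bsub>M\<^esub>}"
  have 1: "submodule ?C R M" by (rule submodule_kernel[OF left_module_axioms left_module_axioms p])
  have 2: "N \<inter> ?C = {\<zero>\<^bsub>M\<^esub>}" using p_N N1 by auto
  have 3: "\<exists>u\<in>N. \<exists>v\<in>?C. x = u \<oplus>\<^bsub>M\<^esub> v" if x: "x \<in> carrier M" for x
  proof (rule bexI, rule bexI)
    have px: "p x \<in> carrier M" using pN NM x by blast
    show "x = p x \<oplus>\<^bsub>M\<^esub> (x \<ominus>\<^bsub>M\<^esub> p x)"
      using x px by (simp add: a_minus_def M.a_comm[of x] M.r_neg2)
    have "p (x \<ominus>\<^bsub>M\<^esub> p x) = p x \<ominus>\<^bsub>M\<^esub> p (p x)"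
      using x px by (simp add: a_minus_def lhom_add[OF p] lhom_minus[OF left_module_axioms left_module_axioms p])
    then show "x \<ominus>\<^bsub>M\<^esub> p x \<in> ?C" using x px by (simp add: p_N[OF pN[OF x]] a_minus_def M.r_neg)
  qed (rule pN[OF x])
  show ?thesis by (rule that[OF 1 2 3])
qed

text \<open>Induction on the measure of a submodule \<open>N\<close>: split off a simple submodule
  of \<open>N\<close> and continue with what is left of a complement inside
  \<open>N\<close>.\<close>

theorem semisimple:
  assumes fin: "lfin M" and char: "of_nat (card K) \<noteq> (0::'l)"
  obtains n :: nat and S :: "nat \<Rightarrow> (('l, 'd) semilin \<Rightarrow> 'l, 'b) module" where "\<And>i. i < n \<Longrightarrow> simple_lmod R (S i)" "lmod_iso R M (direct_sum {..<n} S)"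
proof -
  from lfin_measure[OF fin] obtain \<mu> :: "'b set \<Rightarrow> nat" and n0 where
    m: "(\<forall>N N'. l_submodule N \<longrightarrow> l_submodule N' \<longrightarrow> N \<subset> N' \<longrightarrow> \<mu> N < \<mu> N') \<and> (\<forall>N. \<mu> N \<le> n0)"
    by iprover
  have \<mu>: "l_submodule N \<Longrightarrow> l_submodule N' \<Longrightarrow> N \<subset> N' \<Longrightarrow> \<mu> N < \<mu> N'" "\<mu> N \<le> n0" for N N'
    using m by simp_all
  have LM: "left_module R M" by (rule left_module_axioms)
  have "\<exists>n (S :: nat \<Rightarrow> (('l, 'd) semilin \<Rightarrow> 'l, 'b) module). (\<forall>i<n::nat. simple_lmod R (S i)) \<and> lmod_iso R (M\<lparr>carrier := N\<rparr>) (direct_sum {..<n} S)"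
    if "submodule N R M" for N
    using that
  proof (induction "\<mu> N" arbitrary: N rule: less_induct)
    case less
    note N = less.prems
    show ?case
    proof (cases "N = {\<zero>\<^bsub>M\<^esub>}")
      case True
      \<comment> \<open>The empty direct sum has exactly one element, the function that is
        \<open>undefined\<close> everywhere; it represents the zero module.\<close>
      have "lmod_iso R (M\<lparr>carrier := N\<rparr>) (direct_sum {..<0::nat} (\<lambda>_. M))"
        by (rule lmod_isoI[of "\<lambda>_ _. undefined"])
           (auto simp: True lhom_def direct_sum_simps bij_betw_def smult_zero_r)
      then have *: "(\<forall>i<0::nat. simple_lmod R M) \<and> lmod_iso R (M\<lparr>carrier := N\<rparr>) (direct_sum {..<0::nat} (\<lambda>_. M))"
        by simp
      show ?thesis by (rule exI[where x = "0::nat"], rule exI[where x = "\<lambda>_. M"], rule *)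
    next
      case False
      let ?Q = "\<lambda>T. submodule T R M \<and> T \<subseteq> N \<and> T \<noteq> {\<zero>\<^bsub>M\<^esub>}"
      have "?Q N" using N False by simp
      from ex_has_least_nat[of ?Q, OF this, of \<mu>]
      obtain T where T: "submodule T R M" "T \<subseteq> N" "T \<noteq> {\<zero>\<^bsub>M\<^esub>}" and min: "\<And>T'. ?Q T' \<Longrightarrow> \<mu> T \<le> \<mu> T'" by blast
      \<comment> \<open>A nonzero submodule of least measure is simple, because \<open>\<mu>\<close>
        grows strictly along proper inclusions.\<close>
      have simple: "simple_lmod R (M\<lparr>carrier := T\<rparr>)"
        unfolding simple_lmod_def
      proof (intro conjI allI impI)
        fix A assume A: "submodule A R (M\<lparr>carrier := T\<rparr>)"
        have A1: "submodule A R M" by (rule submodule_trans[OF T(1) A LM])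
        have AT: "A \<subseteq> T" using submodule_subset[OF A] by simp
        show "A = {\<zero>\<^bsub>M\<lparr>carrier := T\<rparr>\<^esub>} \<or> A = carrier (M\<lparr>carrier := T\<rparr>)"
        proof (rule ccontr)
          assume "\<not> ?thesis"
          then have "A \<noteq> {\<zero>\<^bsub>M\<^esub>}" "A \<subset> T" using AT by auto
          then have "\<mu> T \<le> \<mu> A" "\<mu> A < \<mu> T"
            using min[of A] A1 AT T(2) \<mu>(1)[OF submodule_l[OF A1] submodule_l[OF T(1)]] by auto
          then show False by simp
        qed
      qed (use T submodule_left_module[OF LM T(1)] in auto)
      obtain C where C: "submodule C R M" "T \<inter> C = {\<zero>\<^bsub>M\<^esub>}" "\<And>x. x \<in> carrier M \<Longrightarrow> \<exists>u\<in>T. \<exists>v\<in>C. x = u \<oplus>\<^bsub>M\<^esub> v"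
        by (rule Maschke[OF fin char T(1)]) (rule that; blast)
      \<comment> \<open>By the modular law \<open>N\<close> is the direct sum of \<open>T\<close>
        and the part of \<open>C\<close> inside \<open>N\<close>; this part has smaller
        measure.\<close>
      have N': "submodule (N \<inter> C) R M" by (rule submodule_Int[OF N C(1) LM])
      have "N \<inter> C \<subset> N"
      proof -
        have "\<not> T \<subseteq> C" using C(2) T(3) submodule_zero[OF T(1)] by blast
        then show ?thesis using T(2) by blast
      qed
      then have "\<mu> (N \<inter> C) < \<mu> N" by (rule \<mu>(1)[OF submodule_l[OF N'] submodule_l[OF N]])
      from less.hyps[OF this N'] obtain n :: nat and S :: "nat \<Rightarrow> (('l, 'd) semilin \<Rightarrow> 'l, 'b) module" where
        S: "\<And>i. i < n \<Longrightarrow> simple_lmod R (S i)" "lmod_iso R (M\<lparr>carrier := N \<inter> C\<rparr>) (direct_sum {..<n} S)" by blast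
      let ?N = "M\<lparr>carrier := N\<rparr>"
      have TM: "u \<in> carrier M" if "u \<in> T" for u using submodule_subset[OF T(1)] that by blast
      have CM: "u \<in> carrier M" if "u \<in> C" for u using submodule_subset[OF C(1)] that by blast
      have "lmod_iso R ?N (direct_sum (insert n {..<n}) (S(n := M\<lparr>carrier := T\<rparr>)))"
      proof (rule direct_sum_internal[of _ _ "N \<inter> C" T])
        show "left_module R ?N" by (rule submodule_left_module[OF LM N])
        show "submodule (N \<inter> C) R ?N" by (rule submodule_restrict[OF N N' _ LM]) blast
        show "submodule T R ?N" by (rule submodule_restrict[OF N T(1,2) LM])
        show "N \<inter> C \<inter> T = {\<zero>\<^bsub>?N\<^esub>}" using C(2) T(2) by auto
        show "\<exists>u\<in>N \<inter> C. \<exists>v\<in>T. x = u \<oplus>\<^bsub>?N\<^esub> v" if x: "x \<in> carrier ?N" for x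
        proof -
          have xN: "x \<in> N" "x \<in> carrier M" using x submodule_subset[OF N] by auto
          then obtain u v where uv: "u \<in> T" "v \<in> C" "x = u \<oplus>\<^bsub>M\<^esub> v" using C(3) by blast
          have "v = x \<ominus>\<^bsub>M\<^esub> u" using uv TM CM by (simp add: a_minus_def M.a_comm[of u] M.a_assoc M.r_neg)
          then have "v \<in> N" using submodule_diff[OF N xN(1)] uv(1) T(2) by blast
          moreover have "x = v \<oplus>\<^bsub>M\<^esub> u" using uv TM CM by (simp add: M.a_comm)
          ultimately show ?thesis using uv by auto
        qed
        show "lmod_iso R (?N\<lparr>carrier := N \<inter> C\<rparr>) (direct_sum {..<n} S)" using S(2) by simp
        show "lmod_iso R (?N\<lparr>carrier := T\<rparr>) (M\<lparr>carrier := T\<rparr>)" by (simp add: lmod_iso_refl)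
        show "left_module R (M\<lparr>carrier := T\<rparr>)" by (rule submodule_left_module[OF LM T(1)])
      qed (use S(1) simple_left_module in auto)
      then show ?thesis
        using S(1) simple by (intro exI[of _ "Suc n"] exI[of _ "S(n := M\<lparr>carrier := T\<rparr>)"]) (auto simp: lessThan_Suc less_Suc_eq)
    qed
  qed
  moreover have "submodule (carrier M) R M" by (auto simp: submodule_iff)
  ultimately have "\<exists>n (S :: nat \<Rightarrow> (('l, 'd) semilin \<Rightarrow> 'l, 'b) module). (\<forall>i<n::nat. simple_lmod R (S i)) \<and> lmod_iso R (M\<lparr>carrier := carrier M\<rparr>) (direct_sum {..<n} S)" by blast
  then show ?thesis using that by auto
qed

text \<open>A generating set of least cardinality is a basis, and \<open>\<rho>\<close> collects the
  matrices of the group elements in it. The cocycle of the (d-1)-st exterior power is obtained here,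
  without explicit matrices.\<close>

theorem lfin_basis:
  assumes fin: "lfin M"
  obtains B :: "'b set" and \<rho> where "finite B" "cocycle K B \<rho>" "lmod_iso R M (tmod B \<rho> lfield)"
proof -
  let ?G = "\<lambda>B. finite B \<and> B \<subseteq> carrier M \<and> (\<forall>N. l_submodule N \<and> B \<subseteq> N \<longrightarrow> N = carrier M)"
  obtain B0 where "?G B0" using fin unfolding lfin_def by iprover
  from ex_has_least_nat[of ?G, OF this, of card]
  obtain B where GB: "?G B" and min: "\<forall>B'. ?G B' \<longrightarrow> card B \<le> card B'" by iprover
  have B: "finite B" "B \<subseteq> carrier M" using GB by simp_all
  have gen: "N = carrier M" if "l_submodule N" "B \<subseteq> N" for N using GB that by blast
  have bM: "b \<in> carrier M" if "b \<in> B" for b using B(2) that by blast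
  define \<Theta> where "\<Theta> c = finsum M (\<lambda>b. scal M (c b) b) B" for c
  note N = comb_submodule[OF B(1), of "\<lambda>b. b"]
  have \<Theta>M: "\<Theta> c \<in> carrier M" for c unfolding \<Theta>_def using bM by (intro M.finsum_closed) auto
  have \<Theta>_add: "\<Theta> (\<lambda>b. c b + c' b) = \<Theta> c \<oplus>\<^bsub>M\<^esub> \<Theta> c'" for c c'
  proof -
    have "\<Theta> (\<lambda>b. c b + c' b) = finsum M (\<lambda>i. scal M (c i) i \<oplus>\<^bsub>M\<^esub> scal M (c' i) i) B"
      unfolding \<Theta>_def by (rule M.finsum_cong'[OF refl]) (use bM in \<open>auto simp: scal_add_l\<close>)
    also have "\<dots> = \<Theta> c \<oplus>\<^bsub>M\<^esub> \<Theta> c'" unfolding \<Theta>_def by (rule M.finsum_addf) (use bM in auto)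
    finally show ?thesis .
  qed
  have \<Theta>_scal: "\<Theta> (\<lambda>b. a * c b) = scal M a (\<Theta> c)" for a c
  proof -
    have "scal M a (\<Theta> c) = finsum M (\<lambda>i. scal M a (scal M (c i) i)) B"
      unfolding \<Theta>_def by (rule scal_finsum) (use bM B in auto)
    also have "\<dots> = \<Theta> (\<lambda>b. a * c b)"
      unfolding \<Theta>_def by (rule M.finsum_cong'[OF refl]) (use bM in \<open>auto simp: scal_scal\<close>)
    finally show ?thesis ..
  qed
  have \<Theta>_cong: "\<Theta> c = \<Theta> c'" if "\<And>b. b \<in> B \<Longrightarrow> c b = c' b" for c c'
    unfolding \<Theta>_def by (rule M.finsum_cong'[OF refl]) (use that bM in auto)
  have \<Theta>_unit: "\<Theta> (\<lambda>i. if i = b then 1 else 0) = b" if b: "b \<in> B" for b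
  proof -
    have "\<Theta> (\<lambda>i. if i = b then 1 else 0) = finsum M (\<lambda>i. if b = i then i else \<zero>\<^bsub>M\<^esub>) B"
      unfolding \<Theta>_def by (rule M.finsum_cong'[OF refl]) (use bM in auto)
    also have "\<dots> = b" by (rule M.finsum_singleton) (use bM B b in auto)
    finally show ?thesis .
  qed
  have span: "\<exists>c. x = \<Theta> c" if x: "x \<in> carrier M" for x
  proof -
    have "(\<lambda>b. b) \<in> B \<rightarrow> carrier M" using bM by simp
    note N' = N[OF this]
    have "{finsum M (\<lambda>i. scal M (c i) i) B | c. True} = carrier M"
      by (rule gen[OF N'(1)]) (use N'(2) in blast)
    then show ?thesis using x unfolding \<Theta>_def by blast
  qed
  \<comment> \<open>In a relation with nonzero coefficient at \<open>b0\<close> one can solve for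
    \<open>b0\<close>, so the remaining elements would already generate, against minimality.\<close>
  have indep: "c b0 = 0" if c: "\<Theta> c = \<zero>\<^bsub>M\<^esub>" and b0: "b0 \<in> B" for c b0
  proof (rule ccontr)
    assume nz: "c b0 \<noteq> 0"
    let ?B = "B - {b0}"
    have "?G ?B"
    proof (intro conjI allI impI)
      fix N assume N: "l_submodule N \<and> ?B \<subseteq> N"
      then have N1: "l_submodule N" "\<And>b. b \<in> ?B \<Longrightarrow> b \<in> N" by blast+
      note N2 = N1(1)[unfolded l_submodule_iff]
      let ?r = "finsum M (\<lambda>b. scal M (c b) b) ?B"
      have r: "?r \<in> N" by (rule l_submodule_finsum[OF N1(1)]) (use B N1 N2 in auto)
      then have rM: "?r \<in> carrier M" using N2 by blast
      have "finsum M (\<lambda>b. scal M (c b) b) (insert b0 ?B) = scal M (c b0) b0 \<oplus>\<^bsub>M\<^esub> ?r"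
        by (rule M.finsum_insert) (use B bM b0 in auto)
      then have "scal M (c b0) b0 \<oplus>\<^bsub>M\<^esub> ?r = \<zero>\<^bsub>M\<^esub>" using c b0 by (simp add: \<Theta>_def insert_absorb)
      then have "scal M (c b0) b0 = \<ominus>\<^bsub>M\<^esub> ?r"
        by (intro M.minus_equality[symmetric] scal_closed bM[OF b0] rM)
      then have "scal M (c b0) b0 = scal M (- 1) ?r" using rM by (simp add: scal_minus_1)
      then have "scal M (1 / c b0) (scal M (c b0) b0) \<in> N" using r N2 by simp
      then have "b0 \<in> N" using nz bM[OF b0] by (simp add: scal_scal)
      then have "B \<subseteq> N" using N1(2) by blast
      then show "N = carrier M" by (rule gen[OF N1(1)])
    qed (use B in auto)
    then have "card B \<le> card ?B" by (rule min[THEN spec, THEN mp])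
    moreover have "card ?B < card B" using B(1) b0 by (rule card_Diff1_less)
    ultimately show False by simp
  qed
  have inj: "c b = c' b" if "\<Theta> c = \<Theta> c'" "b \<in> B" for c c' b
  proof -
    have "\<Theta> (\<lambda>b. c b + - 1 * c' b) = \<Theta> c \<oplus>\<^bsub>M\<^esub> scal M (- 1) (\<Theta> c')" by (simp only: \<Theta>_add \<Theta>_scal)
    also have "\<dots> = \<zero>\<^bsub>M\<^esub>" using that \<Theta>M by (simp add: scal_minus_1 M.r_neg)
    finally show ?thesis using indep that(2) by fastforce
  qed
  \<comment> \<open>Cut down to \<open>B\<close> because the elements of \<open>tmod\<close> are
    extensional; by \<open>coordI\<close> the values do not depend on the chosen
    coefficients.\<close>
  define coord where "coord x = (\<lambda>b\<in>B. (SOME c. x = \<Theta> c) b)" for x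
  have coord: "\<Theta> (coord x) = x" if "x \<in> carrier M" for x
  proof -
    have "x = \<Theta> (SOME c. x = \<Theta> c)" using someI_ex[OF span[OF that]] .
    moreover have "\<Theta> (coord x) = \<Theta> (SOME c. x = \<Theta> c)" by (rule \<Theta>_cong) (simp add: coord_def)
    ultimately show ?thesis by simp
  qed
  have coordI: "coord x b = c b" if "x = \<Theta> c" "b \<in> B" for x c b
    using inj[of "coord x" c b] coord[of x] \<Theta>M[of c] that by simp
  define \<rho> where "\<rho> g i j = coord (act M g j) i" for g i j
  have act_\<Theta>: "coord (act M g (\<Theta> c)) i = (\<Sum>j\<in>B. \<rho> g i j * snd g (c j))"
    if g: "g \<in> K" and i: "i \<in> B" for g c i
  proof (rule coordI[OF _ i])
    have sum\<Theta>: "\<Theta> (\<lambda>i. \<Sum>j\<in>A. f j i) = finsum M (\<lambda>j. \<Theta> (f j)) A" if "finite A" for f and A :: "'b set"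
      using that
    proof (induction A)
      case empty
      have "\<Theta> (\<lambda>i. 0 * 0) = scal M 0 (\<Theta> (\<lambda>_. 0))" by (rule \<Theta>_scal)
      then show ?case using \<Theta>M by simp
    next
      case (insert a A)
      then show ?case using \<Theta>M by (simp add: \<Theta>_add Pi_def)
    qed
    have "act M g (\<Theta> c) = finsum M (\<lambda>j. act M g (scal M (c j) j)) B"
      unfolding \<Theta>_def by (rule act_finsum[OF g]) (use bM B in auto)
    also have "\<dots> = finsum M (\<lambda>j. \<Theta> (\<lambda>i. snd g (c j) * \<rho> g i j)) B"
    proof (rule M.finsum_cong'[OF refl])
      fix j assume j: "j \<in> B"
      have "\<Theta> (\<lambda>i. snd g (c j) * \<rho> g i j) = scal M (snd g (c j)) (act M g j)"
        using coord[OF act_closed[OF g bM[OF j]]] unfolding \<Theta>_scal \<rho>_def by simp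
      then show "act M g (scal M (c j) j) = \<Theta> (\<lambda>i. snd g (c j) * \<rho> g i j)"
        using g bM[OF j] by (simp add: act_scal)
    qed (use \<Theta>M in auto)
    also have "\<dots> = \<Theta> (\<lambda>i. \<Sum>j\<in>B. snd g (c j) * \<rho> g i j)" by (rule sum\<Theta>[OF B(1), symmetric])
    finally show "act M g (\<Theta> c) = \<Theta> (\<lambda>i. \<Sum>j\<in>B. \<rho> g i j * snd g (c j))" by (simp add: mult.commute)
  qed
  have \<rho>: "cocycle K B \<rho>"
    unfolding cocycle_def
  proof (intro conjI ballI)
    fix i j assume ij: "i \<in> B" "j \<in> B"
    show "\<rho> semilin_one i j = (if i = j then 1 else 0)"
      unfolding \<rho>_def using coordI[OF _ ij(1), of j "\<lambda>i. if i = j then 1 else 0"] \<Theta>_unit[OF ij(2)] bM[OF ij(2)] by simp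
    fix g h assume gh: "g \<in> K" "h \<in> K"
    have "\<rho> (semilin_mult g h) i j = coord (act M g (\<Theta> (coord (act M h j)))) i"
      unfolding \<rho>_def using gh bM[OF ij(2)] by (simp add: coord act_act)
    then show "\<rho> (semilin_mult g h) i j = (\<Sum>k\<in>B. \<rho> g i k * snd g (\<rho> h k j))"
      unfolding act_\<Theta>[OF gh(1) ij(1)] by (simp only: \<rho>_def)
  qed
  interpret L: skew_module K lfield by (rule skew_module_lfield)
  let ?L = "tmod B \<rho> lfield"
  have PL: "skew_module K ?L" by (rule L.skew_module_tmod[OF B(1) \<rho>])
  have cL: "coord x \<in> carrier ?L" for x by (simp add: coord_def tmod_simps lfield_simps)
  have "lmod_iso R M ?L"
  proof (rule lmod_isoI[of coord])
    show "coord \<in> lhom R M ?L"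
    proof (rule skew_lhomI[OF skew_module_axioms PL])
      fix x y assume xy: "x \<in> carrier M" "y \<in> carrier M"
      have "coord (x \<oplus>\<^bsub>M\<^esub> y) i = coord x i + coord y i" if "i \<in> B" for i
        by (rule coordI[OF _ that]) (simp add: \<Theta>_add coord xy)
      then show "coord (x \<oplus>\<^bsub>M\<^esub> y) = coord x \<oplus>\<^bsub>?L\<^esub> coord y"
        by (intro extensionalityI[of _ B]) (auto simp: tmod_simps lfield_simps coord_def)
    next
      fix c x assume x: "x \<in> carrier M"
      have "coord (scal M c x) i = c * coord x i" if "i \<in> B" for i
        by (rule coordI[OF _ that]) (simp add: \<Theta>_scal coord x)
      then show "coord (scal M c x) = scal ?L c (coord x)"
        unfolding L.scal_tmod[OF B(1) \<rho> cL]
        by (intro extensionalityI[of _ B]) (auto simp: scal_lfield coord_def)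
    next
      fix g x assume g: "g \<in> K" and x: "x \<in> carrier M"
      have "coord (act M g x) i = (\<Sum>j\<in>B. \<rho> g i j * snd g (coord x j))" if "i \<in> B" for i
        using act_\<Theta>[OF g that, of "coord x"] coord[OF x] by simp
      then show "coord (act M g x) = act ?L g (coord x)"
        unfolding L.act_tmod[OF g cL]
        by (intro extensionalityI[of _ B]) (auto simp: scal_lfield act_lfield finsum_lfield coord_def)
    qed (rule cL)
    show "bij_betw coord (carrier M) (carrier ?L)"
    proof (rule bij_betw_byWitness[where f' = \<Theta>])
      show "\<forall>c\<in>carrier ?L. coord (\<Theta> c) = c"
      proof
        fix c assume c: "c \<in> carrier ?L"
        show "coord (\<Theta> c) = c"
        proof (rule extensionalityI[of _ B])
          show "c \<in> extensional B" using c by (auto simp: tmod_simps PiE_iff)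
        qed (auto simp: coord_def[of "\<Theta> c", symmetric] coordI, simp add: coord_def)
      qed
    qed (use coord cL \<Theta>M in auto)
  qed
  then show ?thesis by (rule that[OF B(1) \<rho>])
qed

end

section \<open>Exterior powers\<close>

locale ext_power = skew_module K M
  for K :: "('l::field, 'd::finite) semilin set" and M :: "(('l, 'd) semilin \<Rightarrow> 'l, 'b) module" +
  fixes m :: nat
begin

abbreviation eact :: "('l, 'd) semilin \<Rightarrow> 'b list \<Rightarrow> 'b list"
  where "eact g \<equiv> map (\<lambda>u. skew_elt 1 g \<odot>\<^bsub>M\<^esub> u)"

abbreviation "X \<equiv> {us. length us = m \<and> set us \<subseteq> carrier M}"

lemma eact: "eact g us = map (act M g) us"
  by (simp add: act_def)

sublocale free_module K eact X
proof unfold_locales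
  fix g us assume "g \<in> K" "us \<in> X"
  then show "eact g us \<in> X" using act_closed by (auto simp: eact)
next
  fix us assume "us \<in> X"
  then show "eact semilin_one us = us" unfolding eact by (intro map_idI) auto
next
  fix g h us assume "g \<in> K" "h \<in> K" "us \<in> X"
  then show "eact (semilin_mult g h) us = eact g (eact h us)"
    unfolding eact map_map by (intro map_cong refl) (auto simp: act_act subset_iff act_def[symmetric])
qed

abbreviation "S \<equiv> l_span F (exterior_relations m M)"

lemma exterior_eq: "exterior_power K m M = quotient_lmod F S"
  by (simp add: exterior_power_def Let_def)

lemma X_update: "us \<in> X \<Longrightarrow> u \<in> carrier M \<Longrightarrow> us[i := u] \<in> X"
  using set_update_subset_insert[of us i u] by auto

lemma relE:
  assumes "r \<in> exterior_relations m M"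
  obtains us i u u' where "us \<in> X" "i < m" "u \<in> carrier M" "u' \<in> carrier M"
      "r = (\<lambda>y. delta (us[i := u \<oplus>\<^bsub>M\<^esub> u']) y - delta (us[i := u]) y - delta (us[i := u']) y)"
  | us i c u where "us \<in> X" "i < m" "u \<in> carrier M"
      "r = (\<lambda>y. delta (us[i := scal M c u]) y - c * delta (us[i := u]) y)"
  | us i j where "us \<in> X" "i < j" "j < m" "us ! i = us ! j" "r = delta us"
proof -
  have "(\<exists>us i u u'. r = (\<lambda>y. delta (us[i := u \<oplus>\<^bsub>M\<^esub> u']) y - delta (us[i := u]) y - delta (us[i := u']) y) \<and>
      length us = m \<and> set us \<subseteq> carrier M \<and> i < m \<and> u \<in> carrier M \<and> u' \<in> carrier M) \<or>
    (\<exists>us i c u. r = (\<lambda>y. delta (us[i := scal M c u]) y - c * delta (us[i := u]) y) \<and>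
      length us = m \<and> set us \<subseteq> carrier M \<and> i < m \<and> u \<in> carrier M) \<or>
    (\<exists>us. r = delta us \<and> length us = m \<and> set us \<subseteq> carrier M \<and> (\<exists>i j. i < j \<and> j < m \<and> us ! i = us ! j))"
    using assms unfolding exterior_relations_def scal_def by blast
  then show ?thesis
  proof (elim disjE exE conjE, goal_cases)
    case (1 us i u u')
    then show ?case by (intro that(1)[of us i u u']) auto
  next
    case (2 us i c u)
    then show ?case by (intro that(2)[of us i u c]) auto
  next
    case (3 us i j)
    then show ?case by (intro that(3)[of us i j]) auto
  qed
qed

lemma rel1: "us \<in> X \<Longrightarrow> i < m \<Longrightarrow> u \<in> carrier M \<Longrightarrow> u' \<in> carrier M \<Longrightarrow>
    (\<lambda>y. delta (us[i := u \<oplus>\<^bsub>M\<^esub> u']) y - delta (us[i := u]) y - delta (us[i := u']) y) \<in> exterior_relations m M"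
  and rel2: "us \<in> X \<Longrightarrow> i < m \<Longrightarrow> u \<in> carrier M \<Longrightarrow>
    (\<lambda>y. delta (us[i := scal M c u]) y - c * delta (us[i := u]) y) \<in> exterior_relations m M"
  and rel3: "us \<in> X \<Longrightarrow> i < j \<Longrightarrow> j < m \<Longrightarrow> us ! i = us ! j \<Longrightarrow> delta us \<in> exterior_relations m M"
  unfolding exterior_relations_def scal_def by blast+

lemma dF: "us \<in> X \<Longrightarrow> delta us \<in> carrier F"
  by (rule delta_in_free)

lemma relations_F: "exterior_relations m M \<subseteq> carrier F"
proof
  fix r assume "r \<in> exterior_relations m M"
  then show "r \<in> carrier F"
    by (cases rule: relE)
       (simp_all only: F_diff fsubspace_scale[OF fsubspace_F] dF X_update M.a_closed scal_closed)
qed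

lemmas S = l_span_F[OF relations_F]

lemma act_F_diff:
  assumes "g \<in> K" "f \<in> carrier F" "h \<in> carrier F"
  shows "act F g (\<lambda>y. f y - h y) = (\<lambda>y. act F g f y - act F g h y)"
  unfolding act_F[OF assms(1) F_diff[OF assms(2,3)]] act_F[OF assms(1,2)] act_F[OF assms(1,3)]
  using field_aut_add[OF aut_K[OF assms(1)]] field_aut_minus[OF aut_K[OF assms(1)]]
  by (auto simp: fun_eq_iff diff_conv_add_uminus simp del: add_uminus_conv_diff)

lemma act_F_scale:
  assumes "g \<in> K" "f \<in> carrier F"
  shows "act F g (\<lambda>y. c * f y) = (\<lambda>y. snd g c * act F g f y)"
  unfolding act_F[OF assms(1) fsubspace_scale[OF fsubspace_F assms(2)]] act_F[OF assms]
  using field_aut_mult[OF aut_K[OF assms(1)]] by (auto simp: fun_eq_iff)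

text \<open>The group carries relations to relations, with \<open>c\<close> replaced by
  \<open>snd g c\<close>. For tensor products stability came with the description as a kernel; here
  it has to be seen on the generators.\<close>

lemma submodule_S: "submodule S R F"
proof -
  have lS: "F.l_submodule S" using S(1,3) by (simp add: l_submodule_F)
  have "act F g f \<in> S" if g: "g \<in> K" and f: "f \<in> S" for g f
  proof -
    let ?T = "{f \<in> carrier F. act F g f \<in> S}"
    have "fsubspace ?T"
      unfolding fsubspace_def
    proof (intro conjI ballI allI)
      show "(\<lambda>_. 0) \<in> ?T"
        using F.act_0[OF g] fsubspace_0[OF S(1)] fsubspace_0[OF fsubspace_F] by (simp add: free_lmod_simps(2))
    next
      fix f h assume fh: "f \<in> ?T" "h \<in> ?T"
      then have "act F g (\<lambda>y. f y + h y) = (\<lambda>y. act F g f y + act F g h y)"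
        using F.act_add[OF g, of f h] by (simp add: free_lmod_simps(3))
      then show "(\<lambda>y. f y + h y) \<in> ?T" using fh fsubspace_add[OF S(1)] fsubspace_add[OF fsubspace_F] by simp
    next
      fix c f assume f: "f \<in> ?T"
      then show "(\<lambda>y. c * f y) \<in> ?T"
        using fsubspace_scale[OF S(1)] fsubspace_scale[OF fsubspace_F] by (simp add: act_F_scale[OF g])
    qed
    moreover have "exterior_relations m M \<subseteq> ?T"
    proof
      fix r assume r: "r \<in> exterior_relations m M"
      have gX: "map (act M g) us \<in> X" if "us \<in> X" for us using p_closed[OF g that] by (simp add: eact)
      have ad: "act F g (delta us) = delta (map (act M g) us)" if "us \<in> X" for us
        using act_delta[OF g that] by (simp add: eact)
      have "act F g r \<in> exterior_relations m M"
        using r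
      proof (cases rule: relE)
        case (1 us i u u')
        have "act F g r = (\<lambda>y. delta ((map (act M g) us)[i := act M g u \<oplus>\<^bsub>M\<^esub> act M g u']) y -
           delta ((map (act M g) us)[i := act M g u]) y - delta ((map (act M g) us)[i := act M g u']) y)"
          unfolding 1(5) using 1 g
          by (simp only: act_F_diff F_diff dF X_update M.a_closed ad map_update act_add)
        then show ?thesis using rel1[OF gX[OF 1(1)] 1(2) act_closed[OF g 1(3)] act_closed[OF g 1(4)]] by simp
      next
        case (2 us i c u)
        have "act F g r = (\<lambda>y. delta ((map (act M g) us)[i := scal M (snd g c) (act M g u)]) y -
           snd g c * delta ((map (act M g) us)[i := act M g u]) y)"
          unfolding 2(4) using 2 g
          by (simp only: act_F_diff act_F_scale fsubspace_scale[OF fsubspace_F] dF X_update scal_closed ad map_update act_scal)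
        then show ?thesis using rel2[OF gX[OF 2(1)] 2(2) act_closed[OF g 2(3)]] by simp
      next
        case (3 us i j)
        have "map (act M g) us ! i = map (act M g) us ! j" using 3 by simp
        then show ?thesis unfolding 3(5) ad[OF 3(1)] using rel3[OF gX[OF 3(1)] 3(2,3)] by simp
      qed
      then show "r \<in> ?T" using r relations_F S(2) by blast
    qed
    ultimately have "S \<subseteq> ?T" by (intro S(4)) auto
    then show ?thesis using f by blast
  qed
  then show ?thesis using lS unfolding F.submodule_iff F.l_submodule_iff by blast
qed

lemma skew_module_exterior: "skew_module K (exterior_power K m M)"
  using quotient_lmod_submodule(1)[OF F.left_module_axioms submodule_S]
  by (simp add: exterior_eq skew_module_def skew_axioms)

lemma S_add: "us \<in> X \<Longrightarrow> i < m \<Longrightarrow> u \<in> carrier M \<Longrightarrow> u' \<in> carrier M \<Longrightarrow>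
    mod_eq S (delta (us[i := u \<oplus>\<^bsub>M\<^esub> u'])) (\<lambda>y. delta (us[i := u]) y + delta (us[i := u']) y)"
  unfolding mod_eq_def diff_diff_add[symmetric] by (rule subsetD[OF S(2) rel1])

lemma S_scal: "us \<in> X \<Longrightarrow> i < m \<Longrightarrow> u \<in> carrier M \<Longrightarrow>
    mod_eq S (delta (us[i := scal M c u])) (\<lambda>y. c * delta (us[i := u]) y)"
  unfolding mod_eq_def by (rule subsetD[OF S(2) rel2])

lemma S_sum:
  assumes "us \<in> X" "i < m" "finite A" "\<And>j. j \<in> A \<Longrightarrow> v j \<in> carrier M"
  shows "mod_eq S (delta (us[i := finsum M v A])) (\<lambda>y. \<Sum>j\<in>A. delta (us[i := v j]) y)"
  using assms(3,4)
proof (induction A)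
  case empty
  have "mod_eq S (delta (us[i := scal M 0 \<zero>\<^bsub>M\<^esub>])) (\<lambda>y. 0 * delta (us[i := \<zero>\<^bsub>M\<^esub>]) y)"
    by (rule S_scal[OF assms(1,2) M.zero_closed])
  then show ?case by simp
next
  case (insert a A)
  have c: "finsum M v A \<in> carrier M" "v a \<in> carrier M" using insert by (auto intro!: M.finsum_closed)
  have "mod_eq S (delta (us[i := v a \<oplus>\<^bsub>M\<^esub> finsum M v A])) (\<lambda>y. delta (us[i := v a]) y + delta (us[i := finsum M v A]) y)"
    by (rule S_add[OF assms(1,2) c(2,1)])
  moreover have "mod_eq S (\<lambda>y. delta (us[i := v a]) y + delta (us[i := finsum M v A]) y)
    (\<lambda>y. delta (us[i := v a]) y + (\<Sum>j\<in>A. delta (us[i := v j]) y))"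
    by (rule mod_eq_add[OF S(1) mod_eq_refl[OF S(1)] insert.IH]) (use insert in auto)
  ultimately have "mod_eq S (delta (us[i := v a \<oplus>\<^bsub>M\<^esub> finsum M v A])) (\<lambda>y. delta (us[i := v a]) y + (\<Sum>j\<in>A. delta (us[i := v j]) y))"
    by (rule mod_eq_trans[OF S(1)])
  then show ?case using insert by (simp add: Pi_def)
qed

text \<open>Multilinearity modulo \<open>S\<close> replaces the entries of a list by basis vectors,
  one slot at a time. \<open>T\<close> is any subspace above \<open>S\<close>: once the preimage of
  a subspace of the quotient, once the multiples of a fixed wedge modulo \<open>S\<close>.\<close>

lemma exterior_generated:
  assumes I: "finite I" and e: "\<And>j. e j \<in> carrier M"
    and coord: "\<And>u. u \<in> carrier M \<Longrightarrow> finsum M (\<lambda>i. scal M (\<psi> u i) (e i)) I = u"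
    and T: "fsubspace T" "S \<subseteq> T" and basis: "\<And>ps. length ps = m \<Longrightarrow> set ps \<subseteq> I \<Longrightarrow> delta (map e ps) \<in> T"
  shows "carrier F \<subseteq> T"
proof (rule free_lmod_induct[OF T(1)])
  \<comment> \<open>Slots below \<open>k\<close> are still arbitrary, all later slots already hold
    basis vectors; \<open>k = m\<close> is the claim for arbitrary lists.\<close>
  have "k \<le> m \<Longrightarrow> us \<in> X \<Longrightarrow> \<forall>i<m. k \<le> i \<longrightarrow> us ! i \<in> e ` I \<Longrightarrow> delta us \<in> T" for k us
  proof (induction k arbitrary: us)
    case 0
    then have "set us \<subseteq> e ` I" by (auto simp: set_conv_nth)
    then have "map e (map (inv_into I e) us) = us"
      unfolding map_map by (intro map_idI) (auto simp: f_inv_into_f)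
    moreover have "set (map (inv_into I e) us) \<subseteq> I"
      using \<open>set us \<subseteq> e ` I\<close> by (auto intro!: inv_into_into)
    ultimately show ?case using basis[of "map (inv_into I e) us"] 0 by simp
  next
    case (Suc k)
    then have k: "k < m" "k \<le> m" by auto
    have uk: "us ! k \<in> carrier M" using Suc.prems k by (auto simp: subset_iff)
    have uE: "us[k := e j] \<in> X" for j by (rule X_update[OF Suc.prems(2) e])
    have "mod_eq S (delta (us[k := finsum M (\<lambda>i. scal M (\<psi> (us ! k) i) (e i)) I]))
      (\<lambda>y. \<Sum>j\<in>I. delta (us[k := scal M (\<psi> (us ! k) j) (e j)]) y)"
      by (rule S_sum[OF Suc.prems(2) k(1) I]) (use e in auto)
    then have 1: "mod_eq S (delta us) (\<lambda>y. \<Sum>j\<in>I. delta (us[k := scal M (\<psi> (us ! k) j) (e j)]) y)"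
      by (simp add: coord[OF uk])
    have 2: "mod_eq S (\<lambda>y. \<Sum>j\<in>I. delta (us[k := scal M (\<psi> (us ! k) j) (e j)]) y)
      (\<lambda>y. \<Sum>j\<in>I. \<psi> (us ! k) j * delta (us[k := e j]) y)"
      by (rule mod_eq_sum[OF S(1)], rule S_scal[OF Suc.prems(2) k(1) e])
    have 3: "(\<lambda>y. \<Sum>j\<in>I. \<psi> (us ! k) j * delta (us[k := e j]) y) \<in> T"
    proof (rule fsubspace_sum[OF T(1)], rule fsubspace_scale[OF T(1)])
      fix j assume j: "j \<in> I"
      show "delta (us[k := e j]) \<in> T"
        by (rule Suc.IH[OF k(2) uE]) (use Suc.prems j k in \<open>auto simp: nth_list_update\<close>)
    qed
    from mod_eq_trans[OF S(1) 1 2] have "mod_eq T (delta us) (\<lambda>y. \<Sum>j\<in>I. \<psi> (us ! k) j * delta (us[k := e j]) y)"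
      unfolding mod_eq_def using T(2) by blast
    then show ?case by (rule mod_eq_mem[OF T(1) _ 3])
  qed
  from this[of m] show "delta us \<in> T" if "us \<in> X" for us using that by simp
qed

lemma S_coset: "f \<in> S \<Longrightarrow> S +>\<^bsub>F\<^esub> f = \<zero>\<^bsub>quotient_lmod F S\<^esub>"
proof -
  interpret abelian_subgroup S F
    by (rule abelian_subgroupI3) (use submodule_S in \<open>simp_all add: F.M.abelian_group_axioms additive_subgroup_def submodule_def\<close>)
  show "f \<in> S \<Longrightarrow> ?thesis" using a_rcos_const by (simp add: quotient_lmod_def)
qed

text \<open>The wedges of basis vectors generate, and there are finitely many lists of length
  \<open>m\<close> over \<open>I\<close>. Finite generation is all that \<open>lfin_basis\<close>
  asks for.\<close>

lemma lfin_exterior: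
  assumes I: "finite I" and \<rho>: "cocycle K I \<rho>" and iso: "lmod_iso R M (tmod I \<rho> lfield)"
  shows "lfin (exterior_power K m M)"
proof -
  let ?Q = "quotient_lmod F S" and ?\<pi> = "\<lambda>f. S +>\<^bsub>F\<^esub> f"
  interpret Q: skew_module K ?Q using skew_module_exterior by (simp add: exterior_eq)
  from tmod_unit_vectors[OF I \<rho> iso] obtain \<psi> and e :: "_ \<Rightarrow> 'b" where *:
    "\<psi> \<in> lhom R M (tmod I \<rho> lfield) \<and> bij_betw \<psi> (carrier M) (carrier (tmod I \<rho> lfield)) \<and>
    (\<forall>j. e j \<in> carrier M) \<and> (\<forall>j. \<psi> (e j) = (\<lambda>i\<in>I. if i = j then 1 else 0)) \<and>
    (\<forall>u\<in>carrier M. finsum M (\<lambda>i. scal M (\<psi> u i) (e i)) I = u)" by iprover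
  have e: "e j \<in> carrier M" for j using * by simp
  have coord: "finsum M (\<lambda>i. scal M (\<psi> u i) (e i)) I = u" if "u \<in> carrier M" for u using * that by simp
  note \<pi> = quotient_lmod_submodule[OF F.left_module_axioms submodule_S]
  have \<pi>': "?\<pi> \<in> lhom (skew_group_ring {semilin_one}) F ?Q"
    by (rule skew_lhomI[OF F.l_module Q.l_module])
       (auto simp: lhomD[OF \<pi>(2)] lhom_scal[OF skew_axioms \<pi>(2)])
  let ?B = "(\<lambda>ps. ?\<pi> (delta (map e ps))) ` {ps. set ps \<subseteq> I \<and> length ps = m}"
  show ?thesis
    unfolding lfin_def exterior_eq
  proof (intro exI[of _ ?B] conjI allI impI)
    show "finite ?B" using finite_lists_length_eq[OF I] by simp
    have mX: "map e ps \<in> X" if "length ps = m" for ps using that e by auto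
    then show "?B \<subseteq> carrier ?Q" using lhom_closed[OF \<pi>(2) dF] by auto
    fix N assume N: "Q.l_submodule N \<and> ?B \<subseteq> N"
    have "F.l_submodule {f \<in> carrier F. ?\<pi> f \<in> N}"
      by (rule submodule_vimage[OF _ _ \<pi>'])
         (use N F.l_module Q.l_module in \<open>auto simp: skew_module_def\<close>)
    then have T: "fsubspace {f \<in> carrier F. ?\<pi> f \<in> N}" by (simp add: l_submodule_F)
    have "\<zero>\<^bsub>?Q\<^esub> \<in> N" using N submodule_zero by blast
    then have ST: "S \<subseteq> {f \<in> carrier F. ?\<pi> f \<in> N}" using S(3) S_coset by auto
    have "carrier F \<subseteq> {f \<in> carrier F. ?\<pi> f \<in> N}"
    proof (rule exterior_generated[OF I e coord T ST])
      fix ps assume "length ps = m" "set ps \<subseteq> I"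
      then show "delta (map e ps) \<in> {f \<in> carrier F. ?\<pi> f \<in> N}" using N dF[OF mX] by blast
    qed
    then have "?\<pi> f \<in> N" if "f \<in> carrier F" for f using that by blast
    then have "carrier ?Q \<subseteq> N" unfolding \<pi>(3)[symmetric] by (rule image_subsetI)
    moreover have "N \<subseteq> carrier ?Q" using N by (intro submodule_subset) (rule conjunct1)
    ultimately show "N = carrier ?Q" by (rule equalityI[rotated])
  qed
qed

text \<open>Expand the vanishing wedge with the sum of \<open>a\<close> and \<open>b\<close> in both
  slots; the terms with equal entries vanish, so the two mixed ones cancel. This form is valid in
  characteristic 2 as well.\<close>

lemma S_swap:
  assumes us: "us \<in> X" and ij: "i < j" "j < m" and a: "a \<in> carrier M" "b \<in> carrier M"
  shows "mod_eq S (delta (us[i := a, j := b])) (\<lambda>y. - 1 * delta (us[i := b, j := a]) y)"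
proof -
  have im: "i < m" "i \<noteq> j" "j \<noteq> i" using ij by auto
  let ?d = "\<lambda>u v. delta (us[i := u, j := v])"
  have X: "us[i := u] \<in> X" "us[j := u] \<in> X" if "u \<in> carrier M" for u using X_update[OF us that] by auto
  have ab: "a \<oplus>\<^bsub>M\<^esub> b \<in> carrier M" using a by simp
  have eq0: "?d u u \<in> S" if "u \<in> carrier M" for u
    by (rule subsetD[OF S(2)], rule rel3[OF X_update[OF X(1)[OF that] that] ij]) (use us im ij in auto)
  have 1: "mod_eq S (?d (a \<oplus>\<^bsub>M\<^esub> b) (a \<oplus>\<^bsub>M\<^esub> b)) (\<lambda>y. ?d a (a \<oplus>\<^bsub>M\<^esub> b) y + ?d b (a \<oplus>\<^bsub>M\<^esub> b) y)"
    using S_add[OF X(2)[OF ab] im(1) a] by (simp add: list_update_swap[OF im(2)])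
  have 2: "mod_eq S (?d u (a \<oplus>\<^bsub>M\<^esub> b)) (\<lambda>y. ?d u a y + ?d u b y)" if "u \<in> carrier M" for u
    by (rule S_add[OF X(1)[OF that] ij(2) a])
  have 3: "mod_eq S (?d (a \<oplus>\<^bsub>M\<^esub> b) (a \<oplus>\<^bsub>M\<^esub> b)) (\<lambda>y. (?d a a y + ?d a b y) + (?d b a y + ?d b b y))"
    by (rule mod_eq_trans[OF S(1) 1 mod_eq_add[OF S(1) 2[OF a(1)] 2[OF a(2)]]])
  have "(\<lambda>y. (?d a a y + ?d a b y) + (?d b a y + ?d b b y)) \<in> S"
    using mod_eq_mem[OF S(1) mod_eq_sym[OF S(1) 3] eq0[OF ab]] .
  then have "(\<lambda>y. ((?d a a y + ?d a b y) + (?d b a y + ?d b b y)) - (?d a a y + ?d b b y)) \<in> S"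
    by (rule fsubspace_diff[OF S(1) _ fsubspace_add[OF S(1) eq0[OF a(1)] eq0[OF a(2)]]])
  moreover have "(\<lambda>y. ((?d a a y + ?d a b y) + (?d b a y + ?d b b y)) - (?d a a y + ?d b b y)) =
    (\<lambda>y. ?d a b y - (- 1 * ?d b a y))" by (simp add: fun_eq_iff)
  ultimately show ?thesis unfolding mod_eq_def by simp
qed

end

section \<open>The top exterior power and the determinant\<close>

lemma field_aut_det:
  assumes \<sigma>: "field_aut \<sigma>"
  shows "det (map_matrix \<sigma> (A :: 'l::field^'d^'d)) = \<sigma> (det A)"
proof -
  have p: "\<sigma> (prod f B) = (\<Prod>i\<in>B. \<sigma> (f i))" for f and B :: "'d set"
    by (induction B rule: infinite_finite_induct) (auto simp: field_aut_1[OF \<sigma>] field_aut_mult[OF \<sigma>])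
  have s: "\<sigma> (of_int (sign q)) = of_int (sign q)" for q :: "'d \<Rightarrow> 'd"
    by (simp add: sign_def field_aut_1[OF \<sigma>] field_aut_minus[OF \<sigma>])
  show ?thesis unfolding det_def by (simp add: field_aut_sum[OF \<sigma>] field_aut_mult[OF \<sigma>] p s)
qed

definition cmat :: "('g \<Rightarrow> 'd::finite \<Rightarrow> 'd \<Rightarrow> 'l) \<Rightarrow> 'g \<Rightarrow> 'l^'d^'d"
  where "cmat \<rho> g = (\<chi> i j. \<rho> g i j)"

text \<open>Determinants are multiplicative and commute with field automorphisms. Indexing by
  \<open>{()}\<close> makes the character a one-dimensional cocycle to which \<open>tmod\<close>
  applies.\<close>

lemma cocycle_det:
  assumes K: "skew K" and \<rho>: "cocycle K UNIV (\<rho> :: ('l::field, 'd::finite) semilin \<Rightarrow> 'e::finite \<Rightarrow> 'e \<Rightarrow> 'l)"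
  shows "cocycle K {()} (\<lambda>g _ _. det (cmat \<rho> g))"
proof -
  interpret skew K by fact
  have 1: "cmat \<rho> semilin_one = mat 1" using \<rho> by (simp add: cocycle_def cmat_def mat_def)
  have 2: "cmat \<rho> (semilin_mult g h) = cmat \<rho> g ** map_matrix (snd g) (cmat \<rho> h)" if "g \<in> K" "h \<in> K" for g h
    using \<rho> that by (simp add: cocycle_def cmat_def matrix_matrix_mult_def vec_eq_iff)
  show ?thesis
    unfolding cocycle_def by (simp add: 1 2 det_mul field_aut_det[OF aut_K])
qed

text \<open>A list of vectors goes to the determinant of its coordinate matrix, which kills the
  relations. Conversely a list of basis vectors is, modulo \<open>S\<close>, zero or the standard
  wedge up to sign; so every element is a multiple of the standard wedge, and the determinant
  detects the factor.\<close>

theorem (in skew_module) exterior_top: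
  fixes \<rho> :: "('l, 'd) semilin \<Rightarrow> 'e::finite \<Rightarrow> 'e \<Rightarrow> 'l"
  assumes \<rho>: "cocycle K UNIV \<rho>" and iso: "lmod_iso R M (tmod UNIV \<rho> lfield)"
  shows "lmod_iso R (exterior_power K CARD('e) M) (tmod {()} (\<lambda>g _ _. det (cmat \<rho> g)) lfield)"
proof -
  define m where "m = CARD('e)"
  interpret E: ext_power K M m by unfold_locales
  interpret l: skew_module K lfield by (rule skew_module_lfield)
  let ?\<chi> = "\<lambda>g _ _. det (cmat \<rho> g)"
  let ?P = "tmod {()} ?\<chi> lfield"
  have \<chi>: "cocycle K {()} ?\<chi>" by (rule cocycle_det[OF skew_axioms \<rho>])
  have P: "skew_module K ?P" by (rule l.skew_module_tmod[OF _ \<chi>]) simp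
  interpret P: skew_module K ?P by (rule P)
  let ?L = "tmod UNIV \<rho> lfield"
  from tmod_unit_vectors[OF _ \<rho> iso] obtain \<psi> and e :: "'e \<Rightarrow> 'b" where *:
    "\<psi> \<in> lhom R M ?L \<and> bij_betw \<psi> (carrier M) (carrier ?L) \<and>
    (\<forall>j. e j \<in> carrier M) \<and> (\<forall>j. \<psi> (e j) = (\<lambda>i\<in>UNIV. if i = j then 1 else 0)) \<and>
    (\<forall>u\<in>carrier M. finsum M (\<lambda>i. scal M (\<psi> u i) (e i)) UNIV = u)" using finite_class.finite_UNIV by iprover
  have \<psi>: "\<psi> \<in> lhom R M ?L" using * by simp
  have e: "e j \<in> carrier M" "\<psi> (e j) i = (if i = j then 1 else 0)" for i j using * by simp_all
  have coord: "finsum M (\<lambda>i. scal M (\<psi> u i) (e i)) UNIV = u" if "u \<in> carrier M" for u using * that by simp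
  note \<psi>D = lhomD[OF \<psi>] lhom_scal[OF skew_axioms \<psi>] lhom_act[OF skew_axioms \<psi>]
  \<comment> \<open>Wedges are ordered lists while the index type carries no order:
    \<open>js\<close> fixes one, and \<open>b\<close> will be its inverse.\<close>
  obtain js :: "'e list" where js: "set js = UNIV" "distinct js" using finite_distinct_list[of "UNIV :: 'e set"] by auto
  have ljs: "length js = m" using distinct_card[OF js(2)] js(1) by (simp add: m_def)
  define b where "b j = (THE n. n < m \<and> js ! n = j)" for j
  have b: "b j < m \<and> js ! b j = j" for j
  proof -
    have "\<exists>!n. n < m \<and> js ! n = j"
      using js ljs by (metis UNIV_I distinct_Ex1)
    then show ?thesis unfolding b_def by (rule theI')
  qed
  have b_js: "b (js ! n) = n" if "n < m" for n    using nth_eq_iff_index_eq[OF js(2), of "b (js ! n)" n] b[of "js ! n"] ljs that by simp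
  \<comment> \<open>Row \<open>j\<close> holds the coordinates of the entry at position
    \<open>b j\<close>, so that changing one entry changes exactly one row.\<close>
  define A :: "'b list \<Rightarrow> 'l^'e^'e" where "A us = (\<chi> j. \<chi> i. \<psi> (us ! b j) i)" for us
  define \<phi> where "\<phi> us = (\<lambda>_\<in>{()}. det (A us))" for us
  have \<phi>P: "\<phi> us \<in> carrier ?P" for us by (simp add: \<phi>_def tmod_simps lfield_simps)
  have usM: "us ! b j \<in> carrier M" if "us \<in> E.X" for us j using that b[of j] by (auto simp: subset_iff)
  have A_upd: "A (us[n := u]) = (\<chi> j. if j = js ! n then (\<chi> i. \<psi> u i) else (\<chi> i. \<psi> (us ! b j) i))"
    if "us \<in> E.X" "n < m" for us n u
  proof -
    have "us[n := u] ! b j = (if j = js ! n then u else us ! b j)" for j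
      using that b[of j] b_js[OF that(2)] by (cases "b j = n") auto
    then show ?thesis unfolding A_def by (auto simp: vec_eq_iff)
  qed
  have eqv: "\<phi> (E.eact g us) = act ?P g (\<phi> us)" if g: "g \<in> K" and us: "us \<in> E.X" for g us
  proof -
    \<comment> \<open>Vectors are stored as rows but the cocycle acts on columns, hence the
      transpose; the determinant does not see it.\<close>
    have "A (map (act M g) us) = map_matrix (snd g) (A us) ** transpose (cmat \<rho> g)"
    proof -
      have "\<psi> (map (act M g) us ! b j) i = (\<Sum>k\<in>UNIV. \<rho> g i k * snd g (\<psi> (us ! b j) k))" for i j
      proof -
        have "map (act M g) us ! b j = act M g (us ! b j)" using us b[of j] by simp
        then show ?thesis
          using \<psi>D(5)[OF usM[OF us] g] l.act_tmod[OF g \<psi>D(1)[OF usM[OF us]]]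
          by (simp add: finsum_lfield scal_lfield act_lfield)
      qed
      then show ?thesis
        by (simp add: A_def vec_eq_iff matrix_matrix_mult_def transpose_def cmat_def mult.commute)
    qed
    then have "det (A (map (act M g) us)) = snd g (det (A us)) * det (cmat \<rho> g)"
      by (simp add: det_mul field_aut_det[OF aut_K[OF g]])
    then show ?thesis
      unfolding l.act_tmod[OF g \<phi>P] E.eact
      by (simp add: \<phi>_def finsum_lfield scal_lfield act_lfield mult.commute)
  qed
  let ?\<Phi> = "E.lin ?P \<phi>"
  have \<Phi>: "?\<Phi> \<in> lhom R E.F ?P" by (rule E.lin_lhom[OF P \<phi>P eqv])
  have lin: "f \<in> carrier E.F \<Longrightarrow> g \<in> carrier E.F \<Longrightarrow> ?\<Phi> (\<lambda>y. f y + g y) = ?\<Phi> f \<oplus>\<^bsub>?P\<^esub> ?\<Phi> g"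
    "f \<in> carrier E.F \<Longrightarrow> ?\<Phi> (\<lambda>y. c * f y) = scal ?P c (?\<Phi> f)"
    "f \<in> carrier E.F \<Longrightarrow> g \<in> carrier E.F \<Longrightarrow> ?\<Phi> (\<lambda>y. f y - g y) = ?\<Phi> f \<ominus>\<^bsub>?P\<^esub> ?\<Phi> g"
    "us \<in> E.X \<Longrightarrow> ?\<Phi> (delta us) = \<phi> us"
    and ker: "fsubspace {f \<in> carrier E.F. ?\<Phi> f = \<zero>\<^bsub>?P\<^esub>}" for f g c us
    using E.lin_add[of ?P \<phi> f g] E.lin_scale[of ?P \<phi> f c] E.lin_diff[of ?P \<phi> f g] E.lin_delta[of ?P \<phi> us]
      E.lin_kernel_fsubspace[of ?P \<phi>] P \<phi>P by blast+
  have Pval: "scal ?P c x () = c * x ()" "(x \<ominus>\<^bsub>?P\<^esub> y) () = x () - y ()" "\<zero>\<^bsub>?P\<^esub> () = 0"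
    if "x \<in> carrier ?P" "y \<in> carrier ?P" for c x y
  proof -
    show s: "scal ?P c x () = c * x ()" for c
      using that by (simp add: l.scal_tmod[OF _ \<chi>] scal_lfield)
    have "(x \<ominus>\<^bsub>?P\<^esub> y) () = (x \<oplus>\<^bsub>?P\<^esub> scal ?P (- 1) y) ()" using that by (simp add: P.scal_minus_1 a_minus_def)
    also have "\<dots> = x () + - 1 * y ()"
      using that by (simp add: l.scal_tmod[OF _ \<chi>] scal_lfield tmod_simps lfield_simps)
    finally show "(x \<ominus>\<^bsub>?P\<^esub> y) () = x () - y ()" by simp
    show "\<zero>\<^bsub>?P\<^esub> () = 0" by (simp add: tmod_simps lfield_simps)
  qed
  have Peq: "x = y \<longleftrightarrow> x () = y ()" if "x \<in> carrier ?P" "y \<in> carrier ?P" for x y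
    using that by (auto simp: tmod_simps fun_eq_iff PiE_iff extensional_def)
  have \<Phi>P: "?\<Phi> f \<in> carrier ?P" if "f \<in> carrier E.F" for f by (rule lhom_closed[OF \<Phi> that])
  have \<Phi>s: "?\<Phi> (\<lambda>y. c * f y) () = c * ?\<Phi> f ()" "?\<Phi> (\<lambda>y. f y - g y) () = ?\<Phi> f () - ?\<Phi> g ()"
    if "f \<in> carrier E.F" "g \<in> carrier E.F" for c f g
    unfolding lin(2)[OF that(1)] lin(3)[OF that] using Pval(1,2)[OF \<Phi>P[OF that(1)] \<Phi>P[OF that(2)]] by simp_all
  have \<Phi>d: "?\<Phi> (delta us) () = det (A us)" if "us \<in> E.X" for us
    by (simp add: lin(4)[OF that] \<phi>_def)
  have \<Phi>0: "?\<Phi> f = \<zero>\<^bsub>?P\<^esub> \<longleftrightarrow> ?\<Phi> f () = 0" if "f \<in> carrier E.F" for f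
    using Peq[OF \<Phi>P[OF that] P.M.zero_closed] Pval(3)[OF P.M.zero_closed P.M.zero_closed] by simp
  have dupd: "delta (us[i := u]) \<in> carrier E.F" if "us \<in> E.X" "u \<in> carrier M" for us i u
    by (rule E.dF[OF E.X_update[OF that]])
  have S_ker1: "E.S \<subseteq> {f \<in> carrier E.F. ?\<Phi> f = \<zero>\<^bsub>?P\<^esub>}"
  proof (rule E.S(4)[OF ker])
    show "exterior_relations m M \<subseteq> {f \<in> carrier E.F. ?\<Phi> f = \<zero>\<^bsub>?P\<^esub>}"
    proof
      fix r assume r: "r \<in> exterior_relations m M"
      have rF: "r \<in> carrier E.F" using r E.relations_F by blast
      have "?\<Phi> r () = 0"
        using r
      proof (cases rule: E.relE)
        case (1 us i u u')
        note uu = 1(3,4) M.a_closed[OF 1(3,4)]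
        have "(\<chi> i. \<psi> (u \<oplus>\<^bsub>M\<^esub> u') i) = (\<chi> i. \<psi> u i) + (\<chi> i. \<psi> u' i)"
          by (simp add: vec_eq_iff \<psi>D(2)[OF 1(3,4)] tmod_simps lfield_simps)
        then have "det (A (us[i := u \<oplus>\<^bsub>M\<^esub> u'])) = det (A (us[i := u])) + det (A (us[i := u']))"
          unfolding A_upd[OF 1(1,2)] by (simp only: det_row_add)
        then show ?thesis
          unfolding 1(5) using E.X_update[OF 1(1)] uu
          by (simp add: \<Phi>s E.F_diff dupd[OF 1(1)] \<Phi>d)
      next
        case (2 us i c u)
        have "(\<chi> i. \<psi> (scal M c u) i) = c *s (\<chi> i. \<psi> u i)"
          by (simp add: vec_eq_iff \<psi>D(4)[OF 2(3)] l.scal_tmod[OF finite_class.finite_UNIV \<rho> \<psi>D(1)[OF 2(3)]] scal_lfield)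
        then have "det (A (us[i := scal M c u])) = c * det (A (us[i := u]))"
          unfolding A_upd[OF 2(1,2)] by (simp only: det_row_mul)
        then show ?thesis
          unfolding 2(4) using E.X_update[OF 2(1)] 2(3)
          by (simp add: \<Phi>s(2) \<Phi>s(1)[OF dupd[OF 2(1,3)] dupd[OF 2(1,3)]] fsubspace_scale[OF E.fsubspace_F] dupd[OF 2(1)] \<Phi>d)
      next
        case (3 us i j)
        have "js ! i \<noteq> js ! j" using 3(2,3) js(2) ljs by (simp add: nth_eq_iff_index_eq)
        moreover have "row (js ! i) (A us) = row (js ! j) (A us)"
          using 3 by (simp add: row_def A_def b_js)
        ultimately have "det (A us) = 0" by (rule det_identical_rows)
        then show ?thesis unfolding 3(5) by (simp add: \<Phi>d[OF 3(1)])
      qed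
      then show "r \<in> {f \<in> carrier E.F. ?\<Phi> f = \<zero>\<^bsub>?P\<^esub>}" using rF \<Phi>0 by simp
    qed
  qed auto
  let ?u = "map e js"
  have mX: "map e ps \<in> E.X" if "length ps = m" for ps using that e(1) by auto
  have uX: "?u \<in> E.X" by (rule mX[OF ljs])
  have det_u: "det (A ?u) = 1"
  proof -
    have "A ?u = mat 1" using b ljs by (auto simp: A_def mat_def vec_eq_iff e(2))
    then show ?thesis by simp
  qed
  \<comment> \<open>The multiples of the standard wedge modulo \<open>S\<close>; the goal is that
    this is everything.\<close>
  let ?T = "{f. \<exists>c. mod_eq E.S f (\<lambda>y. c * delta ?u y)}"
  note S1 = E.S(1)
  have T: "fsubspace ?T"
    unfolding fsubspace_def
  proof (intro conjI ballI allI)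
    show "(\<lambda>_. 0) \<in> ?T" using mod_eq_refl[OF S1, of "\<lambda>_. 0"] by (auto intro!: exI[of _ 0])
  next
    fix f g assume "f \<in> ?T" "g \<in> ?T"
    then obtain c c' where "mod_eq E.S f (\<lambda>y. c * delta ?u y)" "mod_eq E.S g (\<lambda>y. c' * delta ?u y)" by blast
    from mod_eq_add[OF S1 this] have "mod_eq E.S (\<lambda>y. f y + g y) (\<lambda>y. (c + c') * delta ?u y)"
      by (simp add: distrib_right)
    then show "(\<lambda>y. f y + g y) \<in> ?T" by blast
  next
    fix a f assume "f \<in> ?T"
    then obtain c where "mod_eq E.S f (\<lambda>y. c * delta ?u y)" by blast
    from mod_eq_scale[OF S1 this, of a] have "mod_eq E.S (\<lambda>y. a * f y) (\<lambda>y. (a * c) * delta ?u y)"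
      by (simp add: mult.assoc)
    then show "(\<lambda>y. a * f y) \<in> ?T" by blast
  qed
  have ST: "E.S \<subseteq> ?T"
  proof
    fix f assume "f \<in> E.S"
    then have "mod_eq E.S f (\<lambda>y. 0 * delta ?u y)" by (simp add: mod_eq_def)
    then show "f \<in> ?T" by blast
  qed
  \<comment> \<open>Sorting by transpositions: exchanging the entries at \<open>i\<close> and
    \<open>k\<close> puts \<open>js ! i\<close> into its place, misplaces nothing, and costs a sign
    by \<open>S_swap\<close>. The induction is on the number of misplaced positions.\<close>
  have perm: "delta (map e ps) \<in> ?T" if "length ps = m" "distinct ps" for ps
    using that
  proof (induction "card {i. i < m \<and> ps ! i \<noteq> js ! i}" arbitrary: ps rule: less_induct)
    case less
    show ?case
    proof (cases "\<forall>i<m. ps ! i = js ! i")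
      case True
      then have "ps = js" using less.prems ljs by (intro nth_equalityI) auto
      then have "mod_eq E.S (delta (map e ps)) (\<lambda>y. 1 * delta ?u y)" using mod_eq_refl[OF S1] by simp
      then show ?thesis by blast
    next
      case False
      then obtain i where i: "i < m" "ps ! i \<noteq> js ! i" by blast
      have "set ps = UNIV"
        using less.prems by (metis card_subset_eq distinct_card finite_class.finite_UNIV m_def subset_UNIV)
      then obtain k where k: "k < m" "ps ! k = js ! i" using less.prems(1) by (metis UNIV_I in_set_conv_nth)
      have ik: "i \<noteq> k" using i k by auto
      define qs where "qs = ps[i := ps ! k, k := ps ! i]"
      have qs: "length qs = m" using less.prems by (simp add: qs_def)
      have "distinct qs"
        unfolding qs_def by (subst distinct_swap) (use less.prems i(1) k(1) in simp_all)
      have "{n. n < m \<and> qs ! n \<noteq> js ! n} \<subset> {n. n < m \<and> ps ! n \<noteq> js ! n}"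
      proof
        show "{n. n < m \<and> qs ! n \<noteq> js ! n} \<subseteq> {n. n < m \<and> ps ! n \<noteq> js ! n}"
        proof
          fix n assume n: "n \<in> {n. n < m \<and> qs ! n \<noteq> js ! n}"
          have "ps ! k \<noteq> js ! k" using k(1,2) i(1) ik js(2) ljs by (simp add: nth_eq_iff_index_eq)
          moreover have "qs ! n = ps ! n" if "n \<noteq> i" "n \<noteq> k" using that by (simp add: qs_def)
          ultimately show "n \<in> {n. n < m \<and> ps ! n \<noteq> js ! n}" using n i by (cases "n = i"; cases "n = k") auto
        qed
        have "qs ! i = js ! i" using less.prems i k ik by (simp add: qs_def)
        then show "{n. n < m \<and> qs ! n \<noteq> js ! n} \<noteq> {n. n < m \<and> ps ! n \<noteq> js ! n}" using i by blast
      qed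
      then have "card {n. n < m \<and> qs ! n \<noteq> js ! n} < card {n. n < m \<and> ps ! n \<noteq> js ! n}"
        by (intro psubset_card_mono) auto
      then have q: "delta (map e qs) \<in> ?T" using less.hyps qs \<open>distinct qs\<close> by blast
      have sw: "mod_eq E.S (delta us) (\<lambda>z. - 1 * delta (us[x := us ! y, y := us ! x]) z)"
        if "us \<in> E.X" "x < y" "y < m" for us x y
      proof -
        have "mod_eq E.S (delta (us[x := us ! x, y := us ! y])) (\<lambda>z. - 1 * delta (us[x := us ! y, y := us ! x]) z)"
          by (rule E.S_swap) (use that in \<open>auto simp: subset_iff\<close>)
        then show ?thesis by simp
      qed
      have "mod_eq E.S (delta (map e ps)) (\<lambda>z. - 1 * delta (map e qs) z)"
      proof (cases "i < k")
        case True
        then show ?thesis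
          using sw[OF mX[OF less.prems(1)] True k(1)] i k less.prems(1) by (simp add: qs_def map_update)
      next
        case False
        then have ki: "k < i" using ik by simp
        show ?thesis
          using sw[OF mX[OF less.prems(1)] ki i(1)] i k ik less.prems(1)
          by (simp add: qs_def map_update list_update_swap[of i k])
      qed
      moreover have "(\<lambda>z. - 1 * delta (map e qs) z) \<in> ?T" by (rule fsubspace_scale[OF T q])
      then obtain c where "mod_eq E.S (\<lambda>z. - 1 * delta (map e qs) z) (\<lambda>z. c * delta ?u z)" by blast
      ultimately have "mod_eq E.S (delta (map e ps)) (\<lambda>z. c * delta ?u z)" by (rule mod_eq_trans[OF S1])
      then show ?thesis by blast
    qed
  qed
  have "carrier E.F \<subseteq> ?T"
  proof (rule E.exterior_generated[OF finite_class.finite_UNIV e(1) coord T ST])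
    fix ps :: "'e list" assume l: "length ps = m"
    show "delta (map e ps) \<in> ?T"
    proof (cases "distinct ps")
      case False
      then obtain i j where "i < m" "j < m" "i \<noteq> j" "ps ! i = ps ! j" using l by (auto simp: distinct_conv_nth)
      then obtain i j where ij: "i < j" "j < m" "ps ! i = ps ! j" by (metis linorder_neqE_nat)
      have "delta (map e ps) \<in> E.S"
        by (rule subsetD[OF E.S(2)], rule E.rel3[OF mX[OF l] ij(1,2)]) (use ij l in simp)
      then show ?thesis using ST by blast
    qed (rule perm[OF l])
  qed
  then have red: "\<exists>c. mod_eq E.S f (\<lambda>y. c * delta ?u y)" if "f \<in> carrier E.F" for f using that by blast
  have du: "(\<lambda>y. c * delta ?u y) \<in> carrier E.F" for c by (rule fsubspace_scale[OF E.fsubspace_F E.dF[OF uX]])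
  have \<Phi>u: "?\<Phi> (\<lambda>y. c * delta ?u y) () = c" for c using \<Phi>s(1)[OF E.dF[OF uX] E.dF[OF uX]] \<Phi>d[OF uX] det_u by simp
  have S_ker: "E.S = {f \<in> carrier E.F. ?\<Phi> f = \<zero>\<^bsub>?P\<^esub>}"
  proof (rule equalityI[OF S_ker1], rule subsetI)
    fix f assume f: "f \<in> {f \<in> carrier E.F. ?\<Phi> f = \<zero>\<^bsub>?P\<^esub>}"
    then obtain c where c: "mod_eq E.S f (\<lambda>y. c * delta ?u y)" using red by blast
    then have "(\<lambda>y. f y - c * delta ?u y) \<in> E.S" by (simp add: mod_eq_def)
    then have "?\<Phi> (\<lambda>y. f y - c * delta ?u y) () = 0" using S_ker1 \<Phi>0 by blast
    then have "c = 0" using f \<Phi>0[of f] \<Phi>s(2)[of f "\<lambda>y. c * delta ?u y"] du \<Phi>u by simp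
    then show "f \<in> E.S" using c by (simp add: mod_eq_def)
  qed
  have surj: "?\<Phi> ` carrier E.F = carrier ?P"
  proof
    show "?\<Phi> ` carrier E.F \<subseteq> carrier ?P" using \<Phi>P by blast
    show "carrier ?P \<subseteq> ?\<Phi> ` carrier E.F"
    proof
      fix x assume x: "x \<in> carrier ?P"
      have "x = ?\<Phi> (\<lambda>y. x () * delta ?u y)" using Peq[OF x \<Phi>P[OF du]] \<Phi>u by simp
      then show "x \<in> ?\<Phi> ` carrier E.F" using du by (rule image_eqI)
    qed
  qed
  show ?thesis
    unfolding m_def[symmetric] E.exterior_eq
    by (rule quotient_lmod_iso(2)[OF E.F.M.abelian_group_axioms P.left_module_axioms E.F.smult_closed \<Phi> surj S_ker])
qed

section \<open>The cotangent module\<close>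

definition ps_unit :: "'d \<Rightarrow> 'd \<Rightarrow> nat"
  where "ps_unit j = (\<lambda>i. if i = j then 1 else 0)"

definition ps_decomp :: "('d \<Rightarrow> nat) \<Rightarrow> (('d \<Rightarrow> nat) \<times> ('d \<Rightarrow> nat)) set"
  where "ps_decomp \<gamma> = {(\<alpha>, \<beta>). (\<lambda>j. \<alpha> j + \<beta> j) = \<gamma>}"

lemma finite_ps_decomp: "finite (ps_decomp (\<gamma> :: 'd::finite \<Rightarrow> nat))"
proof -
  have "finite (\<Pi>\<^sub>E j\<in>(UNIV :: 'd set). {..\<gamma> j})" by (intro finite_PiE) auto
  moreover have "ps_decomp \<gamma> \<subseteq> (\<Pi>\<^sub>E j\<in>(UNIV :: 'd set). {..\<gamma> j}) \<times> (\<Pi>\<^sub>E j\<in>(UNIV :: 'd set). {..\<gamma> j})"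
    by (auto simp: ps_decomp_def)
  ultimately show ?thesis by (meson finite_SigmaI finite_subset)
qed

lemma ps_simps:
  "carrier pow_series_ring = UNIV" "\<zero>\<^bsub>pow_series_ring\<^esub> = (\<lambda>_. 0)"
  "f \<oplus>\<^bsub>pow_series_ring\<^esub> h = (\<lambda>\<alpha>. f \<alpha> + h \<alpha>)"
  "\<one>\<^bsub>pow_series_ring\<^esub> = (\<lambda>\<alpha>. if \<alpha> = (\<lambda>_. 0) then 1 else 0)"
  by (simp_all add: pow_series_ring_def)

lemma ps_mult: "(f \<otimes>\<^bsub>pow_series_ring\<^esub> h) \<gamma> = (\<Sum>p\<in>ps_decomp \<gamma>. f (fst p) * h (snd p))"
  by (simp add: pow_series_ring_def ps_decomp_def case_prod_beta)

lemma ps_mult_comm: "f \<otimes>\<^bsub>pow_series_ring\<^esub> h = h \<otimes>\<^bsub>pow_series_ring\<^esub> (f :: ('d::finite \<Rightarrow> nat) \<Rightarrow> 'l::field)"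
  unfolding fun_eq_iff ps_mult
  by (intro allI sum.reindex_bij_witness[where i = prod.swap and j = prod.swap])
     (auto simp: ps_decomp_def mult.commute add.commute)

text \<open>Both sides are sums over triples of exponent vectors with total \<open>\<gamma>\<close>,
  grouped differently.\<close>

lemma ps_mult_assoc:
  "(f \<otimes>\<^bsub>pow_series_ring\<^esub> g) \<otimes>\<^bsub>pow_series_ring\<^esub> h =
    f \<otimes>\<^bsub>pow_series_ring\<^esub> (g \<otimes>\<^bsub>pow_series_ring\<^esub> (h :: ('d::finite \<Rightarrow> nat) \<Rightarrow> 'l::field))"
proof
  fix \<gamma>
  have "((f \<otimes>\<^bsub>pow_series_ring\<^esub> g) \<otimes>\<^bsub>pow_series_ring\<^esub> h) \<gamma> =
    (\<Sum>p\<in>ps_decomp \<gamma>. \<Sum>q\<in>ps_decomp (fst p). f (fst q) * g (snd q) * h (snd p))"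
    by (simp add: ps_mult sum_distrib_right)
  also have "\<dots> = (\<Sum>pq\<in>Sigma (ps_decomp \<gamma>) (\<lambda>p. ps_decomp (fst p)).
      f (fst (snd pq)) * g (snd (snd pq)) * h (snd (fst pq)))"
    by (subst sum.Sigma) (simp_all add: finite_ps_decomp case_prod_beta)
  also have "\<dots> = (\<Sum>pq\<in>Sigma (ps_decomp \<gamma>) (\<lambda>p. ps_decomp (snd p)).
      f (fst (fst pq)) * (g (fst (snd pq)) * h (snd (snd pq))))"
    by (rule sum.reindex_bij_witness[where
          i = "\<lambda>((\<alpha>, q), (\<beta>, \<delta>)). (((\<lambda>j. \<alpha> j + \<beta> j), \<delta>), (\<alpha>, \<beta>))" and
          j = "\<lambda>((p, \<delta>), (\<alpha>, \<beta>)). ((\<alpha>, (\<lambda>j. \<beta> j + \<delta> j)), (\<beta>, \<delta>))"])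
       (auto simp: ps_decomp_def fun_eq_iff mult.assoc, (metis add.assoc)+)
  also have "\<dots> = (\<Sum>p\<in>ps_decomp \<gamma>. \<Sum>q\<in>ps_decomp (snd p). f (fst p) * (g (fst q) * h (snd q)))"
    by (subst sum.Sigma) (simp_all add: finite_ps_decomp case_prod_beta)
  also have "\<dots> = (f \<otimes>\<^bsub>pow_series_ring\<^esub> (g \<otimes>\<^bsub>pow_series_ring\<^esub> h)) \<gamma>"
    by (simp add: ps_mult sum_distrib_left)
  finally show "((f \<otimes>\<^bsub>pow_series_ring\<^esub> g) \<otimes>\<^bsub>pow_series_ring\<^esub> h) \<gamma> = (f \<otimes>\<^bsub>pow_series_ring\<^esub> (g \<otimes>\<^bsub>pow_series_ring\<^esub> h)) \<gamma>" .
qed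

lemma ps_var_mult:
  "(ps_var j \<otimes>\<^bsub>pow_series_ring\<^esub> (h :: ('d::finite \<Rightarrow> nat) \<Rightarrow> 'l::field)) \<gamma> =
    (if \<gamma> j = 0 then 0 else h (\<gamma>(j := \<gamma> j - 1)))"
proof -
  have "(ps_var j \<otimes>\<^bsub>pow_series_ring\<^esub> h) \<gamma> = (\<Sum>p\<in>(if \<gamma> j = 0 then {} else {(ps_unit j, \<gamma>(j := \<gamma> j - 1))}). h (snd p))"
    unfolding ps_mult
  proof (rule sum.mono_neutral_cong_right[OF finite_ps_decomp])
    show "(if \<gamma> j = 0 then {} else {(ps_unit j, \<gamma>(j := \<gamma> j - 1))}) \<subseteq> ps_decomp \<gamma>"
      by (auto simp: ps_decomp_def ps_unit_def fun_eq_iff)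
    show "\<forall>p\<in>ps_decomp \<gamma> - (if \<gamma> j = 0 then {} else {(ps_unit j, \<gamma>(j := \<gamma> j - 1))}). ps_var j (fst p) * h (snd p) = 0"
    proof
      fix p assume p: "p \<in> ps_decomp \<gamma> - (if \<gamma> j = 0 then {} else {(ps_unit j, \<gamma>(j := \<gamma> j - 1))})"
      have "fst p \<noteq> ps_unit j"
      proof
        assume f: "fst p = ps_unit j"
        have "(\<lambda>i. fst p i + snd p i) = \<gamma>" using p by (auto simp: ps_decomp_def)
        then have "fst p i + snd p i = \<gamma> i" for i by (rule fun_cong)
        then have s: "(if i = j then 1 else 0) + snd p i = \<gamma> i" for i
          unfolding f ps_unit_def .
        have "\<gamma> j \<noteq> 0" using s[of j] by simp
        moreover have "snd p = \<gamma>(j := \<gamma> j - 1)"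
        proof
          fix i show "snd p i = (\<gamma>(j := \<gamma> j - 1)) i" using s[of i] by auto
        qed
        ultimately show False using p f by (cases p) auto
      qed
      then show "ps_var j (fst p) * h (snd p) = 0" by (simp add: ps_var_def ps_unit_def)
    qed
    fix p assume "p \<in> (if \<gamma> j = 0 then {} else {(ps_unit j, \<gamma>(j := \<gamma> j - 1))})"
    then show "ps_var j (fst p) * h (snd p) = h (snd p)"
      by (auto simp: ps_var_def ps_unit_def split: if_splits)
  qed
  then show ?thesis by auto
qed

lemma ps_one_mult: "\<one>\<^bsub>pow_series_ring\<^esub> \<otimes>\<^bsub>pow_series_ring\<^esub> h = (h :: ('d::finite \<Rightarrow> nat) \<Rightarrow> 'l::field)"
proof
  fix \<gamma> :: "'d \<Rightarrow> nat"
  have "(\<one>\<^bsub>pow_series_ring\<^esub> \<otimes>\<^bsub>pow_series_ring\<^esub> h) \<gamma> = (\<Sum>p\<in>{((\<lambda>_. 0 :: nat) :: 'd \<Rightarrow> nat, \<gamma>)}. h (snd p))"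
    unfolding ps_mult by (rule sum.mono_neutral_cong_right[OF finite_ps_decomp]) (auto simp: ps_decomp_def ps_simps)
  then show "(\<one>\<^bsub>pow_series_ring\<^esub> \<otimes>\<^bsub>pow_series_ring\<^esub> h) \<gamma> = h \<gamma>" by simp
qed

lemma cring_pow_series: "cring (pow_series_ring :: (('d::finite \<Rightarrow> nat) \<Rightarrow> 'l::field) ring)"
proof (rule cringI)
  show "abelian_group (pow_series_ring :: (('d \<Rightarrow> nat) \<Rightarrow> 'l) ring)"
  proof (rule abelian_groupI)
    fix f :: "('d \<Rightarrow> nat) \<Rightarrow> 'l"
    show "\<exists>g\<in>carrier pow_series_ring. g \<oplus>\<^bsub>pow_series_ring\<^esub> f = \<zero>\<^bsub>pow_series_ring\<^esub>"
      by (intro bexI[of _ "\<lambda>\<alpha>. - f \<alpha>"]) (simp_all add: ps_simps)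
  qed (simp_all add: ps_simps add_ac)
  show "comm_monoid (pow_series_ring :: (('d \<Rightarrow> nat) \<Rightarrow> 'l) ring)"
    by (rule comm_monoidI) (simp_all add: ps_simps(1) ps_mult_assoc ps_one_mult, rule ps_mult_comm)
qed (auto simp: ps_simps fun_eq_iff ps_mult distrib_right sum.distrib)

interpretation PS: cring "pow_series_ring :: (('d::finite \<Rightarrow> nat) \<Rightarrow> 'l::field) ring"
  by (rule cring_pow_series)

lemma ps_mult_coeff_0: "(f \<otimes>\<^bsub>pow_series_ring\<^esub> h) (\<lambda>_. 0) = f (\<lambda>_. 0) * (h (\<lambda>_. 0) :: 'l::field)"
proof -
  have "ps_decomp (\<lambda>_::'a. 0) = {((\<lambda>_. 0), (\<lambda>_. 0))}" by (auto simp: ps_decomp_def fun_eq_iff)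
  then show ?thesis by (simp add: ps_mult)
qed

lemma ps_decomp_unit: "ps_decomp (ps_unit j) = {((\<lambda>_. 0), ps_unit j), (ps_unit j, (\<lambda>_. 0))}"
proof (rule equalityI; rule subsetI)
  fix p assume "p \<in> ps_decomp (ps_unit j)"
  then obtain \<alpha> \<beta> where p: "p = (\<alpha>, \<beta>)" and s: "\<And>i. \<alpha> i + \<beta> i = (if i = j then 1 else 0)"
    by (auto simp: ps_decomp_def ps_unit_def fun_eq_iff)
  have o: "\<alpha> i = 0" "\<beta> i = 0" if "i \<noteq> j" for i using s[of i] that by auto
  have "(\<alpha> j = 0 \<and> \<beta> j = 1) \<or> (\<alpha> j = 1 \<and> \<beta> j = 0)" using s[of j] by auto
  then show "p \<in> {((\<lambda>_. 0), ps_unit j), (ps_unit j, (\<lambda>_. 0))}"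
  proof
    assume "\<alpha> j = 0 \<and> \<beta> j = 1"
    then have "\<alpha> = (\<lambda>_. 0)" "\<beta> = ps_unit j" using o by (auto simp: fun_eq_iff ps_unit_def) metis
    then show ?thesis using p by simp
  next
    assume "\<alpha> j = 1 \<and> \<beta> j = 0"
    then have "\<beta> = (\<lambda>_. 0)" "\<alpha> = ps_unit j" using o by (auto simp: fun_eq_iff ps_unit_def) metis
    then show ?thesis using p by simp
  qed
qed (auto simp: ps_decomp_def)

lemma ps_unit_neq_0: "ps_unit j \<noteq> (\<lambda>_. 0)" "(\<lambda>_. 0) \<noteq> ps_unit j"
  by (metis (full_types) ps_unit_def zero_neq_one)+

lemma ps_mult_coeff_1:
  "(f \<otimes>\<^bsub>pow_series_ring\<^esub> h) (ps_unit j) = f (\<lambda>_. 0) * h (ps_unit j) + f (ps_unit j) * (h (\<lambda>_. 0) :: 'l::field)"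
  by (simp add: ps_mult ps_decomp_unit ps_unit_neq_0)

lemma ps_unit_inj: "ps_unit i = ps_unit j \<longleftrightarrow> i = j"
  by (metis (full_types) ps_unit_def zero_neq_one)

lemma ps_var_coeff: "ps_var j (\<lambda>_. 0) = 0" "ps_var j (ps_unit i) = (if i = j then 1 else 0)"
  using ps_unit_neq_0(2)[of j] ps_unit_inj[of i j] by (auto simp: ps_var_def ps_unit_def[abs_def])

text \<open>Division by the variables: \<open>SOME\<close> assigns to each nonzero exponent vector
  one variable of its support, depending on the vector alone, and \<open>ps_quot j f\<close>
  collects the terms assigned to \<open>j\<close>, with one factor of that variable removed.\<close>

definition ps_quot :: "'d \<Rightarrow> (('d \<Rightarrow> nat) \<Rightarrow> 'l) \<Rightarrow> ('d \<Rightarrow> nat) \<Rightarrow> 'l::field"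
  where "ps_quot j f \<beta> = (let \<gamma> = \<beta>(j := \<beta> j + 1) in if (SOME i. \<gamma> i \<noteq> 0) = j then f \<gamma> else 0)"

lemma ps_quot_decomp:
  fixes f :: "('d::finite \<Rightarrow> nat) \<Rightarrow> 'l::field"
  assumes "f (\<lambda>_. 0) = 0"
  shows "f = (\<lambda>\<gamma>. \<Sum>j\<in>UNIV. (ps_var j \<otimes>\<^bsub>pow_series_ring\<^esub> ps_quot j f) \<gamma>)"
proof
  fix \<gamma> :: "'d \<Rightarrow> nat"
  let ?c = "SOME i. \<gamma> i \<noteq> 0"
  have e: "(ps_var j \<otimes>\<^bsub>pow_series_ring\<^esub> ps_quot j f) \<gamma> = (if \<gamma> j \<noteq> 0 \<and> ?c = j then f \<gamma> else 0)" for j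
  proof (cases "\<gamma> j = 0")
    case False
    then have g: "(\<gamma>(j := \<gamma> j - 1)) (j := (\<gamma>(j := \<gamma> j - 1)) j + 1) = \<gamma>" by auto
    show ?thesis using False unfolding ps_var_mult ps_quot_def g Let_def by simp
  qed (simp add: ps_var_mult)
  show "f \<gamma> = (\<Sum>j\<in>UNIV. (ps_var j \<otimes>\<^bsub>pow_series_ring\<^esub> ps_quot j f) \<gamma>)"
  proof (cases "\<gamma> = (\<lambda>_. 0)")
    case True
    then show ?thesis unfolding e using assms by simp
  next
    case False
    then have "\<exists>i. \<gamma> i \<noteq> 0" by (auto simp: fun_eq_iff)
    then have "\<gamma> ?c \<noteq> 0" by (rule someI_ex)
    then have "(if \<gamma> j \<noteq> 0 \<and> ?c = j then f \<gamma> else 0) = (if ?c = j then f \<gamma> else 0)" for j by auto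
    then show ?thesis unfolding e by simp
  qed
qed

text \<open>For the larger inclusion, \<open>ps_quot\<close> writes a series without constant term
  as a finite combination of the variables, with series as coefficients.\<close>

lemma ps_max_ideal_eq: "ps_max_ideal = {f :: ('d::finite \<Rightarrow> nat) \<Rightarrow> 'l::field. f (\<lambda>_. 0) = 0}"
proof
  let ?S = "pow_series_ring :: (('d \<Rightarrow> nat) \<Rightarrow> 'l) ring"
  let ?n = "{f :: ('d \<Rightarrow> nat) \<Rightarrow> 'l. f (\<lambda>_. 0) = 0}"
  have "ideal ?n ?S"
  proof (rule idealI[OF PS.ring_axioms])
    show "subgroup ?n (add_monoid ?S)"
    proof (rule PS.add.subgroupI)
      fix f :: "('d \<Rightarrow> nat) \<Rightarrow> 'l" assume f: "f \<in> ?n"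
      have "\<ominus>\<^bsub>?S\<^esub> f = (\<lambda>\<alpha>. - f \<alpha>)" by (rule PS.minus_equality) (simp_all add: ps_simps)
      then show "\<ominus>\<^bsub>?S\<^esub> f \<in> ?n" using f by simp
    qed (auto simp: ps_simps)
  qed (simp_all add: ps_mult_coeff_0)
  moreover have "range ps_var \<subseteq> ?n" using ps_var_coeff(1) by auto
  ultimately show "ps_max_ideal \<subseteq> ?n" unfolding ps_max_ideal_def by (rule PS.genideal_minimal)
  have I: "ideal (Idl\<^bsub>?S\<^esub> (range ps_var)) ?S" by (rule PS.genideal_ideal) (simp add: ps_simps)
  interpret I: ideal "Idl\<^bsub>?S\<^esub> (range ps_var)" ?S by (rule I)
  show "?n \<subseteq> ps_max_ideal"
  proof
    fix f :: "('d \<Rightarrow> nat) \<Rightarrow> 'l" assume f: "f \<in> ?n"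
    have "(\<lambda>\<gamma>. \<Sum>j\<in>A. (ps_var j \<otimes>\<^bsub>?S\<^esub> ps_quot j f) \<gamma>) \<in> Idl\<^bsub>?S\<^esub> (range ps_var)" for A :: "'d set"
    proof (induction A rule: infinite_finite_induct)
      case (insert j A)
      have "ps_var j \<in> Idl\<^bsub>?S\<^esub> (range ps_var)"
        using PS.genideal_self[of "range ps_var"] by (auto simp: ps_simps)
      then have "ps_var j \<otimes>\<^bsub>?S\<^esub> ps_quot j f \<in> Idl\<^bsub>?S\<^esub> (range ps_var)"
        by (rule I.I_r_closed) (simp add: ps_simps)
      from I.a_closed[OF this insert.IH] show ?case using insert by (simp add: ps_simps)
    qed (use I.zero_closed in \<open>simp_all add: ps_simps\<close>)
    note * = this[of UNIV]
    have e: "(\<lambda>\<gamma>. \<Sum>j\<in>UNIV. (ps_var j \<otimes>\<^bsub>?S\<^esub> ps_quot j f) \<gamma>) = f"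
      by (rule ps_quot_decomp[symmetric]) (use f in simp)
    show "f \<in> ps_max_ideal" using * unfolding e ps_max_ideal_def .
  qed
qed

text \<open>In the decomposition of \<open>f\<close> by \<open>ps_quot\<close> the constant term of
  the factor at \<open>j\<close> is zero or the linear coefficient of \<open>f\<close> at
  \<open>j\<close>. If the linear terms vanish, all factors lie in the maximal ideal.\<close>

lemma ps_max_ideal_square:
  "ideal_prod pow_series_ring ps_max_ideal ps_max_ideal =
    {f :: ('d::finite \<Rightarrow> nat) \<Rightarrow> 'l::field. f (\<lambda>_. 0) = 0 \<and> (\<forall>j. f (ps_unit j) = 0)}"
proof
  let ?S = "pow_series_ring :: (('d \<Rightarrow> nat) \<Rightarrow> 'l) ring"
  let ?n2 = "{f :: ('d \<Rightarrow> nat) \<Rightarrow> 'l. f (\<lambda>_. 0) = 0 \<and> (\<forall>j. f (ps_unit j) = 0)}"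
  show "ideal_prod ?S ps_max_ideal ps_max_ideal \<subseteq> ?n2"
  proof
    fix f assume "f \<in> ideal_prod ?S ps_max_ideal ps_max_ideal"
    then show "f \<in> ?n2"
      by induction (auto simp: ps_max_ideal_eq ps_mult_coeff_0 ps_mult_coeff_1 ps_simps)
  qed
  show "?n2 \<subseteq> ideal_prod ?S ps_max_ideal ps_max_ideal"
  proof
    fix f :: "('d \<Rightarrow> nat) \<Rightarrow> 'l" assume f: "f \<in> ?n2"
    have q: "ps_quot j f \<in> ps_max_ideal" for j
    proof -
      have "(\<lambda>_. 0)(j := 0 + 1) = ps_unit j" by (auto simp: ps_unit_def fun_eq_iff)
      then show ?thesis using f by (simp add: ps_max_ideal_eq ps_quot_def Let_def)
    qed
    have v: "ps_var j \<in> (ps_max_ideal :: (('d \<Rightarrow> nat) \<Rightarrow> 'l) set)" for j by (simp add: ps_max_ideal_eq ps_var_coeff)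
    have "(\<lambda>\<gamma>. \<Sum>j\<in>A. (ps_var j \<otimes>\<^bsub>?S\<^esub> ps_quot j f) \<gamma>) \<in> ideal_prod ?S ps_max_ideal ps_max_ideal" for A :: "'d set"
    proof (induction A rule: infinite_finite_induct)
      \<comment> \<open>Zero is obtained as the product of zero with itself, because
        \<open>ideal_prod\<close> is generated by products and sums.\<close>
      have z: "(\<lambda>_. 0) \<in> ideal_prod ?S ps_max_ideal ps_max_ideal"
      proof -
        have "(\<lambda>_. 0) \<in> (ps_max_ideal :: (('d \<Rightarrow> nat) \<Rightarrow> 'l) set)" by (simp add: ps_max_ideal_eq)
        from ideal_prod.prod[of _ ps_max_ideal _ ps_max_ideal ?S, OF this this] show ?thesis
          using PS.l_null[of "(\<lambda>_. 0) :: ('d \<Rightarrow> nat) \<Rightarrow> 'l"] by (simp add: ps_simps)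
      qed
      {
        case (infinite A)
        then show ?case using z by simp
      next
        case empty
        then show ?case using z by simp
      }
    next
      case (insert j A)
      from ideal_prod.sum[OF ideal_prod.prod[of _ ps_max_ideal _ ps_max_ideal ?S, OF v q] insert.IH]
      show ?case using insert by (simp add: ps_simps)
    qed
    note * = this[of UNIV]
    have e: "(\<lambda>\<gamma>. \<Sum>j\<in>UNIV. (ps_var j \<otimes>\<^bsub>?S\<^esub> ps_quot j f) \<gamma>) = f"
      by (rule ps_quot_decomp[symmetric]) (use f in simp)
    show "f \<in> ideal_prod ?S ps_max_ideal ps_max_ideal" using * unfolding e .
  qed
qed

lemma ps_act_coeff_0:
  assumes "field_aut (snd g)" "f (\<lambda>_. 0) = 0"
  shows "ps_act g f (\<lambda>_. 0) = 0"
proof -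
  have "{\<alpha> :: 'b \<Rightarrow> nat. (\<Sum>j\<in>UNIV. \<alpha> j) = (\<Sum>j\<in>(UNIV :: 'b set). 0)} = {\<lambda>_. 0}"
    by (auto simp: fun_eq_iff)
  then show ?thesis by (simp add: ps_act_def assms field_aut_0)
qed

lemma sum_eq_1_unit: "(\<Sum>j\<in>UNIV. \<alpha> j) = (1::nat) \<longleftrightarrow> (\<exists>j :: 'd::finite. \<alpha> = ps_unit j)"
proof
  assume s: "(\<Sum>j\<in>UNIV. \<alpha> j) = 1"
  then obtain j where j: "\<alpha> j \<noteq> 0" by (metis sum.neutral zero_neq_one)
  have "\<alpha> j + (\<Sum>i\<in>UNIV - {j}. \<alpha> i) = 1" unfolding s[symmetric] by (rule sum.remove[symmetric]) auto
  then have a: "\<alpha> j = 1" "(\<Sum>i\<in>UNIV - {j}. \<alpha> i) = 0" using j by linarith+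
  have "\<forall>i\<in>UNIV - {j}. \<alpha> i = 0" using a(2) by (subst (asm) sum_eq_0_iff) auto
  then have "\<alpha> = ps_unit j" using a(1) by (auto simp: fun_eq_iff ps_unit_def)
  then show "\<exists>j. \<alpha> = ps_unit j" ..
qed (auto simp: ps_unit_def)

text \<open>In degree one the exponent vectors are the \<open>ps_unit j\<close>, and the product of
  powers of linear forms belonging to such a vector is the single form at \<open>j\<close>.\<close>

lemma ps_act_coeff_1:
  "ps_act g f (ps_unit i) = (\<Sum>j\<in>UNIV. snd g (f (ps_unit j)) * fst g $ i $ j)"
proof -
  let ?S = "pow_series_ring :: (('b \<Rightarrow> nat) \<Rightarrow> 'a) ring"
  have p: "(\<Otimes>\<^bsub>?S\<^esub>k\<in>UNIV. ps_lin_form (fst g) k [^]\<^bsub>?S\<^esub> ps_unit j k) = ps_lin_form (fst g) j" for j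
  proof -
    have "(\<Otimes>\<^bsub>?S\<^esub>k\<in>UNIV. ps_lin_form (fst g) k [^]\<^bsub>?S\<^esub> ps_unit j k) =
      (\<Otimes>\<^bsub>?S\<^esub>k\<in>UNIV. if j = k then ps_lin_form (fst g) k else \<one>\<^bsub>?S\<^esub>)"
      by (rule PS.finprod_cong') (auto simp: ps_simps(1) ps_unit_def ps_one_mult)
    also have "\<dots> = ps_lin_form (fst g) j"
      by (rule PS.finprod_singleton) (auto simp: ps_simps(1))
    finally show ?thesis .
  qed
  have l: "ps_lin_form (fst g) j (ps_unit i) = fst g $ i $ j" for j
    by (simp add: ps_lin_form_def ps_var_coeff if_distrib[of "\<lambda>c. _ * c"] cong: if_cong)
  have u: "(\<Sum>j\<in>UNIV. ps_unit i j) = (1::nat)" unfolding sum_eq_1_unit by blast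
  have s: "{\<alpha> :: 'b \<Rightarrow> nat. (\<Sum>j\<in>UNIV. \<alpha> j) = 1} = range ps_unit" unfolding sum_eq_1_unit by blast
  have "ps_act g f (ps_unit i) = (\<Sum>\<alpha>\<in>range ps_unit. snd g (f \<alpha>) *
       (\<Otimes>\<^bsub>?S\<^esub>j\<in>UNIV. ps_lin_form (fst g) j [^]\<^bsub>?S\<^esub> \<alpha> j) (ps_unit i))"
    unfolding ps_act_def u s ..
  also have "\<dots> = (\<Sum>j\<in>UNIV. snd g (f (ps_unit j)) * fst g $ i $ j)"
    by (subst sum.reindex) (auto simp: inj_on_def ps_unit_inj p l)
  finally show ?thesis .
qed

context skew
begin

text \<open>The matrix of \<open>g\<close> in the basis of the classes of the variables, by the
  substitution rule that sends the variable at \<open>j\<close> to the combination given by column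
  \<open>j\<close>.\<close>

definition cotangent_cocycle :: "('l, 'd) semilin \<Rightarrow> 'd \<Rightarrow> 'd \<Rightarrow> 'l"
  where "cotangent_cocycle g i j = fst g $ i $ j"

lemma cocycle_cotangent: "cocycle K UNIV cotangent_cocycle"
  unfolding cocycle_def cotangent_cocycle_def
  by (auto simp: semilin_one_def mat_def semilin_mult_def matrix_matrix_mult_def)

text \<open>Reading off linear coefficients maps the maximal ideal onto coordinates with its square
  as kernel. The module laws come from the target, so the substitution action on power series is
  evaluated only in degrees 0 and 1.\<close>

theorem cotangent_module_iso:
  shows "skew_module K (cotangent_module K)"
    and "lmod_iso R (cotangent_module K) (tmod UNIV cotangent_cocycle lfield)"
proof -
  let ?n = "ps_max_ideal :: (('d \<Rightarrow> nat) \<Rightarrow> 'l) set"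
  let ?M = "(pow_series_module K)\<lparr>carrier := ?n\<rparr>"
  let ?P = "tmod UNIV cotangent_cocycle lfield"
  interpret l: skew_module K lfield by (rule skew_module_lfield)
  interpret P: skew_module K ?P by (rule l.skew_module_tmod[OF _ cocycle_cotangent]) simp
  let ?L = "\<lambda>f. \<lambda>i\<in>UNIV. f (ps_unit i)"
  have M: "carrier ?M = ?n" "\<zero>\<^bsub>?M\<^esub> = (\<lambda>_. 0)" "f \<oplus>\<^bsub>?M\<^esub> h = (\<lambda>\<alpha>. f \<alpha> + h \<alpha>)"
    "a \<odot>\<^bsub>?M\<^esub> f = (\<lambda>\<beta>. \<Sum>g\<in>K. a g * ps_act g f \<beta>)" for f h a
    by (simp_all add: pow_series_module_def ps_simps)
  have ag: "abelian_group ?M"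
  proof (rule abelian_groupI)
    fix f assume "f \<in> carrier ?M"
    then show "\<exists>g\<in>carrier ?M. g \<oplus>\<^bsub>?M\<^esub> f = \<zero>\<^bsub>?M\<^esub>"
      unfolding M by (intro bexI[of _ "\<lambda>\<alpha>. - f \<alpha>"]) (simp_all add: ps_max_ideal_eq)
  qed (unfold M, simp_all add: ps_max_ideal_eq add_ac)
  have cl: "a \<odot>\<^bsub>?M\<^esub> f \<in> carrier ?M" if "a \<in> carrier R" "f \<in> carrier ?M" for a f
    using that unfolding M by (simp add: ps_max_ideal_eq ps_act_coeff_0 aut_K)
  have L: "?L \<in> lhom R ?M ?P"
  proof (rule lhomI)
    fix a f assume a: "a \<in> carrier R" and f: "f \<in> carrier ?M"
    have "(\<Sum>g\<in>K. a g * ps_act g f (ps_unit i)) = (\<Sum>j\<in>UNIV. \<Sum>g\<in>K. a g * cotangent_cocycle g i j * snd g (f (ps_unit j)))" for i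
      unfolding ps_act_coeff_1 sum_distrib_left cotangent_cocycle_def
      by (subst sum.swap) (simp add: mult_ac)
    then show "?L (a \<odot>\<^bsub>?M\<^esub> f) = a \<odot>\<^bsub>?P\<^esub> ?L f"
      unfolding M tmod_simps using a by (simp add: finsum_lfield lfield_smult R_simps)
  qed (unfold M, auto simp: tmod_simps lfield_simps)
  have surj: "?L ` carrier ?M = carrier ?P"
  proof (rule equalityI; rule subsetI)
    fix u :: "'d \<Rightarrow> 'l" assume "u \<in> carrier ?P"
    let ?f = "\<lambda>\<alpha>. \<Sum>j\<in>UNIV. u j * ps_var j \<alpha>"
    have 1: "?f \<in> carrier ?M" by (simp add: M ps_max_ideal_eq ps_var_coeff)
    have 2: "u = ?L ?f" by (simp add: ps_var_coeff if_distrib[of "\<lambda>c. _ * c"] fun_eq_iff cong: if_cong)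
    show "u \<in> ?L ` carrier ?M" by (rule image_eqI[where f = ?L and x = ?f, OF 2 1])
  qed (auto simp: tmod_simps lfield_simps)
  have ker: "ideal_prod pow_series_ring ?n ?n = {f \<in> carrier ?M. ?L f = \<zero>\<^bsub>?P\<^esub>}"
    unfolding ps_max_ideal_square by (auto simp: M ps_max_ideal_eq tmod_simps lfield_simps fun_eq_iff)
  note Q = quotient_lmod_iso[OF ag P.left_module_axioms cl L surj ker]
  have "left_module R (cotangent_module K)" unfolding cotangent_module_def by (rule Q(1))
  then show "skew_module K (cotangent_module K)" by (simp add: skew_module_def skew_axioms)
  show "lmod_iso R (cotangent_module K) ?P" unfolding cotangent_module_def by (rule Q(2))
qed

end

section \<open>Galois descent\<close>

inductive_set eval_span :: "(('l::field \<Rightarrow> 'l) \<Rightarrow> 'l) set"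
  where eval: "(\<lambda>\<sigma>. c * \<sigma> x) \<in> eval_span"
  | add: "f \<in> eval_span \<Longrightarrow> g \<in> eval_span \<Longrightarrow> (\<lambda>\<sigma>. f \<sigma> + g \<sigma>) \<in> eval_span"

text \<open>Evaluations multiply by \<open>\<sigma> x * \<sigma> y = \<sigma> (x * y)\<close>. This
  holds for automorphisms only, so \<open>h\<close> agrees with the product on these and not as a
  function.\<close>

lemma eval_span_mult:
  assumes "f \<in> eval_span" "g \<in> eval_span"
  shows "\<exists>h\<in>eval_span. \<forall>\<sigma>. field_aut \<sigma> \<longrightarrow> h \<sigma> = f \<sigma> * (g \<sigma> :: 'l::field)"
  using assms(1)
proof induction
  case (eval c x)
  show ?case using assms(2)
  proof induction
    case (eval d y)
    show ?case
      by (rule bexI[OF _ eval_span.eval[of "c * d" "x * y"]]) (simp add: field_aut_mult)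
  next
    case (add g g')
    then obtain h h' where "h \<in> eval_span" "h' \<in> eval_span"
      "\<forall>\<sigma>. field_aut \<sigma> \<longrightarrow> h \<sigma> = c * \<sigma> x * g \<sigma>" "\<forall>\<sigma>. field_aut \<sigma> \<longrightarrow> h' \<sigma> = c * \<sigma> x * g' \<sigma>" by blast
    then show ?case by (intro bexI[OF _ eval_span.add[of h h']]) (simp_all add: distrib_left)
  qed
next
  case (add f f')
  then obtain h h' where "h \<in> eval_span" "h' \<in> eval_span"
    "\<forall>\<sigma>. field_aut \<sigma> \<longrightarrow> h \<sigma> = f \<sigma> * g \<sigma>" "\<forall>\<sigma>. field_aut \<sigma> \<longrightarrow> h' \<sigma> = f' \<sigma> * g \<sigma>" by blast
  then show ?case by (intro bexI[OF _ eval_span.add[of h h']]) (simp_all add: distrib_right)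
qed

text \<open>The dual form of the linear independence of automorphisms; \<open>eval_span\<close> is the span of the evaluations.\<close>

lemma eval_span_delta:
  assumes "finite T" "\<And>\<tau>. \<tau> \<in> T \<Longrightarrow> field_aut \<tau>" "field_aut \<sigma>"
  shows "\<exists>f\<in>eval_span. f \<sigma> = 1 \<and> (\<forall>\<tau>\<in>T. \<tau> \<noteq> \<sigma> \<longrightarrow> f \<tau> = (0::'l::field))"
  using assms(1,2)
proof (induction T)
  case empty
  show ?case by (rule bexI[OF _ eval_span.eval[of 1 1]]) (simp add: field_aut_1[OF assms(3)])
next
  case (insert \<tau> T)
  then obtain f where f: "f \<in> eval_span" "f \<sigma> = 1" "\<forall>\<tau>\<in>T. \<tau> \<noteq> \<sigma> \<longrightarrow> f \<tau> = 0" by auto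
  show ?case
  proof (cases "\<tau> = \<sigma>")
    case True
    then show ?thesis using f by auto
  next
    case False
    then obtain x where x: "\<tau> x \<noteq> \<sigma> x" by auto
    \<comment> \<open>Normalises an interpolation factor: \<open>?g\<close> is 1 at
      \<open>\<sigma>\<close> and 0 at \<open>\<tau>\<close>, since automorphisms fix 1.\<close>
    define a where "a = 1 / (\<sigma> x - \<tau> x)"
    let ?g = "\<lambda>\<rho>. a * \<rho> x + (- a * \<tau> x) * \<rho> 1"
    have "?g \<in> eval_span" by (intro eval_span.intros)
    then obtain h where h: "h \<in> eval_span" "\<forall>\<rho>. field_aut \<rho> \<longrightarrow> h \<rho> = f \<rho> * ?g \<rho>"
      using eval_span_mult[OF f(1)] by blast
    have "?g \<tau> = 0" using insert.prems by (simp add: field_aut_1)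
    moreover have "?g \<sigma> = 1"
    proof -
      have "?g \<sigma> = a * (\<sigma> x - \<tau> x)" using assms(3) by (simp add: field_aut_1 right_diff_distrib)
      then show ?thesis using x by (simp add: a_def)
    qed
    ultimately have "h \<sigma> = 1" "h \<tau> = 0" "\<forall>\<tau>'\<in>T. \<tau>' \<noteq> \<sigma> \<longrightarrow> h \<tau>' = 0"
      using h(2) f insert.prems assms(3) by auto
    then show ?thesis using h(1) by auto
  qed
qed

lemma (in skew) snd_ginv: "g \<in> K \<Longrightarrow> snd g (snd (ginv g) c) = c" "g \<in> K \<Longrightarrow> snd (ginv g) (snd g c) = c"
  using snd_semilin_mult[of g "ginv g"] snd_semilin_mult[of "ginv g" g]
  by (metis comp_apply id_apply ginv_right snd_semilin_one, metis comp_apply id_apply ginv_left snd_semilin_one)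

context skew
begin

abbreviation "H \<equiv> linear_part K"

lemma H_iff: "h \<in> H \<longleftrightarrow> h \<in> K \<and> snd h = id"
  by (simp add: linear_part_def)

lemma H_K: "h \<in> H \<Longrightarrow> h \<in> K"
  by (simp add: linear_part_def)

lemma snd_ginv_H: "h \<in> H \<Longrightarrow> ginv h \<in> H"
  using snd_ginv(1)[of h] by (auto simp: H_iff fun_eq_iff)

lemma skew_H: "skew H"
proof (rule skew_mono[OF skew_axioms])
  fix g assume "g \<in> H"
  then show "\<exists>h\<in>H. semilin_mult h g = semilin_one \<and> semilin_mult g h = semilin_one"
    using snd_ginv_H H_K by (intro bexI[of _ "ginv g"]) auto
qed (auto simp: H_iff)

text \<open>If \<open>\<tau>\<close> did not come from \<open>K\<close>, comparing the sums of
  evaluations over \<open>K\<close> and over its translate by \<open>\<tau>\<close> would contradict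
  independence of automorphisms: the identity occurs \<open>card H\<close> times in one sum and not
  at all in the other.\<close>

theorem galois_surj:
  assumes char: "of_nat (card H) \<noteq> (0::'l)" and \<tau>: "field_aut \<tau>"
    and fixd: "\<And>x. (\<forall>g\<in>K. snd g x = x) \<Longrightarrow> \<tau> x = x"
  shows "\<exists>g\<in>K. snd g = \<tau>"
proof (rule ccontr)
  assume no: "\<not> (\<exists>g\<in>K. snd g = \<tau>)"
  \<comment> \<open>A sum over the orbit of \<open>x\<close> is fixed by the group, hence by
    \<open>\<tau>\<close>.\<close>
  have tr: "(\<Sum>g\<in>K. \<tau> (snd g x)) = (\<Sum>g\<in>K. snd g x)" for x
  proof -
    have "snd h (\<Sum>g\<in>K. snd g x) = (\<Sum>g\<in>K. snd g x)" if h: "h \<in> K" for h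
    proof -
      have "snd h (\<Sum>g\<in>K. snd g x) = (\<Sum>g\<in>K. snd (semilin_mult h g) x)"
        by (simp add: field_aut_sum[OF aut_K[OF h]])
      also have "\<dots> = (\<Sum>g\<in>K. snd g x)" by (rule sum.reindex_bij_betw[OF bij_mult_left[OF h]])
      finally show ?thesis .
    qed
    then have "\<tau> (\<Sum>g\<in>K. snd g x) = (\<Sum>g\<in>K. snd g x)" by (intro fixd) blast
    then show ?thesis by (simp add: field_aut_sum[OF \<tau>])
  qed
  have *: "(\<Sum>g\<in>K. f (\<tau> \<circ> snd g)) = (\<Sum>g\<in>K. f (snd g))" if "f \<in> eval_span" for f
    using that
  proof induction
    case (eval c x)
    show ?case using tr[of x] by (simp flip: sum_distrib_left)
  qed (simp add: sum.distrib)
  \<comment> \<open>All automorphisms occurring on either side of \<open>*\<close>. A function that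
    vanishes on them except at the identity turns the right side into the order of \<open>H\<close>
    and the left side into zero.\<close>
  let ?T = "(\<lambda>g. \<tau> \<circ> snd g) ` K \<union> snd ` K"
  have "field_aut \<sigma>" if "\<sigma> \<in> ?T" for \<sigma> using that aut_K field_aut_comp[OF \<tau>] by auto
  then have "\<exists>f\<in>eval_span. f id = 1 \<and> (\<forall>\<sigma>\<in>?T. \<sigma> \<noteq> id \<longrightarrow> f \<sigma> = 0)"
    by (intro eval_span_delta field_aut_id) (use finite_K in auto)
  then obtain f where f: "f \<in> eval_span" "f id = 1" "\<forall>\<sigma>\<in>?T. \<sigma> \<noteq> id \<longrightarrow> f \<sigma> = 0" by blast
  have "f (\<tau> \<circ> snd g) = 0" if g: "g \<in> K" for g
  proof -
    have "\<tau> \<circ> snd g \<noteq> id"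
    proof
      assume "\<tau> \<circ> snd g = id"
      then have "\<tau> x = snd (ginv g) x" for x
        using snd_ginv(1)[OF g, of x] by (metis comp_apply id_apply)
      then show False using no g ginv_K by (metis ext)
    qed
    then show ?thesis using f(3) g by blast
  qed
  moreover have "(\<Sum>g\<in>K. f (snd g)) = (\<Sum>g\<in>H. 1)"
    by (rule sum.mono_neutral_cong_right[OF finite_K]) (use f in \<open>auto simp: H_iff\<close>)
  ultimately have "of_nat (card H) = (0::'l)" using *[OF f(1)] by simp
  then show False using char by simp
qed

end

text \<open>
  Averaging \<open>c f\<close> over \<open>K\<close> gives \<open>K\<close>-homomorphisms for all \<open>c\<close> in \<open>l\<close>; a linear combination of their values
  at \<open>v0\<close> kills all terms outside the linear part, by independence of automorphisms, and leaves a
  nonzero multiple of \<open>f v0\<close>.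
\<close>

theorem Galois_descent:
  assumes M: "skew_module K M" and N: "skew_module K N"
    and char: "of_nat (card (linear_part K)) \<noteq> (0::'l)"
    and f: "f \<in> lhom (skew_group_ring (linear_part K)) M N" "v0 \<in> carrier M" "f v0 \<noteq> \<zero>\<^bsub>N\<^esub>"
  shows "\<exists>p\<in>lhom (skew_group_ring (K :: ('l::field, 'd::finite) semilin set)) M N. p v0 \<noteq> \<zero>\<^bsub>N\<^esub>"
proof -
  interpret M: skew_module K M by fact
  interpret N: skew_module K N by fact
  note fs = lhom_closed[OF f(1)] lhom_add[OF f(1)] lhom_scal[OF M.skew_H f(1)] lhom_act[OF M.skew_H f(1)]
  define y where "y v g = act N g (f (act M (M.ginv g) v))" for v g
  have yN: "y v g \<in> carrier N" if "v \<in> carrier M" "g \<in> K" for v g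
    using that fs(1) by (simp add: y_def)
  \<comment> \<open>Each summand carries the scalar \<open>snd g c\<close> and not \<open>c\<close>:
    under translation by \<open>h\<close> it is twisted exactly as \<open>act N h\<close> requires,
    so \<open>p c\<close> is equivariant even for a \<open>c\<close> that the group moves.\<close>
  define p where "p c v = finsum N (\<lambda>g. scal N (snd g c) (y v g)) K" for c v
  have pM: "p c v \<in> carrier N" if "v \<in> carrier M" for c v
    unfolding p_def using yN[OF that] by (intro N.M.finsum_closed) auto
  have hom: "p c \<in> lhom M.R M N" for c
  proof (rule skew_lhomI[OF M N])
    fix v w assume vw: "v \<in> carrier M" "w \<in> carrier M"
    have "p c (v \<oplus>\<^bsub>M\<^esub> w) = finsum N (\<lambda>g. scal N (snd g c) (y v g) \<oplus>\<^bsub>N\<^esub> scal N (snd g c) (y w g)) K"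
      unfolding p_def
    proof (rule N.M.finsum_cong'[OF refl])
      fix g assume g: "g \<in> K"
      have "y (v \<oplus>\<^bsub>M\<^esub> w) g = y v g \<oplus>\<^bsub>N\<^esub> y w g"
        unfolding y_def using g vw fs(1) by (simp add: M.act_add fs(2) N.act_add)
      then show "scal N (snd g c) (y (v \<oplus>\<^bsub>M\<^esub> w) g) = scal N (snd g c) (y v g) \<oplus>\<^bsub>N\<^esub> scal N (snd g c) (y w g)"
        using yN g vw by (simp add: N.scal_add_r)
    qed (use yN vw in auto)
    also have "\<dots> = p c v \<oplus>\<^bsub>N\<^esub> p c w"
      unfolding p_def by (rule N.M.finsum_addf) (use yN vw in auto)
    finally show "p c (v \<oplus>\<^bsub>M\<^esub> w) = p c v \<oplus>\<^bsub>N\<^esub> p c w" .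
  next
    fix a v assume v: "v \<in> carrier M"
    have "p c (scal M a v) = finsum N (\<lambda>g. scal N a (scal N (snd g c) (y v g))) K"
      unfolding p_def
    proof (rule N.M.finsum_cong'[OF refl])
      fix g assume g: "g \<in> K"
      have "y (scal M a v) g = scal N a (y v g)"
        unfolding y_def using g v fs(1) by (simp add: M.act_scal fs(3) N.act_scal M.snd_ginv)
      then show "scal N (snd g c) (y (scal M a v) g) = scal N a (scal N (snd g c) (y v g))"
        using yN g v by (simp add: N.scal_scal mult.commute)
    qed (use yN v in auto)
    also have "\<dots> = scal N a (p c v)"
      unfolding p_def by (rule N.scal_finsum[symmetric]) (use yN v M.finite_K in auto)
    finally show "p c (scal M a v) = scal N a (p c v)" .
  next
    fix h v assume h: "h \<in> K" and v: "v \<in> carrier M"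
    have "p c (act M h v) = finsum N (\<lambda>g. scal N (snd g c) (y (act M h v) g)) (semilin_mult h ` K)"
      unfolding p_def bij_betw_imp_surj_on[OF M.bij_mult_left[OF h]] ..
    also have "\<dots> = finsum N (\<lambda>g. scal N (snd (semilin_mult h g) c) (y (act M h v) (semilin_mult h g))) K"
    proof (rule N.M.finsum_reindex)
      show "inj_on (semilin_mult h) K" by (rule bij_betw_imp_inj_on[OF M.bij_mult_left[OF h]])
      show "(\<lambda>g. scal N (snd g c) (y (act M h v) g)) \<in> semilin_mult h ` K \<rightarrow> carrier N"
        unfolding bij_betw_imp_surj_on[OF M.bij_mult_left[OF h]]
        using yN[OF M.act_closed[OF h v]] by (intro Pi_I) (rule N.scal_closed)
    qed
    also have "\<dots> = finsum N (\<lambda>g. act N h (scal N (snd g c) (y v g))) K"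
    proof (rule N.M.finsum_cong'[OF refl])
      fix g assume g: "g \<in> K"
      have "semilin_mult (semilin_mult h g) (semilin_mult (M.ginv g) (M.ginv h)) = semilin_one"
        using g h by (simp add: M.assoc_K M.ginv_cancel)
      then have "M.ginv (semilin_mult h g) = semilin_mult (M.ginv g) (M.ginv h)"
        using M.ginv_cancel(1)[OF M.mult_K[OF h g], of "semilin_mult (M.ginv g) (M.ginv h)"]
          M.ginv_K[OF M.mult_K[OF h g]] by simp
      then have "y (act M h v) (semilin_mult h g) = act N h (y v g)"
        unfolding y_def using g h v fs(1) by (simp add: M.act_act N.act_act M.assoc_K)
      then show "scal N (snd (semilin_mult h g) c) (y (act M h v) (semilin_mult h g)) =
        act N h (scal N (snd g c) (y v g))"
        using h yN[OF v g] by (simp add: N.act_scal)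
    qed (use yN h v in auto)
    also have "\<dots> = act N h (p c v)"
      unfolding p_def by (rule N.act_finsum[symmetric]) (use yN v h M.finite_K in auto)
    finally show "p c (act M h v) = act N h (p c v)" .
  qed (rule pM)
  have "\<exists>c. p c v0 \<noteq> \<zero>\<^bsub>N\<^esub>"
  proof (rule ccontr)
    assume "\<not> ?thesis"
    then have z: "finsum N (\<lambda>g. scal N (snd g c) (y v0 g)) K = \<zero>\<^bsub>N\<^esub>" for c by (simp add: p_def)
    \<comment> \<open>If the averages vanish at \<open>v0\<close> for all \<open>c\<close>, then so
      does every combination with coefficients from the span of the evaluations, in particular the
      one that isolates the identity automorphism.\<close>
    have *: "finsum N (\<lambda>g. scal N (F (snd g)) (y v0 g)) K = \<zero>\<^bsub>N\<^esub>" if "F \<in> eval_span" for F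
      using that
    proof induction
      case (eval c x)
      have "finsum N (\<lambda>g. scal N (c * snd g x) (y v0 g)) K = finsum N (\<lambda>g. scal N c (scal N (snd g x) (y v0 g))) K"
        by (rule N.M.finsum_cong'[OF refl]) (use yN f(2) in \<open>auto simp: N.scal_scal\<close>)
      also have "\<dots> = scal N c (finsum N (\<lambda>g. scal N (snd g x) (y v0 g)) K)"
        by (rule N.scal_finsum[symmetric]) (use yN f(2) M.finite_K in auto)
      finally show ?case by (simp add: z)
    next
      case (add F F')
      have "finsum N (\<lambda>g. scal N (F (snd g) + F' (snd g)) (y v0 g)) K =
        finsum N (\<lambda>g. scal N (F (snd g)) (y v0 g) \<oplus>\<^bsub>N\<^esub> scal N (F' (snd g)) (y v0 g)) K"
        by (rule N.M.finsum_cong'[OF refl]) (use yN f(2) in \<open>auto simp: N.scal_add_l\<close>)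
      also have "\<dots> = finsum N (\<lambda>g. scal N (F (snd g)) (y v0 g)) K \<oplus>\<^bsub>N\<^esub> finsum N (\<lambda>g. scal N (F' (snd g)) (y v0 g)) K"
        by (rule N.M.finsum_addf) (use yN f(2) in auto)
      finally show ?case using add by simp
    qed
    obtain F where F: "F \<in> eval_span" "F id = 1" "\<forall>\<sigma>\<in>snd ` K. \<sigma> \<noteq> id \<longrightarrow> F \<sigma> = 0"
    proof -
      have "field_aut \<sigma>" if "\<sigma> \<in> snd ` K" for \<sigma> using that M.aut_K by auto
      then have "\<exists>F\<in>eval_span. F id = 1 \<and> (\<forall>\<sigma>\<in>snd ` K. \<sigma> \<noteq> id \<longrightarrow> F \<sigma> = 0)"
        by (intro eval_span_delta field_aut_id) (use M.finite_K in auto)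
      then show ?thesis using that by blast
    qed
    have "finsum N (\<lambda>g. scal N (F (snd g)) (y v0 g)) K = finsum N (\<lambda>g. f v0) (linear_part K)"
    proof (rule N.M.add.finprod_mono_neutral_cong_right)
      fix g assume g: "g \<in> K - linear_part K"
      then have "F (snd g) = 0" using F(3) by (simp add: M.H_iff)
      then show "scal N (F (snd g)) (y v0 g) = \<zero>\<^bsub>N\<^esub>" using g yN[OF f(2)] by simp
    next
      fix g assume g: "g \<in> linear_part K"
      have gK: "g \<in> K" "snd g = id" using g by (simp_all add: M.H_iff)
      have "f (act M (M.ginv g) v0) = act N (M.ginv g) (f v0)" by (rule fs(4)[OF f(2) M.snd_ginv_H[OF g]])
      then have "y v0 g = f v0" using gK fs(1)[OF f(2)] by (simp add: y_def N.act_act)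
      then show "scal N (F (snd g)) (y v0 g) = f v0" using gK F(2) fs(1)[OF f(2)] by simp
    qed (use M.finite_K yN[OF f(2)] M.H_K in auto)
    also have "\<dots> = finsum N (\<lambda>g. scal N 1 (f v0)) (linear_part K)"
      using fs(1)[OF f(2)] by simp
    also have "\<dots> = scal N (\<Sum>g\<in>linear_part K. 1) (f v0)"
      by (rule N.finsum_scal[symmetric]) (use skew.finite_K[OF M.skew_H] fs(1)[OF f(2)] in auto)
    finally have "scal N (of_nat (card (linear_part K))) (f v0) = \<zero>\<^bsub>N\<^esub>" using *[OF F(1)] by simp
    then have "scal N (1 / of_nat (card (linear_part K))) (scal N (of_nat (card (linear_part K))) (f v0)) = \<zero>\<^bsub>N\<^esub>"
      by simp
    then show False using char fs(1)[OF f(2)] f(3) by (simp add: N.scal_scal)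
  qed
  then show ?thesis using hom by blast
qed

section \<open>Twisted modules\<close>

text \<open>Restriction along a ring endomorphism, covering both twists that occur:
  \<open>g \<otimes> W\<close> by \<open>conj_ring g\<close>, and the tensor product with the
  determinant character by \<open>twist det_char\<close>.\<close>

definition pullback :: "('a \<Rightarrow> 'a) \<Rightarrow> ('a, 'b) module \<Rightarrow> ('a, 'b) module"
  where "pullback \<theta> W = W\<lparr>smult := (\<lambda>a w. \<theta> a \<odot>\<^bsub>W\<^esub> w)\<rparr>"

lemma pullback_simps [simp]:
  "carrier (pullback \<theta> W) = carrier W" "\<zero>\<^bsub>pullback \<theta> W\<^esub> = \<zero>\<^bsub>W\<^esub>" "x \<oplus>\<^bsub>pullback \<theta> W\<^esub> y = x \<oplus>\<^bsub>W\<^esub> y"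
  "a \<odot>\<^bsub>pullback \<theta> W\<^esub> x = \<theta> a \<odot>\<^bsub>W\<^esub> x"
  by (simp_all add: pullback_def)

definition ring_endo :: "('a, 'r) ring_scheme \<Rightarrow> ('a \<Rightarrow> 'a) \<Rightarrow> bool"
  where "ring_endo R \<theta> \<longleftrightarrow> (\<forall>a\<in>carrier R. \<theta> a \<in> carrier R) \<and> \<theta> \<one>\<^bsub>R\<^esub> = \<one>\<^bsub>R\<^esub> \<and>
    (\<forall>a\<in>carrier R. \<forall>b\<in>carrier R. \<theta> (a \<oplus>\<^bsub>R\<^esub> b) = \<theta> a \<oplus>\<^bsub>R\<^esub> \<theta> b \<and> \<theta> (a \<otimes>\<^bsub>R\<^esub> b) = \<theta> a \<otimes>\<^bsub>R\<^esub> \<theta> b)"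

lemma pullback_left_module:
  assumes "left_module R W" "ring_endo R \<theta>"
  shows "left_module R (pullback \<theta> W)"
proof -
  interpret left_module R W by fact
  note \<theta> = assms(2)[unfolded ring_endo_def]
  show ?thesis
  proof (rule left_moduleI)
    fix x assume "x \<in> carrier (pullback \<theta> W)"
    then show "\<exists>y\<in>carrier (pullback \<theta> W). y \<oplus>\<^bsub>pullback \<theta> W\<^esub> x = \<zero>\<^bsub>pullback \<theta> W\<^esub>"
      by (intro bexI[of _ "\<ominus>\<^bsub>W\<^esub> x"]) (simp_all add: M.l_neg)
  next
    fix x y assume "x \<in> carrier (pullback \<theta> W)" "y \<in> carrier (pullback \<theta> W)"
    then show "x \<oplus>\<^bsub>pullback \<theta> W\<^esub> y = y \<oplus>\<^bsub>pullback \<theta> W\<^esub> x" using M.a_comm[of x y] by simp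
  qed (use \<theta> in \<open>simp_all add: R.ring_axioms M.a_assoc smult_closed smult_l_distr smult_r_distr smult_assoc1 smult_one\<close>)
qed

lemma pullback_iso:
  assumes "lmod_iso R W W'" "ring_endo R \<theta>"
  shows "lmod_iso R (pullback \<theta> W) (pullback \<theta> W')"
  using assms unfolding lmod_iso_lhom by (auto simp: lhom_def ring_endo_def)

text \<open>As \<open>\<theta>\<close> is surjective, every scalar acts on the original modules as
  some scalar acts on the pullbacks.\<close>

lemma pullback_iso_rev:
  assumes "lmod_iso R (pullback \<theta> W) (pullback \<theta> W')" "carrier R \<subseteq> \<theta> ` carrier R"
  shows "lmod_iso R W W'"
proof -
  obtain f where f: "f \<in> lhom R (pullback \<theta> W) (pullback \<theta> W')" "bij_betw f (carrier W) (carrier W')"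
    using assms(1) by (auto simp: lmod_iso_lhom)
  have "f \<in> lhom R W W'"
  proof (rule lhomI)
    fix a x assume "a \<in> carrier R" "x \<in> carrier W"
    moreover then obtain b where "b \<in> carrier R" "a = \<theta> b" using assms(2) by blast
    ultimately show "f (a \<odot>\<^bsub>W\<^esub> x) = a \<odot>\<^bsub>W'\<^esub> f x" using lhom_smult[OF f(1), of b x] by simp
  qed (use lhom_closed[OF f(1)] lhom_add[OF f(1)] in auto)
  then show ?thesis using f(2) by (rule lmod_isoI)
qed

lemma pullback_simple:
  assumes W: "simple_lmod R W" and \<theta>: "ring_endo R \<theta>" "carrier R \<subseteq> \<theta> ` carrier R"
  shows "simple_lmod R (pullback \<theta> W)"
proof -
  interpret left_module R W using W by (rule simple_left_module)
  have "N = {\<zero>\<^bsub>W\<^esub>} \<or> N = carrier W" if N: "submodule N R (pullback \<theta> W)" for N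
  proof (rule simple_submodule[OF W])
    show "submodule N R W"
    proof (rule submoduleI)
      fix a x assume "a \<in> carrier R" "x \<in> N"
      moreover then obtain b where "b \<in> carrier R" "a = \<theta> b" using \<theta>(2) by blast
      ultimately show "a \<odot>\<^bsub>W\<^esub> x \<in> N" using submodule_smult[OF N, of b x] by simp
    qed (use submodule_subset[OF N] submodule_zero[OF N] submodule_add[OF N] in auto)
  qed
  moreover have "carrier W \<noteq> {\<zero>\<^bsub>W\<^esub>}" using W by (simp add: simple_lmod_def)
  ultimately show ?thesis
    using pullback_left_module[OF left_module_axioms \<theta>(1)] by (simp add: simple_lmod_def)
qed

lemma pullback_direct_sum: "pullback \<theta> (direct_sum I S) = direct_sum I (\<lambda>i. pullback \<theta> (S i))"
  by (simp add: pullback_def direct_sum_def)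

lemma pullback_pullback:
  assumes "\<And>a. a \<in> carrier R \<Longrightarrow> \<theta>' (\<theta> a) = a"
  shows "lmod_iso R (pullback \<theta> (pullback \<theta>' W)) W"
  by (rule lmod_isoI[of id]) (auto intro!: lhomI simp: assms)

text \<open>Sends the monomial \<open>c g\<close> to \<open>c \<kappa>(g) g\<close>; multiplicative
  when \<open>\<kappa>\<close> is a one-dimensional cocycle. Pulling back along it is tensoring with
  the one-dimensional module of \<open>\<kappa>\<close>.\<close>

definition twist :: "(('l::field, 'd::finite) semilin \<Rightarrow> 'l) \<Rightarrow> (('l, 'd) semilin \<Rightarrow> 'l) \<Rightarrow> ('l, 'd) semilin \<Rightarrow> 'l"
  where "twist \<kappa> a = (\<lambda>g. a g * \<kappa> g)"

context skew
begin

lemma twist_endo: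
  assumes "\<kappa> semilin_one = 1" "\<And>g h. g \<in> K \<Longrightarrow> h \<in> K \<Longrightarrow> \<kappa> (semilin_mult g h) = \<kappa> g * snd g (\<kappa> h)"
  shows "ring_endo R (twist \<kappa>)"
  unfolding ring_endo_def
proof (intro conjI ballI)
  show "twist \<kappa> \<one>\<^bsub>R\<^esub> = \<one>\<^bsub>R\<^esub>" by (auto simp: twist_def R_simps skew_elt_def assms(1))
  fix a b
  show "twist \<kappa> (a \<oplus>\<^bsub>R\<^esub> b) = twist \<kappa> a \<oplus>\<^bsub>R\<^esub> twist \<kappa> b" by (simp add: twist_def R_simps distrib_right)
  show "twist \<kappa> (a \<otimes>\<^bsub>R\<^esub> b) = twist \<kappa> a \<otimes>\<^bsub>R\<^esub> twist \<kappa> b"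
  proof
    fix g
    have "(if semilin_mult h h' = g then a h * snd h (b h') else 0) * \<kappa> g =
      (if semilin_mult h h' = g then a h * \<kappa> h * snd h (b h' * \<kappa> h') else 0)" if "h \<in> K" "h' \<in> K" for h h'
      using assms(2)[OF that] by (auto simp: field_aut_mult[OF aut_K[OF that(1)]])
    then show "twist \<kappa> (a \<otimes>\<^bsub>R\<^esub> b) g = (twist \<kappa> a \<otimes>\<^bsub>R\<^esub> twist \<kappa> b) g"
      unfolding twist_def R_mult sum_distrib_right by (intro sum.cong refl) simp
  qed
qed (simp add: twist_def R_simps)

end

lemma tmod_unit_pullback:
  "lmod_iso R (tmod {()} \<rho> N) (pullback (twist (\<lambda>g. \<rho> g () ())) N)"
  if N: "skew_module K N" and R: "R = skew_group_ring K"
proof -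
  interpret skew_module K N by (rule N)
  show ?thesis
    unfolding R
  proof (rule lmod_isoI[of "\<lambda>v. v ()"])
    show "(\<lambda>v. v ()) \<in> lhom (skew_group_ring K) (tmod {()} \<rho> N) (pullback (twist (\<lambda>g. \<rho> g () ())) N)"
    proof (rule lhomI)
      fix a v assume "a \<in> carrier (skew_group_ring K)" "v \<in> carrier (tmod {()} \<rho> N)"
      then have "(\<lambda>g. a g * \<rho> g () ()) \<odot>\<^bsub>N\<^esub> v () \<in> carrier N"
        by (intro smult_closed R_mult_pointwise) (auto simp: tmod_simps)
      then show "(a \<odot>\<^bsub>tmod {()} \<rho> N\<^esub> v) () = a \<odot>\<^bsub>pullback (twist (\<lambda>g. \<rho> g () ())) N\<^esub> v ()"
        by (simp add: tmod_simps twist_def)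
    qed (auto simp: tmod_simps)
    show "bij_betw (\<lambda>v. v ()) (carrier (tmod {()} \<rho> N)) (carrier (pullback (twist (\<lambda>g. \<rho> g () ())) N))"
      by (rule bij_betw_byWitness[where f' = "\<lambda>x. \<lambda>_\<in>{()}. x"])
         (auto simp: tmod_simps fun_eq_iff)
  qed
qed

section \<open>Conjugate modules and restriction to the linear part\<close>

lemma galois_group_iff: "\<sigma> \<in> galois_group k \<longleftrightarrow> field_aut \<sigma> \<and> (\<forall>x\<in>k. \<sigma> x = x)"
  by (auto simp: galois_group_def field_aut_def)

lemma field_aut_inv: "field_aut \<sigma> \<Longrightarrow> field_aut (inv_into UNIV \<sigma>)"
proof -
  assume \<sigma>: "field_aut \<sigma>"
  note b = field_aut_bij[OF \<sigma>]
  have i: "\<sigma> (inv_into UNIV \<sigma> x) = x" "inv_into UNIV \<sigma> (\<sigma> x) = x" for x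
    using b by (simp_all add: bij_is_surj bij_is_inj surj_f_inv_f)
  show ?thesis
    unfolding field_aut_def
  proof (intro conjI allI)
    show "bij (inv_into UNIV \<sigma>)" using b by (rule bij_imp_bij_inv)
    fix x y
    show "inv_into UNIV \<sigma> (x + y) = inv_into UNIV \<sigma> x + inv_into UNIV \<sigma> y" by (metis i field_aut_add[OF \<sigma>])
    show "inv_into UNIV \<sigma> (x * y) = inv_into UNIV \<sigma> x * inv_into UNIV \<sigma> y" by (metis i field_aut_mult[OF \<sigma>])
  qed
qed

lemma invertible_map_matrix:
  assumes \<sigma>: "field_aut \<sigma>" and A: "invertible (A :: 'l::field^'d^'d)"
  shows "invertible (map_matrix \<sigma> A)"
proof -
  obtain B where "A ** B = mat 1" "B ** A = mat 1" using A by (auto simp: invertible_def)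
  then have "map_matrix \<sigma> A ** map_matrix \<sigma> B = mat 1" "map_matrix \<sigma> B ** map_matrix \<sigma> A = mat 1"
    by (simp_all add: map_matrix_mat_1[OF \<sigma>] flip: map_matrix_mult[OF \<sigma>])
  then show ?thesis unfolding invertible_def by blast
qed

lemma group_semilin: "group (semilin_group k :: ('l::field, 'd::finite) semilin monoid)"
proof (rule groupI)
  let ?S = "semilin_group k :: ('l, 'd) semilin monoid"
  have c: "x \<in> carrier ?S \<longleftrightarrow> invertible (fst x) \<and> snd x \<in> galois_group k" for x
    by (cases x) (simp add: semilin_group_def)
  have m: "x \<otimes>\<^bsub>?S\<^esub> y = semilin_mult x y" "\<one>\<^bsub>?S\<^esub> = semilin_one" for x y by (simp_all add: semilin_group_def)
  have a: "field_aut (snd x)" if "x \<in> carrier ?S" for x using that by (simp add: c galois_group_iff)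
  {
    fix x y assume xy: "x \<in> carrier ?S" "y \<in> carrier ?S"
    then show "x \<otimes>\<^bsub>?S\<^esub> y \<in> carrier ?S"
      unfolding c m galois_group_iff semilin_mult_def fst_conv snd_conv
      by (auto intro!: invertible_mult invertible_map_matrix field_aut_comp)
  next
    show "\<one>\<^bsub>?S\<^esub> \<in> carrier ?S"
      unfolding c m galois_group_iff semilin_one_def by (auto simp: field_aut_id invertible_def)
  next
    fix x y z assume "x \<in> carrier ?S" "y \<in> carrier ?S" "z \<in> carrier ?S"
    then show "x \<otimes>\<^bsub>?S\<^esub> y \<otimes>\<^bsub>?S\<^esub> z = x \<otimes>\<^bsub>?S\<^esub> (y \<otimes>\<^bsub>?S\<^esub> z)" unfolding m by (intro semilin_mult_assoc a)
  next
    fix x assume "x \<in> carrier ?S"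
    show "\<one>\<^bsub>?S\<^esub> \<otimes>\<^bsub>?S\<^esub> x = x" unfolding m by simp
  next
    fix x assume x: "x \<in> carrier ?S"
    obtain B where B: "B ** fst x = mat 1" "fst x ** B = mat 1" using x by (auto simp: c invertible_def)
    let ?i = "inv_into UNIV (snd x)"
    note b = field_aut_bij[OF a[OF x]]
    have i: "snd x (?i y) = y" "?i (snd x y) = y" for y
      using b by (simp_all add: bij_is_surj bij_is_inj surj_f_inv_f)
    have ia: "field_aut ?i" by (rule field_aut_inv[OF a[OF x]])
    \<comment> \<open>The inverse of \<open>(A, \<sigma>)\<close> is the inverse matrix moved by the
      inverse automorphism, together with that automorphism.\<close>
    let ?y = "(map_matrix ?i B, ?i)"
    have "invertible B" using B by (auto simp: invertible_def)
    moreover have "?i y = y" if "y \<in> k" for y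
      using x that i(2)[of y] by (simp add: c galois_group_iff)
    ultimately have "?y \<in> carrier ?S"
      unfolding c galois_group_iff fst_conv snd_conv by (simp add: ia invertible_map_matrix)
    moreover have "?y \<otimes>\<^bsub>?S\<^esub> x = \<one>\<^bsub>?S\<^esub>"
      unfolding m semilin_mult_def semilin_one_def fst_conv snd_conv
      using i(2) by (simp flip: map_matrix_mult[OF ia] add: B map_matrix_mat_1[OF ia] fun_eq_iff)
    ultimately show "\<exists>y\<in>carrier ?S. y \<otimes>\<^bsub>?S\<^esub> x = \<one>\<^bsub>?S\<^esub>" by blast
  }
qed

lemma subgroup_skew:
  assumes sub: "subgroup G (semilin_group k)" and fin: "finite (G :: ('l::field, 'd::finite) semilin set)"
  shows "skew G" and "\<And>g. g \<in> G \<Longrightarrow> inv\<^bsub>semilin_group k\<^esub> g = skew.ginv G g"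
proof -
  interpret S: group "semilin_group k :: ('l, 'd) semilin monoid" by (rule group_semilin)
  interpret G: subgroup G "semilin_group k" by (rule sub)
  have m: "x \<otimes>\<^bsub>semilin_group k\<^esub> y = semilin_mult x y" "\<one>\<^bsub>semilin_group k\<^esub> = semilin_one" for x y :: "('l, 'd) semilin"
    by (simp_all add: semilin_group_def)
  note mem = G.mem_carrier
  show "skew G"
  proof
    fix g assume g: "g \<in> G"
    show "\<exists>h\<in>G. semilin_mult h g = semilin_one \<and> semilin_mult g h = semilin_one"
      using G.m_inv_closed[OF g] S.l_inv[OF mem[OF g]] S.r_inv[OF mem[OF g]] unfolding m by blast
    show "field_aut (snd g)" using mem[OF g] by (cases g) (simp add: semilin_group_def galois_group_iff)
  qed (use fin G.one_closed G.m_closed in \<open>auto simp: m\<close>)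
  then interpret skew G .
  fix g assume g: "g \<in> G"
  have "semilin_mult (inv\<^bsub>semilin_group k\<^esub> g) g = semilin_one" using S.l_inv[OF mem[OF g]] unfolding m .
  then have "semilin_mult (semilin_mult (inv\<^bsub>semilin_group k\<^esub> g) g) (ginv g) = ginv g" by simp
  then show "inv\<^bsub>semilin_group k\<^esub> g = ginv g"
    using assoc_K[OF G.m_inv_closed[OF g]] g G.m_inv_closed[OF g] by simp
qed

text \<open>Lagrange; it carries the condition on the characteristic from \<open>G\<close> over to
  its linear part.\<close>

lemma subgroup_linear_part:
  assumes "subgroup G (semilin_group k)" "finite G"
  shows "card (linear_part G) dvd card (G :: ('l::field, 'd::finite) semilin set)"
proof -
  interpret skew G by (rule subgroup_skew(1)[OF assms])
  interpret S: group "semilin_group k :: ('l, 'd) semilin monoid" by (rule group_semilin)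
  let ?G = "(semilin_group k)\<lparr>carrier := G\<rparr>"
  interpret G: group ?G by (rule subgroup.subgroup_is_group[OF assms(1) group_semilin])
  have "subgroup H ?G"
  proof (rule G.subgroupI)
    fix h assume h: "h \<in> H"
    have "inv\<^bsub>?G\<^esub> h = ginv h"
      using S.m_inv_consistent[OF assms(1) H_K[OF h]] subgroup_skew(2)[OF assms H_K[OF h]] by simp
    then show "inv\<^bsub>?G\<^esub> h \<in> H" using snd_ginv_H[OF h] by simp
  next
    fix h h' assume "h \<in> H" "h' \<in> H"
    then show "h \<otimes>\<^bsub>?G\<^esub> h' \<in> H" by (simp add: semilin_group_def H_iff)
  next
    show "H \<noteq> {}" using skew.one_K[OF skew_H] by blast
  qed (auto simp: H_iff)
  from G.lagrange[OF this] show ?thesis by (simp add: order_def) (metis dvd_triv_right)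
qed

section \<open>Isomorphism classes of simple modules and their conjugates\<close>

lemma iso_class_eq:
  assumes "lmod_iso R M M'" "left_module R M"
  shows "iso_class R M = iso_class R M'"
  unfolding iso_class_def using assms lmod_iso_sym[OF assms(2,1)] by (auto intro: lmod_iso_trans)

lemma simD:
  assumes "C \<in> sim R"
  shows rep_simple: "simple_lmod R (rep C)" and rep_class: "C = iso_class R (rep C)"
proof -
  obtain M where M: "C = iso_class R M" "simple_lmod R M" using assms by (auto simp: sim_def)
  have "M \<in> C" using M simple_left_module[OF M(2)] by (simp add: iso_class_def lmod_iso_refl)
  then have "rep C \<in> C" unfolding rep_def by (rule someI)
  then have r: "left_module R (rep C)" "lmod_iso R (rep C) M" using M(1) by (simp_all add: iso_class_def)
  show "C = iso_class R (rep C)" unfolding M(1) by (rule iso_class_eq[OF r(2,1), symmetric, unfolded M(1)])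
  show "simple_lmod R (rep C)"
    by (rule simple_lmod_cong[OF M(2) lmod_iso_sym[OF r] r(1)])
qed

lemma rep_left_module: "C \<in> sim R \<Longrightarrow> left_module R (rep C)"
  by (rule simple_left_module[OF rep_simple])

lemma iso_class_sim: "simple_lmod R M \<Longrightarrow> iso_class R M \<in> sim R"
  by (auto simp: sim_def)

lemma rep_iso_class:
  assumes "simple_lmod R M"
  shows "lmod_iso R (rep (iso_class R M)) M"
proof -
  have "M \<in> iso_class R M" using simple_left_module[OF assms] by (simp add: iso_class_def lmod_iso_refl)
  then have "rep (iso_class R M) \<in> iso_class R M" unfolding rep_def by (rule someI)
  then show ?thesis by (simp add: iso_class_def)
qed

lemma sim_eqI: "C \<in> sim R \<Longrightarrow> C' \<in> sim R \<Longrightarrow> lmod_iso R (rep C) (rep C') \<Longrightarrow> C = C'"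
  using rep_class[of C R] rep_class[of C' R] iso_class_eq[of R "rep C" "rep C'"] rep_left_module[of C R] by simp

context skew
begin

interpretation HH: skew H by (rule skew_H)

text \<open>\<open>pullback (conj_ring g) W\<close> is \<open>g \<otimes> W\<close>.\<close>

definition conj_ring :: "('l, 'd) semilin \<Rightarrow> (('l, 'd) semilin \<Rightarrow> 'l) \<Rightarrow> ('l, 'd) semilin \<Rightarrow> 'l"
  where "conj_ring g a = (\<lambda>h. if h \<in> H
     then snd (ginv g) (a (semilin_mult (semilin_mult g h) (ginv g))) else 0)"

lemma conj_H:
  assumes "g \<in> K"
  shows "h \<in> H \<Longrightarrow> semilin_mult (semilin_mult g h) (ginv g) \<in> H"
    and "h \<in> H \<Longrightarrow> semilin_mult (semilin_mult (ginv g) h) g \<in> H"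
  using assms snd_ginv[OF assms] by (auto simp: H_iff fun_eq_iff)

lemma conj_inverse:
  assumes "g \<in> K" "h \<in> K"
  shows "semilin_mult (semilin_mult (ginv g) (semilin_mult (semilin_mult g h) (ginv g))) g = h"
    and "semilin_mult (semilin_mult g (semilin_mult (semilin_mult (ginv g) h) g)) (ginv g) = h"
  using assms by (simp_all add: assoc_K ginv_cancel)

lemma conj_bij: "g \<in> K \<Longrightarrow> bij_betw (\<lambda>h. semilin_mult (semilin_mult g h) (ginv g)) H H"
  by (rule bij_betw_byWitness[where f' = "\<lambda>h. semilin_mult (semilin_mult (ginv g) h) g"])
     (auto simp: conj_H conj_inverse H_K)

lemma conj_ring_elt:
  assumes g: "g \<in> K" and y: "y \<in> H"
  shows "conj_ring g (skew_elt c y) = skew_elt (snd (ginv g) c) (semilin_mult (semilin_mult (ginv g) y) g)"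
proof
  fix h
  have z: "snd (ginv g) 0 = 0" by (rule field_aut_0[OF aut_K[OF ginv_K[OF g]]])
  show "conj_ring g (skew_elt c y) h = skew_elt (snd (ginv g) c) (semilin_mult (semilin_mult (ginv g) y) g) h"
  proof (cases "h \<in> H")
    case True
    have "semilin_mult (semilin_mult g h) (ginv g) = y \<longleftrightarrow> h = semilin_mult (semilin_mult (ginv g) y) g"
      using conj_inverse[OF g H_K[OF True]] conj_inverse[OF g H_K[OF y]] by metis
    then show ?thesis using True z by (simp add: conj_ring_def skew_elt_def)
  next
    case False
    then have "h \<noteq> semilin_mult (semilin_mult (ginv g) y) g" using conj_H(2)[OF g y] by blast
    then show ?thesis using False by (simp add: conj_ring_def skew_elt_def)
  qed
qed

text \<open>Multiplicativity rests on the normality of \<open>H\<close> and on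
  \<open>snd h = id\<close> for its elements, by which products in the ring of \<open>H\<close>
  involve no twist of their own.\<close>

lemma conj_ring_endo:
  assumes g: "g \<in> K"
  shows "ring_endo HH.R (conj_ring g)" and "carrier HH.R \<subseteq> conj_ring g ` carrier HH.R"
proof -
  let ?c = "\<lambda>h. semilin_mult (semilin_mult g h) (ginv g)"
  note a = aut_K[OF ginv_K[OF g]]
  show "ring_endo HH.R (conj_ring g)"
    unfolding ring_endo_def
  proof (intro conjI ballI)
    have "semilin_mult (semilin_mult (ginv g) semilin_one) g = semilin_one" using g by simp
    then show "conj_ring g \<one>\<^bsub>HH.R\<^esub> = \<one>\<^bsub>HH.R\<^esub>"
      unfolding HH.R_simps conj_ring_elt[OF g HH.one_K] by (simp add: field_aut_1[OF a])
  next
    fix x y assume xy: "x \<in> carrier HH.R" "y \<in> carrier HH.R"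
    show "conj_ring g (x \<oplus>\<^bsub>HH.R\<^esub> y) = conj_ring g x \<oplus>\<^bsub>HH.R\<^esub> conj_ring g y"
      by (auto simp: conj_ring_def HH.R_simps fun_eq_iff field_aut_add[OF a])
    show "conj_ring g (x \<otimes>\<^bsub>HH.R\<^esub> y) = conj_ring g x \<otimes>\<^bsub>HH.R\<^esub> conj_ring g y"
    proof
      fix h
      show "conj_ring g (x \<otimes>\<^bsub>HH.R\<^esub> y) h = (conj_ring g x \<otimes>\<^bsub>HH.R\<^esub> conj_ring g y) h"
      proof (cases "h \<in> H")
        case False
        then show ?thesis using HH.R_mult_closed[of "conj_ring g x" "conj_ring g y"]
          by (simp add: conj_ring_def HH.R_simps)
      next
        case True
        have e: "semilin_mult (?c u) (?c v) = ?c h \<longleftrightarrow> semilin_mult u v = h" if uv: "u \<in> H" "v \<in> H" for u v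
        proof -
          have "semilin_mult (?c u) (?c v) = ?c (semilin_mult u v)"
            using uv g by (simp add: assoc_K H_K ginv_cancel)
          then show ?thesis
            using conj_inverse(1)[OF g, of "semilin_mult u v"] conj_inverse(1)[OF g H_K[OF True]] uv H_K
            by (metis mult_K)
        qed
        have "(x \<otimes>\<^bsub>HH.R\<^esub> y) (?c h) = (\<Sum>u\<in>H. \<Sum>v\<in>H. if semilin_mult (?c u) (?c v) = ?c h then x (?c u) * snd (?c u) (y (?c v)) else 0)"
          unfolding HH.R_mult
          by (subst sum.reindex_bij_betw[OF conj_bij[OF g], symmetric],
              rule sum.cong[OF refl], rule sum.reindex_bij_betw[OF conj_bij[OF g], symmetric])
        also have "\<dots> = (\<Sum>u\<in>H. \<Sum>v\<in>H. if semilin_mult u v = h then x (?c u) * y (?c v) else 0)"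
        proof (intro sum.cong refl)
          fix u v assume uv: "u \<in> H" "v \<in> H"
          have "snd (?c u) = id" using conj_H(1)[OF g uv(1)] H_iff by blast
          then show "(if semilin_mult (?c u) (?c v) = ?c h then x (?c u) * snd (?c u) (y (?c v)) else 0) =
            (if semilin_mult u v = h then x (?c u) * y (?c v) else 0)" by (simp only: e[OF uv] id_apply)
        qed
        finally have "snd (ginv g) ((x \<otimes>\<^bsub>HH.R\<^esub> y) (?c h)) =
          (\<Sum>u\<in>H. \<Sum>v\<in>H. if semilin_mult u v = h then snd (ginv g) (x (?c u)) * snd (ginv g) (y (?c v)) else 0)"
          by (simp add: field_aut_sum[OF a] if_distrib[of "snd (ginv g)"] field_aut_mult[OF a] field_aut_0[OF a] cong: if_cong)
        also have "\<dots> = (conj_ring g x \<otimes>\<^bsub>HH.R\<^esub> conj_ring g y) h"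
          unfolding HH.R_mult
          by (intro sum.cong refl) (simp add: conj_ring_def H_iff)
        finally show ?thesis using True by (simp add: conj_ring_def)
      qed
    qed
  qed (simp add: conj_ring_def HH.R_simps)
  show "carrier HH.R \<subseteq> conj_ring g ` carrier HH.R"
  proof
    fix x assume x: "x \<in> carrier HH.R"
    let ?y = "\<lambda>h. if h \<in> H then snd g (x (semilin_mult (semilin_mult (ginv g) h) g)) else 0"
    have "x h = conj_ring g ?y h" for h
    proof (cases "h \<in> H")
      case True
      then show ?thesis
        using conj_H(1)[OF g True] by (simp add: conj_ring_def conj_inverse(1)[OF g H_K[OF True]] snd_ginv[OF g])
    qed (use x in \<open>simp add: conj_ring_def HH.R_simps\<close>)
    moreover have "?y \<in> carrier HH.R" by (simp add: HH.R_simps)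
    ultimately show "x \<in> conj_ring g ` carrier HH.R" by (intro image_eqI[of _ _ ?y] ext)
  qed
qed

lemma conj_skew_module:
  assumes "skew_module H W" "g \<in> K"
  shows "skew_module H (pullback (conj_ring g) W)"
proof -
  have "left_module HH.R (pullback (conj_ring g) W)"
    using pullback_left_module[OF _ conj_ring_endo(1)[OF assms(2)]] assms(1) unfolding skew_module_def by iprover
  then show ?thesis using assms(1) unfolding skew_module_def by iprover
qed

text \<open>Two elements over the same automorphism differ by some \<open>u\<close> in
  \<open>H\<close>, and acting with \<open>u\<close> intertwines the two conjugates. This makes the
  Galois action on classes well defined.\<close>

lemma conj_iso:
  assumes W: "skew_module H W" and g: "g \<in> K" "g' \<in> K" "snd g = snd g'"
  shows "lmod_iso HH.R (pullback (conj_ring g) W) (pullback (conj_ring g') W)"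
proof -
  interpret W: skew_module H W by (rule W)
  define u where "u = semilin_mult (ginv g') g"
  have u: "u \<in> H" using g snd_ginv(2)[OF g(2)] by (auto simp: u_def H_iff fun_eq_iff)
  have uK: "u \<in> K" by (rule H_K[OF u])
  have s: "scal (pullback (conj_ring x) W) c w = scal W (snd (ginv x) c) w" if "x \<in> K" for x c w
    using that by (simp add: scal_def conj_ring_elt)
  have t: "act (pullback (conj_ring x) W) y w = act W (semilin_mult (semilin_mult (ginv x) y) x) w" if "x \<in> K" "y \<in> H" for x y w
    using that by (simp add: act_def conj_ring_elt field_aut_1[OF aut_K])
  have gi: "snd (ginv g) c = snd (ginv g') c" for c
    using snd_ginv[OF g(1)] snd_ginv[OF g(2)] g(3) by metis
  show ?thesis
  proof (rule lmod_isoI[of "act W u"])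
    show "act W u \<in> lhom HH.R (pullback (conj_ring g) W) (pullback (conj_ring g') W)"
    proof (rule skew_lhomI[OF conj_skew_module[OF W g(1)] conj_skew_module[OF W g(2)]])
      fix c x assume "x \<in> carrier (pullback (conj_ring g) W)"
      then show "act W u (scal (pullback (conj_ring g) W) c x) = scal (pullback (conj_ring g') W) c (act W u x)"
        using u by (simp add: s g gi W.act_scal H_iff)
    next
      fix y x assume y: "y \<in> H" and x: "x \<in> carrier (pullback (conj_ring g) W)"
      have "semilin_mult u (semilin_mult (semilin_mult (ginv g) y) g) = semilin_mult (semilin_mult (semilin_mult (ginv g') y) g') u"
        unfolding u_def using g H_K[OF y] by (simp add: assoc_K ginv_cancel)
      then show "act W u (act (pullback (conj_ring g) W) y x) = act (pullback (conj_ring g') W) y (act W u x)"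
        using x y u g by (simp add: t W.act_act conj_H)
    qed (use u in \<open>simp_all add: W.act_add\<close>)
    show "bij_betw (act W u) (carrier (pullback (conj_ring g) W)) (carrier (pullback (conj_ring g') W))"
      by (rule bij_betw_byWitness[where f' = "act W (ginv u)"])
         (use u uK snd_ginv_H[OF u] in \<open>auto simp: W.act_act\<close>)
  qed
qed

lemma conj_one: "skew_module H W \<Longrightarrow> lmod_iso HH.R (pullback (conj_ring semilin_one) W) W"
proof -
  assume "skew_module H W"
  have i: "ginv semilin_one = semilin_one" using ginv_left[OF one_K] one_right_K[OF ginv_K[OF one_K]] by simp
  have "conj_ring semilin_one a = a" if "a \<in> carrier HH.R" for a
    using that by (auto simp: conj_ring_def i fun_eq_iff HH.R_simps H_iff)
  then show ?thesis by (intro lmod_isoI[of id]) (auto intro!: lhomI)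
qed

end

text \<open>
  The constructions over \<open>K\<close> and over its linear part have the same elements, so that they differ only
  in which scalars act meaningfully.
\<close>

definition mod_agree :: "('a, 'r) ring_scheme \<Rightarrow> ('a, 'b) module \<Rightarrow> ('a, 'b) module \<Rightarrow> bool"
  where "mod_agree R M M' \<longleftrightarrow> carrier M = carrier M' \<and> zero M = zero M' \<and> add M = add M' \<and>
    (\<forall>a\<in>carrier R. \<forall>x. a \<odot>\<^bsub>M\<^esub> x = a \<odot>\<^bsub>M'\<^esub> x)"

lemma mod_agree_iso: "mod_agree R M M' \<Longrightarrow> lmod_iso R M M'"
  by (rule lmod_isoI[of id]) (auto simp: mod_agree_def intro!: lhomI)

lemma mod_agree_add_monoid: "mod_agree R M M' \<Longrightarrow> add_monoid M = add_monoid M'"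
  by (simp add: mod_agree_def)

lemma mod_agree_quotient:
  assumes "mod_agree R M M'"
  shows "mod_agree R (quotient_lmod M N) (quotient_lmod M' N)"
  using assms mod_agree_add_monoid[OF assms]
  by (simp add: mod_agree_def quotient_lmod_def A_RCOSETS_def a_r_coset_def set_add_def)

lemma mod_agree_cotangent:
  fixes K H :: "('l::field, 'd::finite) semilin set"
  assumes "finite K" "H \<subseteq> K"
  shows "mod_agree (skew_group_ring H) (cotangent_module K) (cotangent_module H)"
proof -
  have "(\<Sum>g\<in>K. a g * x g) = (\<Sum>g\<in>H. a g * x g)" if "a \<in> carrier (skew_group_ring H)" for a and x :: "_ \<Rightarrow> 'l"
    by (rule sum.mono_neutral_right) (use assms that in \<open>auto simp: skew_group_ring_def\<close>)
  then show ?thesis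
    unfolding cotangent_module_def
    by (intro mod_agree_quotient) (simp add: mod_agree_def pow_series_module_def)
qed

text \<open>Relations and l-spans involve only scalars at the identity element, which belong to the
  ring of \<open>H\<close>. Both constructions therefore factor out the same set and have the same
  cosets as elements.\<close>

lemma mod_agree_exterior:
  fixes K H :: "('l::field, 'd::finite) semilin set"
  assumes K: "finite K" "H \<subseteq> K" "semilin_one \<in> H"
    and U: "mod_agree (skew_group_ring H) U U'"
  shows "mod_agree (skew_group_ring H) (exterior_power K m U) (exterior_power H m U')"
proof -
  let ?F = "free_lmod K (\<lambda>g. map (\<lambda>u. skew_elt 1 g \<odot>\<^bsub>U\<^esub> u)) {us. length us = m \<and> set us \<subseteq> carrier U}"
  let ?F' = "free_lmod H (\<lambda>g. map (\<lambda>u. skew_elt 1 g \<odot>\<^bsub>U'\<^esub> u)) {us. length us = m \<and> set us \<subseteq> carrier U'}"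
  have elt: "skew_elt c g \<in> carrier (skew_group_ring H)" if "g \<in> H" for c g
    using that by (auto simp: skew_group_ring_def skew_elt_def)
  have UU: "carrier U = carrier U'" "x \<oplus>\<^bsub>U\<^esub> y = x \<oplus>\<^bsub>U'\<^esub> y" "g \<in> H \<Longrightarrow> skew_elt c g \<odot>\<^bsub>U\<^esub> x = skew_elt c g \<odot>\<^bsub>U'\<^esub> x" for c g x y
    using U elt by (simp_all add: mod_agree_def)
  have sums: "(\<Sum>g\<in>K. a g * x g) = (\<Sum>g\<in>H. a g * x g)" if "a \<in> carrier (skew_group_ring H)" for a and x :: "_ \<Rightarrow> 'l"
    by (rule sum.mono_neutral_right) (use K that in \<open>auto simp: skew_group_ring_def\<close>)
  have UU3: "smult U (skew_elt c g) = smult U' (skew_elt c g)" if "g \<in> H" for c g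
    by (rule ext, rule UU(3)[OF that])
  have F: "mod_agree (skew_group_ring H) ?F ?F'"
    unfolding mod_agree_def
  proof (intro conjI ballI allI)
    fix a f assume a: "a \<in> carrier (skew_group_ring H)"
    show "a \<odot>\<^bsub>?F\<^esub> f = a \<odot>\<^bsub>?F'\<^esub> f"
      unfolding free_lmod_def module.simps sums[OF a] by (intro ext sum.cong refl) (simp add: UU3)
  qed (simp_all add: free_lmod_def UU)
  have rel: "exterior_relations m U = exterior_relations m U'"
    unfolding exterior_relations_def UU(1,2) UU(3)[OF K(3)] ..
  have one: "carrier (skew_group_ring {semilin_one}) \<subseteq> carrier (skew_group_ring H)"
  proof
    fix x :: "('l, 'd) semilin \<Rightarrow> 'l" assume "x \<in> carrier (skew_group_ring {semilin_one})"
    then have "x g = 0" if "g \<notin> H" for g using K(3) that by (cases "g = semilin_one") (auto simp: skew_group_ring_def)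
    then show "x \<in> carrier (skew_group_ring H)" by (simp add: skew_group_ring_def)
  qed
  have sm: "a \<odot>\<^bsub>?F\<^esub> x = a \<odot>\<^bsub>?F'\<^esub> x" if "a \<in> carrier (skew_group_ring {semilin_one})" for a x
    using F one that unfolding mod_agree_def by blast
  have "submodule N (skew_group_ring {semilin_one}) ?F \<longleftrightarrow> submodule N (skew_group_ring {semilin_one}) ?F'" for N
    unfolding submodule_def submodule_axioms_def mod_agree_add_monoid[OF F] by (simp only: sm cong: imp_cong)
  then have span: "l_span ?F B = l_span ?F' B" for B unfolding l_span_def by simp
  show ?thesis
    unfolding exterior_power_def Let_def rel span by (rule mod_agree_quotient[OF F])
qed

section \<open>Restricting tensor products to the linear part\<close>

lemma cocycle_mono: "cocycle K I \<rho> \<Longrightarrow> H \<subseteq> K \<Longrightarrow> cocycle H I \<rho>"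
  unfolding cocycle_def by blast

lemma tmod_cong:
  assumes V: "skew_module K V" and W: "skew_module K W" and iso: "lmod_iso (skew_group_ring K) V W"
    and I: "finite I"
  shows "lmod_iso (skew_group_ring K) (tmod I \<rho> V) (tmod I \<rho> W)"
proof -
  interpret V: skew_module K V by (rule V)
  interpret W: skew_module K W by (rule W)
  obtain f where f: "f \<in> lhom V.R V W" "bij_betw f (carrier V) (carrier W)"
    using iso by (auto simp: lmod_iso_lhom)
  define h where "h = inv_into (carrier V) f"
  have h: "h \<in> lhom V.R W V" "\<And>x. x \<in> carrier V \<Longrightarrow> h (f x) = x" "\<And>y. y \<in> carrier W \<Longrightarrow> f (h y) = y"
    unfolding h_def using lhom_inv_into[OF V.left_module_axioms f]
      bij_betw_inv_into_left[OF f(2)] bij_betw_inv_into_right[OF f(2)] by iprover+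
  show ?thesis
  proof (rule lmod_isoI[of "\<lambda>v. \<lambda>i\<in>I. f (v i)"])
    show "(\<lambda>v. \<lambda>i\<in>I. f (v i)) \<in> lhom V.R (tmod I \<rho> V) (tmod I \<rho> W)"
    proof (rule lhomI)
      fix v assume "v \<in> carrier (tmod I \<rho> V)"
      then have "v i \<in> carrier V" if "i \<in> I" for i using that by (auto simp: tmod_simps)
      then show "(\<lambda>i\<in>I. f (v i)) \<in> carrier (tmod I \<rho> W)"
        unfolding tmod_simps restrict_PiE_iff using lhom_closed[OF f(1)] by blast
    next
      fix v w assume "v \<in> carrier (tmod I \<rho> V)" "w \<in> carrier (tmod I \<rho> V)"
      then have "v i \<in> carrier V" "w i \<in> carrier V" if "i \<in> I" for i using that by (auto simp: tmod_simps)
      then show "(\<lambda>i\<in>I. f ((v \<oplus>\<^bsub>tmod I \<rho> V\<^esub> w) i)) = (\<lambda>i\<in>I. f (v i)) \<oplus>\<^bsub>tmod I \<rho> W\<^esub> (\<lambda>i\<in>I. f (w i))"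
        unfolding tmod_simps by (intro restrict_ext) (simp add: lhom_add[OF f(1)])
    next
      fix a v assume a: "a \<in> carrier V.R" and "v \<in> carrier (tmod I \<rho> V)"
      then have v: "v i \<in> carrier V" if "i \<in> I" for i using that by (auto simp: tmod_simps)
      have "f (finsum V (\<lambda>j. (\<lambda>g. a g * \<rho> g i j) \<odot>\<^bsub>V\<^esub> v j) I) = finsum W (\<lambda>j. (\<lambda>g. a g * \<rho> g i j) \<odot>\<^bsub>W\<^esub> f (v j)) I" for i
      proof -
        have "f (finsum V (\<lambda>j. (\<lambda>g. a g * \<rho> g i j) \<odot>\<^bsub>V\<^esub> v j) I) = finsum W (\<lambda>j. f ((\<lambda>g. a g * \<rho> g i j) \<odot>\<^bsub>V\<^esub> v j)) I"
          by (rule lhom_finsum[OF V.left_module_axioms W.left_module_axioms f(1) I])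
             (use v in \<open>auto simp: V.smult_closed V.R_mult_pointwise[OF a]\<close>)
        also have "\<dots> = finsum W (\<lambda>j. (\<lambda>g. a g * \<rho> g i j) \<odot>\<^bsub>W\<^esub> f (v j)) I"
          by (rule W.M.finsum_cong'[OF refl])
             (use v lhom_closed[OF f(1)] in \<open>auto simp: lhom_smult[OF f(1)] W.smult_closed V.R_mult_pointwise[OF a]\<close>)
        finally show ?thesis .
      qed
      moreover have "finsum W (\<lambda>j. (\<lambda>g. a g * \<rho> g i j) \<odot>\<^bsub>W\<^esub> f (v j)) I =
        finsum W (\<lambda>j. (\<lambda>g. a g * \<rho> g i j) \<odot>\<^bsub>W\<^esub> (\<lambda>i\<in>I. f (v i)) j) I" for i
        by (rule W.M.finsum_cong'[OF refl])
           (use v lhom_closed[OF f(1)] in \<open>auto simp: W.smult_closed V.R_mult_pointwise[OF a]\<close>)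
      ultimately show "(\<lambda>i\<in>I. f ((a \<odot>\<^bsub>tmod I \<rho> V\<^esub> v) i)) = a \<odot>\<^bsub>tmod I \<rho> W\<^esub> (\<lambda>i\<in>I. f (v i))"
        unfolding tmod_simps by (intro restrict_ext) simp
    qed
    show "bij_betw (\<lambda>v. \<lambda>i\<in>I. f (v i)) (carrier (tmod I \<rho> V)) (carrier (tmod I \<rho> W))"
      by (rule bij_betw_byWitness[where f' = "\<lambda>v. \<lambda>i\<in>I. h (v i)"])
         (auto simp: tmod_simps PiE_iff fun_eq_iff extensional_def h(2,3) lhom_closed[OF f(1)] lhom_closed[OF h(1)])
  qed
qed

text \<open>Both sides are doubly indexed families; the map exchanges the two indices, and the
  action involves only the one from \<open>I\<close>.\<close>

lemma tmod_direct_sum: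
  assumes W: "\<And>x. x \<in> A \<Longrightarrow> skew_module K (W x)" and I: "finite I" and K: "skew K"
  shows "lmod_iso (skew_group_ring K) (tmod I \<rho> (direct_sum A W)) (direct_sum A (\<lambda>x. tmod I \<rho> (W x)))"
proof -
  interpret skew K by (rule K)
  have lW: "left_module R (W x)" if "x \<in> A" for x using W[OF that] by (simp add: skew_module_def)
  have lD: "left_module R (direct_sum A W)" by (rule left_module_direct_sum[OF ring_R lW])
  interpret D: skew_module K "direct_sum A W" by (simp add: skew_module_def skew_axioms lD)
  show ?thesis
  proof (rule lmod_isoI[of "\<lambda>v. \<lambda>x\<in>A. \<lambda>i\<in>I. v i x"])
    show "(\<lambda>v. \<lambda>x\<in>A. \<lambda>i\<in>I. v i x) \<in> lhom R (tmod I \<rho> (direct_sum A W)) (direct_sum A (\<lambda>x. tmod I \<rho> (W x)))"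
    proof (rule lhomI)
      fix v assume "v \<in> carrier (tmod I \<rho> (direct_sum A W))"
      then show "(\<lambda>x\<in>A. \<lambda>i\<in>I. v i x) \<in> carrier (direct_sum A (\<lambda>x. tmod I \<rho> (W x)))"
        by (simp add: direct_sum_simps tmod_simps restrict_PiE_iff PiE_iff)
    next
      fix v w
      show "(\<lambda>x\<in>A. \<lambda>i\<in>I. (v \<oplus>\<^bsub>tmod I \<rho> (direct_sum A W)\<^esub> w) i x) =
        (\<lambda>x\<in>A. \<lambda>i\<in>I. v i x) \<oplus>\<^bsub>direct_sum A (\<lambda>x. tmod I \<rho> (W x))\<^esub> (\<lambda>x\<in>A. \<lambda>i\<in>I. w i x)"
        unfolding direct_sum_simps tmod_simps by (intro restrict_ext) simp
    next
      fix a v assume a: "a \<in> carrier R" and v: "v \<in> carrier (tmod I \<rho> (direct_sum A W))"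
      have vD: "v j \<in> carrier (direct_sum A W)" if "j \<in> I" for j using v that by (auto simp: tmod_simps)
      have "(\<lambda>i\<in>I. (a \<odot>\<^bsub>tmod I \<rho> (direct_sum A W)\<^esub> v) i x) = a \<odot>\<^bsub>tmod I \<rho> (W x)\<^esub> (\<lambda>i\<in>I. v i x)" if x: "x \<in> A" for x
      proof -
        interpret Wx: skew_module K "W x" by (rule W[OF x])
        have vx: "v j x \<in> carrier (W x)" if "j \<in> I" for j using vD[OF that] x by (auto simp: direct_sum_simps)
        have "finsum (direct_sum A W) (\<lambda>j. (\<lambda>g. a g * \<rho> g i j) \<odot>\<^bsub>direct_sum A W\<^esub> v j) I x =
          finsum (W x) (\<lambda>j. (\<lambda>g. a g * \<rho> g i j) \<odot>\<^bsub>W x\<^esub> (\<lambda>i\<in>I. v i x) j) I" for i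
        proof -
          have "finsum (direct_sum A W) (\<lambda>j. (\<lambda>g. a g * \<rho> g i j) \<odot>\<^bsub>direct_sum A W\<^esub> v j) I x =
            finsum (W x) (\<lambda>j. ((\<lambda>g. a g * \<rho> g i j) \<odot>\<^bsub>direct_sum A W\<^esub> v j) x) I"
            by (rule lhom_finsum[OF lD lW[OF x] lhom_proj[OF x] I])
               (use vD in \<open>auto simp: D.smult_closed D.R_mult_pointwise[OF a]\<close>)
          also have "\<dots> = finsum (W x) (\<lambda>j. (\<lambda>g. a g * \<rho> g i j) \<odot>\<^bsub>W x\<^esub> (\<lambda>i\<in>I. v i x) j) I"
            by (rule Wx.M.finsum_cong'[OF refl])
               (use x vx in \<open>auto simp: direct_sum_simps Wx.smult_closed D.R_mult_pointwise[OF a]\<close>)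
          finally show ?thesis .
        qed
        then show ?thesis unfolding tmod_simps by (intro restrict_ext) simp
      qed
      then show "(\<lambda>x\<in>A. \<lambda>i\<in>I. (a \<odot>\<^bsub>tmod I \<rho> (direct_sum A W)\<^esub> v) i x) =
        a \<odot>\<^bsub>direct_sum A (\<lambda>x. tmod I \<rho> (W x))\<^esub> (\<lambda>x\<in>A. \<lambda>i\<in>I. v i x)"
        unfolding direct_sum_simps by (intro restrict_ext) simp
    qed
    show "bij_betw (\<lambda>v. \<lambda>x\<in>A. \<lambda>i\<in>I. v i x) (carrier (tmod I \<rho> (direct_sum A W))) (carrier (direct_sum A (\<lambda>x. tmod I \<rho> (W x))))"
      by (rule bij_betw_byWitness[where f' = "\<lambda>v. \<lambda>i\<in>I. \<lambda>x\<in>A. v x i"])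
         (auto simp: tmod_simps direct_sum_simps PiE_iff fun_eq_iff extensional_def)
  qed
qed

text \<open>Splitting every \<open>Y z\<close> into simples gives a decomposition of
  \<open>X\<close> indexed by a disjoint union, where counting is additive.\<close>

lemma summand_multiplicity_direct_sum:
  fixes Y :: "'z \<Rightarrow> ('a, 'b) module" and X :: "('a, 'c) module" and V :: "('a, 'v) module"
  assumes X: "left_module R X" and V: "simple_lmod R V" and Z: "finite Z"
    and Y: "\<And>z. z \<in> Z \<Longrightarrow> left_module R (Y z)"
    and ss: "\<And>z. z \<in> Z \<Longrightarrow> \<exists>(n::nat) (S :: nat \<Rightarrow> ('a, 'b) module). (\<forall>i<n. simple_lmod R (S i)) \<and> lmod_iso R (Y z) (direct_sum {..<n} S)"
    and iso: "lmod_iso R X (direct_sum Z Y)"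
  shows "summand_multiplicity R V X = (\<Sum>z\<in>Z. summand_multiplicity R V (Y z))"
proof -
  have "\<forall>z\<in>Z. \<exists>(n::nat) (S :: nat \<Rightarrow> ('a, 'b) module). (\<forall>i<n. simple_lmod R (S i)) \<and> lmod_iso R (Y z) (direct_sum {..<n} S)"
    using ss by blast
  then obtain n where "\<forall>z\<in>Z. \<exists>(S :: nat \<Rightarrow> ('a, 'b) module). (\<forall>i<n z. simple_lmod R (S i)) \<and> lmod_iso R (Y z) (direct_sum {..<n z} S)"
    unfolding bchoice_iff by blast
  then obtain S :: "'z \<Rightarrow> nat \<Rightarrow> ('a, 'b) module" where S: "\<forall>z\<in>Z. (\<forall>i<n z. simple_lmod R (S z i)) \<and> lmod_iso R (Y z) (direct_sum {..<n z} (S z))"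
    unfolding bchoice_iff by blast
  have "lmod_iso R (direct_sum Z Y) (direct_sum Z (\<lambda>z. direct_sum {..<n z} (S z)))"
    by (rule direct_sum_cong_iso) (use S Y in blast)+
  from lmod_iso_trans[OF iso lmod_iso_trans[OF this direct_sum_Sigma]]
  have "lmod_iso R X (direct_sum (Sigma Z (\<lambda>z. {..<n z})) (\<lambda>p. S (fst p) (snd p)))" .
  from summand_multiplicity_eq[OF X V _ _ this]
  have "summand_multiplicity R V X = enat (card {p \<in> Sigma Z (\<lambda>z. {..<n z}). lmod_iso R (S (fst p) (snd p)) V})"
    using S Z by fastforce
  also have "{p \<in> Sigma Z (\<lambda>z. {..<n z}). lmod_iso R (S (fst p) (snd p)) V} = Sigma Z (\<lambda>z. {i \<in> {..<n z}. lmod_iso R (S z i) V})"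
    by auto
  also have "enat (card \<dots>) = (\<Sum>z\<in>Z. enat (card {i \<in> {..<n z}. lmod_iso R (S z i) V}))"
    using Z by (simp add: card_SigmaI flip: of_nat_eq_enat)
  also have "\<dots> = (\<Sum>z\<in>Z. summand_multiplicity R V (Y z))"
  proof (rule sum.cong[OF refl])
    fix z assume z: "z \<in> Z"
    show "enat (card {i \<in> {..<n z}. lmod_iso R (S z i) V}) = summand_multiplicity R V (Y z)"
      by (rule summand_multiplicity_eq[OF Y[OF z] V, symmetric]) (use S z in auto)
  qed
  finally show ?thesis .
qed

text \<open>
  Composing the projection of \<open>M\<close> to the common constituent with its inclusion into \<open>N\<close> gives a nonzero
  homomorphism over the linear part, to which Galois descent applies.
\<close>

lemma common_constituent_iso:
  fixes M :: "(('l::field, 'd::finite) semilin \<Rightarrow> 'l, 'b) module" and N :: "(('l, 'd) semilin \<Rightarrow> 'l, 'c) module"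
    and S :: "'x \<Rightarrow> (('l, 'd) semilin \<Rightarrow> 'l, 'p) module" and T :: "'y \<Rightarrow> (('l, 'd) semilin \<Rightarrow> 'l, 'q) module"
  assumes K: "skew K" and char: "of_nat (card (linear_part K)) \<noteq> (0::'l)"
    and M: "simple_lmod (skew_group_ring K) M" and N: "simple_lmod (skew_group_ring K) N"
    and S: "\<And>x. x \<in> A \<Longrightarrow> simple_lmod (skew_group_ring (linear_part K)) (S x)"
    and T: "\<And>y. y \<in> B \<Longrightarrow> simple_lmod (skew_group_ring (linear_part K)) (T y)"
    and MS: "lmod_iso (skew_group_ring (linear_part K)) M (direct_sum A S)"
    and NT: "lmod_iso (skew_group_ring (linear_part K)) N (direct_sum B T)"
    and xy: "x \<in> A" "y \<in> B" "lmod_iso (skew_group_ring (linear_part K)) (S x) (T y)"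
  shows "lmod_iso (skew_group_ring K) M N"
proof -
  interpret skew K by (rule K)
  let ?R = "skew_group_ring (linear_part K)"
  have sM: "skew_module K M" and sN: "skew_module K N"
    using simple_left_module[OF M] simple_left_module[OF N] K by (simp_all add: skew_module_def)
  have hM: "left_module ?R M" and hN: "left_module ?R N"
    using skew_module_restrict[OF sM skew_H] skew_module_restrict[OF sN skew_H] H_K
    unfolding skew_module_def by blast+
  have R: "ring ?R" by (rule skew.ring_R[OF skew_H])
  have lS: "left_module ?R (S a)" if "a \<in> A" for a by (rule simple_left_module[OF S[OF that]])
  have lT: "left_module ?R (T b)" if "b \<in> B" for b by (rule simple_left_module[OF T[OF that]])
  have dS: "left_module ?R (direct_sum A S)" by (rule left_module_direct_sum[OF R lS])
  have dT: "left_module ?R (direct_sum B T)" by (rule left_module_direct_sum[OF R lT])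
  obtain \<phi> where \<phi>: "\<phi> \<in> lhom ?R M (direct_sum A S)" "bij_betw \<phi> (carrier M) (carrier (direct_sum A S))"
    using MS unfolding lmod_iso_lhom by blast
  obtain \<psi> where \<psi>: "\<psi> \<in> lhom ?R (direct_sum B T) N" "bij_betw \<psi> (carrier (direct_sum B T)) (carrier N)"
    using lmod_iso_sym[OF hN NT] unfolding lmod_iso_lhom by blast
  obtain \<theta> where \<theta>: "\<theta> \<in> lhom ?R (S x) (T y)" "bij_betw \<theta> (carrier (S x)) (carrier (T y))"
    using xy(3) unfolding lmod_iso_lhom by blast
  obtain w where w: "w \<in> carrier (S x)" "w \<noteq> \<zero>\<^bsub>S x\<^esub>" using simple_nonzero[OF S[OF xy(1)]] by blast
  have iw: "dinj A S x w \<in> carrier (direct_sum A S)"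
    using lhom_closed[OF lhom_dinj[of A ?R S x] w(1)] lS xy(1) by blast
  obtain v where v: "v \<in> carrier M" "\<phi> v = dinj A S x w"
    using \<phi>(2) iw unfolding bij_betw_def by (metis imageE)
  define f where "f = \<psi> \<circ> (dinj B T y \<circ> (\<theta> \<circ> ((\<lambda>u. u x) \<circ> \<phi>)))"
  have "dinj B T y \<in> lhom ?R (T y) (direct_sum B T)" using lhom_dinj[of B ?R T y] lT xy(2) by blast
  then have f: "f \<in> lhom ?R M N"
    unfolding f_def by (intro lhom_comp[OF _ \<psi>(1)] lhom_comp[of _ ?R M "T y"] lhom_comp[OF _ \<theta>(1)]
      lhom_comp[OF \<phi>(1)] lhom_proj xy(1))
  have "f v \<noteq> \<zero>\<^bsub>N\<^esub>"
  proof
    assume "f v = \<zero>\<^bsub>N\<^esub>"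
    moreover have "f v = \<psi> (dinj B T y (\<theta> w))" using xy(1) by (simp add: f_def v(2) dinj_def)
    moreover have z: "\<psi> \<zero>\<^bsub>direct_sum B T\<^esub> = \<zero>\<^bsub>N\<^esub>" by (rule lhom_zero[OF dT hN \<psi>(1)])
    moreover have "dinj B T y (\<theta> w) \<in> carrier (direct_sum B T)"
      using lhom_closed[OF lhom_dinj[of B ?R T y] lhom_closed[OF \<theta>(1) w(1)]] lT xy(2) by blast
    moreover have "\<zero>\<^bsub>direct_sum B T\<^esub> \<in> carrier (direct_sum B T)"
      using dT unfolding left_module_def abelian_group_def by (blast intro: abelian_monoid.zero_closed)
    ultimately have "dinj B T y (\<theta> w) = \<zero>\<^bsub>direct_sum B T\<^esub>"
      using \<psi>(2) unfolding bij_betw_def inj_on_def by metis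
    then have "dinj B T y (\<theta> w) y = \<zero>\<^bsub>direct_sum B T\<^esub> y" by simp
    then have "\<theta> w = \<zero>\<^bsub>T y\<^esub>" using xy(2) by (simp add: dinj_def direct_sum_simps)
    moreover have "\<theta> \<zero>\<^bsub>S x\<^esub> = \<zero>\<^bsub>T y\<^esub>" by (rule lhom_zero[OF lS[OF xy(1)] lT[OF xy(2)] \<theta>(1)])
    moreover have "\<zero>\<^bsub>S x\<^esub> \<in> carrier (S x)"
      using lS[OF xy(1)] unfolding left_module_def abelian_group_def by (blast intro: abelian_monoid.zero_closed)
    ultimately show False using w \<theta>(2) unfolding bij_betw_def inj_on_def by metis
  qed
  from Galois_descent[OF sM sN char f v(1) this] obtain p where
    p: "p \<in> lhom R M N" "p v \<noteq> \<zero>\<^bsub>N\<^esub>" by blast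
  show ?thesis by (rule lmod_isoI[OF p(1) Schur[OF M N p(1) v(1) p(2)]])
qed

text \<open>In coordinates both tensor products are governed by the same \<open>\<rho>\<close>, and
  \<open>tmod\<close> commutes with direct sums in its module argument, so the restriction of
  \<open>V\<close> can be decomposed first. \<open>E\<close> and \<open>E'\<close> are separate
  because the constructions over \<open>K\<close> and over \<open>H\<close> yield different
  records.\<close>

lemma tensor_restrict:
  fixes E :: "(('l::field, 'd::finite) semilin \<Rightarrow> 'l, 'e) module" and E' :: "(('l, 'd) semilin \<Rightarrow> 'l, 'e) module"
    and V :: "(('l, 'd) semilin \<Rightarrow> 'l, 'b) module" and W :: "'z \<Rightarrow> (('l, 'd) semilin \<Rightarrow> 'l, 'c) module"
  assumes EK: "skew_module K E" and EH: "skew_module H E'" and HK: "H \<subseteq> K"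
    and I: "finite (I :: 'i set)" and \<rho>: "cocycle K I \<rho>"
    and iso: "lmod_iso (skew_group_ring K) E (tmod I \<rho> lfield)"
    and agree: "mod_agree (skew_group_ring H) E E'"
    and V: "skew_module K V" and W: "\<And>z. z \<in> Z \<Longrightarrow> skew_module H (W z)"
    and VW: "lmod_iso (skew_group_ring H) V (direct_sum Z W)"
  shows "lmod_iso (skew_group_ring H) (tensor K E V) (direct_sum Z (\<lambda>z. tensor H E' (W z)))"
proof -
  have H: "skew H" using EH by (simp add: skew_module_def)
  interpret H: skew H by (rule H)
  have sub: "carrier H.R \<subseteq> carrier (skew_group_ring K)" using HK by (auto simp: skew_group_ring_def)
  have lE: "left_module H.R E" using skew_module_restrict[OF EK H HK] by (simp add: skew_module_def)
  have isoH: "lmod_iso H.R E' (tmod I \<rho> lfield)"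
    by (rule lmod_iso_trans[OF lmod_iso_sym[OF lE mod_agree_iso[OF agree]] lmod_iso_mono[OF iso sub]])
  have \<rho>H: "cocycle H I \<rho>" by (rule cocycle_mono[OF \<rho> HK])
  interpret KT: tensor_modules K E V using EK V by (simp add: tensor_modules_def)
  have "lmod_iso H.R (tensor K E V) (tmod I \<rho> V)" by (rule lmod_iso_mono[OF KT.tensor_tmod(2)[OF I \<rho> iso] sub])
  moreover have lD: "skew_module H (direct_sum Z W)"
    using left_module_direct_sum[OF H.ring_R, of Z W] W H by (simp add: skew_module_def)
  have "lmod_iso H.R (tmod I \<rho> V) (tmod I \<rho> (direct_sum Z W))"
    by (rule tmod_cong[OF skew_module_restrict[OF V H HK] lD VW I])
  moreover have "lmod_iso H.R (tmod I \<rho> (direct_sum Z W)) (direct_sum Z (\<lambda>z. tmod I \<rho> (W z)))"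
    by (rule tmod_direct_sum[OF W I H])
  moreover have "lmod_iso H.R (direct_sum Z (\<lambda>z. tmod I \<rho> (W z))) (direct_sum Z (\<lambda>z. tensor H E' (W z)))"
  proof (rule direct_sum_cong_iso)
    fix z assume z: "z \<in> Z"
    interpret HT: tensor_modules H E' "W z" using EH W[OF z] by (simp add: tensor_modules_def)
    show "lmod_iso H.R (tmod I \<rho> (W z)) (tensor H E' (W z))"
      by (rule lmod_iso_sym[OF HT.tensor_tmod[OF I \<rho>H isoH]])
    show "left_module H.R (tmod I \<rho> (W z))"
      using skew_module.skew_module_tmod[OF W[OF z] I \<rho>H] by (simp add: skew_module_def)
  qed
  ultimately show ?thesis by (blast intro: lmod_iso_trans)
qed

lemma tensor_lfin:
  assumes E: "skew_module K E" and I: "finite I" and \<rho>: "cocycle K I \<rho>"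
    and iso: "lmod_iso (skew_group_ring K) E (tmod I \<rho> lfield)" and V: "skew_module K V" "lfin V"
  shows "skew_module K (tensor K E V)" "lfin (tensor K E V)"
proof -
  interpret KT: tensor_modules K E V using E V by (simp add: tensor_modules_def)
  note t = KT.tensor_tmod[OF I \<rho> iso]
  show s: "skew_module K (tensor K E V)" using t(1) E by (simp add: skew_module_def)
  have P: "skew_module K (tmod I \<rho> V)" by (rule skew_module.skew_module_tmod[OF V(1) I \<rho>])
  show "lfin (tensor K E V)"
    by (rule lfin_iso[OF P s lmod_iso_sym[OF t] skew_module.lfin_tmod[OF V(1) I \<rho> V(2)]])
qed

section \<open>Twisting by the determinant\<close>

definition det_char :: "('l::field, 'd::finite) semilin \<Rightarrow> 'l"
  where "det_char g = det (fst g)"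

context skew
begin

text \<open>\<open>det_char\<close> is the cocycle of the top exterior power of the cotangent
  module. It does not vanish on \<open>K\<close>: its value at \<open>g\<close>, times a conjugate
  of its value at the inverse, is its value 1 at the identity.\<close>

lemma det_char_mult: "det_char (semilin_one :: ('l, 'd) semilin) = 1"
  "g \<in> K \<Longrightarrow> h \<in> K \<Longrightarrow> det_char (semilin_mult g h) = det_char g * snd g (det_char h)"
  and det_char_nonzero: "g \<in> K \<Longrightarrow> det_char g \<noteq> 0"
  and tensor_top_exterior: "skew_module K N \<Longrightarrow>
    lmod_iso R (tensor K (exterior_power K CARD('d) (cotangent_module K)) N) (pullback (twist det_char) N)"
proof -
  let ?\<rho> = "\<lambda>g _ _. det (cmat cotangent_cocycle g) :: 'l"
  have d: "det (cmat cotangent_cocycle g) = det_char g" for g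
    by (simp add: cmat_def cotangent_cocycle_def det_char_def)
  have c: "cocycle K {()} ?\<rho>" by (rule cocycle_det[OF skew_axioms cocycle_cotangent])
  show 1: "det_char (semilin_one :: ('l, 'd) semilin) = 1" using c by (simp add: cocycle_def d)
  show m: "det_char (semilin_mult g h) = det_char g * snd g (det_char h)" if "g \<in> K" "h \<in> K" for g h
    using c that by (simp add: cocycle_def d)
  show "det_char g \<noteq> 0" if "g \<in> K" for g
    using m[OF that ginv_K[OF that]] that 1 by auto
  assume N: "skew_module K N"
  interpret U: skew_module K "cotangent_module K" by (rule cotangent_module_iso(1))
  interpret E: ext_power K "cotangent_module K" "CARD('d)" by unfold_locales
  interpret T: tensor_modules K "exterior_power K CARD('d) (cotangent_module K)" N
    using E.skew_module_exterior N by (simp add: tensor_modules_def)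
  have t: "lmod_iso R (tensor K (exterior_power K CARD('d) (cotangent_module K)) N) (tmod {()} ?\<rho> N)"
    by (rule T.tensor_tmod(2)[OF _ c U.exterior_top[OF cocycle_cotangent cotangent_module_iso(2)]]) simp
  show "lmod_iso R (tensor K (exterior_power K CARD('d) (cotangent_module K)) N) (pullback (twist det_char) N)"
    using lmod_iso_trans[OF t tmod_unit_pullback[OF N refl]] unfolding d by (simp add: eta_contract_eq)
qed

lemma det_twist_endo: "ring_endo R (twist det_char)" "carrier R \<subseteq> twist det_char ` carrier R"
proof -
  show "ring_endo R (twist det_char)" by (rule twist_endo[OF det_char_mult])
  show "carrier R \<subseteq> twist det_char ` carrier R"
  proof
    fix a assume a: "a \<in> carrier R"
    let ?b = "\<lambda>g. a g * inverse (det_char g)"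
    have "a g = twist det_char ?b g" for g
      using a det_char_nonzero[of g] by (cases "g \<in> K") (simp_all add: twist_def R_simps)
    moreover have "?b \<in> carrier R" using a by (simp add: R_simps)
    ultimately show "a \<in> twist det_char ` carrier R" by (intro image_eqI[of _ _ ?b] ext)
  qed
qed

text \<open>The definite description denotes: existence by twisting \<open>rep C\<close> with the
  inverse character, uniqueness because the determinant twist is surjective on the ring and hence
  reflects isomorphisms.\<close>

lemma det_untwist:
  assumes C: "C \<in> sim R"
  shows "det_untwist K C \<in> sim R" and "lmod_iso R (rep C) (pullback (twist det_char) (rep (det_untwist K C)))"
proof -
  define E where "E = exterior_power K CARD('d) (cotangent_module K)"
  let ?P = "\<lambda>C'. C' \<in> sim R \<and> lmod_iso R (rep C) (tensor K E (rep C'))"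
  let ?N = "pullback (twist (\<lambda>g. inverse (det_char g))) (rep C)"
  have lm: "skew_module K (rep D)" if "D \<in> sim R" for D
    using rep_left_module[OF that] skew_axioms by (simp add: skew_module_def)
  have eq: "?P C' \<longleftrightarrow> C' \<in> sim R \<and> lmod_iso R (rep C) (pullback (twist det_char) (rep C'))" for C'
  proof (cases "C' \<in> sim R")
    case True
    note t = tensor_top_exterior[OF lm[OF True], folded E_def]
    interpret U: skew_module K "cotangent_module K" by (rule cotangent_module_iso(1))
    interpret X: ext_power K "cotangent_module K" "CARD('d)" by unfold_locales
    have p: "left_module R (pullback (twist det_char) (rep C'))"
      by (rule pullback_left_module[OF rep_left_module[OF True] det_twist_endo(1)])
    have i: "lmod_iso R (rep C) (pullback (twist det_char) (rep C'))" if "lmod_iso R (rep C) (tensor K E (rep C'))"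
      by (rule lmod_iso_trans[OF that t])
    have "left_module R (tensor K E (rep C'))"
      using tensor_lfin(1)[of K E "{()}" "\<lambda>g _ _. det (cmat cotangent_cocycle g)" "rep C'"]
        X.skew_module_exterior cocycle_det[OF skew_axioms cocycle_cotangent]
        U.exterior_top[OF cocycle_cotangent cotangent_module_iso(2)] lm[OF True]
        skew_module.lfin_simple[OF lm[OF True] rep_simple[OF True]]
      unfolding E_def[symmetric] by (simp add: skew_module_def)
    then have "lmod_iso R (pullback (twist det_char) (rep C')) (tensor K E (rep C'))"
      using t by (rule lmod_iso_sym)
    then show ?thesis using True i lmod_iso_trans by blast
  qed simp
  have endo: "ring_endo R (twist (\<lambda>g. inverse (det_char g)))"
  proof (rule twist_endo)
    fix g h assume g: "g \<in> K" "h \<in> K"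
    have "snd g (inverse (det_char h)) = inverse (snd g (det_char h))"
    proof (rule inverse_unique[symmetric])
      show "snd g (det_char h) * snd g (inverse (det_char h)) = 1"
        using det_char_nonzero[OF g(2)] by (simp flip: field_aut_mult[OF aut_K[OF g(1)]] add: field_aut_1[OF aut_K[OF g(1)]])
    qed
    then show "inverse (det_char (semilin_mult g h)) = inverse (det_char g) * snd g (inverse (det_char h))"
      using g by (simp add: det_char_mult)
  qed (simp add: det_char_mult)
  have sN: "simple_lmod R ?N"
  proof (rule pullback_simple[OF rep_simple[OF C] endo])
    show "carrier R \<subseteq> twist (\<lambda>g. inverse (det_char g)) ` carrier R"
    proof
      fix a assume a: "a \<in> carrier R"
      have "a g = twist (\<lambda>g. inverse (det_char g)) (twist det_char a) g" for g
        using a det_char_nonzero[of g] by (cases "g \<in> K") (simp_all add: twist_def R_simps)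
      moreover have "twist det_char a \<in> carrier R" using a by (simp add: R_simps twist_def)
      ultimately show "a \<in> twist (\<lambda>g. inverse (det_char g)) ` carrier R" by (intro image_eqI[of _ _ "twist det_char a"] ext)
    qed
  qed
  define C0 where "C0 = iso_class R ?N"
  have C0: "C0 \<in> sim R" unfolding C0_def by (rule iso_class_sim[OF sN])
  have "lmod_iso R (pullback (twist det_char) (rep C0)) (pullback (twist det_char) ?N)"
    unfolding C0_def by (rule pullback_iso[OF rep_iso_class[OF sN] det_twist_endo(1)])
  moreover have "lmod_iso R (pullback (twist det_char) ?N) (rep C)"
  proof (rule pullback_pullback)
    fix a assume a: "a \<in> carrier R"
    show "twist (\<lambda>g. inverse (det_char g)) (twist det_char a) = a"
    proof
      fix g
      show "twist (\<lambda>g. inverse (det_char g)) (twist det_char a) g = a g"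
        using a det_char_nonzero[of g] by (cases "g \<in> K") (simp_all add: twist_def R_simps)
    qed
  qed
  ultimately have "lmod_iso R (pullback (twist det_char) (rep C0)) (rep C)" by (rule lmod_iso_trans)
  from lmod_iso_sym[OF pullback_left_module[OF rep_left_module[OF C0] det_twist_endo(1)] this]
  have P0: "?P C0" unfolding eq using C0 by blast
  have "?P (THE C'. ?P C')"
  proof (rule theI[of ?P, OF P0])
    fix C1 assume P1: "?P C1"
    have "lmod_iso R (pullback (twist det_char) (rep C1)) (pullback (twist det_char) (rep C0))"
      using lmod_iso_trans[OF lmod_iso_sym[OF rep_left_module[OF C]]] P0 P1 unfolding eq
      by (meson lmod_iso_sym lmod_iso_trans pullback_left_module rep_left_module det_twist_endo(1) C)
    from pullback_iso_rev[OF this det_twist_endo(2)] show "C1 = C0"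
      using P1 C0 by (intro sim_eqI) blast+
  qed
  then have "?P (det_untwist K C)" unfolding det_untwist_def E_def .
  then show "det_untwist K C \<in> sim R" "lmod_iso R (rep C) (pullback (twist det_char) (rep (det_untwist K C)))"
    unfolding eq by blast+
qed

end

text \<open>\<open>conj_module\<close> is the pullback along \<open>conj_ring\<close>; by
  \<open>conj_iso\<close> the union over representatives of the class and over group elements with
  the same automorphism collapses to one class.\<close>

lemma galois_act_eq:
  assumes sub: "subgroup G (semilin_group k)" and fin: "finite (G :: ('l::field, 'd::finite) semilin set)"
    and C: "C \<in> sim (skew_group_ring (linear_part G))" and g: "g \<in> G"
  shows "galois_act k G (snd g) C = iso_class (skew_group_ring (linear_part G)) (pullback (skew.conj_ring G g) (rep C))"
    and "galois_act k G (snd g) C \<in> sim (skew_group_ring (linear_part G))"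
proof -
  interpret skew G by (rule subgroup_skew(1)[OF sub fin])
  interpret HH: skew H by (rule skew_H)
  have repC: "skew_module H (rep C)" using rep_left_module[OF C] skew_H by (simp add: skew_module_def)
  have lp: "left_module HH.R (pullback (conj_ring x) N)" if "x \<in> G" "left_module HH.R N" for x and N :: "(_, (('l, 'd) semilin \<Rightarrow> 'l) set) module"
    by (rule pullback_left_module[OF that(2) conj_ring_endo(1)[OF that(1)]])
  have cls: "iso_class HH.R (conj_module k H x W) = iso_class HH.R (pullback (conj_ring g) (rep C))"
    if W: "W \<in> C" and x: "x \<in> G" "snd x = snd g" for W x
  proof -
    have e: "conj_module k H x W = pullback (conj_ring x) W"
      unfolding conj_module_def pullback_def conj_ring_def subgroup_skew(2)[OF sub fin x(1)] ..
    have W': "left_module HH.R W" "lmod_iso HH.R W (rep C)"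
      using W rep_class[OF C] by (auto simp: iso_class_def)
    have "lmod_iso HH.R (pullback (conj_ring x) W) (pullback (conj_ring x) (rep C))"
      by (rule pullback_iso[OF W'(2) conj_ring_endo(1)[OF x(1)]])
    from lmod_iso_trans[OF this conj_iso[OF repC x(1) g x(2)]] show ?thesis
      unfolding e by (rule iso_class_eq[OF _ lp[OF x(1) W'(1)]])
  qed
  have "rep C \<in> C" using rep_class[OF C] rep_left_module[OF C] by (metis (mono_tags) iso_class_def lmod_iso_refl mem_Collect_eq)
  then show eq: "galois_act k G (snd g) C = iso_class HH.R (pullback (conj_ring g) (rep C))"
    unfolding galois_act_def using cls g by blast
  show "galois_act k G (snd g) C \<in> sim HH.R"
    unfolding eq by (rule iso_class_sim[OF pullback_simple[OF rep_simple[OF C] conj_ring_endo[OF g]]])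
qed

lemma galois_act_id:
  assumes sub: "subgroup G (semilin_group k)" and fin: "finite (G :: ('l::field, 'd::finite) semilin set)"
    and C: "C \<in> sim (skew_group_ring (linear_part G))"
  shows "galois_act k G id C = C"
proof -
  interpret skew G by (rule subgroup_skew(1)[OF sub fin])
  have repC: "skew_module H (rep C)" using rep_left_module[OF C] skew_H by (simp add: skew_module_def)
  have "iso_class (skew_group_ring H) (pullback (conj_ring semilin_one) (rep C)) = iso_class (skew_group_ring H) (rep C)"
    by (rule iso_class_eq[OF conj_one[OF repC] pullback_left_module[OF rep_left_module[OF C] conj_ring_endo(1)[OF one_K]]])
  then show ?thesis
    using galois_act_eq(1)[OF sub fin C one_K] rep_class[OF C] by (simp add: semilin_one_def)
qed

section \<open>Comparison of the McKay quivers\<close>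

text \<open>Condenses the Galois action into what the counting takes from it: all classes of simple
  lH-modules occur among the \<open>W i j\<close>, the orbits are nonempty and distinct, and the
  restriction of \<open>V i\<close> is known.\<close>

locale orbit_decomposition = skew K for K :: "('l::field, 'd::finite) semilin set" +
  fixes s :: nat and t :: "nat \<Rightarrow> nat" and a :: "nat \<Rightarrow> nat"
    and W :: "nat \<Rightarrow> nat \<Rightarrow> ('l, 'd) sgr_vertex" and V :: "nat \<Rightarrow> ('l, 'd) sgr_vertex"
  assumes char_K: "of_nat (card K) \<noteq> (0::'l)" and char_H: "of_nat (card (linear_part K)) \<noteq> (0::'l)"
    and W_sim: "i \<in> {1..s} \<Longrightarrow> j \<in> {1..t i} \<Longrightarrow> W i j \<in> sim (skew_group_ring (linear_part K))"
    and W_ex: "C \<in> sim (skew_group_ring (linear_part K)) \<Longrightarrow> \<exists>i\<in>{1..s}. \<exists>j\<in>{1..t i}. W i j = C"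
    and t_nonempty: "i \<in> {1..s} \<Longrightarrow> {1..t i} \<noteq> {}"
    and inj_orbits: "inj_on (\<lambda>i. W i ` {1..t i}) {1..s}"
    and inj_W: "i \<in> {1..s} \<Longrightarrow> inj_on (W i) {1..t i}"
    and V_sim: "i \<in> {1..s} \<Longrightarrow> V i \<in> sim (skew_group_ring K)"
    and a_pos: "i \<in> {1..s} \<Longrightarrow> 1 \<le> a i"
    and res: "i \<in> {1..s} \<Longrightarrow> lmod_iso (skew_group_ring (linear_part K)) (rep (V i))
             (direct_sum {1..a i} (\<lambda>_. direct_sum {1..t i} (\<lambda>j. rep (W i j))))"
begin

sublocale HH: skew H by (rule skew_H)

abbreviation P :: "nat \<Rightarrow> (nat \<times> nat) set"
  where "P i \<equiv> {1..a i} \<times> {1..t i}"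

lemma H_sub: "H \<subseteq> K" using H_K by blast

lemma carrier_HR: "carrier HH.R \<subseteq> carrier R"
  using H_sub by (auto simp: R_simps HH.R_simps)

lemma W_simple: "i \<in> {1..s} \<Longrightarrow> p \<in> P i \<Longrightarrow> simple_lmod HH.R (rep (W i (snd p)))"
  by (rule rep_simple[OF W_sim]) auto

lemma V_simple: "i \<in> {1..s} \<Longrightarrow> simple_lmod R (rep (V i))"
  by (rule rep_simple[OF V_sim])

lemma V_module: "C \<in> sim R \<Longrightarrow> skew_module K (rep C)" "C \<in> sim R \<Longrightarrow> lfin (rep C)"
  "C \<in> sim HH.R \<Longrightarrow> skew_module H (rep C)" "C \<in> sim HH.R \<Longrightarrow> lfin (rep C)"
proof -
  assume C: "C \<in> sim R"
  show "skew_module K (rep C)" using rep_left_module[OF C] skew_axioms by (simp add: skew_module_def)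
  then show "lfin (rep C)" by (rule skew_module.lfin_simple[OF _ rep_simple[OF C]])
next
  assume C: "C \<in> sim HH.R"
  show "skew_module H (rep C)" using rep_left_module[OF C] skew_H by (simp add: skew_module_def)
  then show "lfin (rep C)" by (rule skew_module.lfin_simple[OF _ rep_simple[OF C]])
qed

lemma V_restrict_left_module: "C \<in> sim R \<Longrightarrow> left_module HH.R (rep C)"
  using skew_module_restrict[OF V_module(1) skew_H H_sub] by (simp add: skew_module_def)

lemma V_res: "i \<in> {1..s} \<Longrightarrow> lmod_iso HH.R (rep (V i)) (direct_sum (P i) (\<lambda>p. rep (W i (snd p))))"
  by (rule lmod_iso_trans[OF res direct_sum_Sigma])

text \<open>A constituent of \<open>V i\<close> has positive multiplicity in the restriction;
  computing this multiplicity also from the decomposition of \<open>V i'\<close> shows that it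
  occurs there.\<close>

lemma V_iso_constituents:
  assumes i: "i \<in> {1..s}" "i' \<in> {1..s}" and iso: "lmod_iso HH.R (rep (V i)) (rep (V i'))"
  shows "W i ` {1..t i} \<subseteq> W i' ` {1..t i'}"
proof
  fix C assume "C \<in> W i ` {1..t i}"
  then obtain j where j: "j \<in> {1..t i}" "C = W i j" by blast
  have lm: "left_module HH.R (rep (V i))" by (rule V_restrict_left_module[OF V_sim[OF i(1)]])
  have C: "C \<in> sim HH.R" unfolding j(2) by (rule W_sim[OF i(1) j(1)])
  have f: "finite (P i)" "finite (P i')" by simp_all
  define A where "A = {p \<in> P i. lmod_iso HH.R (rep (W i (snd p))) (rep C)}"
  define A' where "A' = {p \<in> P i'. lmod_iso HH.R (rep (W i' (snd p))) (rep C)}"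
  have "card A = card A'"
    unfolding A_def A'_def using summand_multiplicity_eq[OF lm rep_simple[OF C] f(1) W_simple[OF i(1)] V_res[OF i(1)]]
      summand_multiplicity_eq[OF lm rep_simple[OF C] f(2) W_simple[OF i(2)] lmod_iso_trans[OF iso V_res[OF i(2)]]]
    by simp
  moreover have "(1, j) \<in> A"
    unfolding A_def using j a_pos[OF i(1)] by (simp add: lmod_iso_refl)
  moreover have "finite A" unfolding A_def by (rule finite_subset[OF Collect_restrict f(1)])
  ultimately have "card A' \<noteq> 0" by (metis card_0_eq empty_iff)
  then obtain p where p: "p \<in> P i'" "lmod_iso HH.R (rep (W i' (snd p))) (rep C)"
    by (metis (no_types, lifting) A'_def card.empty empty_Collect_eq)
  then have "snd p \<in> {1..t i'}" by auto
  then show "C \<in> W i' ` {1..t i'}"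
    using sim_eqI[OF W_sim[OF i(2)] C p(2)] by blast
qed

lemma V_iso_eq:
  assumes i: "i \<in> {1..s}" "i' \<in> {1..s}" and iso: "lmod_iso R (rep (V i)) (rep (V i'))"
  shows "i = i'"
proof -
  have iso': "lmod_iso HH.R (rep (V i)) (rep (V i'))" by (rule lmod_iso_mono[OF iso carrier_HR])
  have "W i ` {1..t i} = W i' ` {1..t i'}"
    using V_iso_constituents[OF i iso']
      V_iso_constituents[OF i(2,1) lmod_iso_sym[OF V_restrict_left_module[OF V_sim[OF i(1)]] iso']]
    by (rule equalityI)
  then show ?thesis using inj_onD[OF inj_orbits _ i] by simp
qed

text \<open>A constituent shared by \<open>V i\<close> and \<open>V i'\<close> makes these
  isomorphic by descent, and then \<open>V_iso_eq\<close> applies. Disjointness of the orbits is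
  obtained in this way.\<close>

lemma W_iso_eq:
  assumes i: "i \<in> {1..s}" "i' \<in> {1..s}" and j: "j \<in> {1..t i}" "j' \<in> {1..t i'}"
    and iso: "lmod_iso HH.R (rep (W i j)) (rep (W i' j'))"
  shows "i = i'" "j = j'"
proof -
  have p: "(1, j) \<in> P i" "(1, j') \<in> P i'" using j a_pos i by simp_all
  have "lmod_iso HH.R (rep (W i (snd (1::nat, j)))) (rep (W i' (snd (1::nat, j'))))" using iso by simp
  from common_constituent_iso[OF skew_axioms char_H V_simple[OF i(1)] V_simple[OF i(2)] W_simple[OF i(1)]
      W_simple[OF i(2)] V_res[OF i(1)] V_res[OF i(2)] p this]
  show e: "i = i'" by (intro V_iso_eq[OF i])
  have "W i j = W i' j'" by (rule sim_eqI[OF W_sim[OF i(1) j(1)] W_sim[OF i(2) j(2)] iso])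
  then show "j = j'" using inj_onD[OF inj_W[OF i(1)]] j e by simp
qed

text \<open>The restriction of \<open>S\<close> is semisimple and nonzero, so it has a simple
  constituent, which is some \<open>W i j\<close> and therefore shared with \<open>V i\<close>;
  descent gives the isomorphism.\<close>

lemma V_complete:
  fixes S :: "(('l, 'd) semilin \<Rightarrow> 'l, 'b) module"
  assumes S: "simple_lmod R S"
  shows "\<exists>i\<in>{1..s}. lmod_iso R S (rep (V i))"
proof -
  have sS: "skew_module K S" using simple_left_module[OF S] skew_axioms by (simp add: skew_module_def)
  interpret r: skew_module H S by (rule skew_module_restrict[OF sS skew_H H_sub])
  obtain n and T :: "nat \<Rightarrow> (('l, 'd) semilin \<Rightarrow> 'l, 'b) module" where
    T: "\<And>i. i < n \<Longrightarrow> simple_lmod HH.R (T i)" "lmod_iso HH.R S (direct_sum {..<n} T)"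
    by (rule r.semisimple[OF skew_module.lfin_simple[OF sS S] char_H]) blast
  have "n \<noteq> 0"
  proof
    assume n: "n = 0"
    obtain f where f: "bij_betw f (carrier S) (carrier (direct_sum {..<n} T))"
      using T(2) unfolding lmod_iso_lhom by blast
    obtain x where x: "x \<in> carrier S" "x \<noteq> \<zero>\<^bsub>S\<^esub>" using simple_nonzero[OF S] by blast
    have "f y = (\<lambda>_. undefined)" if "y \<in> carrier S" for y
      using bij_betwE[OF f] that n by (simp add: direct_sum_simps)
    then have "f x = f \<zero>\<^bsub>S\<^esub>" using x(1) r.M.zero_closed by metis
    then show False using f x r.M.zero_closed by (metis bij_betw_def inj_onD)
  qed
  then have T0: "simple_lmod HH.R (T 0)" "0 \<in> {..<n}" using T(1) by simp_all
  \<comment> \<open>The constituent has its elements in the type of \<open>S\<close>; it is first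
    moved to the type in which the classes of \<open>sim\<close> are formed.\<close>
  obtain N :: "(_, (('l, 'd) semilin \<Rightarrow> 'l) set) module" where N: "simple_lmod HH.R N" "lmod_iso HH.R (T 0) N"
    using simple_lmod_represented[OF T0(1)] by blast
  obtain i j where ij: "i \<in> {1..s}" "j \<in> {1..t i}" "W i j = iso_class HH.R N"
    using W_ex[OF iso_class_sim[OF N(1)]] by blast
  have "lmod_iso HH.R N (rep (W i j))" unfolding ij(3)
    using rep_iso_class[OF N(1)] rep_left_module[OF iso_class_sim[OF N(1)]] lmod_iso_sym by blast
  then have c: "lmod_iso HH.R (T 0) (rep (W i (snd (1::nat, j))))" using lmod_iso_trans[OF N(2)] by simp
  have p: "(1, j) \<in> P i" using ij a_pos by simp
  have Ts: "\<And>x. x \<in> {..<n} \<Longrightarrow> simple_lmod HH.R (T x)" using T(1) by simp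
  show ?thesis
    using common_constituent_iso[OF skew_axioms char_H S V_simple[OF ij(1)] Ts
      W_simple[OF ij(1)] T(2) V_res[OF ij(1)] T0(2) p c] ij(1) by blast
qed

text \<open>\<open>W i j\<close> occurs \<open>a i\<close> times in the restriction of
  \<open>V i\<close> and in that of no other \<open>V i'\<close>, so its occurrences in
  \<open>X\<close> come precisely from the summands isomorphic to \<open>V i\<close>.\<close>

lemma multiplicity_restrict:
  fixes X :: "(('l, 'd) semilin \<Rightarrow> 'l, 'b) module"
  assumes X: "skew_module K X" "lfin X" and i: "i \<in> {1..s}" and j: "j \<in> {1..t i}"
  shows "\<exists>n. summand_multiplicity R (rep (V i)) X = enat n \<and> summand_multiplicity HH.R (rep (W i j)) X = enat (a i * n)"
proof -
  interpret X: skew_module K X by (rule X(1))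
  obtain n and S :: "nat \<Rightarrow> (('l, 'd) semilin \<Rightarrow> 'l, 'b) module" where
    S: "\<And>x. x < n \<Longrightarrow> simple_lmod R (S x)" "lmod_iso R X (direct_sum {..<n} S)"
    by (rule X.semisimple[OF X(2) char_K]) blast
  have "\<forall>x\<in>{..<n}. \<exists>i. i \<in> {1..s} \<and> lmod_iso R (S x) (rep (V i))" using V_complete S(1) by blast
  then obtain c where c: "\<And>x. x < n \<Longrightarrow> c x \<in> {1..s}" "\<And>x. x < n \<Longrightarrow> lmod_iso R (S x) (rep (V (c x)))"
    unfolding bchoice_iff by auto
  have hS: "left_module HH.R (S x)" if "x < n" for x
    using skew_module_restrict[OF _ skew_H H_sub, of "S x"] simple_left_module[OF S(1)[OF that]] skew_axioms
    by (simp add: skew_module_def)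
  have hX: "left_module HH.R X" using skew_module_restrict[OF X(1) skew_H H_sub] by (simp add: skew_module_def)
  have "lmod_iso HH.R (direct_sum {..<n} S) (direct_sum {..<n} (\<lambda>x. direct_sum (P (c x)) (\<lambda>p. rep (W (c x) (snd p)))))"
  proof (rule direct_sum_cong_iso)
    fix x assume "x \<in> {..<n}"
    then have x: "x < n" by simp
    show "left_module HH.R (S x)" by (rule hS[OF x])
    show "lmod_iso HH.R (S x) (direct_sum (P (c x)) (\<lambda>p. rep (W (c x) (snd p))))"
      by (rule lmod_iso_trans[OF lmod_iso_mono[OF c(2)[OF x] carrier_HR] V_res[OF c(1)[OF x]]])
  qed
  from lmod_iso_trans[OF lmod_iso_mono[OF S(2) carrier_HR] lmod_iso_trans[OF this direct_sum_Sigma]]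
  have iso: "lmod_iso HH.R X (direct_sum (Sigma {..<n} (\<lambda>x. P (c x))) (\<lambda>q. rep (W (c (fst q)) (snd (snd q)))))" .
  have "summand_multiplicity HH.R (rep (W i j)) X =
    enat (card {q \<in> Sigma {..<n} (\<lambda>x. P (c x)). lmod_iso HH.R (rep (W (c (fst q)) (snd (snd q)))) (rep (W i j))})"
  proof (rule summand_multiplicity_eq[OF hX rep_simple[OF W_sim[OF i j]] _ _ iso])
    fix q assume "q \<in> Sigma {..<n} (\<lambda>x. P (c x))"
    then have "fst q < n" "snd q \<in> P (c (fst q))" by auto
    then show "simple_lmod HH.R (rep (W (c (fst q)) (snd (snd q))))" by (intro W_simple c(1))
  qed simp
  \<comment> \<open>By \<open>W_iso_eq\<close> an occurrence of \<open>W i j\<close> is a summand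
    \<open>x\<close> of type \<open>i\<close>, one of the \<open>a i\<close> copies in it, and the
    fixed position \<open>j\<close>.\<close>
  also have "{q \<in> Sigma {..<n} (\<lambda>x. P (c x)). lmod_iso HH.R (rep (W (c (fst q)) (snd (snd q)))) (rep (W i j))} =
    {x \<in> {..<n}. c x = i} \<times> ({1..a i} \<times> {j})" (is "?A = ?B")
  proof (rule Set.set_eqI)
    fix q :: "nat \<times> nat \<times> nat"
    obtain x b y where q: "q = (x, b, y)" by (metis surj_pair)
    have "x < n \<Longrightarrow> y \<in> {1..t (c x)} \<Longrightarrow> lmod_iso HH.R (rep (W (c x) y)) (rep (W i j)) \<Longrightarrow> c x = i \<and> y = j"
      using W_iso_eq[OF c(1) i _ j] by blast
    then show "q \<in> ?A \<longleftrightarrow> q \<in> ?B" unfolding q using j by (auto simp: lmod_iso_refl)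
  qed
  also have "card \<dots> = a i * card {x \<in> {..<n}. c x = i}" by (simp add: card_cartesian_product)
  finally have 1: "summand_multiplicity HH.R (rep (W i j)) X = enat (a i * card {x \<in> {..<n}. c x = i})" .
  have "summand_multiplicity R (rep (V i)) X = enat (card {x \<in> {..<n}. lmod_iso R (S x) (rep (V i))})"
    by (rule summand_multiplicity_eq[OF X.left_module_axioms V_simple[OF i] _ _ S(2)]) (use S(1) in auto)
  also have "{x \<in> {..<n}. lmod_iso R (S x) (rep (V i))} = {x \<in> {..<n}. c x = i}"
  proof -
    have "lmod_iso R (S x) (rep (V i)) \<longleftrightarrow> c x = i" if "x < n" for x
      using c[OF that] V_iso_eq[OF c(1)[OF that] i] lmod_iso_trans[OF lmod_iso_sym[OF simple_left_module[OF S(1)[OF that]]]]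
      by blast
    then show ?thesis by auto
  qed
  finally show ?thesis using 1 by blast
qed

text \<open>The common core of both valuations. \<open>C\<close> is the second tensor factor and the
  \<open>D y\<close> are the constituents of its restriction: the \<open>W i' y\<close> in the case
  of d, their determinant untwists, for the source orbit, in the case of d'.\<close>

lemma multiplicity_tensor:
  fixes E E' :: "(('l, 'd) semilin \<Rightarrow> 'l, 'e) module" and I :: "'i set"
  assumes E: "skew_module K E" and E': "skew_module H E'" and I: "finite I" and \<rho>: "cocycle K I \<rho>"
    and iso: "lmod_iso R E (tmod I \<rho> lfield)" and agree: "mod_agree HH.R E E'"
    and C: "C \<in> sim R" and D: "\<And>y. y \<in> {1..t i'} \<Longrightarrow> D y \<in> sim HH.R"
    and CD: "lmod_iso HH.R (rep C) (direct_sum (P i') (\<lambda>p. rep (D (snd p))))"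
    and i: "i \<in> {1..s}" and j: "j \<in> {1..t i}"
  shows "\<exists>n. summand_multiplicity R (rep (V i)) (tensor K E (rep C)) = enat n \<and>
    enat (a i * n) = of_nat (a i') * (\<Sum>y=1..t i'. summand_multiplicity HH.R (rep (W i j)) (tensor H E' (rep (D y))))"
proof -
  let ?T = "tensor K E (rep C)" and ?Y = "\<lambda>p::nat \<times> nat. tensor H E' (rep (D (snd p)))"
  note T = tensor_lfin[OF E I \<rho> iso V_module(1,2)[OF C]]
  have DP: "D (snd p) \<in> sim HH.R" if "p \<in> P i'" for p using that by (intro D) auto
  have iT: "lmod_iso HH.R ?T (direct_sum (P i') ?Y)"
    by (rule tensor_restrict[OF E E' H_sub I \<rho> iso agree V_module(1)[OF C] V_module(3)[OF DP] CD])
  have lE: "left_module HH.R E" using skew_module_restrict[OF E skew_H H_sub] by (simp add: skew_module_def)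
  have iso': "lmod_iso HH.R E' (tmod I \<rho> lfield)"
    by (rule lmod_iso_trans[OF lmod_iso_sym[OF lE mod_agree_iso[OF agree]] lmod_iso_mono[OF iso carrier_HR]])
  note Y = tensor_lfin[OF E' I cocycle_mono[OF \<rho> H_sub] iso' V_module(3,4)[OF DP]]
  have "left_module HH.R ?T" using skew_module_restrict[OF T(1) skew_H H_sub] by (simp add: skew_module_def)
  then have "summand_multiplicity HH.R (rep (W i j)) ?T = (\<Sum>p\<in>P i'. summand_multiplicity HH.R (rep (W i j)) (?Y p))"
  proof (rule summand_multiplicity_direct_sum[OF _ rep_simple[OF W_sim[OF i j]] _ _ _ iT])
    fix p assume p: "p \<in> P i'"
    interpret Y: skew_module H "?Y p" by (rule Y(1)[OF p p])
    show "left_module HH.R (?Y p)" by (rule Y.left_module_axioms)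
    show "\<exists>(n::nat) (S :: nat \<Rightarrow> (('l, 'd) semilin \<Rightarrow> 'l, ('e \<times> (('l, 'd) semilin \<Rightarrow> 'l) set \<Rightarrow> 'l) set) module). (\<forall>i<n. simple_lmod HH.R (S i)) \<and> lmod_iso HH.R (?Y p) (direct_sum {..<n} S)"
    proof (rule Y.semisimple[OF Y(2)[OF p p] char_H])
      fix n :: nat and S :: "nat \<Rightarrow> (('l, 'd) semilin \<Rightarrow> 'l, ('e \<times> (('l, 'd) semilin \<Rightarrow> 'l) set \<Rightarrow> 'l) set) module"
      assume S: "\<And>i. i < n \<Longrightarrow> simple_lmod HH.R (S i)" "lmod_iso HH.R (?Y p) (direct_sum {..<n} S)"
      show ?thesis by (rule exI[of _ n], rule exI[of _ S]) (intro conjI allI impI S)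
    qed
  qed simp
  also have "\<dots> = (\<Sum>x\<in>{1..a i'}. \<Sum>y=1..t i'. summand_multiplicity HH.R (rep (W i j)) (tensor H E' (rep (D y))))"
    unfolding sum.cartesian_product by (simp add: case_prod_unfold)
  also have "\<dots> = of_nat (a i') * (\<Sum>y=1..t i'. summand_multiplicity HH.R (rep (W i j)) (tensor H E' (rep (D y))))"
    by simp
  finally have e: "summand_multiplicity HH.R (rep (W i j)) ?T =
    of_nat (a i') * (\<Sum>y=1..t i'. summand_multiplicity HH.R (rep (W i j)) (tensor H E' (rep (D y))))" .
  obtain n where n: "summand_multiplicity R (rep (V i)) ?T = enat n"
    "summand_multiplicity HH.R (rep (W i j)) ?T = enat (a i * n)"
    using multiplicity_restrict[OF T i j] by iprover
  show ?thesis
    by (rule exI[of _ n], rule conjI[OF n(1)]) (rule trans[OF n(2)[symmetric] e])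
qed

lemma cotangent_agree: "mod_agree HH.R (cotangent_module K) (cotangent_module H)"
  by (rule mod_agree_cotangent[OF finite_K H_sub])

lemma val_eq:
  assumes i: "i \<in> {1..s}" "i' \<in> {1..s}" and j: "j \<in> {1..t i}"
  shows "\<exists>n. val (McKay_quiver K) (V i) (V i') = enat n \<and>
    enat (a i * n) = of_nat (a i') * (\<Sum>j'=1..t i'. val (McKay_quiver H) (W i j) (W i' j'))"
  unfolding McKay_quiver_def valued_quiver.simps
  by (rule multiplicity_tensor[OF cotangent_module_iso(1) HH.cotangent_module_iso(1) _ cocycle_cotangent
      cotangent_module_iso(2) cotangent_agree V_sim[OF i(2)] W_sim[OF i(2)] V_res[OF i(2)] i(1) j]) simp

text \<open>The same function \<open>det_char\<close> serves over \<open>K\<close> and over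
  \<open>H\<close>, so after twisting both sides become the restriction of \<open>V i\<close>. The
  twist is surjective on the ring of \<open>H\<close> and can be cancelled.\<close>

lemma det_untwist_res:
  assumes i: "i \<in> {1..s}"
  shows "lmod_iso HH.R (rep (det_untwist K (V i))) (direct_sum (P i) (\<lambda>p. rep (det_untwist H (W i (snd p)))))"
proof (rule pullback_iso_rev[OF _ HH.det_twist_endo(2)])
  note u = det_untwist[OF V_sim[OF i]]
  have Wp: "W i (snd p) \<in> sim HH.R" if "p \<in> P i" for p using that by (intro W_sim[OF i]) auto
  have "lmod_iso HH.R (pullback (twist det_char) (rep (det_untwist K (V i)))) (rep (V i))"
    by (rule lmod_iso_sym[OF V_restrict_left_module[OF V_sim[OF i]] lmod_iso_mono[OF u(2) carrier_HR]])
  moreover have "lmod_iso HH.R (direct_sum (P i) (\<lambda>p. rep (W i (snd p))))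
    (direct_sum (P i) (\<lambda>p. pullback (twist det_char) (rep (det_untwist H (W i (snd p))))))"
    by (rule direct_sum_cong_iso[OF HH.det_untwist(2)[OF Wp] rep_left_module[OF Wp]])
  ultimately show "lmod_iso HH.R (pullback (twist det_char) (rep (det_untwist K (V i))))
    (pullback (twist det_char) (direct_sum (P i) (\<lambda>p. rep (det_untwist H (W i (snd p))))))"
    unfolding pullback_direct_sum using V_res[OF i] by (blast intro: lmod_iso_trans)
qed

text \<open>An instance of \<open>multiplicity_tensor\<close> with \<open>i\<close> and
  \<open>i'\<close> exchanged, because the tensor factor comes from the source and the constituent
  from the target.\<close>

lemma val'_eq:
  assumes i: "i \<in> {1..s}" "i' \<in> {1..s}" and j: "j' \<in> {1..t i'}"
  shows "\<exists>n. val' (McKay_quiver K) (V i) (V i') = enat n \<and>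
    enat (a i' * n) = of_nat (a i) * (\<Sum>j=1..t i. val' (McKay_quiver H) (W i j) (W i' j'))"
proof -
  let ?m = "CARD('d) - 1"
  let ?E = "exterior_power K ?m (cotangent_module K)" and ?E' = "exterior_power H ?m (cotangent_module H)"
  interpret U: skew_module K "cotangent_module K" by (rule cotangent_module_iso(1))
  interpret U': skew_module H "cotangent_module H" by (rule HH.cotangent_module_iso(1))
  interpret E: ext_power K "cotangent_module K" ?m by unfold_locales
  interpret E': ext_power H "cotangent_module H" ?m by unfold_locales
  \<comment> \<open>Supplies an abstract basis of the (d-1)-st exterior power and with it a cocycle,
    which over \<open>H\<close> is used by restriction.\<close>
  have "lfin ?E" by (rule E.lfin_exterior[OF _ cocycle_cotangent cotangent_module_iso(2)]) simp
  then obtain B :: "((('d \<Rightarrow> nat) \<Rightarrow> 'l) set list \<Rightarrow> 'l) set set" and \<rho> where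
    B: "finite B" "cocycle K B \<rho>" "lmod_iso R ?E (tmod B \<rho> lfield)"
    by (rule skew_module.lfin_basis[OF E.skew_module_exterior])
  have agree: "mod_agree HH.R ?E ?E'"
    by (rule mod_agree_exterior[OF finite_K H_sub HH.one_K cotangent_agree])
  have D: "det_untwist H (W i y) \<in> sim HH.R" if "y \<in> {1..t i}" for y
    by (rule HH.det_untwist(1)[OF W_sim[OF i(1) that]])
  show ?thesis
    unfolding McKay_quiver_def valued_quiver.simps
    by (rule multiplicity_tensor[OF E.skew_module_exterior E'.skew_module_exterior B agree
        det_untwist(1)[OF V_sim[OF i(1)]] D det_untwist_res[OF i(1)] i(2) j])
qed

lemma V_bij: "bij_betw V {1..s} (sim R)"
proof (rule bij_betw_imageI)
  show "inj_on V {1..s}" by (rule inj_onI) (metis V_iso_eq lmod_iso_refl)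
  show "V ` {1..s} = sim R"
  proof
    show "sim R \<subseteq> V ` {1..s}"
    proof
      fix C assume C: "C \<in> sim R"
      obtain i where i: "i \<in> {1..s}" "lmod_iso R (rep C) (rep (V i))" using V_complete[OF rep_simple[OF C]] by blast
      show "C \<in> V ` {1..s}" using sim_eqI[OF C V_sim[OF i(1)] i(2)] i(1) by blast
    qed
  qed (use V_sim in blast)
qed

end

text \<open>The left side is finite and \<open>b\<close> is positive, so \<open>e\<close> is finite
  as well; only then can the equation be divided by \<open>a\<close>.\<close>

lemma enat_ratio:
  assumes "enat (a * n) = of_nat b * e" "1 \<le> a" "1 \<le> b"
  shows "ereal_of_enat (enat n) = ereal (real b / real a) * ereal_of_enat e" "n = 0 \<longleftrightarrow> e = 0"
proof -
  have "e \<noteq> \<infinity>"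
  proof
    assume "e = \<infinity>"
    then have "of_nat b * e = \<infinity>" using assms(3) by (simp add: imult_is_infinity of_nat_eq_enat zero_enat_def)
    then show False using assms(1) by simp
  qed
  then obtain m where m: "e = enat m" by auto
  have "a * n = b * m" using assms(1) by (simp add: m of_nat_eq_enat)
  then have "real a * real n = real b * real m" by (metis of_nat_mult)
  then show "ereal_of_enat (enat n) = ereal (real b / real a) * ereal_of_enat e"
    using assms(2,3) by (simp add: m field_simps)
  show "n = 0 \<longleftrightarrow> e = 0" using \<open>a * n = b * m\<close> assms(2,3) by (auto simp: m zero_enat_def)
qed

theorem theorem0p13:
  fixes k :: "'l::field set"
    and G H :: "('l, 'd::finite) semilin set"
    and \<Gamma> :: "('l \<Rightarrow> 'l) set"
    and MKG MKH :: "('l, 'd) sgr_vertex valued_quiver"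
    and s :: nat and t :: "nat \<Rightarrow> nat"
    and W :: "nat \<Rightarrow> nat \<Rightarrow> ('l, 'd) sgr_vertex"
    and V :: "nat \<Rightarrow> ('l, 'd) sgr_vertex"
    and a :: "nat \<Rightarrow> nat"
  assumes "2 \<le> CARD('d)"
    and "finite_galois_extension k"
    and "\<Gamma> = galois_group k"
    and "subgroup G (semilin_group k)" and "finite G"
    and "\<not> CHAR('l) dvd card G"
    and "k = {x. \<forall>g\<in>G. snd g x = x}"
    and "H = linear_part G"
    and "small (fst ` H)"
    and "MKG = McKay_quiver G"
    and "MKH = McKay_quiver H"
    and "bij_betw (\<lambda>i. W i ` {1..t i}) {1..s}
           (orbits \<Gamma> (galois_act k G) (sim (skew_group_ring H)))"
    and "\<And>i. i \<in> {1..s} \<Longrightarrow> inj_on (W i) {1..t i}"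
    and "\<And>i. i \<in> {1..s} \<Longrightarrow> V i \<in> sim (skew_group_ring G)"
    and "\<And>i. i \<in> {1..s} \<Longrightarrow> 1 \<le> a i"
    and "\<And>i. i \<in> {1..s} \<Longrightarrow>
           lmod_iso (skew_group_ring H) (rep (V i))
             (direct_sum {1..a i} (\<lambda>_. direct_sum {1..t i} (\<lambda>j. rep (W i j))))"
  shows "(\<exists>\<phi>. (\<forall>i\<in>{1..s}. \<phi> (W i ` {1..t i}) = V i) \<and>
            quiver_iso \<phi> (quotient_quiver \<Gamma> (galois_act k G) (underlying_quiver MKH))
              (underlying_quiver MKG)) \<and>
         (\<forall>i\<in>{1..s}. \<forall>i'\<in>{1..s}.
            (\<forall>j\<in>{1..t i}. ereal_of_enat (val MKG (V i) (V i')) =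
               ereal (real (a i') / real (a i)) *
               ereal_of_enat (\<Sum>j'=1..t i'. val MKH (W i j) (W i' j'))) \<and>
            (\<forall>j'\<in>{1..t i'}. ereal_of_enat (val' MKG (V i) (V i')) =
               ereal (real (a i) / real (a i')) *
               ereal_of_enat (\<Sum>j=1..t i. val' MKH (W i j) (W i' j'))))"
proof -
  note \<Gamma> = assms(3) and G = assms(4,5) and k = assms(7) and H = assms(8) and MK = assms(10,11)
    and orb = assms(12)
  let ?O = "orbits \<Gamma> (galois_act k G) (sim (skew_group_ring H))" and ?w = "\<lambda>i. W i ` {1..t i}"
  interpret G: skew G by (rule subgroup_skew(1)[OF G])
  have char: "of_nat (card G) \<noteq> (0::'l)" using assms(6) by (simp add: of_nat_eq_0_iff_char_dvd)
  have "card (linear_part G) dvd card G" by (rule subgroup_linear_part[OF G])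
  then have char_H: "of_nat (card (linear_part G)) \<noteq> (0::'l)"
    using assms(6) dvd_trans by (auto simp: of_nat_eq_0_iff_char_dvd)
  \<comment> \<open>As \<open>k\<close> is the fixed field of \<open>G\<close>, every automorphism
    over \<open>k\<close> is induced by \<open>G\<close>. Without such an element
    \<open>galois_act\<close> would be an empty union and not a class.\<close>
  have "\<exists>g\<in>G. snd g = \<gamma>" if "\<gamma> \<in> \<Gamma>" for \<gamma>
    by (rule G.galois_surj[OF char_H]) (use that k in \<open>auto simp: \<Gamma> galois_group_iff\<close>)
  then have act: "galois_act k G \<gamma> C \<in> sim (skew_group_ring H)" if "\<gamma> \<in> \<Gamma>" "C \<in> sim (skew_group_ring H)" for \<gamma> C
    using galois_act_eq(2)[OF G, of C] that unfolding H by blast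
  have id\<Gamma>: "id \<in> \<Gamma>" by (simp add: \<Gamma> galois_group_iff field_aut_id)
  have orbs: "x \<in> ?O \<Longrightarrow> x \<subseteq> sim (skew_group_ring H) \<and> x \<noteq> {}" for x
    unfolding orbits_def using act id\<Gamma> by blast
  have O: "?w i \<in> ?O" if "i \<in> {1..s}" for i using orb that by (auto simp: bij_betw_def)
  interpret orbit_decomposition G s t a W V
  proof
    fix C assume C: "C \<in> sim (skew_group_ring (linear_part G))"
    then have "{galois_act k G \<gamma> C |\<gamma>. \<gamma> \<in> \<Gamma>} \<in> ?O" unfolding orbits_def H by blast
    then obtain i where i: "i \<in> {1..s}" "{galois_act k G \<gamma> C |\<gamma>. \<gamma> \<in> \<Gamma>} = ?w i"
      using orb unfolding bij_betw_def by (metis (no_types, lifting) imageE)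
    \<comment> \<open>\<open>C\<close> belongs to its own orbit through the identity
      automorphism.\<close>
    have "C \<in> ?w i" unfolding i(2)[symmetric] using galois_act_id[OF G C] id\<Gamma> by force
    then show "\<exists>i\<in>{1..s}. \<exists>j\<in>{1..t i}. W i j = C" using i(1) by blast
  next
    fix i j assume "i \<in> {1..s}" "j \<in> {1..t i}"
    then show "W i j \<in> sim (skew_group_ring (linear_part G))" using orbs[OF O] unfolding H by blast
  next
    fix i assume "i \<in> {1..s}"
    then show "{1..t i} \<noteq> {}" using orbs[OF O] by blast
  next
    show "inj_on ?w {1..s}" using orb by (simp add: bij_betw_def)
  qed (use assms(13-16) char char_H in \<open>simp_all add: H\<close>)
  have pos: "i \<in> {1..s} \<Longrightarrow> 1 \<le> a i" for i by (rule a_pos)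
  have v: "ereal_of_enat (val MKG (V i) (V i')) = ereal (real (a i') / real (a i)) * ereal_of_enat (\<Sum>j'=1..t i'. val MKH (W i j) (W i' j'))"
    and v0: "val MKG (V i) (V i') = 0 \<longleftrightarrow> (\<forall>j'\<in>{1..t i'}. val MKH (W i j) (W i' j') = 0)"
    if i: "i \<in> {1..s}" "i' \<in> {1..s}" "j \<in> {1..t i}" for i i' j
  proof -
    obtain n where n: "val MKG (V i) (V i') = enat n"
      "enat (a i * n) = of_nat (a i') * (\<Sum>j'=1..t i'. val MKH (W i j) (W i' j'))"
      using val_eq[OF i] unfolding MK H by blast
    note r = enat_ratio[OF n(2) pos[OF i(1)] pos[OF i(2)]]
    show "ereal_of_enat (val MKG (V i) (V i')) = ereal (real (a i') / real (a i)) * ereal_of_enat (\<Sum>j'=1..t i'. val MKH (W i j) (W i' j'))"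
      unfolding n(1) by (rule r(1))
    show "val MKG (V i) (V i') = 0 \<longleftrightarrow> (\<forall>j'\<in>{1..t i'}. val MKH (W i j) (W i' j') = 0)"
      unfolding n(1) using r(2) by (simp add: zero_enat_def[symmetric] sum_eq_0_iff) (simp add: zero_enat_def)
  qed
  have v': "ereal_of_enat (val' MKG (V i) (V i')) = ereal (real (a i) / real (a i')) * ereal_of_enat (\<Sum>j=1..t i. val' MKH (W i j) (W i' j'))"
    and v'0: "val' MKG (V i) (V i') = 0 \<longleftrightarrow> (\<forall>j\<in>{1..t i}. val' MKH (W i j) (W i' j') = 0)"
    if i: "i \<in> {1..s}" "i' \<in> {1..s}" "j' \<in> {1..t i'}" for i i' j'
  proof -
    obtain n where n: "val' MKG (V i) (V i') = enat n"
      "enat (a i' * n) = of_nat (a i) * (\<Sum>j=1..t i. val' MKH (W i j) (W i' j'))"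
      using val'_eq[OF i] unfolding MK H by blast
    note r = enat_ratio[OF n(2) pos[OF i(2)] pos[OF i(1)]]
    show "ereal_of_enat (val' MKG (V i) (V i')) = ereal (real (a i) / real (a i')) * ereal_of_enat (\<Sum>j=1..t i. val' MKH (W i j) (W i' j'))"
      unfolding n(1) by (rule r(1))
    show "val' MKG (V i) (V i') = 0 \<longleftrightarrow> (\<forall>j\<in>{1..t i}. val' MKH (W i j) (W i' j') = 0)"
      unfolding n(1) using r(2) by (simp add: zero_enat_def[symmetric] sum_eq_0_iff) (simp add: zero_enat_def)
  qed
  define \<phi> where "\<phi> = V \<circ> inv_into {1..s} ?w"
  have \<phi>: "\<phi> (?w i) = V i" if "i \<in> {1..s}" for i
    using inv_into_f_f[OF inj_orbits that] by (simp add: \<phi>_def)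
  have vert: "verts (quotient_quiver \<Gamma> (galois_act k G) (underlying_quiver MKH)) = ?O"
    "verts (underlying_quiver MKG) = sim (skew_group_ring G)"
    by (simp_all add: quotient_quiver_def underlying_quiver_def MK McKay_quiver_def)
  have bij: "bij_betw \<phi> ?O (sim (skew_group_ring G))"
    unfolding \<phi>_def by (rule bij_betw_trans[OF bij_betw_inv_into[OF orb] V_bij])
  have arrow: "(?w i, ?w i') \<in> arrows (quotient_quiver \<Gamma> (galois_act k G) (underlying_quiver MKH)) \<longleftrightarrow>
    (V i, V i') \<in> arrows (underlying_quiver MKG)" (is "?l \<longleftrightarrow> ?r") if i: "i \<in> {1..s}" "i' \<in> {1..s}" for i i'
  proof -
    obtain j0 j0' where j0: "j0 \<in> {1..t i}" "j0' \<in> {1..t i'}" using t_nonempty i by blast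
    have Ws: "W i j \<in> vertices MKH" "W i' j' \<in> vertices MKH" if "j \<in> {1..t i}" "j' \<in> {1..t i'}" for j j'
      using W_sim i that by (simp_all add: MK McKay_quiver_def H)
    have ul: "(x, y) \<in> arrows (underlying_quiver Q) \<longleftrightarrow>
      x \<in> vertices Q \<and> y \<in> vertices Q \<and> (val Q x y \<noteq> 0 \<or> val' Q x y \<noteq> 0)" for x y and Q :: "'v valued_quiver"
      by (simp add: underlying_quiver_def)
    have vh: "verts (underlying_quiver MKH) = sim (skew_group_ring H)"
      by (simp add: underlying_quiver_def MK McKay_quiver_def)
    have "?l \<longleftrightarrow> (\<exists>x\<in>?w i. \<exists>y\<in>?w i'. (x, y) \<in> arrows (underlying_quiver MKH))"
      unfolding quotient_quiver_def vh using O[OF i(1)] O[OF i(2)] by simp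
    also have "\<dots> \<longleftrightarrow> (\<exists>j\<in>{1..t i}. \<exists>j'\<in>{1..t i'}. val MKH (W i j) (W i' j') \<noteq> 0 \<or> val' MKH (W i j) (W i' j') \<noteq> 0)"
      unfolding ul using Ws by blast
    \<comment> \<open>By \<open>v0\<close> and \<open>v'0\<close> the vanishing of the sums does not
      depend on the index held fixed. An arrow between any members of the two orbits is therefore
      visible at \<open>j0\<close> for d and at \<open>j0'\<close> for d'.\<close>
    also have "\<dots> \<longleftrightarrow> val MKG (V i) (V i') \<noteq> 0 \<or> val' MKG (V i) (V i') \<noteq> 0"
      using v0[OF i] v'0[OF i] j0 by blast
    also have "\<dots> \<longleftrightarrow> ?r"
    proof -
      have "V i \<in> vertices MKG" "V i' \<in> vertices MKG" using V_sim i by (simp_all add: MK McKay_quiver_def)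
      then show ?thesis unfolding ul by blast
    qed
    finally show ?thesis .
  qed
  have "quiver_iso \<phi> (quotient_quiver \<Gamma> (galois_act k G) (underlying_quiver MKH)) (underlying_quiver MKG)"
    unfolding quiver_iso_def vert
  proof (intro conjI ballI bij)
    fix x y assume "x \<in> ?O" "y \<in> ?O"
    then have "x \<in> ?w ` {1..s}" "y \<in> ?w ` {1..s}" using orb unfolding bij_betw_def by simp_all
    then obtain i i' where i: "i \<in> {1..s}" "i' \<in> {1..s}" and xy: "x = ?w i" "y = ?w i'" by (elim imageE) iprover
    show "(x, y) \<in> arrows (quotient_quiver \<Gamma> (galois_act k G) (underlying_quiver MKH)) \<longleftrightarrow>
      (\<phi> x, \<phi> y) \<in> arrows (underlying_quiver MKG)"
      unfolding xy \<phi>[OF i(1)] \<phi>[OF i(2)] by (rule arrow[OF i])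
  qed
  then have "\<exists>\<phi>. (\<forall>i\<in>{1..s}. \<phi> (?w i) = V i) \<and>
      quiver_iso \<phi> (quotient_quiver \<Gamma> (galois_act k G) (underlying_quiver MKH)) (underlying_quiver MKG)"
    using \<phi> by (intro exI[of _ \<phi>] conjI ballI)
  then show ?thesis by (intro conjI ballI v v') assumption
qed

end
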